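(* Let $\mathfrak g$ be a complex Lie superalgebra containing a subalgebra $\mathfrak{sl}_2=\mathrm{span}\{e,h,f\}$ which acts locally finitely on $\mathfrak g$, and let $a,b\in\mathbb C$. (i) Let $\mathfrak g'$ be a subalgebra of $\mathfrak g$ containing $\mathfrak{sl}_2$ and let $\mathcal C_a'$ be the analogue of $\mathcal C_a$ for $\mathfrak g'$. Then $\mathrm{Res}^{\mathfrak g}_{\mathfrak g'}\,\mathcal C_a\cong\mathcal C_a'\,\mathrm{Res}^{\mathfrak g}_{\mathfrak g'}$. (ii) The restriction of the Enright functor $\mathcal C_a$ to $\mathcal M(a)$ defines an additive left exact functor $\mathcal M(a)\to\mathcal M(-a)^e$. (iii) Let $V\in\mathcal M(b)^e$. If $\mathcal D_a(V)$ has a non-zero subquotient with locally nilpotent action of $e$, then $a-b\in\mathbb Z$ or $a\in\mathbb Z$. (iv) For $N\in\mathcal M(0)^e$ the map $v\mapsto1\otimes v$ gives a homomorphism $N\to\mathcal C_0(N)$ with kernel $N^f$. (v) Let $a\notin\mathbb Z$ and $N\in\mathcal M(a)^e$. For every $v\in N$ there exists $s>0$ such that $f^{a+j}\otimes v\in\mathcal C_a(N)$ for every integer $j\ge s$.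
   Context: $\{e,h,f\}$ is the standard basis of $\mathfrak{sl}_2$. $U(\mathfrak g)[f^{-1}]$ is the localization of $U(\mathfrak g)$ at the Ore set $\{f^s\}_{s\ge0}$. For $a\in\mathbb C$, $\phi_a(u)=\sum_{i\ge0}\binom ai(\mathrm{ad}f)^i(u)f^{-i}$ is an automorphism of $U(\mathfrak g)[f^{-1}]$. $U'f^a$ is the $U(\mathfrak g)[f^{-1}]$-bimodule that is free of rank one as a left module on a generator $f^a$, with right action $(uf^a)u'=u\phi_a(u')f^a$; for $s\in\mathbb Z$ one writes $f^{a+s}:=f^s(f^a)\in U'f^a$, which identifies $U'f^{a+s}$ with $U'f^a$. Twisted localization: $\mathcal D_a(N)=U'f^a\otimes_{U(\mathfrak g)[f^{-1}]}U(\mathfrak g)[f^{-1}]\otimes_{U(\mathfrak g)}N$, restricted to $\mathfrak g$ (so $\mathcal D_0(N)=N[f^{-1}]$). Enright functor: $\mathcal C_a(N)=\{v\in\mathcal D_a(N)\mid\dim\mathbb C[e]v<\infty\}$. $N^f=\{v\in N\mid f^sv=0\text{ for }s\gg0\}$. $\mathcal M(b)$ is the category of $\mathfrak g$-modules on which $h$ acts diagonally with eigenvalues in $b+\mathbb Z$; $\mathcal M(b)^e$ is the full subcategory of modules on which $e$ acts locally nilpotently. *)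

theory Defs
  imports "HOL-Algebra.Algebra" "HOL-Algebra.Algebraic_Closure_Type" "HOL-Library.Z2"
begin

section \<open>Complex super vector spaces\<close>

abbreviation CC :: "complex ring" where
  "CC \<equiv> ring_of_type_algebra"

text \<open>
  All vector spaces are modules over \<^term>\<open>CC\<close> in the sense of HOL-Algebra; the ring multiplication
  and unit that the record type inherits are never used. The degrees live in the two-element
  field \<^typ>\<open>bit\<close>.
\<close>

record 'v superspace = "(complex, 'v) module" +
  par :: "bit \<Rightarrow> 'v set"

definition graded :: "('v, 'x) superspace_scheme \<Rightarrow> bool" where
  "graded V \<longleftrightarrow>
     (\<forall>i. submodule (par V i) CC V) \<and>
     (\<forall>v\<in>carrier V. \<exists>v0\<in>par V 0. \<exists>v1\<in>par V 1. v = v0 \<oplus>\<^bsub>V\<^esub> v1) \<and>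
     par V 0 \<inter> par V 1 \<subseteq> {\<zero>\<^bsub>V\<^esub>}"

definition lin_span :: "(complex, 'v, 'x) module_scheme \<Rightarrow> 'v set \<Rightarrow> 'v set" where
  "lin_span V A = \<Inter>{W. submodule W CC V \<and> A \<subseteq> W}"

definition fin_dim :: "(complex, 'v, 'x) module_scheme \<Rightarrow> 'v set \<Rightarrow> bool" where
  "fin_dim V W \<longleftrightarrow> (\<exists>B. finite B \<and> B \<subseteq> W \<and> W = lin_span V B)"

definition sign :: "bit \<Rightarrow> bit \<Rightarrow> complex" where
  "sign i j = (if i = 1 \<and> j = 1 then -1 else 1)"


section \<open>Lie superalgebras\<close>

record 'g lsa = "'g superspace" +
  br :: "'g \<Rightarrow> 'g \<Rightarrow> 'g"

locale lie_superalgebra = module CC L for L :: "'g lsa" (structure) +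
  assumes grading: "graded L"
    and br_closed: "\<lbrakk>x \<in> carrier L; y \<in> carrier L\<rbrakk> \<Longrightarrow> br L x y \<in> carrier L"
    and br_add_left: "\<lbrakk>x \<in> carrier L; y \<in> carrier L; z \<in> carrier L\<rbrakk> \<Longrightarrow>
      br L (x \<oplus>\<^bsub>L\<^esub> y) z = br L x z \<oplus>\<^bsub>L\<^esub> br L y z"
    and br_add_right: "\<lbrakk>x \<in> carrier L; y \<in> carrier L; z \<in> carrier L\<rbrakk> \<Longrightarrow>
      br L x (y \<oplus>\<^bsub>L\<^esub> z) = br L x y \<oplus>\<^bsub>L\<^esub> br L x z"
    and br_smult_left: "\<lbrakk>x \<in> carrier L; y \<in> carrier L\<rbrakk> \<Longrightarrow>
      br L (c \<odot>\<^bsub>L\<^esub> x) y = c \<odot>\<^bsub>L\<^esub> br L x y"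
    and br_smult_right: "\<lbrakk>x \<in> carrier L; y \<in> carrier L\<rbrakk> \<Longrightarrow>
      br L x (c \<odot>\<^bsub>L\<^esub> y) = c \<odot>\<^bsub>L\<^esub> br L x y"
    and br_par: "\<lbrakk>x \<in> par L i; y \<in> par L j\<rbrakk> \<Longrightarrow> br L x y \<in> par L (i + j)"
    and br_skew: "\<lbrakk>x \<in> par L i; y \<in> par L j\<rbrakk> \<Longrightarrow>
      br L x y = \<ominus>\<^bsub>L\<^esub> (sign i j \<odot>\<^bsub>L\<^esub> br L y x)"
    and br_jacobi: "\<lbrakk>x \<in> par L i; y \<in> par L j; z \<in> carrier L\<rbrakk> \<Longrightarrow>
      br L x (br L y z) = br L (br L x y) z \<oplus>\<^bsub>L\<^esub> sign i j \<odot>\<^bsub>L\<^esub> br L y (br L x z)"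

definition sub_lsa :: "'g lsa \<Rightarrow> 'g set \<Rightarrow> 'g lsa" where
  "sub_lsa L S = L\<lparr>carrier := S, par := \<lambda>i. S \<inter> par L i\<rparr>"

definition is_subalgebra :: "'g lsa \<Rightarrow> 'g set \<Rightarrow> bool" where
  "is_subalgebra L S \<longleftrightarrow>
     submodule S CC L \<and> graded (sub_lsa L S) \<and> (\<forall>x\<in>S. \<forall>y\<in>S. br L x y \<in> S)"

definition sl2_in :: "'g lsa \<Rightarrow> 'g \<Rightarrow> 'g \<Rightarrow> 'g \<Rightarrow> bool" where
  "sl2_in L e h f \<longleftrightarrow>
     {e, h, f} \<subseteq> par L 0 \<and>
     (\<forall>c1 c2 c3. c1 \<odot>\<^bsub>L\<^esub> e \<oplus>\<^bsub>L\<^esub> c2 \<odot>\<^bsub>L\<^esub> h \<oplus>\<^bsub>L\<^esub> c3 \<odot>\<^bsub>L\<^esub> f = \<zero>\<^bsub>L\<^esub> \<longrightarrow>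
        c1 = 0 \<and> c2 = 0 \<and> c3 = 0) \<and>
     br L h e = 2 \<odot>\<^bsub>L\<^esub> e \<and> br L h f = (-2) \<odot>\<^bsub>L\<^esub> f \<and> br L e f = h"

definition sl2_locally_finite :: "'g lsa \<Rightarrow> 'g \<Rightarrow> 'g \<Rightarrow> 'g \<Rightarrow> bool" where
  "sl2_locally_finite L e h f \<longleftrightarrow>
     (\<forall>x\<in>carrier L. \<exists>W. submodule W CC L \<and> fin_dim L W \<and> x \<in> W \<and>
        (\<forall>y\<in>{e, h, f}. \<forall>w\<in>W. br L y w \<in> W))"


section \<open>Modules over a Lie superalgebra\<close>

text \<open>
  The flag \<open>gr\<close> selects the category: for \<^term>\<open>True\<close> the modules are graded and the homomorphisms
  preserve degrees; for \<^term>\<open>False\<close> the component \<^const>\<open>par\<close> of a module is ignored.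
\<close>

record ('g, 'v) gmod = "'v superspace" +
  act :: "'g \<Rightarrow> 'v \<Rightarrow> 'v"

definition is_gmodule :: "bool \<Rightarrow> 'g lsa \<Rightarrow> ('g, 'v) gmod \<Rightarrow> bool" where
  "is_gmodule gr L N \<longleftrightarrow>
     module CC N \<and>
     (\<forall>x\<in>carrier L. \<forall>v\<in>carrier N. act N x v \<in> carrier N) \<and>
     (\<forall>x\<in>carrier L. \<forall>v\<in>carrier N. \<forall>w\<in>carrier N.
        act N x (v \<oplus>\<^bsub>N\<^esub> w) = act N x v \<oplus>\<^bsub>N\<^esub> act N x w) \<and>
     (\<forall>c. \<forall>x\<in>carrier L. \<forall>v\<in>carrier N. act N x (c \<odot>\<^bsub>N\<^esub> v) = c \<odot>\<^bsub>N\<^esub> act N x v) \<and>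
     (\<forall>x\<in>carrier L. \<forall>y\<in>carrier L. \<forall>v\<in>carrier N.
        act N (x \<oplus>\<^bsub>L\<^esub> y) v = act N x v \<oplus>\<^bsub>N\<^esub> act N y v) \<and>
     (\<forall>c. \<forall>x\<in>carrier L. \<forall>v\<in>carrier N. act N (c \<odot>\<^bsub>L\<^esub> x) v = c \<odot>\<^bsub>N\<^esub> act N x v) \<and>
     (\<forall>i j. \<forall>x\<in>par L i. \<forall>y\<in>par L j. \<forall>v\<in>carrier N.
        act N (br L x y) v = act N x (act N y v) \<ominus>\<^bsub>N\<^esub> sign i j \<odot>\<^bsub>N\<^esub> act N y (act N x v)) \<and>
     (gr \<longrightarrow> graded N \<and> (\<forall>i j. \<forall>x\<in>par L i. \<forall>v\<in>par N j. act N x v \<in> par N (i + j)))"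

definition gmod_hom :: "bool \<Rightarrow> 'g lsa \<Rightarrow> ('g, 'v) gmod \<Rightarrow> ('g, 'w) gmod \<Rightarrow> ('v \<Rightarrow> 'w) set" where
  "gmod_hom gr L M N = {\<phi>. \<phi> \<in> carrier M \<rightarrow> carrier N \<and>
     (\<forall>v\<in>carrier M. \<forall>w\<in>carrier M. \<phi> (v \<oplus>\<^bsub>M\<^esub> w) = \<phi> v \<oplus>\<^bsub>N\<^esub> \<phi> w) \<and>
     (\<forall>c. \<forall>v\<in>carrier M. \<phi> (c \<odot>\<^bsub>M\<^esub> v) = c \<odot>\<^bsub>N\<^esub> \<phi> v) \<and>
     (\<forall>x\<in>carrier L. \<forall>v\<in>carrier M. \<phi> (act M x v) = act N x (\<phi> v)) \<and>
     (gr \<longrightarrow> (\<forall>i. \<forall>v\<in>par M i. \<phi> v \<in> par N i))}"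

definition gmod_iso :: "bool \<Rightarrow> 'g lsa \<Rightarrow> ('g, 'v) gmod \<Rightarrow> ('g, 'w) gmod \<Rightarrow> ('v \<Rightarrow> 'w) set" where
  "gmod_iso gr L M N = {\<phi> \<in> gmod_hom gr L M N. bij_betw \<phi> (carrier M) (carrier N) \<and>
     inv_into (carrier M) \<phi> \<in> gmod_hom gr L N M}"

definition res_gmod :: "'g lsa \<Rightarrow> ('g, 'v) gmod \<Rightarrow> ('g, 'v) gmod" where
  "res_gmod L' N = N\<lparr>act := restrict (act N) (carrier L')\<rparr>"

definition is_gsubmodule :: "bool \<Rightarrow> 'g lsa \<Rightarrow> ('g, 'v) gmod \<Rightarrow> 'v set \<Rightarrow> bool" where
  "is_gsubmodule gr L N W \<longleftrightarrow>
     submodule W CC N \<and> (\<forall>x\<in>carrier L. \<forall>v\<in>W. act N x v \<in> W) \<and>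
     (gr \<longrightarrow> (\<forall>w\<in>W. \<exists>w0\<in>W \<inter> par N 0. \<exists>w1\<in>W \<inter> par N 1. w = w0 \<oplus>\<^bsub>N\<^esub> w1))"

definition sub_gmod :: "('g, 'v) gmod \<Rightarrow> 'v set \<Rightarrow> ('g, 'v) gmod" where
  "sub_gmod N W = N\<lparr>carrier := W, par := \<lambda>i. W \<inter> par N i\<rparr>"

text \<open>The quotient \<open>A / B\<close> of two submodules \<open>B \<subseteq> A\<close> of \<open>N\<close>.\<close>

definition subquotient :: "('g, 'v) gmod \<Rightarrow> 'v set \<Rightarrow> 'v set \<Rightarrow> ('g, 'v set) gmod" where
  "subquotient N A B =
     \<lparr>carrier = (\<lambda>v. B +>\<^bsub>N\<^esub> v) ` A, monoid.mult = undefined, one = undefined,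
      ring.zero = B, add = set_add N,
      module.smult = (\<lambda>c Z. \<Union>v\<in>Z. (B +>\<^bsub>N\<^esub> (c \<odot>\<^bsub>N\<^esub> v))),
      par = (\<lambda>i. (\<lambda>v. B +>\<^bsub>N\<^esub> v) ` (A \<inter> par N i)),
      act = (\<lambda>x Z. \<Union>v\<in>Z. (B +>\<^bsub>N\<^esub> act N x v))\<rparr>"

definition locally_nilpotent :: "('g, 'v) gmod \<Rightarrow> 'g \<Rightarrow> bool" where
  "locally_nilpotent N e \<longleftrightarrow> (\<forall>v\<in>carrier N. \<exists>k. (act N e ^^ k) v = \<zero>\<^bsub>N\<^esub>)"

definition f_torsion :: "('g, 'v) gmod \<Rightarrow> 'g \<Rightarrow> 'v set" where
  "f_torsion N f = {v \<in> carrier N. \<exists>s0. \<forall>s\<ge>s0. (act N f ^^ s) v = \<zero>\<^bsub>N\<^esub>}"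

text \<open>The objects of \<open>\<M>(b)\<close> and of \<open>\<M>(b)\<^sup>e\<close>.\<close>

definition cat_M :: "bool \<Rightarrow> 'g lsa \<Rightarrow> 'g \<Rightarrow> complex \<Rightarrow> ('g, 'v) gmod \<Rightarrow> bool" where
  "cat_M gr L h b N \<longleftrightarrow> is_gmodule gr L N \<and>
     carrier N = lin_span N {v \<in> carrier N. \<exists>n::int. act N h v = (b + of_int n) \<odot>\<^bsub>N\<^esub> v}"

definition cat_Me :: "bool \<Rightarrow> 'g lsa \<Rightarrow> 'g \<Rightarrow> 'g \<Rightarrow> complex \<Rightarrow> ('g, 'v) gmod \<Rightarrow> bool" where
  "cat_Me gr L e h b N \<longleftrightarrow> cat_M gr L h b N \<and> locally_nilpotent N e"


section \<open>Functors between full subcategories of module categories\<close>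

text \<open>
  The predicates \<open>P\<close> and \<open>Q\<close> single out the objects of the source (modules over \<open>L\<close>) and of the
  target (modules over \<open>L'\<close>). A morphism is a function that matters only on the carrier of its
  domain, so a functor has to respect equality there, and the effect \<open>Fm M N \<phi>\<close> of the functor on
  \<open>\<phi>\<close> depends on the domain \<open>M\<close> and the codomain \<open>N\<close>.
\<close>

definition is_functor :: "bool \<Rightarrow> 'g lsa \<Rightarrow> (('g, 'v) gmod \<Rightarrow> bool) \<Rightarrow> 'g lsa \<Rightarrow> (('g, 'w) gmod \<Rightarrow> bool) \<Rightarrow>
    (('g, 'v) gmod \<Rightarrow> ('g, 'w) gmod) \<Rightarrow>
    (('g, 'v) gmod \<Rightarrow> ('g, 'v) gmod \<Rightarrow> ('v \<Rightarrow> 'v) \<Rightarrow> 'w \<Rightarrow> 'w) \<Rightarrow> bool" where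
  "is_functor gr L P L' Q F Fm \<longleftrightarrow>
     (\<forall>M. P M \<longrightarrow> Q (F M)) \<and>
     (\<forall>M N \<phi>. P M \<and> P N \<and> \<phi> \<in> gmod_hom gr L M N \<longrightarrow> Fm M N \<phi> \<in> gmod_hom gr L' (F M) (F N)) \<and>
     (\<forall>M N \<phi> \<psi>. P M \<and> P N \<and> \<phi> \<in> gmod_hom gr L M N \<and> \<psi> \<in> gmod_hom gr L M N \<and>
        (\<forall>v\<in>carrier M. \<phi> v = \<psi> v) \<longrightarrow> (\<forall>w\<in>carrier (F M). Fm M N \<phi> w = Fm M N \<psi> w)) \<and>
     (\<forall>M. P M \<longrightarrow> (\<forall>w\<in>carrier (F M). Fm M M (\<lambda>v. v) w = w)) \<and>
     (\<forall>M N K \<phi> \<psi>. P M \<and> P N \<and> P K \<and> \<phi> \<in> gmod_hom gr L M N \<and> \<psi> \<in> gmod_hom gr L N K \<longrightarrow>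
        (\<forall>w\<in>carrier (F M). Fm M K (\<psi> \<circ> \<phi>) w = Fm N K \<psi> (Fm M N \<phi> w)))"

definition additive_functor :: "bool \<Rightarrow> 'g lsa \<Rightarrow> (('g, 'v) gmod \<Rightarrow> bool) \<Rightarrow>
    (('g, 'v) gmod \<Rightarrow> ('g, 'w) gmod) \<Rightarrow>
    (('g, 'v) gmod \<Rightarrow> ('g, 'v) gmod \<Rightarrow> ('v \<Rightarrow> 'v) \<Rightarrow> 'w \<Rightarrow> 'w) \<Rightarrow> bool" where
  "additive_functor gr L P F Fm \<longleftrightarrow>
     (\<forall>M N \<phi> \<psi>. P M \<and> P N \<and> \<phi> \<in> gmod_hom gr L M N \<and> \<psi> \<in> gmod_hom gr L M N \<longrightarrow>
        (\<forall>w\<in>carrier (F M).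
           Fm M N (\<lambda>v. \<phi> v \<oplus>\<^bsub>N\<^esub> \<psi> v) w = Fm M N \<phi> w \<oplus>\<^bsub>F N\<^esub> Fm M N \<psi> w))"

definition left_exact_seq :: "('g, 'v) gmod \<Rightarrow> ('g, 'v) gmod \<Rightarrow> ('g, 'v) gmod \<Rightarrow>
    ('v \<Rightarrow> 'v) \<Rightarrow> ('v \<Rightarrow> 'v) \<Rightarrow> bool" where
  "left_exact_seq A B C \<phi> \<psi> \<longleftrightarrow>
     inj_on \<phi> (carrier A) \<and> \<phi> ` carrier A = {v \<in> carrier B. \<psi> v = \<zero>\<^bsub>C\<^esub>}"

definition left_exact_functor :: "bool \<Rightarrow> 'g lsa \<Rightarrow> (('g, 'v) gmod \<Rightarrow> bool) \<Rightarrow>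
    (('g, 'v) gmod \<Rightarrow> ('g, 'w) gmod) \<Rightarrow>
    (('g, 'v) gmod \<Rightarrow> ('g, 'v) gmod \<Rightarrow> ('v \<Rightarrow> 'v) \<Rightarrow> 'w \<Rightarrow> 'w) \<Rightarrow> bool" where
  "left_exact_functor gr L P F Fm \<longleftrightarrow>
     (\<forall>A B C \<phi> \<psi>. P A \<and> P B \<and> P C \<and> \<phi> \<in> gmod_hom gr L A B \<and> \<psi> \<in> gmod_hom gr L B C \<and>
        left_exact_seq A B C \<phi> \<psi> \<longrightarrow>
        left_exact_seq (F A) (F B) (F C) (Fm A B \<phi>) (Fm B C \<psi>))"

definition naturally_isomorphic :: "bool \<Rightarrow> 'g lsa \<Rightarrow> (('g, 'v) gmod \<Rightarrow> bool) \<Rightarrow> 'g lsa \<Rightarrow>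
    (('g, 'v) gmod \<Rightarrow> ('g, 'w) gmod) \<Rightarrow>
    (('g, 'v) gmod \<Rightarrow> ('g, 'v) gmod \<Rightarrow> ('v \<Rightarrow> 'v) \<Rightarrow> 'w \<Rightarrow> 'w) \<Rightarrow>
    (('g, 'v) gmod \<Rightarrow> ('g, 'u) gmod) \<Rightarrow>
    (('g, 'v) gmod \<Rightarrow> ('g, 'v) gmod \<Rightarrow> ('v \<Rightarrow> 'v) \<Rightarrow> 'u \<Rightarrow> 'u) \<Rightarrow> bool" where
  "naturally_isomorphic gr L P L' F Fm G Gm \<longleftrightarrow>
     is_functor gr L P L' (is_gmodule gr L') F Fm \<and>
     is_functor gr L P L' (is_gmodule gr L') G Gm \<and>
     (\<exists>\<eta>. (\<forall>N. P N \<longrightarrow> \<eta> N \<in> gmod_iso gr L' (F N) (G N)) \<and>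
          (\<forall>M N \<phi>. P M \<and> P N \<and> \<phi> \<in> gmod_hom gr L M N \<longrightarrow>
             (\<forall>w\<in>carrier (F M). \<eta> N (Fm M N \<phi> w) = Gm M N \<phi> (\<eta> M w))))"


section \<open>The universal enveloping algebra\<close>

text \<open>The free complex associative algebra on a set \<open>Z\<close>: finitely supported functions on words.\<close>

definition free_alg :: "'g set \<Rightarrow> ('g list \<Rightarrow> complex) ring" where
  "free_alg Z =
     \<lparr>carrier = {p. finite {w. p w \<noteq> 0} \<and> {w. p w \<noteq> 0} \<subseteq> lists Z},
      monoid.mult = (\<lambda>p q w. \<Sum>i\<le>length w. p (take i w) * q (drop i w)),
      one = (\<lambda>w. if w = [] then 1 else 0),
      ring.zero = (\<lambda>w. 0),
      add = (\<lambda>p q w. p w + q w)\<rparr>"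

definition monomial :: "complex \<Rightarrow> 'g list \<Rightarrow> 'g list \<Rightarrow> complex" where
  "monomial c w = (\<lambda>u. if u = w then c else 0)"

text \<open>
  The first two families of relations turn the free algebra on the set \<^term>\<open>carrier L\<close> into the
  tensor algebra of the vector space \<open>L\<close>.
\<close>

definition U_relations :: "'g lsa \<Rightarrow> ('g list \<Rightarrow> complex) set" where
  "U_relations L = (let T = free_alg (carrier L) in
     {monomial 1 [x \<oplus>\<^bsub>L\<^esub> y] \<ominus>\<^bsub>T\<^esub> monomial 1 [x] \<ominus>\<^bsub>T\<^esub> monomial 1 [y] | x y.
        x \<in> carrier L \<and> y \<in> carrier L} \<union>
     {monomial 1 [c \<odot>\<^bsub>L\<^esub> x] \<ominus>\<^bsub>T\<^esub> monomial c [x] | c x. x \<in> carrier L} \<union>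
     {monomial 1 [x, y] \<ominus>\<^bsub>T\<^esub> monomial (sign i j) [y, x] \<ominus>\<^bsub>T\<^esub> monomial 1 [br L x y] | x y i j.
        x \<in> par L i \<and> y \<in> par L j})"

definition U_ideal :: "'g lsa \<Rightarrow> ('g list \<Rightarrow> complex) set" where
  "U_ideal L = Idl\<^bsub>free_alg (carrier L)\<^esub> (U_relations L)"

type_synonym 'g U = "('g list \<Rightarrow> complex) set"

definition U_alg :: "'g lsa \<Rightarrow> 'g U ring" where
  "U_alg L = free_alg (carrier L) Quot U_ideal L"

definition U_class :: "'g lsa \<Rightarrow> ('g list \<Rightarrow> complex) \<Rightarrow> 'g U" where
  "U_class L p = U_ideal L +>\<^bsub>free_alg (carrier L)\<^esub> p"

definition U_gen :: "'g lsa \<Rightarrow> 'g \<Rightarrow> 'g U" where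
  "U_gen L x = U_class L (monomial 1 [x])"

definition U_par :: "'g lsa \<Rightarrow> bit \<Rightarrow> 'g U set" where
  "U_par L i = {U_class L p | p. p \<in> carrier (free_alg (carrier L)) \<and>
     (\<forall>w. p w \<noteq> 0 \<longrightarrow> (\<exists>js. list_all2 (\<lambda>x j. x \<in> par L j) w js \<and> sum_list js = i))}"

definition free_act :: "('g, 'v) gmod \<Rightarrow> ('g list \<Rightarrow> complex) \<Rightarrow> 'v \<Rightarrow> 'v" where
  "free_act N p v = finsum N (\<lambda>w. p w \<odot>\<^bsub>N\<^esub> foldr (act N) w v) {w. p w \<noteq> 0}"

text \<open>The action of the enveloping algebra on a module, computed on any representative.\<close>

definition U_act :: "('g, 'v) gmod \<Rightarrow> 'g U \<Rightarrow> 'v \<Rightarrow> 'v" where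
  "U_act N Z v = free_act N (SOME p. p \<in> Z) v"


section \<open>Localization at the powers of an element\<close>

text \<open>
  The ring of left fractions: \<open>left_frac R f n r\<close> is the class of \<open>f\<^sup>-\<^sup>n r\<close>. It is a ring when the powers of
  \<open>f\<close> satisfy the left Ore condition: the product \<open>f\<^sup>-\<^sup>n r \<cdot> f\<^sup>-\<^sup>m q\<close> is \<open>f\<^sup>-\<^sup>n\<^sup>-\<^sup>k r' q\<close> whenever
  \<open>f\<^sup>k r = r' f\<^sup>m\<close>.
\<close>

definition left_frac :: "('r, 'x) ring_scheme \<Rightarrow> 'r \<Rightarrow> nat \<Rightarrow> 'r \<Rightarrow> (nat \<times> 'r) set" where
  "left_frac R f n r = {(m, q). q \<in> carrier R \<and>
     (\<exists>k l. k + n = l + m \<and> f [^]\<^bsub>R\<^esub> k \<otimes>\<^bsub>R\<^esub> r = f [^]\<^bsub>R\<^esub> l \<otimes>\<^bsub>R\<^esub> q)}"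

definition localization :: "('r, 'x) ring_scheme \<Rightarrow> 'r \<Rightarrow> (nat \<times> 'r) set ring" where
  "localization R f =
     \<lparr>carrier = {left_frac R f n r | n r. r \<in> carrier R},
      monoid.mult = (\<lambda>Z Y. \<Union>{left_frac R f (n + k) (r' \<otimes>\<^bsub>R\<^esub> q) | n k r' q. \<exists>r m.
         (n, r) \<in> Z \<and> (m, q) \<in> Y \<and> r' \<in> carrier R \<and>
         f [^]\<^bsub>R\<^esub> k \<otimes>\<^bsub>R\<^esub> r = r' \<otimes>\<^bsub>R\<^esub> f [^]\<^bsub>R\<^esub> m}),
      one = left_frac R f 0 \<one>\<^bsub>R\<^esub>,
      ring.zero = left_frac R f 0 \<zero>\<^bsub>R\<^esub>,
      add = (\<lambda>Z Y. \<Union>{left_frac R f (n + m) (f [^]\<^bsub>R\<^esub> m \<otimes>\<^bsub>R\<^esub> r \<oplus>\<^bsub>R\<^esub> f [^]\<^bsub>R\<^esub> n \<otimes>\<^bsub>R\<^esub> q) | n r m q.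
         (n, r) \<in> Z \<and> (m, q) \<in> Y})\<rparr>"

type_synonym 'g Uf = "(nat \<times> 'g U) set"

text \<open>\<open>Uf_alg L f\<close> is \<open>U' = U(\<gg>)[f\<^sup>-\<^sup>1]\<close>, and \<open>Uf_of\<close> is the map \<open>U(\<gg>) \<rightarrow> U'\<close>.\<close>

definition Uf_alg :: "'g lsa \<Rightarrow> 'g \<Rightarrow> 'g Uf ring" where
  "Uf_alg L f = localization (U_alg L) (U_gen L f)"

definition Uf_of :: "'g lsa \<Rightarrow> 'g \<Rightarrow> 'g U \<Rightarrow> 'g Uf" where
  "Uf_of L f u = left_frac (U_alg L) (U_gen L f) 0 u"

definition Uf_gen :: "'g lsa \<Rightarrow> 'g \<Rightarrow> 'g \<Rightarrow> 'g Uf" where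
  "Uf_gen L f x = Uf_of L f (U_gen L x)"

definition Uf_const :: "'g lsa \<Rightarrow> 'g \<Rightarrow> complex \<Rightarrow> 'g Uf" where
  "Uf_const L f c = Uf_of L f (U_class L (monomial c []))"

definition Uf_par :: "'g lsa \<Rightarrow> 'g \<Rightarrow> bit \<Rightarrow> 'g Uf set" where
  "Uf_par L f i = {left_frac (U_alg L) (U_gen L f) n u | n u. u \<in> U_par L i}"

definition ad_f :: "'g lsa \<Rightarrow> 'g \<Rightarrow> 'g Uf \<Rightarrow> 'g Uf" where
  "ad_f L f u = (let Q = Uf_alg L f; F = Uf_gen L f f in F \<otimes>\<^bsub>Q\<^esub> u \<ominus>\<^bsub>Q\<^esub> u \<otimes>\<^bsub>Q\<^esub> F)"

text \<open>The sum is finite because \<open>ad f\<close> acts locally nilpotently on \<open>U'\<close>.\<close>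

definition phi :: "'g lsa \<Rightarrow> 'g \<Rightarrow> complex \<Rightarrow> 'g Uf \<Rightarrow> 'g Uf" where
  "phi L f a u = (let Q = Uf_alg L f; F = Uf_gen L f f in
     finsum Q (\<lambda>i. Uf_const L f (a gchoose i) \<otimes>\<^bsub>Q\<^esub> (ad_f L f ^^ i) u \<otimes>\<^bsub>Q\<^esub> (inv\<^bsub>Q\<^esub> F) [^]\<^bsub>Q\<^esub> i)
       {i. (ad_f L f ^^ i) u \<noteq> \<zero>\<^bsub>Q\<^esub>})"


section \<open>Tensor products over noncommutative rings\<close>

text \<open>
  A left or right module over \<open>R\<close> is given by a record of type \<^typ>\<open>('r, 'm) module\<close>; for a right
  module, \<^term>\<open>module.smult M r m\<close> stands for the product of \<open>m\<close> by \<open>r\<close> from the right.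
\<close>

definition with_smult :: "('m, 'x) ring_scheme \<Rightarrow> ('r \<Rightarrow> 'm \<Rightarrow> 'm) \<Rightarrow> ('r, 'm) module" where
  "with_smult A s = \<lparr>carrier = carrier A, monoid.mult = monoid.mult A, one = \<one>\<^bsub>A\<^esub>, ring.zero = \<zero>\<^bsub>A\<^esub>,
     add = add A, module.smult = s\<rparr>"

type_synonym ('m, 'n) tens = "(('m \<times> 'n) \<Rightarrow>\<^sub>0 int) set"

definition tensor_relations :: "('r, 'x) ring_scheme \<Rightarrow> ('r, 'm) module \<Rightarrow> ('r, 'n) module \<Rightarrow>
    (('m \<times> 'n) \<Rightarrow>\<^sub>0 int) set" where
  "tensor_relations R M N =
     {frag_of (m \<oplus>\<^bsub>M\<^esub> m', n) - frag_of (m, n) - frag_of (m', n) | m m' n.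
        m \<in> carrier M \<and> m' \<in> carrier M \<and> n \<in> carrier N} \<union>
     {frag_of (m, n \<oplus>\<^bsub>N\<^esub> n') - frag_of (m, n) - frag_of (m, n') | m n n'.
        m \<in> carrier M \<and> n \<in> carrier N \<and> n' \<in> carrier N} \<union>
     {frag_of (module.smult M r m, n) - frag_of (m, module.smult N r n) | m r n.
        m \<in> carrier M \<and> r \<in> carrier R \<and> n \<in> carrier N}"

definition tensor_free :: "('r, 'm) module \<Rightarrow> ('r, 'n) module \<Rightarrow> (('m \<times> 'n) \<Rightarrow>\<^sub>0 int) monoid" where
  "tensor_free M N = free_Abelian_group (carrier M \<times> carrier N)"

definition tensor_class :: "('r, 'x) ring_scheme \<Rightarrow> ('r, 'm) module \<Rightarrow> ('r, 'n) module \<Rightarrow>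
    (('m \<times> 'n) \<Rightarrow>\<^sub>0 int) \<Rightarrow> ('m, 'n) tens" where
  "tensor_class R M N p =
     generate (tensor_free M N) (tensor_relations R M N) #>\<^bsub>tensor_free M N\<^esub> p"

text \<open>The additive group of the tensor product; it carries no ring structure.\<close>

definition tensor :: "('r, 'x) ring_scheme \<Rightarrow> ('r, 'm) module \<Rightarrow> ('r, 'n) module \<Rightarrow>
    ('m, 'n) tens ring" where
  "tensor R M N =
     (let T = tensor_free M N Mod generate (tensor_free M N) (tensor_relations R M N) in
      \<lparr>carrier = carrier T, monoid.mult = undefined, one = undefined,
       ring.zero = \<one>\<^bsub>T\<^esub>, add = monoid.mult T\<rparr>)"

definition pure_tensor :: "('r, 'x) ring_scheme \<Rightarrow> ('r, 'm) module \<Rightarrow> ('r, 'n) module \<Rightarrow>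
    'm \<Rightarrow> 'n \<Rightarrow> ('m, 'n) tens" where
  "pure_tensor R M N m n = tensor_class R M N (frag_of (m, n))"

text \<open>The map \<open>\<phi> \<otimes> \<psi>\<close> with values in the tensor product of \<open>M\<close> and \<open>N\<close>.\<close>

definition tensor_map :: "('r, 'x) ring_scheme \<Rightarrow> ('r, 'm) module \<Rightarrow> ('r, 'n) module \<Rightarrow>
    ('k \<Rightarrow> 'm) \<Rightarrow> ('l \<Rightarrow> 'n) \<Rightarrow> ('k, 'l) tens \<Rightarrow> ('m, 'n) tens" where
  "tensor_map R M N \<phi> \<psi> Z =
     (\<Union>p\<in>Z. tensor_class R M N (frag_extend (\<lambda>(m, n). frag_of (\<phi> m, \<psi> n)) p))"


section \<open>Twisted localization and the Enright functor\<close>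

text \<open>
  The bimodule \<open>U' f\<^sup>a\<close>: the element \<open>u f\<^sup>a\<close> is represented by \<open>u\<close>, so that the left action is
  the multiplication of \<open>U'\<close>; the record describes the right action.
\<close>

definition Ufa :: "'g lsa \<Rightarrow> 'g \<Rightarrow> complex \<Rightarrow> ('g Uf, 'g Uf) module" where
  "Ufa L f a = with_smult (Uf_alg L f) (\<lambda>u' u. u \<otimes>\<^bsub>Uf_alg L f\<^esub> phi L f a u')"

definition fpow :: "'g lsa \<Rightarrow> 'g \<Rightarrow> int \<Rightarrow> 'g Uf" where
  "fpow L f s = Uf_gen L f f [^]\<^bsub>Uf_alg L f\<^esub> s"

definition Uf_over_U :: "'g lsa \<Rightarrow> 'g \<Rightarrow> ('g U, 'g Uf) module" where
  "Uf_over_U L f = with_smult (Uf_alg L f) (\<lambda>u w. w \<otimes>\<^bsub>Uf_alg L f\<^esub> Uf_of L f u)"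

definition U_module :: "('g, 'v) gmod \<Rightarrow> ('g U, 'v) module" where
  "U_module N = with_smult N (U_act N)"

text \<open>\<open>U' \<otimes>\<^bsub>U(\<gg>)\<^esub> N\<close> as a left module over \<open>U'\<close>.\<close>

definition loc_mod :: "'g lsa \<Rightarrow> 'g \<Rightarrow> ('g, 'v) gmod \<Rightarrow> ('g Uf, ('g Uf, 'v) tens) module" where
  "loc_mod L f N = with_smult (tensor (U_alg L) (Uf_over_U L f) (U_module N))
     (\<lambda>u. tensor_map (U_alg L) (Uf_over_U L f) (U_module N) (\<lambda>w. u \<otimes>\<^bsub>Uf_alg L f\<^esub> w) (\<lambda>v. v))"

type_synonym ('g, 'v) twisted = "('g Uf, ('g Uf, 'v) tens) tens"

text \<open>\<open>twisted_tensor L f a N u v\<close> is \<open>u f\<^sup>a \<otimes> 1 \<otimes> v\<close>.\<close>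

definition twisted_tensor :: "'g lsa \<Rightarrow> 'g \<Rightarrow> complex \<Rightarrow> ('g, 'v) gmod \<Rightarrow> 'g Uf \<Rightarrow> 'v \<Rightarrow>
    ('g, 'v) twisted" where
  "twisted_tensor L f a N u v = pure_tensor (Uf_alg L f) (Ufa L f a) (loc_mod L f N) u
     (pure_tensor (U_alg L) (Uf_over_U L f) (U_module N) \<one>\<^bsub>Uf_alg L f\<^esub> v)"

definition D_left_mult :: "'g lsa \<Rightarrow> 'g \<Rightarrow> complex \<Rightarrow> ('g, 'v) gmod \<Rightarrow> 'g Uf \<Rightarrow>
    ('g, 'v) twisted \<Rightarrow> ('g, 'v) twisted" where
  "D_left_mult L f a N u = tensor_map (Uf_alg L f) (Ufa L f a) (loc_mod L f N)
     (\<lambda>w. u \<otimes>\<^bsub>Uf_alg L f\<^esub> w) (\<lambda>v. v)"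

text \<open>The generator \<open>f\<^sup>a\<close> of \<open>U' f\<^sup>a\<close> is even.\<close>

definition D_par :: "'g lsa \<Rightarrow> 'g \<Rightarrow> complex \<Rightarrow> ('g, 'v) gmod \<Rightarrow> bit \<Rightarrow> ('g, 'v) twisted set" where
  "D_par L f a N i = generate (add_monoid (tensor (Uf_alg L f) (Ufa L f a) (loc_mod L f N)))
     {pure_tensor (Uf_alg L f) (Ufa L f a) (loc_mod L f N) u
        (pure_tensor (U_alg L) (Uf_over_U L f) (U_module N) w v) | u w v j k l.
      u \<in> Uf_par L f j \<and> w \<in> Uf_par L f k \<and> v \<in> par N l \<and> j + k + l = i}"

definition D_obj :: "'g lsa \<Rightarrow> 'g \<Rightarrow> complex \<Rightarrow> ('g, 'v) gmod \<Rightarrow> ('g, ('g, 'v) twisted) gmod" where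
  "D_obj L f a N = (let T = tensor (Uf_alg L f) (Ufa L f a) (loc_mod L f N) in
     \<lparr>carrier = carrier T, monoid.mult = undefined, one = undefined, ring.zero = \<zero>\<^bsub>T\<^esub>, add = add T,
      module.smult = (\<lambda>c. D_left_mult L f a N (Uf_const L f c)),
      par = D_par L f a N,
      act = (\<lambda>x. D_left_mult L f a N (Uf_gen L f x))\<rparr>)"

text \<open>The target \<open>N\<close> determines the map; the source is not needed.\<close>

definition D_mor :: "'g lsa \<Rightarrow> 'g \<Rightarrow> complex \<Rightarrow> ('g, 'v) gmod \<Rightarrow> ('g, 'v) gmod \<Rightarrow>
    ('v \<Rightarrow> 'v) \<Rightarrow> ('g, 'v) twisted \<Rightarrow> ('g, 'v) twisted" where
  "D_mor L f a M N \<phi> = tensor_map (Uf_alg L f) (Ufa L f a) (loc_mod L f N) (\<lambda>u. u)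
     (tensor_map (U_alg L) (Uf_over_U L f) (U_module N) (\<lambda>w. w) \<phi>)"

definition C_obj :: "'g lsa \<Rightarrow> 'g \<Rightarrow> 'g \<Rightarrow> complex \<Rightarrow> ('g, 'v) gmod \<Rightarrow>
    ('g, ('g, 'v) twisted) gmod" where
  "C_obj L e f a N = (let D = D_obj L f a N in
     sub_gmod D {v \<in> carrier D. fin_dim D (lin_span D (range (\<lambda>k. (act D e ^^ k) v)))})"

text \<open>On morphisms the Enright functor restricts twisted localization.\<close>

definition C_mor :: "'g lsa \<Rightarrow> 'g \<Rightarrow> 'g \<Rightarrow> complex \<Rightarrow> ('g, 'v) gmod \<Rightarrow> ('g, 'v) gmod \<Rightarrow>
    ('v \<Rightarrow> 'v) \<Rightarrow> ('g, 'v) twisted \<Rightarrow> ('g, 'v) twisted" where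
  "C_mor L e f a M N \<phi> = restrict (D_mor L f a M N \<phi>) (carrier (C_obj L e f a M))"

end

theory Submission
  imports Defs
begin

text \<open>
  Every element of \<open>\<D>\<^sub>a(N)\<close> has the form \<open>f\<^sup>a \<otimes> f\<^sup>-\<^sup>n \<otimes> v\<close>, denoted \<open>tw n v\<close>. It vanishes if and only if
  some \<open>f\<^sup>k v\<close> does, and \<open>x \<in> \<gg>\<close> sends it to the sum of the
  \<open>(-1)\<^sup>j (a - n choose j) f\<^sup>a \<otimes> f\<^sup>-\<^sup>n\<^sup>-\<^sup>j \<otimes> (ad f)\<^sup>j(x) v\<close>. That \<open>\<phi>\<^sub>a\<close> is a ring homomorphism, which all of this
  rests on, is an identity polynomial in \<open>a\<close> that holds for natural \<open>a\<close>, where \<open>\<phi>\<^sub>a\<close> is the conjugation by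
  \<open>f\<^sup>a\<close>. The subalgebra generated by \<open>f\<close> and \<open>x\<close> determines these formulas, hence (i); functoriality and left
  exactness are read off them, since a weight vector in \<open>\<C>\<^sub>a(N)\<close> is killed by a power of \<open>e\<close>.

  On a vector of weight \<open>\<nu>\<close> the operator \<open>f\<^sup>K e\<^sup>K\<close> is the product of the \<open>fe - i(\<nu> + i + 1)\<close> for \<open>i < K\<close>, and
  \<open>fe\<close> sends \<open>tw n v\<close> to \<open>tw n ((fe + c(\<mu> + 1 - c)) v)\<close> if \<open>v\<close> has weight \<open>\<mu>\<close> and \<open>c = a - n\<close>. So \<open>e\<^sup>k v = 0\<close> and
  \<open>e\<^sup>K tw n v = 0\<close> each yield a product of linear factors in \<open>fe\<close> that annihilates \<open>tw n v\<close>. In (iii) the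
  two products are coprime unless \<open>a\<close> or \<open>a - \<mu>\<close> is an integer. In (v) the first product divides the
  second one as soon as \<open>a - \<mu>\<close> is a natural number \<open>K \<ge> k\<close>, which replacing \<open>v\<close> by \<open>f\<^sup>j v\<close> achieves; as
  \<open>f\<close> is injective on \<open>\<D>\<^sub>a(N)\<close>, this gives \<open>e\<^sup>K (f\<^sup>a \<otimes> v) = 0\<close>.
\<close>

subsection \<open>Additive maps\<close>

text \<open>The factor u of a tensor u f^a \<otimes> z is moved to the right of f^a by the inverse
  \<open>P.Psi a\<close> of \<open>phi L f a\<close>, which produces the normal form; since passing
  f^(-n) turns \<open>P.Psi a\<close> into the series for a - n, the binomials of a - n appear. The
  obstacle is that a tensor product, a quotient by generated relations, shows directly that tensors
  agree, never that they differ. Vanishing is therefore decided by mapping out: first by sending u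
  f^a \<otimes> z to \<open>P.Psi a u\<close> z in the localized module, then into an explicit group
  of fractions of N. Products of fractions are treated as operators on the additive group of
  fractions, on which right multiplication by f is invertible; this replaces the choices in the Ore
  condition. Products of linear factors are kept as lists of roots, and a coincidence of two roots
  is the vanishing of one of two linear expressions in a, \<mu> and integers. Weight vectors suffice
  because a subspace stable under h contains the weight components of its elements.\<close>

definition ahom :: "('a, 'x) ring_scheme \<Rightarrow> ('b, 'y) ring_scheme \<Rightarrow> ('a \<Rightarrow> 'b) set" where
  "ahom A B = {f. f \<in> carrier A \<rightarrow> carrier B \<and>
     (\<forall>x\<in>carrier A. \<forall>y\<in>carrier A. f (x \<oplus>\<^bsub>A\<^esub> y) = f x \<oplus>\<^bsub>B\<^esub> f y)}"

lemma ahomI: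
  assumes "\<And>x. x \<in> carrier A \<Longrightarrow> f x \<in> carrier B"
    and "\<And>x y. x \<in> carrier A \<Longrightarrow> y \<in> carrier A \<Longrightarrow> f (x \<oplus>\<^bsub>A\<^esub> y) = f x \<oplus>\<^bsub>B\<^esub> f y"
  shows "f \<in> ahom A B"
  using assms by (auto simp: ahom_def)

lemma ahom_closed: "f \<in> ahom A B \<Longrightarrow> x \<in> carrier A \<Longrightarrow> f x \<in> carrier B"
  by (auto simp: ahom_def)

lemma ahom_add: "f \<in> ahom A B \<Longrightarrow> x \<in> carrier A \<Longrightarrow> y \<in> carrier A \<Longrightarrow> f (x \<oplus>\<^bsub>A\<^esub> y) = f x \<oplus>\<^bsub>B\<^esub> f y"
  by (auto simp: ahom_def)

context
  fixes A B f
  assumes A: "abelian_group A" and B: "abelian_group B" and f: "f \<in> ahom A B"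
begin

interpretation A: abelian_group A by (rule A)
interpretation B: abelian_group B by (rule B)
interpretation group_hom "add_monoid A" "add_monoid B" f
  by unfold_locales (use f in \<open>auto simp: ahom_def hom_def\<close>)

lemma ahom_zero: "f \<zero>\<^bsub>A\<^esub> = \<zero>\<^bsub>B\<^esub>"
  using hom_one by simp

lemma ahom_neg: "x \<in> carrier A \<Longrightarrow> f (\<ominus>\<^bsub>A\<^esub> x) = \<ominus>\<^bsub>B\<^esub> f x"
  using hom_inv[of x] by (simp add: a_inv_def)

lemma ahom_minus: "x \<in> carrier A \<Longrightarrow> y \<in> carrier A \<Longrightarrow> f (x \<ominus>\<^bsub>A\<^esub> y) = f x \<ominus>\<^bsub>B\<^esub> f y"
  using ahom_add[OF f, of x "\<ominus>\<^bsub>A\<^esub> y"] by (simp add: A.minus_eq B.minus_eq ahom_neg)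

lemma ahom_finsum:
  assumes "g \<in> I \<rightarrow> carrier A"
  shows "f (finsum A g I) = finsum B (\<lambda>i. f (g i)) I"
  using assms
proof (induction I rule: infinite_finite_induct)
  case (infinite I)
  then show ?case by (simp add: ahom_zero)
next
  case empty
  then show ?case by (simp add: ahom_zero)
next
  case (insert i I)
  then have "(\<lambda>i. f (g i)) \<in> I \<rightarrow> carrier B" "f (g i) \<in> carrier B"
    by (auto intro: ahom_closed[OF f])
  with insert show ?case
    by (simp add: ahom_add[OF f] A.finsum_closed)
qed

end

lemma ahom_comp: "f \<in> ahom A B \<Longrightarrow> g \<in> ahom B C \<Longrightarrow> (\<lambda>x. g (f x)) \<in> ahom A C"
  by (rule ahomI) (simp_all add: ahom_closed ahom_add)

subsection \<open>Tensor products\<close>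

text \<open>The hypotheses are closure conditions, which both stages of the construction satisfy by
  inspection; the group structure comes from the free abelian group in which the relations
  live.\<close>

locale tensor_product =
  fixes R :: "('r, 'x) ring_scheme" and M :: "('r, 'm) module" and N :: "('r, 'n) module"
  assumes M_add: "\<And>m m'. m \<in> carrier M \<Longrightarrow> m' \<in> carrier M \<Longrightarrow> m \<oplus>\<^bsub>M\<^esub> m' \<in> carrier M"
    and M_smult: "\<And>r m. r \<in> carrier R \<Longrightarrow> m \<in> carrier M \<Longrightarrow> module.smult M r m \<in> carrier M"
    and N_add: "\<And>m m'. m \<in> carrier N \<Longrightarrow> m' \<in> carrier N \<Longrightarrow> m \<oplus>\<^bsub>N\<^esub> m' \<in> carrier N"
    and N_smult: "\<And>r m. r \<in> carrier R \<Longrightarrow> m \<in> carrier N \<Longrightarrow> module.smult N r m \<in> carrier N"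
begin

abbreviation "F \<equiv> tensor_free M N"
abbreviation "T \<equiv> tensor R M N"
abbreviation "cl \<equiv> tensor_class R M N"
abbreviation "pt \<equiv> pure_tensor R M N"

definition K where "K = generate F (tensor_relations R M N)"

lemma comm_group_F: "comm_group F"
  by (simp add: tensor_free_def abelian_free_Abelian_group)

lemma carrier_F: "p \<in> carrier F \<longleftrightarrow> Poly_Mapping.keys p \<subseteq> carrier M \<times> carrier N"
  by (simp add: tensor_free_def)

lemma F_simps [simp]: "p \<otimes>\<^bsub>F\<^esub> q = p + q" "\<one>\<^bsub>F\<^esub> = 0"
  by (simp_all add: tensor_free_def)

lemma F_inv: "p \<in> carrier F \<Longrightarrow> inv\<^bsub>F\<^esub> p = - p"
  by (simp add: tensor_free_def)

lemma F_closed: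
  "p \<in> carrier F \<Longrightarrow> q \<in> carrier F \<Longrightarrow> p + q \<in> carrier F"
  "p \<in> carrier F \<Longrightarrow> q \<in> carrier F \<Longrightarrow> p - q \<in> carrier F"
  "p \<in> carrier F \<Longrightarrow> - p \<in> carrier F"
  "0 \<in> carrier F"
  "m \<in> carrier M \<Longrightarrow> n \<in> carrier N \<Longrightarrow> frag_of (m, n) \<in> carrier F"
  unfolding carrier_F using keys_add[of p q] keys_diff[of p q] by auto

lemma relations_carrier: "tensor_relations R M N \<subseteq> carrier F"
  unfolding tensor_relations_def
  by (auto simp: M_add N_add M_smult N_smult intro!: F_closed)

interpretation F: comm_group F by (rule comm_group_F)

lemma K_subgroup: "subgroup K F"
  unfolding K_def by (rule F.generate_is_subgroup[OF relations_carrier])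

lemma K_normal: "K \<lhd> F"
  by (rule F.subgroup_imp_normal[OF K_subgroup])

lemma K_carrier: "k \<in> K \<Longrightarrow> k \<in> carrier F"
  using subgroup.subset[OF K_subgroup] by auto

lemma K_closed:
  "0 \<in> K"
  "k \<in> K \<Longrightarrow> l \<in> K \<Longrightarrow> k + l \<in> K"
  "k \<in> K \<Longrightarrow> - k \<in> K"
  using subgroup.one_closed[OF K_subgroup] subgroup.m_closed[OF K_subgroup, of k l]
    subgroup.m_inv_closed[OF K_subgroup, of k] F_inv[OF K_carrier] by auto

lemma K_diff: "k \<in> K \<Longrightarrow> l \<in> K \<Longrightarrow> k - l \<in> K"
  using K_closed(2)[OF _ K_closed(3), of k l] by simp

lemma cl_eq: "cl p = {k + p | k. k \<in> K}"
  by (auto simp: tensor_class_def r_coset_def K_def)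

lemma cl_self: "p \<in> cl p"
  using K_closed(1) by (force simp: cl_eq)

lemma cl_eq_iff: "cl p = cl q \<longleftrightarrow> p - q \<in> K"
proof
  assume "cl p = cl q"
  then have "p \<in> cl q" using cl_self by auto
  then show "p - q \<in> K" by (auto simp: cl_eq)
next
  assume pq: "p - q \<in> K"
  show "cl p = cl q"
  proof (intro equalityI subsetI)
    fix x assume "x \<in> cl p"
    then have "x - p \<in> K" by (auto simp: cl_eq)
    then have "x - q \<in> K" using K_closed(2)[OF _ pq, of "x - p"] by simp
    then show "x \<in> cl q" by (auto simp: cl_eq intro: exI[of _ "x - q"])
  next
    fix x assume "x \<in> cl q"
    then have "x - q \<in> K" by (auto simp: cl_eq)
    then have "x - p \<in> K" using K_diff[OF _ pq, of "x - q"] by simp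
    then show "x \<in> cl p" by (auto simp: cl_eq intro: exI[of _ "x - p"])
  qed
qed

lemma T_carrier: "carrier T = cl ` carrier F"
  by (simp add: tensor_def Let_def carrier_FactGroup tensor_class_def[abs_def])

lemma cl_closed: "p \<in> carrier F \<Longrightarrow> cl p \<in> carrier T"
  by (simp add: T_carrier)

lemma T_zero: "\<zero>\<^bsub>T\<^esub> = cl 0"
  by (simp add: tensor_def Let_def cl_eq K_def)

lemma cl_add: "p \<in> carrier F \<Longrightarrow> q \<in> carrier F \<Longrightarrow> cl p \<oplus>\<^bsub>T\<^esub> cl q = cl (p + q)"
  using normal.rcos_sum[OF K_normal, of p q] by (simp add: tensor_def Let_def tensor_class_def K_def)

lemma T_add_monoid: "add_monoid T = F Mod K"
  by (simp add: tensor_def Let_def K_def FactGroup_def)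

lemma abelian_group_T: "abelian_group T"
  using F.abelian_FactGroup[OF K_subgroup] T_add_monoid
  by (metis comm_group_abelian_groupI)

interpretation T: abelian_group T by (rule abelian_group_T)

lemma cl_diff: "p \<in> carrier F \<Longrightarrow> q \<in> carrier F \<Longrightarrow> cl p \<ominus>\<^bsub>T\<^esub> cl q = cl (p - q)"
proof -
  assume p: "p \<in> carrier F" and q: "q \<in> carrier F"
  have "cl (p - q) \<oplus>\<^bsub>T\<^esub> cl q = cl p"
    using p q by (subst cl_add) (auto simp: F_closed)
  then show ?thesis
    using p q by (metis F_closed(2) T.add.inv_solve_right' T.minus_eq cl_closed)
qed

lemma relation_eq:
  assumes "p - q \<in> tensor_relations R M N"
  shows "cl p = cl q"
  unfolding cl_eq_iff K_def using assms by (rule generate.incl)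

lemma pt_closed: "m \<in> carrier M \<Longrightarrow> n \<in> carrier N \<Longrightarrow> pt m n \<in> carrier T"
  by (simp add: pure_tensor_def cl_closed F_closed)

lemma pt_add_left:
  assumes "m \<in> carrier M" "m' \<in> carrier M" "n \<in> carrier N"
  shows "pt (m \<oplus>\<^bsub>M\<^esub> m') n = pt m n \<oplus>\<^bsub>T\<^esub> pt m' n"
  unfolding pure_tensor_def using assms
  by (subst cl_add) (auto intro!: relation_eq simp: F_closed tensor_relations_def diff_diff_eq[symmetric])

lemma pt_add_right:
  assumes "m \<in> carrier M" "n \<in> carrier N" "n' \<in> carrier N"
  shows "pt m (n \<oplus>\<^bsub>N\<^esub> n') = pt m n \<oplus>\<^bsub>T\<^esub> pt m n'"
proof -
  have "frag_of (m, n \<oplus>\<^bsub>N\<^esub> n') - (frag_of (m, n) + frag_of (m, n')) \<in> tensor_relations R M N"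
    unfolding tensor_relations_def diff_diff_eq[symmetric] using assms by blast
  then show ?thesis
    unfolding pure_tensor_def using assms by (simp add: cl_add F_closed relation_eq)
qed

lemma pt_balanced:
  assumes "m \<in> carrier M" "r \<in> carrier R" "n \<in> carrier N"
  shows "pt (module.smult M r m) n = pt m (module.smult N r n)"
  unfolding pure_tensor_def using assms
  by (intro relation_eq) (auto simp: tensor_relations_def)

text \<open>The case \<open>diff\<close> handles sums and negatives together, since the underlying
  free group has integer coefficients.\<close>

lemma tensor_induct [consumes 1, case_names zero pure diff]:
  assumes "z \<in> carrier T"
    and "P \<zero>\<^bsub>T\<^esub>"
    and "\<And>m n. m \<in> carrier M \<Longrightarrow> n \<in> carrier N \<Longrightarrow> P (pt m n)"
    and "\<And>x y. x \<in> carrier T \<Longrightarrow> y \<in> carrier T \<Longrightarrow> P x \<Longrightarrow> P y \<Longrightarrow> P (x \<ominus>\<^bsub>T\<^esub> y)"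
  shows "P z"
proof -
  obtain p where p: "p \<in> carrier F" "z = cl p"
    using assms(1) by (auto simp: T_carrier)
  have "P (cl p)"
  proof (rule free_Abelian_group_induct[OF p(1)[unfolded carrier_F]])
    show "P (cl 0)" using assms(2) by (simp add: T_zero)
    show "P (cl (frag_of a))" if "a \<in> carrier M \<times> carrier N" for a
      using assms(3) that by (auto simp: pure_tensor_def)
    show "P (cl (x - y))" if "Poly_Mapping.keys x \<subseteq> carrier M \<times> carrier N"
      "Poly_Mapping.keys y \<subseteq> carrier M \<times> carrier N" "P (cl x)" "P (cl y)" for x y
      using assms(4)[of "cl x" "cl y"] that by (simp add: cl_diff carrier_F cl_closed)
  qed
  then show ?thesis by (simp add: p)
qed

lemma ahom_eq_on_pure:
  assumes G: "abelian_group G" and "\<phi> \<in> ahom T G" "\<psi> \<in> ahom T G"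
    and eq: "\<And>m n. m \<in> carrier M \<Longrightarrow> n \<in> carrier N \<Longrightarrow> \<phi> (pt m n) = \<psi> (pt m n)"
    and "z \<in> carrier T"
  shows "\<phi> z = \<psi> z"
  using \<open>z \<in> carrier T\<close>
  by (induction z rule: tensor_induct)
    (simp_all add: ahom_zero[OF abelian_group_T G assms(2)] ahom_zero[OF abelian_group_T G assms(3)]
      ahom_minus[OF abelian_group_T G assms(2)] ahom_minus[OF abelian_group_T G assms(3)] eq)

lemma K_hom_zero:
  assumes G: "group G" and g: "g \<in> hom F G"
    and rel: "\<And>p. p \<in> tensor_relations R M N \<Longrightarrow> g p = \<one>\<^bsub>G\<^esub>"
    and k: "k \<in> K"
  shows "g k = \<one>\<^bsub>G\<^esub>"
proof -
  interpret group_hom F G g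
    using G g F.is_group by (simp add: group_hom_def group_hom_axioms_def)
  have "tensor_relations R M N \<subseteq> kernel F G g"
    using relations_carrier rel by (auto simp: kernel_def)
  then have "K \<subseteq> kernel F G g"
    unfolding K_def by (rule F.generate_subgroup_incl[OF _ subgroup_kernel])
  then show ?thesis using k by (auto simp: kernel_def)
qed

text \<open>The universal property. It is the tool for showing that a tensor is not zero; both
  vanishing criteria, \<open>tau_zero_iff\<close> and \<open>tw_zero_iff\<close>, rest on
  it.\<close>

lemma tensor_lift:
  assumes G: "abelian_group G"
    and closed: "\<And>m n. m \<in> carrier M \<Longrightarrow> n \<in> carrier N \<Longrightarrow> b m n \<in> carrier G"
    and addl: "\<And>m m' n. m \<in> carrier M \<Longrightarrow> m' \<in> carrier M \<Longrightarrow> n \<in> carrier N \<Longrightarrow>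
       b (m \<oplus>\<^bsub>M\<^esub> m') n = b m n \<oplus>\<^bsub>G\<^esub> b m' n"
    and addr: "\<And>m n n'. m \<in> carrier M \<Longrightarrow> n \<in> carrier N \<Longrightarrow> n' \<in> carrier N \<Longrightarrow>
       b m (n \<oplus>\<^bsub>N\<^esub> n') = b m n \<oplus>\<^bsub>G\<^esub> b m n'"
    and bal: "\<And>m r n. m \<in> carrier M \<Longrightarrow> r \<in> carrier R \<Longrightarrow> n \<in> carrier N \<Longrightarrow>
       b (module.smult M r m) n = b m (module.smult N r n)"
  obtains \<phi> where "\<phi> \<in> ahom T G" "\<And>m n. m \<in> carrier M \<Longrightarrow> n \<in> carrier N \<Longrightarrow> \<phi> (pt m n) = b m n"
proof -
  interpret G: abelian_group G by (rule G)
  have "(\<lambda>(m, n). b m n) ` (carrier M \<times> carrier N) \<subseteq> carrier (add_monoid G)"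
    using closed by auto
  from G.a_comm_group[THEN comm_group.free_Abelian_group_universal, OF this]
  obtain g where g: "g \<in> hom F (add_monoid G)"
    and gf: "\<And>m n. m \<in> carrier M \<Longrightarrow> n \<in> carrier N \<Longrightarrow> g (frag_of (m, n)) = b m n"
    unfolding tensor_free_def by (metis (no_types, lifting) SigmaI case_prod_conv)
  have gadd: "g (p + q) = g p \<oplus>\<^bsub>G\<^esub> g q" "g p \<in> carrier G"
    if "p \<in> carrier F" "q \<in> carrier F" for p q
    using g that by (auto simp: hom_def)
  have gdiff: "g (p - q) = g p \<ominus>\<^bsub>G\<^esub> g q" if "p \<in> carrier F" "q \<in> carrier F" for p q
  proof -
    have "g p = g (p - q) \<oplus>\<^bsub>G\<^esub> g q"
      using gadd(1)[of "p - q" q] that F_closed by simp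
    then show ?thesis using that F_closed gadd(2)
      by (metis G.add.inv_solve_right' G.minus_eq)
  qed
  have rel: "g p = \<one>\<^bsub>add_monoid G\<^esub>" if "p \<in> tensor_relations R M N" for p
  proof -
    have z: "x \<ominus>\<^bsub>G\<^esub> x = \<zero>\<^bsub>G\<^esub>" if "x \<in> carrier G" for x
      using that by (simp add: G.minus_eq G.r_neg)
    have z3: "(x \<oplus>\<^bsub>G\<^esub> y) \<ominus>\<^bsub>G\<^esub> x \<ominus>\<^bsub>G\<^esub> y = \<zero>\<^bsub>G\<^esub>" if "x \<in> carrier G" "y \<in> carrier G" for x y
      using that by (metis G.a_comm G.add.inv_solve_right' G.minus_closed G.minus_eq z G.add.m_closed)
    show ?thesis
      using that unfolding tensor_relations_def
      by (auto simp: gdiff gf F_closed M_add N_add M_smult N_smult addl addr bal closed z z3)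
  qed
  \<comment> \<open>The chosen representative differs from any other one by an element of
    \<open>K\<close>, on which g vanishes.\<close>
  define \<phi> where "\<phi> Z = g (SOME p. p \<in> Z \<and> p \<in> carrier F)" for Z
  have \<phi>: "\<phi> (cl p) = g p" if p: "p \<in> carrier F" for p
  proof -
    have "(SOME q. q \<in> cl p \<and> q \<in> carrier F) \<in> cl p \<and> (SOME q. q \<in> cl p \<and> q \<in> carrier F) \<in> carrier F"
      by (rule someI[of _ p]) (simp add: p cl_self)
    then obtain k where k: "k \<in> K" "(SOME q. q \<in> cl p \<and> q \<in> carrier F) = k + p"
      by (auto simp: cl_eq)
    have "g k = \<zero>\<^bsub>G\<^esub>"
      using K_hom_zero[OF G.a_group g rel k(1)] by simp
    then show ?thesis
      unfolding \<phi>_def k(2) using gadd[OF K_carrier[OF k(1)] p] gadd(2)[OF p p] by simp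
  qed
  show thesis
  proof
    show "\<phi> \<in> ahom T G"
      by (rule ahomI) (auto simp: T_carrier \<phi> gadd cl_add F_closed)
    show "\<phi> (pt m n) = b m n" if "m \<in> carrier M" "n \<in> carrier N" for m n
      using that by (simp add: pure_tensor_def \<phi> F_closed gf)
  qed
qed

lemma tensor_map:
  fixes \<alpha> :: "'m \<Rightarrow> 'k" and \<beta> :: "'n \<Rightarrow> 'l" and R' :: "('s, 'y) ring_scheme"
  assumes "tensor_product R' M' N'"
    and \<alpha>: "\<alpha> \<in> ahom M M'" and \<beta>: "\<beta> \<in> ahom N N'"
    and bal: "\<And>m r n. m \<in> carrier M \<Longrightarrow> r \<in> carrier R \<Longrightarrow> n \<in> carrier N \<Longrightarrow>
      pure_tensor R' M' N' (\<alpha> (module.smult M r m)) (\<beta> n)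
      = pure_tensor R' M' N' (\<alpha> m) (\<beta> (module.smult N r n))"
  shows "tensor_map R' M' N' \<alpha> \<beta> \<in> ahom T (tensor R' M' N')"
    and "\<And>m n. m \<in> carrier M \<Longrightarrow> n \<in> carrier N \<Longrightarrow>
       tensor_map R' M' N' \<alpha> \<beta> (pt m n) = pure_tensor R' M' N' (\<alpha> m) (\<beta> n)"
proof -
  interpret T': tensor_product R' M' N' by fact
  interpret TT': abelian_group T'.T by (rule T'.abelian_group_T)
  let ?g = "frag_extend (\<lambda>(m, n). frag_of (\<alpha> m, \<beta> n))"
  have g: "?g p \<in> carrier T'.F" if "p \<in> carrier F" for p
    using keys_frag_extend[of "\<lambda>(m, n). frag_of (\<alpha> m, \<beta> n)" p] that
      ahom_closed[OF \<alpha>] ahom_closed[OF \<beta>]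
    unfolding carrier_F T'.carrier_F by fastforce
  have hom: "(\<lambda>p. T'.cl (?g p)) \<in> hom F (add_monoid T'.T)"
    by (auto simp: hom_def frag_extend_add T'.cl_add g T'.cl_closed)
  have "T'.cl (?g k) = \<zero>\<^bsub>T'.T\<^esub>" if "k \<in> K" for k
  proof -
    have eq0: "T'.cl (?g p - ?g q) = \<zero>\<^bsub>T'.T\<^esub>" if "T'.cl (?g p) = T'.cl (?g q)"  for p q
      using that T'.cl_eq_iff[of "?g p - ?g q" 0] T'.cl_eq_iff[of "?g p" "?g q"] by (simp add: T'.T_zero)
    have eq0': "T'.cl (?g p - ?g q - ?g r) = \<zero>\<^bsub>T'.T\<^esub>"
      if "T'.cl (?g p) = T'.cl (?g q + ?g r)"  for p q r
      using that T'.cl_eq_iff[of "?g p - ?g q - ?g r" 0] T'.cl_eq_iff[of "?g p" "?g q + ?g r"]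
      by (simp add: T'.T_zero diff_diff_eq)
    have "T'.cl (?g p) = \<zero>\<^bsub>T'.T\<^esub>" if "p \<in> tensor_relations R M N" for p
      using that unfolding tensor_relations_def
    proof (elim UnE CollectE exE conjE; (simp only: frag_extend_diff)?)
      fix m m' n assume *: "m \<in> carrier M" "m' \<in> carrier M" "n \<in> carrier N"
      show "T'.cl (?g (frag_of (m \<oplus>\<^bsub>M\<^esub> m', n)) - ?g (frag_of (m, n)) - ?g (frag_of (m', n))) = \<zero>\<^bsub>T'.T\<^esub>"
        using T'.pt_add_left[of "\<alpha> m" "\<alpha> m'" "\<beta> n"] *
        by (intro eq0') (simp add: ahom_add[OF \<alpha>] ahom_closed[OF \<alpha>] ahom_closed[OF \<beta>]
          pure_tensor_def T'.cl_add T'.F_closed)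
    next
      fix m n n' assume *: "m \<in> carrier M" "n' \<in> carrier N" "n \<in> carrier N"
      show "T'.cl (?g (frag_of (m, n \<oplus>\<^bsub>N\<^esub> n')) - ?g (frag_of (m, n)) - ?g (frag_of (m, n'))) = \<zero>\<^bsub>T'.T\<^esub>"
        using T'.pt_add_right[of "\<alpha> m" "\<beta> n" "\<beta> n'"] *
        by (intro eq0') (simp add: ahom_add[OF \<beta>] ahom_closed[OF \<alpha>] ahom_closed[OF \<beta>]
          pure_tensor_def T'.cl_add T'.F_closed)
    next
      fix m r n assume *: "m \<in> carrier M" "r \<in> carrier R" "n \<in> carrier N"
      show "T'.cl (?g (frag_of (module.smult M r m, n)) - ?g (frag_of (m, module.smult N r n))) = \<zero>\<^bsub>T'.T\<^esub>"
        using bal[OF *] by (intro eq0) (simp add: pure_tensor_def)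
    qed
    then show ?thesis using K_hom_zero[OF TT'.a_group hom _ that] by simp
  qed
  \<comment> \<open>Hence all members of a coset have the same image class, and the union over the
    coset is that class.\<close>
  then have k0: "T'.cl (?g (k + p)) = T'.cl (?g p)" if "k \<in> K" for k p
    using that by (simp add: frag_extend_add T'.cl_eq_iff T'.T_zero)
  have map: "tensor_map R' M' N' \<alpha> \<beta> (cl p) = T'.cl (?g p)" if "p \<in> carrier F" for p
    unfolding Defs.tensor_map_def cl_eq using k0 K_closed(1) by auto
  show "tensor_map R' M' N' \<alpha> \<beta> \<in> ahom T (tensor R' M' N')"
    by (rule ahomI) (auto simp: T_carrier map g T'.cl_closed cl_add T'.cl_add F_closed frag_extend_add)
  show "tensor_map R' M' N' \<alpha> \<beta> (pt m n) = T'.pt (\<alpha> m) (\<beta> n)"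
    if "m \<in> carrier M" "n \<in> carrier N" for m n
    using that by (simp add: pure_tensor_def map F_closed)
qed

end

subsection \<open>Fractions with respect to an endomorphism of an abelian group\<close>

text \<open>The fraction f^(-n) v with an arbitrary additive endomorphism in the role of f. Two
  instances occur: left multiplication by f on the enveloping algebra, giving the additive group of
  its localization, and the action of f on N, giving a model of the localized module.\<close>

definition frac :: "('a, 'x) ring_scheme \<Rightarrow> ('a \<Rightarrow> 'a) \<Rightarrow> nat \<Rightarrow> 'a \<Rightarrow> (nat \<times> 'a) set" where
  "frac A \<phi> n v = {(m, w). w \<in> carrier A \<and> (\<exists>k l. k + n = l + m \<and> (\<phi> ^^ k) v = (\<phi> ^^ l) w)}"

definition frac_group :: "('a, 'x) ring_scheme \<Rightarrow> ('a \<Rightarrow> 'a) \<Rightarrow> (nat \<times> 'a) set ring" where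
  "frac_group A \<phi> =
     \<lparr>carrier = {frac A \<phi> n v | n v. v \<in> carrier A}, monoid.mult = undefined, one = undefined,
      ring.zero = frac A \<phi> 0 \<zero>\<^bsub>A\<^esub>,
      add = (\<lambda>Z Y. \<Union>{frac A \<phi> (n + m) ((\<phi> ^^ m) v \<oplus>\<^bsub>A\<^esub> (\<phi> ^^ n) w) | n v m w. (n, v) \<in> Z \<and> (m, w) \<in> Y})\<rparr>"

lemma funpow_add_app: "(f ^^ m) ((f ^^ n) x) = (f ^^ (m + n)) x"
  by (simp add: funpow_add)

lemma funpow_ahom: "f \<in> ahom A A \<Longrightarrow> f ^^ n \<in> ahom A A"
proof (induction n)
  case 0
  then show ?case by (auto simp: ahom_def)
next
  case (Suc n)
  then show ?case using ahom_comp[of "f ^^ n" A A f A] by (simp add: comp_def)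
qed

lemma (in abelian_group) minus_eq_zero_iff:
  assumes "x \<in> carrier G" "y \<in> carrier G"
  shows "x \<ominus> y = \<zero> \<longleftrightarrow> x = y"
proof
  assume "x \<ominus> y = \<zero>"
  then have "\<zero> \<oplus> y = x"
    using assms by (metis a_inv_closed add.inv_solve_right' minus_eq zero_closed)
  then show "x = y" using assms by simp
qed (use assms in \<open>simp add: minus_eq r_neg\<close>)

locale group_endo = abelian_group A for A :: "('a, 'x) ring_scheme" (structure) +
  fixes \<phi> :: "'a \<Rightarrow> 'a"
  assumes endo: "\<phi> \<in> ahom A A"
begin

abbreviation "fr \<equiv> frac A \<phi>"
abbreviation "Fr \<equiv> frac_group A \<phi>"

lemmas pow_endo = funpow_ahom[OF endo]

lemma pow_closed [simp]: "v \<in> carrier A \<Longrightarrow> (\<phi> ^^ n) v \<in> carrier A"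
  by (rule ahom_closed[OF pow_endo])

lemma pow_zero [simp]: "(\<phi> ^^ n) \<zero> = \<zero>"
  by (rule ahom_zero[OF abelian_group_axioms abelian_group_axioms pow_endo])

lemma fr_memD:
  assumes "(m, w) \<in> fr n v"
  obtains k l where "w \<in> carrier A" "k + n = l + m" "(\<phi> ^^ k) v = (\<phi> ^^ l) w"
  using assms by (auto simp: frac_def)

lemma fr_self: "v \<in> carrier A \<Longrightarrow> (n, v) \<in> fr n v"
  by (auto simp: frac_def)

text \<open>Two cross-multiplied equations compose because the powers of a single map
  commute.\<close>

lemma fr_trans:
  assumes "k + n = l + m" "(\<phi> ^^ k) v = (\<phi> ^^ l) w" "k' + m = l' + p" "(\<phi> ^^ k') w = (\<phi> ^^ l') u"
  shows "(k' + k) + n = (l + l') + p" "(\<phi> ^^ (k' + k)) v = (\<phi> ^^ (l + l')) u"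
proof -
  show "(k' + k) + n = (l + l') + p" using assms by linarith
  have "(\<phi> ^^ (k' + k)) v = (\<phi> ^^ (k' + l)) w" by (simp add: funpow_add assms(2))
  also have "\<dots> = (\<phi> ^^ (l + k')) w" by (simp add: add.commute)
  also have "\<dots> = (\<phi> ^^ (l + l')) u" by (simp add: funpow_add assms(4))
  finally show "(\<phi> ^^ (k' + k)) v = (\<phi> ^^ (l + l')) u" .
qed

lemma fr_eqI:
  assumes "k + n = l + m" "(\<phi> ^^ k) v = (\<phi> ^^ l) w"
  shows "fr n v = fr m w"
proof (intro equalityI subrelI)
  fix p u assume "(p, u) \<in> fr n v"
  then obtain k' l' where u: "u \<in> carrier A" "k' + n = l' + p" "(\<phi> ^^ k') v = (\<phi> ^^ l') u"
    by (rule fr_memD)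
  show "(p, u) \<in> fr m w"
    using u(1) fr_trans[OF assms(1)[symmetric] assms(2)[symmetric] u(2,3)] by (auto simp: frac_def)
next
  fix p u assume "(p, u) \<in> fr m w"
  then obtain k' l' where u: "u \<in> carrier A" "k' + m = l' + p" "(\<phi> ^^ k') w = (\<phi> ^^ l') u"
    by (rule fr_memD)
  show "(p, u) \<in> fr n v"
    using u(1) fr_trans[OF assms u(2,3)] by (auto simp: frac_def)
qed

lemma fr_mem_eq: "(m, w) \<in> fr n v \<Longrightarrow> fr m w = fr n v"
  using fr_eqI by (elim fr_memD) metis

lemma fr_eq_iff:
  assumes "w \<in> carrier A"
  shows "fr n v = fr m w \<longleftrightarrow> (\<exists>k l. k + n = l + m \<and> (\<phi> ^^ k) v = (\<phi> ^^ l) w)"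
proof
  assume "fr n v = fr m w"
  then have "(m, w) \<in> fr n v" using fr_self[OF assms] by simp
  then show "\<exists>k l. k + n = l + m \<and> (\<phi> ^^ k) v = (\<phi> ^^ l) w" by (auto simp: frac_def)
qed (elim exE conjE, rule fr_eqI)

lemma fr_shift: "fr (n + k) ((\<phi> ^^ k) v) = fr n v"
  by (rule fr_eqI[of 0 _ k]) (simp_all add: add.commute)

lemma X_carrier: "z \<in> carrier Fr \<longleftrightarrow> (\<exists>n v. v \<in> carrier A \<and> z = fr n v)"
  by (auto simp: frac_group_def)

lemma fr_closed [simp]: "v \<in> carrier A \<Longrightarrow> fr n v \<in> carrier Fr"
  by (auto simp: X_carrier)

lemma common_denominator:
  assumes "z \<in> carrier Fr" "y \<in> carrier Fr"
  obtains n v w where "v \<in> carrier A" "w \<in> carrier A" "z = fr n v" "y = fr n w"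
proof -
  obtain n v m w where "v \<in> carrier A" "z = fr n v" "w \<in> carrier A" "y = fr m w"
    using assms by (auto simp: X_carrier)
  moreover from this have "z = fr (n + m) ((\<phi> ^^ m) v)" "y = fr (n + m) ((\<phi> ^^ n) w)"
    using fr_shift[of n m v] fr_shift[of m n w] by (simp_all add: add.commute)
  ultimately show thesis using that pow_closed by metis
qed

text \<open>The sum is a union over all pairs of representatives; applying suitable powers of
  \<open>\<phi>\<close> to both numerators shows that every pair yields the same class.\<close>

lemma fr_add:
  assumes v: "v \<in> carrier A" and w: "w \<in> carrier A"
  shows "fr n v \<oplus>\<^bsub>Fr\<^esub> fr m w = fr (n + m) ((\<phi> ^^ m) v \<oplus> (\<phi> ^^ n) w)"
proof -
  have "fr (n' + m') ((\<phi> ^^ m') v' \<oplus> (\<phi> ^^ n') w') = fr (n + m) ((\<phi> ^^ m) v \<oplus> (\<phi> ^^ n) w)"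
    if v': "(n', v') \<in> fr n v" and w': "(m', w') \<in> fr m w" for n' v' m' w'
  proof -
    obtain k l where 1: "v' \<in> carrier A" "k + n = l + n'" "(\<phi> ^^ k) v = (\<phi> ^^ l) v'"
      by (rule fr_memD[OF v'])
    obtain k' l' where 2: "w' \<in> carrier A" "k' + m = l' + m'" "(\<phi> ^^ k') w = (\<phi> ^^ l') w'"
      by (rule fr_memD[OF w'])
    have "(\<phi> ^^ (l + l')) ((\<phi> ^^ m') v') = (\<phi> ^^ (l' + m')) ((\<phi> ^^ l) v')"
      by (simp add: funpow_add_app ac_simps)
    also have "\<dots> = (\<phi> ^^ (k + k')) ((\<phi> ^^ m) v)"
      unfolding 1(3)[symmetric] 2(2)[symmetric] by (simp add: funpow_add_app ac_simps)
    finally have a: "(\<phi> ^^ (l + l')) ((\<phi> ^^ m') v') = (\<phi> ^^ (k + k')) ((\<phi> ^^ m) v)" .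
    have "(\<phi> ^^ (l + l')) ((\<phi> ^^ n') w') = (\<phi> ^^ (l + n')) ((\<phi> ^^ l') w')"
      by (simp add: funpow_add_app ac_simps)
    also have "\<dots> = (\<phi> ^^ (k + k')) ((\<phi> ^^ n) w)"
      unfolding 1(2)[symmetric] 2(3)[symmetric] by (simp add: funpow_add_app ac_simps)
    finally have b: "(\<phi> ^^ (l + l')) ((\<phi> ^^ n') w') = (\<phi> ^^ (k + k')) ((\<phi> ^^ n) w)" .
    show ?thesis
      by (rule fr_eqI[of "l + l'" _ "k + k'"])
        (use a b 1 2 v w in \<open>simp_all add: ahom_add[OF pow_endo] del: funpow.simps\<close>)
  qed
  then have "{fr (n' + m') ((\<phi> ^^ m') v' \<oplus> (\<phi> ^^ n') w') | n' v' m' w'. (n', v') \<in> fr n v \<and> (m', w') \<in> fr m w}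
      = {fr (n + m) ((\<phi> ^^ m) v \<oplus> (\<phi> ^^ n) w)}"
    using fr_self[OF v, of n] fr_self[OF w, of m] by blast
  then show ?thesis unfolding frac_group_def by simp
qed

lemma fr_add_same:
  assumes v: "v \<in> carrier A" and w: "w \<in> carrier A"
  shows "fr n v \<oplus>\<^bsub>Fr\<^esub> fr n w = fr n (v \<oplus> w)"
  using fr_shift[of n n "v \<oplus> w"] assms by (simp add: fr_add ahom_add[OF pow_endo])

lemma X_zero: "fr n \<zero> = \<zero>\<^bsub>Fr\<^esub>"
  using fr_shift[of 0 n \<zero>] by (simp add: frac_group_def)

lemma fr_zero_iff: "fr n v = \<zero>\<^bsub>Fr\<^esub> \<longleftrightarrow> (\<exists>k. (\<phi> ^^ k) v = \<zero>)"
  unfolding X_zero[of n, symmetric] by (subst fr_eq_iff) auto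

lemma abelian_group_X: "abelian_group Fr"
proof (rule abelian_groupI)
  fix x y z assume x: "x \<in> carrier Fr" and y: "y \<in> carrier Fr" and z: "z \<in> carrier Fr"
  obtain n u v where 1: "u \<in> carrier A" "v \<in> carrier A" "x = fr n u" "y = fr n v"
    by (rule common_denominator[OF x y])
  obtain m w where 2: "w \<in> carrier A" "z = fr m w" using z by (auto simp: X_carrier)
  have 3: "x = fr (n + m) ((\<phi> ^^ m) u)" "y = fr (n + m) ((\<phi> ^^ m) v)" "z = fr (n + m) ((\<phi> ^^ n) w)"
    using 1 2 fr_shift[of n m u] fr_shift[of n m v] fr_shift[of m n w] by (simp_all add: add.commute)
  show "x \<oplus>\<^bsub>Fr\<^esub> y \<oplus>\<^bsub>Fr\<^esub> z = x \<oplus>\<^bsub>Fr\<^esub> (y \<oplus>\<^bsub>Fr\<^esub> z)"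
    unfolding 3 using 1 2 by (simp add: fr_add_same a_assoc)
  show "x \<oplus>\<^bsub>Fr\<^esub> y \<in> carrier Fr" "x \<oplus>\<^bsub>Fr\<^esub> y = y \<oplus>\<^bsub>Fr\<^esub> x"
    using 1 by (simp_all add: fr_add_same a_comm)
next
  show "\<zero>\<^bsub>Fr\<^esub> \<in> carrier Fr" by (metis X_zero fr_closed zero_closed)
  fix x assume "x \<in> carrier Fr"
  then obtain n v where x: "v \<in> carrier A" "x = fr n v" by (auto simp: X_carrier)
  show "\<zero>\<^bsub>Fr\<^esub> \<oplus>\<^bsub>Fr\<^esub> x = x" unfolding x(2) X_zero[of n, symmetric] using x(1) by (simp add: fr_add_same)
  show "\<exists>y\<in>carrier Fr. y \<oplus>\<^bsub>Fr\<^esub> x = \<zero>\<^bsub>Fr\<^esub>"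
    by (rule bexI[of _ "fr n (\<ominus> v)"])
      (use x in \<open>simp_all add: fr_add_same l_neg X_zero\<close>)
qed

definition lift :: "(nat \<Rightarrow> 'a \<Rightarrow> 'b) \<Rightarrow> (nat \<times> 'a) set \<Rightarrow> 'b" where
  "lift g Z = (case (SOME p. p \<in> Z) of (n, v) \<Rightarrow> g n v)"

text \<open>Invariance under one step, from (n, v) to (n + 1, \<phi> v), suffices: any two
  representatives of a fraction become equal after finitely many such steps.\<close>

lemma lift_fr:
  assumes g: "\<And>n v. v \<in> carrier A \<Longrightarrow> g (Suc n) (\<phi> v) = g n v" and v: "v \<in> carrier A"
  shows "lift g (fr n v) = g n v"
proof -
  have g': "g (k + n) ((\<phi> ^^ k) v) = g n v" if "v \<in> carrier A" for k n v
    using that by (induction k) (simp_all add: g)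
  have "(SOME p. p \<in> fr n v) \<in> fr n v"
    by (rule someI[of _ "(n, v)"]) (rule fr_self[OF v])
  moreover obtain m w where mw: "(SOME p. p \<in> fr n v) = (m, w)" by fastforce
  ultimately obtain k l where "w \<in> carrier A" "k + n = l + m" "(\<phi> ^^ k) v = (\<phi> ^^ l) w"
    using fr_memD by metis
  then show ?thesis
    using g'[of v k n] g'[of w l m] v mw by (simp add: lift_def)
qed

lemma lift_ahom:
  assumes g: "\<And>n v. v \<in> carrier A \<Longrightarrow> g (Suc n) (\<phi> v) = g n v" and "\<And>n. g n \<in> ahom A B"
  shows "lift g \<in> ahom Fr B"
proof (rule ahomI)
  show "lift g x \<in> carrier B" if "x \<in> carrier Fr" for x
    using that ahom_closed[OF assms(2)] by (auto simp: X_carrier lift_fr[of g, OF g])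
  show "lift g (x \<oplus>\<^bsub>Fr\<^esub> y) = lift g x \<oplus>\<^bsub>B\<^esub> lift g y" if xy: "x \<in> carrier Fr" "y \<in> carrier Fr" for x y
  proof -
    obtain n v w where 1: "v \<in> carrier A" "w \<in> carrier A" "x = fr n v" "y = fr n w"
      by (rule common_denominator[OF xy])
    have l: "lift g (fr n u) = g n u" if "u \<in> carrier A" for u
      by (rule lift_fr) (use g that in simp_all)
    show ?thesis
      unfolding 1(3,4) fr_add_same[OF 1(1,2)]
      by (simp only: l 1 a_closed ahom_add[OF assms(2)])
  qed
qed

end

subsection \<open>Localization at the powers of an element\<close>

text \<open>The Ore condition is asked for a single factor f and iterated in \<open>ore_pow\<close>.
  On fractions, \<open>reversible\<close> makes right multiplication by f injective and
  \<open>ore\<close> makes it surjective.\<close>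

locale ore_localization = ring R for R :: "('r, 'x) ring_scheme" (structure) +
  fixes f :: 'r
  assumes f_closed [simp]: "f \<in> carrier R"
    and ore: "r \<in> carrier R \<Longrightarrow> \<exists>k r'. r' \<in> carrier R \<and> f [^] (k::nat) \<otimes> r = r' \<otimes> f"
    and reversible: "r \<in> carrier R \<Longrightarrow> r \<otimes> f = \<zero> \<Longrightarrow> \<exists>k::nat. f [^] k \<otimes> r = \<zero>"
begin

lemma l_mult_ahom: "q \<in> carrier R \<Longrightarrow> (\<lambda>x. q \<otimes> x) \<in> ahom R R"
  by (rule ahomI) (simp_all add: r_distr)

lemma r_mult_ahom: "q \<in> carrier R \<Longrightarrow> (\<lambda>x. x \<otimes> q) \<in> ahom R R"
  by (rule ahomI) (simp_all add: l_distr)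

sublocale E: group_endo R "\<lambda>x. f \<otimes> x"
  by unfold_locales (rule l_mult_ahom[OF f_closed])

abbreviation "fr \<equiv> left_frac R f"
abbreviation "Q \<equiv> localization R f"

lemma funpow_f: "r \<in> carrier R \<Longrightarrow> ((\<lambda>x. f \<otimes> x) ^^ k) r = f [^] k \<otimes> r"
proof (induction k)
  case (Suc k)
  have "f [^] Suc k = f \<otimes> f [^] k" by (rule nat_pow_Suc2) simp
  with Suc show ?case by (simp add: m_assoc)
qed simp

lemma fr_eq: "r \<in> carrier R \<Longrightarrow> fr n r = E.fr n r"
  unfolding left_frac_def frac_def by (rule Collect_cong) (clarsimp simp: funpow_f, metis funpow_f)

lemma ore_pow: "r \<in> carrier R \<Longrightarrow> \<exists>k r'. r' \<in> carrier R \<and> f [^] (k::nat) \<otimes> r = r' \<otimes> f [^] (m::nat)"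
proof (induction m)
  case 0
  then show ?case by (intro exI[of _ 0] exI[of _ r]) simp
next
  case (Suc m)
  then obtain k :: nat and r' where 1: "r' \<in> carrier R" "f [^] k \<otimes> r = r' \<otimes> f [^] m" by blast
  obtain l :: nat and r'' where 2: "r'' \<in> carrier R" "f [^] (l::nat) \<otimes> r' = r'' \<otimes> f" using ore[OF 1(1)] by blast
  have "f [^] (l + k) \<otimes> r = f [^] l \<otimes> (r' \<otimes> f [^] m)"
    using Suc.prems 1 by (simp add: nat_pow_mult[symmetric] m_assoc)
  also have "\<dots> = r'' \<otimes> f \<otimes> f [^] m" using 1 2 by (simp add: m_assoc[symmetric])
  also have "\<dots> = r'' \<otimes> f [^] Suc m" using 2 nat_pow_Suc2[of f m] by (simp add: m_assoc)
  finally show ?case using 2 by blast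
qed

text \<open>Products are built from additive operators: x times f^(-m) q is obtained by inverting
  right multiplication by f m times and then multiplying by q. The ring axioms become rules for
  composing operators, free of Ore representatives.\<close>

definition rmul :: "'r \<Rightarrow> (nat \<times> 'r) set \<Rightarrow> (nat \<times> 'r) set" where
  "rmul q = E.lift (\<lambda>n r. E.fr n (r \<otimes> q))"

lemma rmul_fr: "q \<in> carrier R \<Longrightarrow> r \<in> carrier R \<Longrightarrow> rmul q (E.fr n r) = E.fr n (r \<otimes> q)"
  unfolding rmul_def by (rule E.lift_fr) (use E.fr_shift[of _ 1] in \<open>auto simp: m_assoc\<close>)

lemma fr_ahom: "E.fr n \<in> ahom R E.Fr"
  by (rule ahomI) (simp_all add: E.fr_add_same)

lemma rmul_ahom: "q \<in> carrier R \<Longrightarrow> rmul q \<in> ahom E.Fr E.Fr"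
  unfolding rmul_def
  by (rule E.lift_ahom)
    (use E.fr_shift[of _ 1] ahom_comp[OF r_mult_ahom fr_ahom] in \<open>simp_all add: m_assoc\<close>)

lemma rmul_closed: "q \<in> carrier R \<Longrightarrow> x \<in> carrier E.Fr \<Longrightarrow> rmul q x \<in> carrier E.Fr"
  by (rule ahom_closed[OF rmul_ahom])

lemma rmul_mult: "q \<in> carrier R \<Longrightarrow> r \<in> carrier R \<Longrightarrow> x \<in> carrier E.Fr \<Longrightarrow> rmul (r \<otimes> q) x = rmul q (rmul r x)"
  by (auto simp: E.X_carrier rmul_fr m_assoc)

lemma rmul_add: "q \<in> carrier R \<Longrightarrow> r \<in> carrier R \<Longrightarrow> x \<in> carrier E.Fr \<Longrightarrow> rmul (r \<oplus> q) x = rmul r x \<oplus>\<^bsub>E.Fr\<^esub> rmul q x"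
  by (auto simp: E.X_carrier rmul_fr E.fr_add_same r_distr)

lemma rmul_one: "x \<in> carrier E.Fr \<Longrightarrow> rmul \<one> x = x"
  by (auto simp: E.X_carrier rmul_fr)

text \<open>If f^(-n) r is killed by f on the right, then f^k r f = 0 for some k, and
  \<open>reversible\<close> for f^k r turns this into f^(l+k) r = 0.\<close>

lemma rmul_f_inj: "inj_on (rmul f) (carrier E.Fr)"
proof -
  interpret X: abelian_group E.Fr by (rule E.abelian_group_X)
  have "x = \<zero>\<^bsub>E.Fr\<^esub>" if x: "x \<in> carrier E.Fr" "rmul f x = \<zero>\<^bsub>E.Fr\<^esub>" for x
  proof -
    obtain n r where r: "r \<in> carrier R" "x = E.fr n r" using x by (auto simp: E.X_carrier)
    then obtain k :: nat where "f [^] k \<otimes> (r \<otimes> f) = \<zero>"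
      using x(2) by (auto simp: rmul_fr E.fr_zero_iff funpow_f)
    then obtain l :: nat where "f [^] (l::nat) \<otimes> (f [^] k \<otimes> r) = \<zero>"
      using reversible[of "f [^] k \<otimes> r"] r by (auto simp: m_assoc)
    then have "f [^] (l + k) \<otimes> r = \<zero>" using r by (simp add: nat_pow_mult[symmetric] m_assoc)
    then show ?thesis unfolding r(2) E.fr_zero_iff using r by (auto simp: funpow_f)
  qed
  then show ?thesis
    using ahom_minus[OF E.abelian_group_X E.abelian_group_X rmul_ahom[OF f_closed]]
    by (intro inj_onI) (metis X.minus_closed X.minus_eq_zero_iff rmul_closed f_closed)
qed

text \<open>From f^k r = r' f one gets f^(-n) r = f^(-(n+k)) r' f.\<close>

lemma rmul_f_surj: "x \<in> carrier E.Fr \<Longrightarrow> \<exists>y\<in>carrier E.Fr. rmul f y = x"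
proof -
  assume "x \<in> carrier E.Fr"
  then obtain n r where r: "r \<in> carrier R" "x = E.fr n r" by (auto simp: E.X_carrier)
  obtain k :: nat and r' where r': "r' \<in> carrier R" "f [^] (k::nat) \<otimes> r = r' \<otimes> f" using ore[OF r(1)] by blast
  have "rmul f (E.fr (n + k) r') = x"
    using r r' E.fr_shift[of n k r] by (simp add: rmul_fr funpow_f)
  then show ?thesis using r' by (intro bexI[of _ "E.fr (n + k) r'"]) simp_all
qed

definition rinv :: "(nat \<times> 'r) set \<Rightarrow> (nat \<times> 'r) set" where
  "rinv = inv_into (carrier E.Fr) (rmul f)"

lemma rmul_rinv: "x \<in> carrier E.Fr \<Longrightarrow> rmul f (rinv x) = x" "x \<in> carrier E.Fr \<Longrightarrow> rinv x \<in> carrier E.Fr"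
  unfolding rinv_def using rmul_f_surj[of x]
  by (metis f_inv_into_f imageI, metis imageI inv_into_into)

lemma rinv_rmul: "x \<in> carrier E.Fr \<Longrightarrow> rinv (rmul f x) = x"
  unfolding rinv_def by (rule inv_into_f_f[OF rmul_f_inj])

lemma rinv_ahom: "rinv \<in> ahom E.Fr E.Fr"
proof (rule ahomI)
  interpret X: abelian_group E.Fr by (rule E.abelian_group_X)
  show "rinv (x \<oplus>\<^bsub>E.Fr\<^esub> y) = rinv x \<oplus>\<^bsub>E.Fr\<^esub> rinv y" if "x \<in> carrier E.Fr" "y \<in> carrier E.Fr" for x y
    using that rinv_rmul[of "rinv x \<oplus>\<^bsub>E.Fr\<^esub> rinv y"]
    by (simp add: ahom_add[OF rmul_ahom] rmul_rinv)
qed (rule rmul_rinv)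

lemma rinv_pow_closed: "x \<in> carrier E.Fr \<Longrightarrow> (rinv ^^ n) x \<in> carrier E.Fr"
  by (rule ahom_closed[OF funpow_ahom[OF rinv_ahom]])

lemma rinv_pow_eqI: "r \<in> carrier R \<Longrightarrow> x = E.fr n (r \<otimes> f [^] (m::nat)) \<Longrightarrow> (rinv ^^ m) x = E.fr n r"
proof (induction m arbitrary: x)
  case (Suc m)
  have "rmul f (E.fr n (r \<otimes> f [^] m)) = x"
    using Suc.prems by (simp add: rmul_fr m_assoc)
  then have "rinv x = E.fr n (r \<otimes> f [^] m)" using rinv_rmul[of "E.fr n (r \<otimes> f [^] m)"] Suc.prems by simp
  then show ?case using Suc by (simp add: funpow_Suc_right del: funpow.simps)
qed simp

text \<open>Right multiplication by the fraction Y, as an operator on x; \<open>Q_mult\<close>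
  identifies it with the product of \<open>localization\<close>.\<close>

definition ract :: "(nat \<times> 'r) set \<Rightarrow> (nat \<times> 'r) set \<Rightarrow> (nat \<times> 'r) set" where
  "ract Y x = E.lift (\<lambda>m q. rmul q ((rinv ^^ m) x)) Y"

lemma ract_fr: "q \<in> carrier R \<Longrightarrow> x \<in> carrier E.Fr \<Longrightarrow> ract (E.fr m q) x = rmul q ((rinv ^^ m) x)"
  unfolding ract_def
  by (rule E.lift_fr) (simp_all add: rmul_mult rmul_rinv rinv_pow_closed)

lemma Q_carrier: "carrier Q = carrier E.Fr"
  unfolding localization_def frac_group_def by (simp, metis fr_eq)

lemma Q_zero: "\<zero>\<^bsub>Q\<^esub> = \<zero>\<^bsub>E.Fr\<^esub>"
  by (simp add: localization_def frac_group_def fr_eq)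

lemma Q_add:
  assumes "x \<in> carrier E.Fr" "y \<in> carrier E.Fr"
  shows "x \<oplus>\<^bsub>Q\<^esub> y = x \<oplus>\<^bsub>E.Fr\<^esub> y"
proof -
  have *: "(n, r) \<in> x \<Longrightarrow> r \<in> carrier R" "(n, r) \<in> y \<Longrightarrow> r \<in> carrier R" for n r
    using assms by (auto simp: E.X_carrier frac_def)
  have "{fr (n + m) (f [^] m \<otimes> r \<oplus> f [^] n \<otimes> q) | n r m q. (n, r) \<in> x \<and> (m, q) \<in> y}
     = {E.fr (n + m) (((\<lambda>x. f \<otimes> x) ^^ m) r \<oplus> ((\<lambda>x. f \<otimes> x) ^^ n) q) | n r m q. (n, r) \<in> x \<and> (m, q) \<in> y}"
    by (intro Collect_cong iff_exI) (use * in \<open>auto simp: funpow_f fr_eq\<close>)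
  then show ?thesis
    by (simp add: localization_def frac_group_def)
qed

text \<open>Every Ore choice f^k r = r' f^m exhibits x as f^(-(n+k)) r' f^m, so it computes the same
  x f^(-m) = f^(-(n+k)) r'. The union in the definition is thus over a single class, and
  \<open>ore_pow\<close> provides at least one choice.\<close>

lemma Q_mult:
  assumes x: "x \<in> carrier E.Fr" and y: "y \<in> carrier E.Fr"
  shows "x \<otimes>\<^bsub>Q\<^esub> y = ract y x"
proof -
  have 1: "fr (n + k) (r' \<otimes> q) = ract y x"
    if *: "(n, r) \<in> x" "(m, q) \<in> y" "r' \<in> carrier R" "f [^] (k::nat) \<otimes> r = r' \<otimes> f [^] (m::nat)"
    for n k r' q r m
  proof -
    have r: "r \<in> carrier R" "x = E.fr n r"
      using x *(1) E.fr_mem_eq by (auto simp: E.X_carrier elim: E.fr_memD)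
    have q: "q \<in> carrier R" "y = E.fr m q"
      using y *(2) E.fr_mem_eq by (auto simp: E.X_carrier elim: E.fr_memD)
    have "x = E.fr (n + k) (r' \<otimes> f [^] m)"
      using E.fr_shift[of n k r] *(4) r by (simp add: funpow_f)
    then have "(rinv ^^ m) x = E.fr (n + k) r'" by (rule rinv_pow_eqI[OF *(3)])
    then show ?thesis using q x *(3) by (simp add: ract_fr rmul_fr fr_eq)
  qed
  obtain n r where r: "r \<in> carrier R" "x = E.fr n r" using x by (auto simp: E.X_carrier)
  obtain m q where q: "q \<in> carrier R" "y = E.fr m q" using y by (auto simp: E.X_carrier)
  obtain k :: nat and r' where k: "r' \<in> carrier R" "f [^] k \<otimes> r = r' \<otimes> f [^] m"
    using ore_pow[OF r(1)] by blast
  have "{fr (n + k) (r' \<otimes> q) | n k r' q. \<exists>r m. (n, r) \<in> x \<and> (m, q) \<in> y \<and> r' \<in> carrier R \<and>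
         f [^] k \<otimes> r = r' \<otimes> f [^] m} = {ract y x}" (is "?S = _")
  proof (intro equalityI subsetI)
    have "(n, r) \<in> x" "(m, q) \<in> y" using r q E.fr_self by simp_all
    then have "fr (n + k) (r' \<otimes> q) \<in> ?S" and "fr (n + k) (r' \<otimes> q) = ract y x"
      using k 1[of n r m q r' k] by blast+
    then show "z \<in> ?S" if "z \<in> {ract y x}" for z using that by simp
  qed (use 1 in blast)
  then show ?thesis by (simp add: localization_def)
qed

lemma ract_ahom: "y \<in> carrier E.Fr \<Longrightarrow> ract y \<in> ahom E.Fr E.Fr"
proof -
  assume "y \<in> carrier E.Fr"
  then obtain m q where q: "q \<in> carrier R" "y = E.fr m q" by (auto simp: E.X_carrier)
  show ?thesis
  proof (rule ahomI)
    interpret X: abelian_group E.Fr by (rule E.abelian_group_X)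
    show "ract y (u \<oplus>\<^bsub>E.Fr\<^esub> v) = ract y u \<oplus>\<^bsub>E.Fr\<^esub> ract y v" if "u \<in> carrier E.Fr" "v \<in> carrier E.Fr" for u v
      using that q
      by (simp add: ract_fr ahom_add[OF rmul_ahom] ahom_add[OF funpow_ahom[OF rinv_ahom]] rinv_pow_closed)
  qed (use q in \<open>simp add: ract_fr rmul_closed rinv_pow_closed\<close>)
qed

lemma ract_add:
  assumes "y \<in> carrier E.Fr" "z \<in> carrier E.Fr" "x \<in> carrier E.Fr"
  shows "ract (y \<oplus>\<^bsub>E.Fr\<^esub> z) x = ract y x \<oplus>\<^bsub>E.Fr\<^esub> ract z x"
proof -
  obtain n v w where "v \<in> carrier R" "w \<in> carrier R" "y = E.fr n v" "z = E.fr n w"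
    by (rule E.common_denominator[OF assms(1,2)])
  then show ?thesis
    using assms(3) by (simp add: E.fr_add_same ract_fr rmul_add rinv_pow_closed)
qed

lemma ract_rmul:
  assumes "y \<in> carrier E.Fr" "q \<in> carrier R" "x \<in> carrier E.Fr"
  shows "ract (rmul q y) x = rmul q (ract y x)"
  using assms by (auto simp: E.X_carrier[of y] ract_fr rmul_fr rmul_mult rinv_pow_closed)

lemma ract_rinv:
  assumes "y \<in> carrier E.Fr" "x \<in> carrier E.Fr"
  shows "ract (rinv y) x = rinv (ract y x)"
proof -
  have "ract y x = rmul f (ract (rinv y) x)"
    using ract_rmul[of "rinv y" f x] assms by (simp add: rmul_rinv)
  then show ?thesis using assms rinv_rmul[of "ract (rinv y) x"] ahom_closed[OF ract_ahom] rmul_rinv(2) by simp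
qed

text \<open>Associativity. \<open>ract_rmul\<close> and \<open>ract_rinv\<close> pull right
  multiplication by q and right division by f out of the operator, and every fraction z acts as a
  composite of these two.\<close>

lemma ract_ract:
  assumes "z \<in> carrier E.Fr" "y \<in> carrier E.Fr" "x \<in> carrier E.Fr"
  shows "ract (ract z y) x = ract z (ract y x)"
proof -
  have s: "ract ((rinv ^^ m) y) x = (rinv ^^ m) (ract y x)" for m
    by (induction m) (simp_all add: ract_rinv assms rinv_pow_closed)
  obtain m q where q: "q \<in> carrier R" "z = E.fr m q" using assms(1) by (auto simp: E.X_carrier)
  then show ?thesis
    using assms ahom_closed[OF ract_ahom] by (simp add: ract_fr ract_rmul rinv_pow_closed s)
qed

lemma fr_one_pow: "(rinv ^^ m) (E.fr n \<one>) = E.fr (n + m) \<one>"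
  by (rule rinv_pow_eqI) (use E.fr_shift[of n m \<one>] in \<open>simp_all add: funpow_f\<close>)

lemma Q_one: "\<one>\<^bsub>Q\<^esub> = E.fr 0 \<one>"
  by (simp add: localization_def fr_eq)

lemma ring_Q: "ring Q"
proof (rule ringI)
  interpret X: abelian_group E.Fr by (rule E.abelian_group_X)
  show "abelian_group Q"
  proof (rule abelian_groupI)
    show "\<exists>y\<in>carrier Q. y \<oplus>\<^bsub>Q\<^esub> x = \<zero>\<^bsub>Q\<^esub>" if "x \<in> carrier Q" for x
      by (rule bexI[of _ "\<ominus>\<^bsub>E.Fr\<^esub> x"]) (use that in \<open>simp_all add: Q_carrier Q_add Q_zero X.l_neg\<close>)
  qed (simp_all add: Q_carrier Q_zero Q_add X.a_ac)
  note closed = ahom_closed[OF ract_ahom]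
  show "Group.monoid Q"
  proof (rule monoidI)
    show "\<one>\<^bsub>Q\<^esub> \<otimes>\<^bsub>Q\<^esub> x = x" if x: "x \<in> carrier Q" for x
    proof -
      obtain n r where "r \<in> carrier R" "x = E.fr n r"
        using x by (auto simp: Q_carrier E.X_carrier)
      then show ?thesis by (simp add: Q_one Q_mult ract_fr fr_one_pow rmul_fr)
    qed
    show "x \<otimes>\<^bsub>Q\<^esub> \<one>\<^bsub>Q\<^esub> = x" if "x \<in> carrier Q" for x
      using that by (simp add: Q_carrier Q_one Q_mult ract_fr rmul_one)
  qed (simp_all add: Q_carrier Q_mult closed Q_one ract_ract)
  show "(x \<oplus>\<^bsub>Q\<^esub> y) \<otimes>\<^bsub>Q\<^esub> z = x \<otimes>\<^bsub>Q\<^esub> z \<oplus>\<^bsub>Q\<^esub> y \<otimes>\<^bsub>Q\<^esub> z"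
    if "x \<in> carrier Q" "y \<in> carrier Q" "z \<in> carrier Q" for x y z
    using that by (simp add: Q_carrier Q_add Q_mult closed ahom_add[OF ract_ahom])
  show "z \<otimes>\<^bsub>Q\<^esub> (x \<oplus>\<^bsub>Q\<^esub> y) = z \<otimes>\<^bsub>Q\<^esub> x \<oplus>\<^bsub>Q\<^esub> z \<otimes>\<^bsub>Q\<^esub> y"
    if "x \<in> carrier Q" "y \<in> carrier Q" "z \<in> carrier Q" for x y z
    using that by (simp add: Q_carrier Q_add Q_mult closed ract_add)
qed

lemma fr_mult_of: "r \<in> carrier R \<Longrightarrow> q \<in> carrier R \<Longrightarrow> fr n r \<otimes>\<^bsub>Q\<^esub> fr 0 q = fr n (r \<otimes> q)"
  by (simp add: fr_eq Q_mult ract_fr rmul_fr)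

lemma fr_add_Q: "r \<in> carrier R \<Longrightarrow> q \<in> carrier R \<Longrightarrow> fr n r \<oplus>\<^bsub>Q\<^esub> fr n q = fr n (r \<oplus> q)"
  by (simp add: fr_eq Q_add E.fr_add_same)

lemma fr_closed_Q: "r \<in> carrier R \<Longrightarrow> fr n r \<in> carrier Q"
  by (auto simp: localization_def)

lemma of_hom: "fr 0 \<in> ring_hom R Q"
  by (rule ring_hom_memI)
    (simp_all add: fr_closed_Q fr_mult_of fr_add_Q, simp add: localization_def)

lemma f_unit: "fr 0 f \<in> Units Q" "inv\<^bsub>Q\<^esub> (fr 0 f) = fr 1 \<one>"
proof -
  interpret Q: ring Q by (rule ring_Q)
  have 1: "fr 1 \<one> \<otimes>\<^bsub>Q\<^esub> fr 0 f = \<one>\<^bsub>Q\<^esub>"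
    using E.fr_shift[of 0 1 \<one>] fr_mult_of[of \<one> f 1] by (simp add: Q_one fr_eq)
  have 2: "fr 0 f \<otimes>\<^bsub>Q\<^esub> fr 1 \<one> = \<one>\<^bsub>Q\<^esub>"
    using rinv_pow_eqI[of \<one> "E.fr 0 f" 0 1] by (simp add: fr_eq Q_mult ract_fr Q_one rmul_one)
  show "fr 0 f \<in> Units Q"
    using 1 2 by (auto simp: Units_def intro!: bexI[of _ "fr 1 \<one>"] fr_closed_Q)
  show "inv\<^bsub>Q\<^esub> (fr 0 f) = fr 1 \<one>"
    by (rule Q.inv_unique'[symmetric]) (simp_all add: 1[simplified] 2[simplified] fr_closed_Q)
qed

lemma fr_eq_inv_mult:
  assumes r: "r \<in> carrier R"
  shows "fr n r = (inv\<^bsub>Q\<^esub> (fr 0 f)) [^]\<^bsub>Q\<^esub> n \<otimes>\<^bsub>Q\<^esub> fr 0 r"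
proof -
  interpret Q: ring Q by (rule ring_Q)
  have "fr n \<one> = (fr 1 \<one>) [^]\<^bsub>Q\<^esub> n"
  proof (induction n)
    case 0
    then show ?case by (simp add: localization_def)
  next
    case (Suc n)
    have "(fr 1 \<one>) [^]\<^bsub>Q\<^esub> Suc n = fr n \<one> \<otimes>\<^bsub>Q\<^esub> fr 1 \<one>" by (simp add: Suc)
    also have "\<dots> = fr (Suc n) \<one>"
      using fr_one_pow[of 1 n] by (simp add: fr_eq Q_mult ract_fr rmul_one)
    finally show ?case by simp
  qed
  then show ?thesis using r fr_mult_of[of \<one> r n] by (simp add: f_unit(2))
qed

end

subsection \<open>Conjugation by complex powers of a unit\<close>

text \<open>A sum over 0..<d whose congruence rule is free of membership conditions, unlike that of
  \<open>finsum\<close>; lengthening by zero terms (\<open>nsum_pad\<close>) gives several series a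
  common length.\<close>

primrec nsum :: "('a, 'x) ring_scheme \<Rightarrow> (nat \<Rightarrow> 'a) \<Rightarrow> nat \<Rightarrow> 'a" where
  "nsum A g 0 = \<zero>\<^bsub>A\<^esub>"
| "nsum A g (Suc d) = nsum A g d \<oplus>\<^bsub>A\<^esub> g d"

lemma (in abelian_group) nsum_closed [simp]: "(\<And>i. i < d \<Longrightarrow> g i \<in> carrier G) \<Longrightarrow> nsum G g d \<in> carrier G"
  by (induction d) simp_all

lemma nsum_cong: "(\<And>i. i < d \<Longrightarrow> g i = h i) \<Longrightarrow> nsum A g d = nsum A h d"
  by (induction d) simp_all

lemma (in abelian_group) nsum_add:
  "(\<And>i. i < d \<Longrightarrow> g i \<in> carrier G) \<Longrightarrow> (\<And>i. i < d \<Longrightarrow> h i \<in> carrier G) \<Longrightarrow>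
    nsum G (\<lambda>i. g i \<oplus> h i) d = nsum G g d \<oplus> nsum G h d"
  by (induction d) (simp_all add: a_ac)

lemma (in abelian_group) nsum_zero: "(\<And>i. i < d \<Longrightarrow> g i = \<zero>) \<Longrightarrow> nsum G g d = \<zero>"
  by (induction d) simp_all

lemma (in abelian_group) nsum_pad:
  assumes "d \<le> D" "\<And>i. i < d \<Longrightarrow> g i \<in> carrier G" "\<And>i. d \<le> i \<Longrightarrow> i < D \<Longrightarrow> g i = \<zero>"
  shows "nsum G g D = nsum G g d"
  using assms
proof (induction D rule: dec_induct)
  case (step D)
  then have "g D = \<zero>" "nsum G g D = nsum G g d" by simp_all
  then show ?case using step by simp
qed simp

lemma (in abelian_group) nsum_Suc_shift:
  "(\<And>i. i \<le> d \<Longrightarrow> g i \<in> carrier G) \<Longrightarrow> nsum G g (Suc d) = g 0 \<oplus> nsum G (\<lambda>i. g (Suc i)) d"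
  by (induction d) (simp_all add: a_assoc)

lemma (in abelian_group) nsum_single:
  assumes "k < d" "g k \<in> carrier G" "\<And>i. i < d \<Longrightarrow> i \<noteq> k \<Longrightarrow> g i = \<zero>"
  shows "nsum G g d = g k"
  using assms
proof (induction d)
  case (Suc d)
  show ?case
  proof (cases "k = d")
    case True
    with Suc.prems have "nsum G g d = \<zero>" by (intro nsum_zero) simp
    then show ?thesis using True Suc.prems by simp
  qed (use Suc in simp)
qed simp

lemma ahom_nsum:
  assumes "abelian_group A" "abelian_group B" "f \<in> ahom A B" "\<And>i. i < d \<Longrightarrow> g i \<in> carrier A"
  shows "f (nsum A g d) = nsum B (\<lambda>i. f (g i)) d"
proof -
  interpret A: abelian_group A by fact
  show ?thesis using assms(4)
    by (induction d) (simp_all add: ahom_zero[OF assms(1-3)] ahom_add[OF assms(3)])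
qed

lemma (in abelian_group) nsum_eq_finsum:
  "(\<And>i. i < d \<Longrightarrow> g i \<in> carrier G) \<Longrightarrow> nsum G g d = finsum G g {..<d}"
proof (induction d)
  case (Suc d)
  moreover have "finsum G g {..<Suc d} = g d \<oplus> finsum G g {..<d}"
    unfolding lessThan_Suc using Suc.prems by (intro finsum_insert) auto
  ultimately show ?case by (simp add: a_comm)
qed simp

text \<open>\<open>\<kappa>\<close> is a central copy of the complex numbers. Local nilpotency of
  \<open>ad\<close> makes the binomial series in \<open>ad\<close> finite, so that identities in a
  complex exponent can be reduced to natural exponents.\<close>

locale complex_power = ring Q for Q :: "('q, 'x) ring_scheme" (structure) +
  fixes \<kappa> :: "complex \<Rightarrow> 'q" and F :: 'q
  assumes \<kappa>_closed [simp]: "\<kappa> c \<in> carrier Q"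
    and \<kappa>_add: "\<kappa> (c + d) = \<kappa> c \<oplus> \<kappa> d"
    and \<kappa>_mult: "\<kappa> (c * d) = \<kappa> c \<otimes> \<kappa> d"
    and \<kappa>_one [simp]: "\<kappa> 1 = \<one>"
    and \<kappa>_central: "x \<in> carrier Q \<Longrightarrow> x \<otimes> \<kappa> c = \<kappa> c \<otimes> x"
    and F_unit: "F \<in> Units Q"
    and ad_nilpotent': "u \<in> carrier Q \<Longrightarrow> \<exists>n. ((\<lambda>u. F \<otimes> u \<ominus> u \<otimes> F) ^^ n) u = \<zero>"
begin

abbreviation "ad \<equiv> \<lambda>u. F \<otimes> u \<ominus> u \<otimes> F"
abbreviation "Fi \<equiv> inv F"

lemma F_closed [simp]: "F \<in> carrier Q" "Fi \<in> carrier Q" "F \<otimes> Fi = \<one>" "Fi \<otimes> F = \<one>"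
  using F_unit by (simp_all add: Units_closed)

lemma Fpow_inv [simp]: "F [^] (n::nat) \<otimes> Fi [^] n = \<one>" "Fi [^] n \<otimes> F [^] n = \<one>"
proof -
  show "F [^] n \<otimes> Fi [^] n = \<one>"
  proof (induction n)
    case (Suc n)
    have "F [^] Suc n \<otimes> Fi [^] Suc n = F [^] n \<otimes> F \<otimes> (Fi \<otimes> Fi [^] n)"
      by (simp only: nat_pow_Suc[of F] nat_pow_Suc2[of Fi, OF F_closed(2)])
    also have "\<dots> = F [^] n \<otimes> (F \<otimes> Fi) \<otimes> Fi [^] n"
      by (simp add: m_assoc del: F_closed(3,4))
    finally show ?case using Suc by simp
  qed simp
  show "Fi [^] n \<otimes> F [^] n = \<one>"
  proof (induction n)
    case (Suc n)
    have "Fi [^] Suc n \<otimes> F [^] Suc n = Fi [^] n \<otimes> Fi \<otimes> (F \<otimes> F [^] n)"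
      by (simp only: nat_pow_Suc[of Fi] nat_pow_Suc2[of F, OF F_closed(1)])
    also have "\<dots> = Fi [^] n \<otimes> (Fi \<otimes> F) \<otimes> F [^] n"
      by (simp add: m_assoc del: F_closed(3,4))
    finally show ?case using Suc by simp
  qed simp
qed

lemma cancel_assoc [simp]:
  assumes "x \<in> carrier Q"
  shows "F \<otimes> (Fi \<otimes> x) = x" "Fi \<otimes> (F \<otimes> x) = x"
    "F [^] (n::nat) \<otimes> (Fi [^] n \<otimes> x) = x" "Fi [^] n \<otimes> (F [^] n \<otimes> x) = x"
  using assms by (simp_all add: m_assoc[symmetric])

lemma \<kappa>_zero [simp]: "\<kappa> 0 = \<zero>"
  using \<kappa>_add[of 0 0] by (metis \<kappa>_closed add.r_cancel_one' add_0)

lemma \<kappa>_neg: "\<kappa> (- c) = \<ominus> \<kappa> c"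
  using \<kappa>_add[of "- c" c] by (metis \<kappa>_closed \<kappa>_zero add.left_inverse minus_equality)

lemma \<kappa>_lcomm: "x \<in> carrier Q \<Longrightarrow> y \<in> carrier Q \<Longrightarrow> x \<otimes> (\<kappa> c \<otimes> y) = \<kappa> c \<otimes> (x \<otimes> y)"
  by (simp add: m_assoc[symmetric] \<kappa>_central)

lemma \<kappa>_\<kappa>: "x \<in> carrier Q \<Longrightarrow> \<kappa> c \<otimes> (\<kappa> d \<otimes> x) = \<kappa> (c * d) \<otimes> x"
  by (simp add: m_assoc[symmetric] \<kappa>_mult)

lemma lmult_ahom: "x \<in> carrier Q \<Longrightarrow> (\<lambda>y. x \<otimes> y) \<in> ahom Q Q"
  by (rule ahomI) (simp_all add: r_distr)

lemma rmult_ahom: "x \<in> carrier Q \<Longrightarrow> (\<lambda>y. y \<otimes> x) \<in> ahom Q Q"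
  by (rule ahomI) (simp_all add: l_distr)

lemmas nsum_lmult = ahom_nsum[OF abelian_group_axioms abelian_group_axioms lmult_ahom]
lemmas nsum_rmult = ahom_nsum[OF abelian_group_axioms abelian_group_axioms rmult_ahom]

text \<open>Polynomial functions of a complex variable with coefficients in Q, in the binomial
  basis: \<open>Phi\<close> comes in this form, and evaluation at 0, 1, 2, ... is triangular with
  unit diagonal in this basis. The vanishing of x from d on allows summing two of them up to a
  common bound.\<close>

definition polymap :: "(complex \<Rightarrow> 'q) \<Rightarrow> bool" where
  "polymap p \<longleftrightarrow> (\<exists>d x. (\<forall>i. x i \<in> carrier Q) \<and> (\<forall>i\<ge>d. x i = \<zero>) \<and>
     (\<forall>a. p a = nsum Q (\<lambda>i. \<kappa> (a gchoose i) \<otimes> x i) d))"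

text \<open>At a = i the binomials with j > i vanish and the i-th one is 1, so strong induction
  kills the coefficients one after the other.\<close>

lemma polymap_vanish:
  assumes "polymap p" "\<And>n::nat. p (of_nat n) = \<zero>"
  shows "p a = \<zero>"
proof -
  obtain d x where x: "\<And>i. x i \<in> carrier Q" "\<And>i. i \<ge> d \<Longrightarrow> x i = \<zero>"
    "\<And>a. p a = nsum Q (\<lambda>i. \<kappa> (a gchoose i) \<otimes> x i) d"
    using assms(1) by (auto simp: polymap_def)
  have "x i = \<zero>" for i
  proof (induction i rule: less_induct)
    case (less i)
    show ?case
    proof (cases "i < d")
      case True
      have "p (of_nat i) = \<kappa> (of_nat i gchoose i) \<otimes> x i"
        unfolding x(3)
      proof (rule nsum_single[OF True])
        fix j assume "j \<noteq> i"
        then consider "j < i" | "j > i" by linarith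
        then show "\<kappa> (of_nat i gchoose j) \<otimes> x j = \<zero>"
        proof cases
          case 2
          have "(of_nat i gchoose j :: complex) = of_nat (i choose j)" by (rule binomial_gbinomial[symmetric])
          then show ?thesis using 2 x(1) by (simp add: binomial_eq_0)
        qed (use less in simp)
      qed (use x in simp)
      moreover have "(of_nat i gchoose i :: complex) = of_nat (i choose i)" by (rule binomial_gbinomial[symmetric])
      ultimately show ?thesis using assms(2)[of i] x(1) by simp
    qed (use x in simp)
  qed
  then show ?thesis by (simp add: x(3) nsum_zero)
qed

lemma polymapE:
  assumes "polymap p"
  obtains d0 x where "\<And>i. x i \<in> carrier Q" "\<And>i. i \<ge> d0 \<Longrightarrow> x i = \<zero>"
    "\<And>a d. d \<ge> d0 \<Longrightarrow> p a = nsum Q (\<lambda>i. \<kappa> (a gchoose i) \<otimes> x i) d"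
proof -
  obtain d x where x: "\<And>i. x i \<in> carrier Q" "\<And>i. i \<ge> d \<Longrightarrow> x i = \<zero>"
    "\<And>a. p a = nsum Q (\<lambda>i. \<kappa> (a gchoose i) \<otimes> x i) d"
    using assms(1) by (auto simp: polymap_def)
  have "p a = nsum Q (\<lambda>i. \<kappa> (a gchoose i) \<otimes> x i) D" if "D \<ge> d" for a D
    unfolding x(3) by (rule nsum_pad[OF that, symmetric]) (use x in auto)
  with x(1,2) show thesis by (rule that)
qed

lemma polymap_closed: "polymap p \<Longrightarrow> p a \<in> carrier Q"
  by (auto simp: polymap_def)

lemma polymap_add:
  assumes "polymap p" "polymap q"
  shows "polymap (\<lambda>a. p a \<oplus> q a)"
proof -
  obtain d x where x: "\<And>i. x i \<in> carrier Q" "\<And>i. i \<ge> d \<Longrightarrow> x i = \<zero>"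
    "\<And>a D. D \<ge> d \<Longrightarrow> p a = nsum Q (\<lambda>i. \<kappa> (a gchoose i) \<otimes> x i) D"
    using polymapE[OF assms(1)] by metis
  obtain e y where y: "\<And>i. y i \<in> carrier Q" "\<And>i. i \<ge> e \<Longrightarrow> y i = \<zero>"
    "\<And>a D. D \<ge> e \<Longrightarrow> q a = nsum Q (\<lambda>i. \<kappa> (a gchoose i) \<otimes> y i) D"
    using polymapE[OF assms(2)] by metis
  show ?thesis
    unfolding polymap_def
    by (rule exI[of _ "max d e"], rule exI[of _ "\<lambda>i. x i \<oplus> y i"])
      (use x(1,2) y(1,2) x(3)[of "max d e"] y(3)[of "max d e"] in \<open>simp add: r_distr nsum_add\<close>)
qed

lemma polymap_monomial: "x \<in> carrier Q \<Longrightarrow> polymap (\<lambda>a. \<kappa> (a gchoose i) \<otimes> x)"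
  unfolding polymap_def
  by (rule exI[of _ "Suc i"], rule exI[of _ "\<lambda>j. if j = i then x else \<zero>"])
    (use nsum_zero[of i "\<lambda>j. \<kappa> (_ gchoose j) \<otimes> (if j = i then x else \<zero>)"] in simp)

lemma polymap_const: "x \<in> carrier Q \<Longrightarrow> polymap (\<lambda>a. x)"
  using polymap_monomial[of x 0] by simp

lemma polymap_nsum: "(\<And>i. i < d \<Longrightarrow> polymap (p i)) \<Longrightarrow> polymap (\<lambda>a. nsum Q (\<lambda>i. p i a) d)"
  by (induction d) (simp_all add: polymap_const polymap_add)

lemma polymap_image:
  assumes "polymap p" "g \<in> ahom Q Q" "\<And>c x. x \<in> carrier Q \<Longrightarrow> g (\<kappa> c \<otimes> x) = \<kappa> c \<otimes> g x"
  shows "polymap (\<lambda>a. g (p a))"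
proof -
  obtain d x where x: "\<And>i. x i \<in> carrier Q" "\<And>a. p a = nsum Q (\<lambda>i. \<kappa> (a gchoose i) \<otimes> x i) d"
    using assms(1) by (auto simp: polymap_def)
  have "g (p a) = nsum Q (\<lambda>i. \<kappa> (a gchoose i) \<otimes> g (x i)) d" for a
    unfolding x(2) using x(1) assms(3)
    by (subst ahom_nsum[OF abelian_group_axioms abelian_group_axioms assms(2)]) simp_all
  then have "(\<lambda>a. g (p a)) = (\<lambda>a. nsum Q (\<lambda>i. \<kappa> (a gchoose i) \<otimes> g (x i)) d)" by (rule ext)
  then show ?thesis using x(1) ahom_closed[OF assms(2)] by (simp add: polymap_nsum polymap_monomial)
qed

lemma polymap_lmult: "polymap p \<Longrightarrow> x \<in> carrier Q \<Longrightarrow> polymap (\<lambda>a. x \<otimes> p a)"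
  by (rule polymap_image[OF _ lmult_ahom]) (simp_all add: \<kappa>_lcomm)

lemma polymap_rmult: "polymap p \<Longrightarrow> x \<in> carrier Q \<Longrightarrow> polymap (\<lambda>a. p a \<otimes> x)"
  by (rule polymap_image[OF _ rmult_ahom]) (simp_all add: m_assoc)

text \<open>The property that complex polynomials are wanted for: multiplication by s keeps
  polynomial maps polynomial. Working with it avoids expanding products of binomials in the binomial
  basis.\<close>

definition scalar_poly :: "(complex \<Rightarrow> complex) \<Rightarrow> bool" where
  "scalar_poly s \<longleftrightarrow> (\<forall>p. polymap p \<longrightarrow> polymap (\<lambda>a. \<kappa> (s a) \<otimes> p a))"

text \<open>Rests on a (a choose i) = (i + 1) (a choose i + 1) + i (a choose i), which re-expands
  the product in the binomial basis.\<close>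

lemma scalar_poly_id: "scalar_poly (\<lambda>a. a)"
  unfolding scalar_poly_def
proof (intro allI impI)
  fix p assume "polymap p"
  then obtain d x where x: "\<And>i. x i \<in> carrier Q" "\<And>a. p a = nsum Q (\<lambda>i. \<kappa> (a gchoose i) \<otimes> x i) d"
    by (auto simp: polymap_def)
  have g: "a * (a gchoose i) = of_nat (Suc i) * (a gchoose Suc i) + of_nat i * (a gchoose i)" for a :: complex and i
    using gbinomial_mult_1[of a i] by (simp add: algebra_simps)
  have "\<kappa> a \<otimes> p a = nsum Q (\<lambda>i. \<kappa> (a gchoose Suc i) \<otimes> (\<kappa> (of_nat (Suc i)) \<otimes> x i) \<oplus>
      \<kappa> (a gchoose i) \<otimes> (\<kappa> (of_nat i) \<otimes> x i)) d" for a
    unfolding x(2) using x(1)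
    by (subst nsum_lmult) (simp_all add: \<kappa>_\<kappa> g \<kappa>_add l_distr mult.commute[of "_ gchoose _"] cong: nsum_cong del: of_nat_Suc)
  then have *: "(\<lambda>a. \<kappa> a \<otimes> p a) = (\<lambda>a. nsum Q (\<lambda>i. \<kappa> (a gchoose Suc i) \<otimes> (\<kappa> (of_nat (Suc i)) \<otimes> x i) \<oplus>
      \<kappa> (a gchoose i) \<otimes> (\<kappa> (of_nat i) \<otimes> x i)) d)" by (rule ext)
  show "polymap (\<lambda>a. \<kappa> a \<otimes> p a)"
    unfolding * using x(1) by (intro polymap_nsum polymap_add polymap_monomial) simp_all
qed

lemma scalar_poly_const: "scalar_poly (\<lambda>a. c)"
  by (simp add: scalar_poly_def polymap_lmult)

lemma scalar_poly_add: "scalar_poly s \<Longrightarrow> scalar_poly t \<Longrightarrow> scalar_poly (\<lambda>a. s a + t a)"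
  unfolding scalar_poly_def by (simp add: \<kappa>_add l_distr polymap_closed polymap_add)

lemma scalar_poly_mult: "scalar_poly s \<Longrightarrow> scalar_poly t \<Longrightarrow> scalar_poly (\<lambda>a. s a * t a)"
  unfolding scalar_poly_def by (simp add: \<kappa>_\<kappa>[symmetric] polymap_closed)

text \<open>Recursion on i through (x choose i + 1) = (x - i) (x choose i) / (i + 1) with x = a + b.
  The shift b is there for \<open>polymap_Psi_shift\<close>.\<close>

lemma scalar_poly_gchoose: "scalar_poly (\<lambda>a. (a + b) gchoose i)"
proof (induction i)
  case 0
  then show ?case by (simp add: scalar_poly_const)
next
  case (Suc i)
  have "((a + b) gchoose Suc i) = (1 / of_nat (Suc i)) * ((a + (b - of_nat i)) * ((a + b) gchoose i))" for a
    using gbinomial_mult_1[of "a + b" i] by (simp add: field_simps del: of_nat_Suc)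
  then have "(\<lambda>a. (a + b) gchoose Suc i) =
      (\<lambda>a. (1 / of_nat (Suc i)) * ((a + (b - of_nat i)) * ((a + b) gchoose i)))" by (rule ext)
  then show ?case
    by (simp only:) (intro scalar_poly_mult scalar_poly_const scalar_poly_add scalar_poly_id Suc)
qed

text \<open>Expanding p alone turns the product into a sum of binomials times
  \<open>x i \<otimes> q a\<close>, each of which is covered by
  \<open>scalar_poly_gchoose\<close>.\<close>

lemma polymap_mult:
  assumes "polymap p" "polymap q"
  shows "polymap (\<lambda>a. p a \<otimes> q a)"
proof -
  obtain d x where x: "\<And>i. x i \<in> carrier Q" "\<And>a. p a = nsum Q (\<lambda>i. \<kappa> (a gchoose i) \<otimes> x i) d"
    using assms(1) by (auto simp: polymap_def)
  have "p a \<otimes> q a = nsum Q (\<lambda>i. \<kappa> (a gchoose i) \<otimes> (x i \<otimes> q a)) d" for a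
    unfolding x(2) using x(1) polymap_closed[OF assms(2)]
    by (subst nsum_rmult) (simp_all add: m_assoc)
  then have *: "(\<lambda>a. p a \<otimes> q a) = (\<lambda>a. nsum Q (\<lambda>i. \<kappa> (a gchoose i) \<otimes> (x i \<otimes> q a)) d)" by (rule ext)
  show ?thesis
    unfolding *
  proof (rule polymap_nsum)
    show "polymap (\<lambda>a. \<kappa> (a gchoose i) \<otimes> (x i \<otimes> q a))" for i
      using scalar_poly_gchoose[of 0 i] polymap_lmult[OF assms(2) x(1)] by (simp add: scalar_poly_def)
  qed
qed

text \<open>The principle behind the rules for \<open>Phi\<close> and \<open>Psi\<close>: at natural
  exponents both are conjugations by a power of F, and each rule is a cancellation of
  powers.\<close>

lemma polymap_eqI:
  assumes "polymap p" "polymap q" "\<And>n::nat. p (of_nat n) = q (of_nat n)"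
  shows "p a = q a"
proof -
  have "polymap (\<lambda>a. \<ominus> q a)"
    by (rule polymap_image[OF assms(2)]) (auto intro!: ahomI simp: minus_add r_minus)
  then have "polymap (\<lambda>a. p a \<oplus> \<ominus> q a)" by (rule polymap_add[OF assms(1)])
  from polymap_vanish[OF this, of a] show ?thesis
    using assms(3) polymap_closed[OF assms(1)] polymap_closed[OF assms(2)]
    by (metis minus_eq minus_eq_zero_iff r_neg)
qed

section \<open>The binomial series of conjugation by a complex power\<close>

lemma ad_ahom: "ad \<in> ahom Q Q"
  by (rule ahomI) (simp_all add: l_distr r_distr minus_eq minus_add a_ac)

lemma ad_pow_closed [simp]: "u \<in> carrier Q \<Longrightarrow> (ad ^^ n) u \<in> carrier Q"
  by (rule ahom_closed[OF funpow_ahom[OF ad_ahom]])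

lemma ad_pow_zero: "(ad ^^ n) \<zero> = \<zero>"
  by (rule ahom_zero[OF abelian_group_axioms abelian_group_axioms funpow_ahom[OF ad_ahom]])

definition deg :: "'q \<Rightarrow> nat" where "deg u = (LEAST n. (ad ^^ n) u = \<zero>)"

lemma ad_deg: "u \<in> carrier Q \<Longrightarrow> deg u \<le> d \<Longrightarrow> (ad ^^ d) u = \<zero>"
proof -
  assume u: "u \<in> carrier Q" and d: "deg u \<le> d"
  have "(ad ^^ deg u) u = \<zero>" unfolding deg_def by (rule LeastI_ex[OF ad_nilpotent'[OF u]])
  moreover have "(ad ^^ d) u = (ad ^^ (d - deg u)) ((ad ^^ deg u) u)"
    using d by (simp add: funpow_add_app)
  ultimately show ?thesis by (simp add: ad_pow_zero)
qed

lemma deg_le: "(ad ^^ d) u = \<zero> \<Longrightarrow> deg u \<le> d"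
  unfolding deg_def by (rule Least_le)

definition Phi :: "complex \<Rightarrow> 'q \<Rightarrow> 'q" where
  "Phi c u = nsum Q (\<lambda>i. \<kappa> (c gchoose i) \<otimes> ((ad ^^ i) u \<otimes> Fi [^] i)) (deg u)"

text \<open>The series of F^(-c) u F^c, the inverse of \<open>Phi c\<close>. The powers of the
  inverse stand on the left, so that in f^a \<otimes> f^(-n) \<otimes> v they can be merged with the
  denominator.\<close>

definition Psi :: "complex \<Rightarrow> 'q \<Rightarrow> 'q" where
  "Psi c u = nsum Q (\<lambda>i. \<kappa> ((-1) ^ i * (c gchoose i)) \<otimes> (Fi [^] i \<otimes> (ad ^^ i) u)) (deg u)"

lemma Phi_eq:
  assumes "u \<in> carrier Q" "deg u \<le> d"
  shows "Phi c u = nsum Q (\<lambda>i. \<kappa> (c gchoose i) \<otimes> ((ad ^^ i) u \<otimes> Fi [^] i)) d"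
  unfolding Phi_def
  by (rule nsum_pad[OF assms(2), symmetric]) (use assms in \<open>simp_all add: ad_deg\<close>)

lemma Psi_eq:
  assumes "u \<in> carrier Q" "deg u \<le> d"
  shows "Psi c u = nsum Q (\<lambda>i. \<kappa> ((-1) ^ i * (c gchoose i)) \<otimes> (Fi [^] i \<otimes> (ad ^^ i) u)) d"
  unfolding Psi_def
  by (rule nsum_pad[OF assms(2), symmetric]) (use assms in \<open>simp_all add: ad_deg\<close>)

lemma Phi_closed [simp]: "u \<in> carrier Q \<Longrightarrow> Phi c u \<in> carrier Q"
  by (simp add: Phi_def)

lemma Psi_closed [simp]: "u \<in> carrier Q \<Longrightarrow> Psi c u \<in> carrier Q"
  by (simp add: Psi_def)

lemma polymap_Phi: "u \<in> carrier Q \<Longrightarrow> polymap (\<lambda>c. Phi c u)"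
  unfolding Phi_def by (intro polymap_nsum polymap_monomial) simp

lemma polymap_Psi_shift:
  assumes "u \<in> carrier Q"
  shows "polymap (\<lambda>c. Psi (c + b) u)"
proof -
  have "scalar_poly (\<lambda>c. (-1) ^ i * ((c + b) gchoose i))" for i
    by (intro scalar_poly_mult scalar_poly_const scalar_poly_gchoose)
  then show ?thesis
    unfolding Psi_def using assms
    by (intro polymap_nsum) (simp add: scalar_poly_def polymap_const)
qed

lemma polymap_Psi: "u \<in> carrier Q \<Longrightarrow> polymap (\<lambda>c. Psi c u)"
  using polymap_Psi_shift[of u 0] by simp

lemma deg_ad: "u \<in> carrier Q \<Longrightarrow> deg (ad u) \<le> deg u"
  using ad_deg[of u "Suc (deg u)"] by (intro deg_le) (simp add: funpow_Suc_right del: funpow.simps)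

text \<open>One more conjugation, F u F^(-1) = u + (ad u) F^(-1), matched term by term through
  Pascal's rule. The sum for u is taken one term longer than \<open>deg u\<close>, so that after
  splitting off u both series run over the same range.\<close>

lemma Phi_Suc:
  assumes u: "u \<in> carrier Q"
  shows "Phi (c + 1) u = Phi c u \<oplus> Phi c (ad u) \<otimes> Fi"
proof -
  have adu: "ad u \<in> carrier Q" using u by simp
  have p: "(ad ^^ i) (ad u) = (ad ^^ Suc i) u" for i by (simp add: funpow_Suc_right del: funpow.simps)
  have 1: "Phi c (ad u) \<otimes> Fi = nsum Q (\<lambda>i. \<kappa> (c gchoose i) \<otimes> ((ad ^^ Suc i) u \<otimes> Fi [^] Suc i)) (deg u)"
    unfolding Phi_eq[OF adu deg_ad[OF u]] p
    by (subst nsum_rmult) (use u ad_pow_closed[of u "Suc _"] in \<open>simp_all add: m_assoc del: funpow.simps\<close>)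
  have 2: "Phi c' u = u \<oplus> nsum Q (\<lambda>i. \<kappa> (c' gchoose Suc i) \<otimes> ((ad ^^ Suc i) u \<otimes> Fi [^] Suc i)) (deg u)" for c'
    using u ad_pow_closed[of u "_"]
    by (subst Phi_eq[of u "Suc (deg u)"], simp, simp, subst nsum_Suc_shift)
       (simp_all del: funpow.simps add: funpow_0)
  show ?thesis
    unfolding 1 2 using u ad_pow_closed[of u "Suc _"]
    by (simp add: gbinomial_Suc_Suc \<kappa>_add l_distr nsum_add a_ac del: funpow.simps)
qed

text \<open>The mirror image of \<open>Phi_Suc\<close>, from F^(-1) u F = u - F^(-1) (ad u).\<close>

lemma Psi_Suc:
  assumes u: "u \<in> carrier Q"
  shows "Psi (c + 1) u = Psi c u \<ominus> Fi \<otimes> Psi c (ad u)"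
proof -
  have adu: "ad u \<in> carrier Q" using u by simp
  have p: "(ad ^^ i) (ad u) = (ad ^^ Suc i) u" for i by (simp add: funpow_Suc_right del: funpow.simps)
  have neg: "\<ominus> x = \<kappa> (-1) \<otimes> x" if "x \<in> carrier Q" for x
    using that by (simp add: \<kappa>_neg[of 1] l_minus)
  have 1: "\<ominus> (Fi \<otimes> Psi c (ad u)) =
      nsum Q (\<lambda>i. \<kappa> ((-1) ^ Suc i * (c gchoose i)) \<otimes> (Fi [^] Suc i \<otimes> (ad ^^ Suc i) u)) (deg u)"
  proof -
    have "\<ominus> (Fi \<otimes> Psi c (ad u)) = (\<kappa> (-1) \<otimes> Fi) \<otimes> Psi c (ad u)"
      using adu by (subst neg) (simp_all add: m_assoc del: Psi_closed add: Psi_closed)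
    also have "\<dots> = nsum Q (\<lambda>i. \<kappa> (-1) \<otimes> Fi \<otimes> (\<kappa> ((-1) ^ i * (c gchoose i)) \<otimes> (Fi [^] i \<otimes> (ad ^^ Suc i) u))) (deg u)"
      unfolding Psi_eq[OF adu deg_ad[OF u]] p
      by (subst nsum_lmult) (use u ad_pow_closed[of u "Suc _"] in \<open>simp_all del: funpow.simps\<close>)
    also have "\<dots> = nsum Q (\<lambda>i. \<kappa> ((-1) ^ Suc i * (c gchoose i)) \<otimes> (Fi [^] Suc i \<otimes> (ad ^^ Suc i) u)) (deg u)"
      using u ad_pow_closed[of u "Suc _"] nat_pow_Suc2[of Fi]
      by (intro nsum_cong) (simp add: m_assoc \<kappa>_lcomm[of Fi] \<kappa>_\<kappa> del: funpow.simps nat_pow_Suc)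
    finally show ?thesis .
  qed
  have 2: "Psi c' u = u \<oplus> nsum Q (\<lambda>i. \<kappa> ((-1) ^ Suc i * (c' gchoose Suc i)) \<otimes> (Fi [^] Suc i \<otimes> (ad ^^ Suc i) u)) (deg u)" for c'
    using u ad_pow_closed[of u "_"]
    by (subst Psi_eq[of u "Suc (deg u)"], simp, simp, subst nsum_Suc_shift)
       (simp_all del: funpow.simps add: funpow_0)
  show ?thesis
  proof (rule trans[OF _ minus_eq[symmetric]])
    show "Psi (c + 1) u = Psi c u \<oplus> \<ominus> (Fi \<otimes> Psi c (ad u))"
      unfolding 1 2 using u ad_pow_closed[of u "Suc _"]
    by (simp add: gbinomial_Suc_Suc \<kappa>_add l_distr nsum_add a_ac distrib_left del: funpow.simps power_Suc)
  qed
qed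

lemma Phi_zero: "u \<in> carrier Q \<Longrightarrow> Phi 0 u = u"
proof -
  assume u: "u \<in> carrier Q"
  have "Phi 0 u = nsum Q (\<lambda>i. \<kappa> (0 gchoose i) \<otimes> ((ad ^^ i) u \<otimes> Fi [^] i)) (Suc (deg u))"
    by (rule Phi_eq[OF u]) simp
  also have "\<dots> = \<kappa> (0 gchoose 0) \<otimes> ((ad ^^ 0) u \<otimes> Fi [^] (0::nat))"
    by (rule nsum_single) (use u in \<open>auto simp: gbinomial_0(2) gr0_conv_Suc\<close>)
  finally show ?thesis using u by simp
qed

lemma Psi_zero: "u \<in> carrier Q \<Longrightarrow> Psi 0 u = u"
proof -
  assume u: "u \<in> carrier Q"
  have "Psi 0 u = nsum Q (\<lambda>i. \<kappa> ((-1) ^ i * (0 gchoose i)) \<otimes> (Fi [^] i \<otimes> (ad ^^ i) u)) (Suc (deg u))"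
    by (rule Psi_eq[OF u]) simp
  also have "\<dots> = \<kappa> ((-1) ^ 0 * (0 gchoose 0)) \<otimes> (Fi [^] (0::nat) \<otimes> (ad ^^ 0) u)"
    by (rule nsum_single) (use u in \<open>auto simp: gbinomial_0(2) gr0_conv_Suc\<close>)
  finally show ?thesis using u by simp
qed

lemma Phi_nat: "u \<in> carrier Q \<Longrightarrow> Phi (of_nat m) u = F [^] m \<otimes> (u \<otimes> Fi [^] m)"
proof (induction m arbitrary: u)
  case 0
  then show ?case by (simp add: Phi_zero)
next
  case (Suc m)
  have adu: "ad u \<in> carrier Q" using Suc.prems by simp
  have "Phi (of_nat (Suc m)) u = Phi (of_nat m) u \<oplus> Phi (of_nat m) (ad u) \<otimes> Fi"
    using Phi_Suc[OF Suc.prems, of "of_nat m"] by (simp add: add.commute)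
  also have "\<dots> = F [^] m \<otimes> (u \<otimes> Fi [^] m) \<oplus> F [^] m \<otimes> (ad u \<otimes> Fi [^] m) \<otimes> Fi"
    using Suc.IH[OF Suc.prems] Suc.IH[OF adu] by simp
  also have "\<dots> = F [^] m \<otimes> ((u \<otimes> F \<oplus> ad u) \<otimes> Fi [^] Suc m)"
    using Suc.prems nat_pow_Suc2[of Fi m] nat_pow_Suc[of Fi m]
    by (simp add: m_assoc l_distr r_distr minus_eq del: nat_pow_Suc)
  also have "u \<otimes> F \<oplus> ad u = F \<otimes> u"
    using Suc.prems by (simp add: minus_eq a_lcomm r_neg)
  finally show ?case using Suc.prems by (simp add: m_assoc)
qed

lemma Psi_nat: "u \<in> carrier Q \<Longrightarrow> Psi (of_nat m) u = Fi [^] m \<otimes> (u \<otimes> F [^] m)"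
proof (induction m arbitrary: u)
  case 0
  then show ?case by (simp add: Psi_zero)
next
  case (Suc m)
  have adu: "ad u \<in> carrier Q" using Suc.prems by simp
  have "Psi (of_nat (Suc m)) u = Psi (of_nat m) u \<ominus> Fi \<otimes> Psi (of_nat m) (ad u)"
    using Psi_Suc[OF Suc.prems, of "of_nat m"] by (simp add: add.commute)
  also have "\<dots> = Fi [^] m \<otimes> (u \<otimes> F [^] m) \<ominus> Fi \<otimes> (Fi [^] m \<otimes> (ad u \<otimes> F [^] m))"
    using Suc.IH[OF Suc.prems] Suc.IH[OF adu] by simp
  also have "\<dots> = Fi [^] Suc m \<otimes> ((F \<otimes> u \<ominus> ad u) \<otimes> F [^] m)"
  proof -
    define y where "y = ad u"
    have y: "y \<in> carrier Q" using adu by (simp add: y_def)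
    have "Fi [^] Suc m \<otimes> ((F \<otimes> u \<ominus> ad u) \<otimes> F [^] m)
       = Fi [^] Suc m \<otimes> (F \<otimes> (u \<otimes> F [^] m)) \<ominus> Fi [^] Suc m \<otimes> (ad u \<otimes> F [^] m)"
      using Suc.prems y unfolding y_def[symmetric]
      by (simp add: minus_eq l_distr r_distr l_minus r_minus m_assoc del: nat_pow_Suc)
    moreover have "Fi [^] Suc m \<otimes> (F \<otimes> (u \<otimes> F [^] m)) = Fi [^] m \<otimes> (u \<otimes> F [^] m)"
      using Suc.prems by (simp add: m_assoc)
    moreover have "Fi [^] Suc m \<otimes> (ad u \<otimes> F [^] m) = Fi \<otimes> (Fi [^] m \<otimes> (ad u \<otimes> F [^] m))"
      using Suc.prems nat_pow_Suc2[of Fi m] adu by (simp add: m_assoc del: nat_pow_Suc)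
    ultimately show ?thesis by simp
  qed
  also have "F \<otimes> u \<ominus> ad u = u \<otimes> F"
    using Suc.prems by (simp add: minus_eq minus_add r_neg a_assoc[symmetric])
  finally show ?case using Suc.prems nat_pow_Suc2[of F m] by (simp add: m_assoc del: nat_pow_Suc)
qed

lemma Psi_add:
  assumes "u \<in> carrier Q" "v \<in> carrier Q"
  shows "Psi c (u \<oplus> v) = Psi c u \<oplus> Psi c v"
  by (rule polymap_eqI[where a = c]) (use assms in \<open>simp_all add: polymap_Psi polymap_add Psi_nat l_distr r_distr\<close>)

lemma Psi_ahom: "Psi c \<in> ahom Q Q"
  by (rule ahomI) (simp_all add: Psi_add)

text \<open>At natural c both sides are F^(-c) u v F^c. Multiplicativity is recorded for the inverse
  automorphism because the retraction in \<open>tw_zero_iff\<close> applies that one.\<close>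

lemma Psi_mult:
  assumes "u \<in> carrier Q" "v \<in> carrier Q"
  shows "Psi c (u \<otimes> v) = Psi c u \<otimes> Psi c v"
  by (rule polymap_eqI[where a = c]) (use assms in \<open>simp_all add: polymap_Psi polymap_mult Psi_nat m_assoc\<close>)

lemma Psi_smult:
  assumes "u \<in> carrier Q"
  shows "Psi c (\<kappa> s \<otimes> u) = \<kappa> s \<otimes> Psi c u"
  by (rule polymap_eqI[where a = c])
    (use assms in \<open>simp_all add: polymap_Psi polymap_lmult Psi_nat m_assoc \<kappa>_lcomm\<close>)

lemma Phi_add:
  assumes "u \<in> carrier Q" "v \<in> carrier Q"
  shows "Phi c (u \<oplus> v) = Phi c u \<oplus> Phi c v"
  by (rule polymap_eqI[where a = c]) (use assms in \<open>simp_all add: polymap_Phi polymap_add Phi_nat l_distr r_distr\<close>)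

lemma Phi_ahom: "Phi c \<in> ahom Q Q"
  by (rule ahomI) (simp_all add: Phi_add)

lemma Phi_smult:
  assumes "u \<in> carrier Q"
  shows "Phi c (\<kappa> s \<otimes> u) = \<kappa> s \<otimes> Phi c u"
  by (rule polymap_eqI[where a = c])
    (use assms in \<open>simp_all add: polymap_Phi polymap_lmult Phi_nat m_assoc \<kappa>_lcomm\<close>)

lemma Psi_Phi:
  assumes u: "u \<in> carrier Q"
  shows "Psi c (Phi c u) = u"
proof (rule polymap_eqI[where a = c])
  have "Psi c (Phi c u) = nsum Q (\<lambda>i. \<kappa> (c gchoose i) \<otimes> Psi c ((ad ^^ i) u \<otimes> Fi [^] i)) (deg u)" for c
    unfolding Phi_def
    by (subst ahom_nsum[OF abelian_group_axioms abelian_group_axioms Psi_ahom]) (use u in \<open>simp_all add: Psi_smult\<close>)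
  \<comment> \<open>The exponent occurs twice; expanding the inner series leaves in each term a
    binomial times \<open>Psi c\<close> of a fixed element, and this is polynomial in c.\<close>
  then have *: "(\<lambda>c. Psi c (Phi c u)) = (\<lambda>c. nsum Q (\<lambda>i. \<kappa> (c gchoose i) \<otimes> Psi c ((ad ^^ i) u \<otimes> Fi [^] i)) (deg u))"
    by (rule ext)
  show "polymap (\<lambda>c. Psi c (Phi c u))"
    unfolding * using u scalar_poly_gchoose[of 0]
    by (intro polymap_nsum) (simp add: scalar_poly_def polymap_Psi)
qed (use u in \<open>simp_all add: polymap_const Phi_nat Psi_nat m_assoc\<close>)

lemma Phi_Psi:
  assumes u: "u \<in> carrier Q"
  shows "Phi c (Psi c u) = u"
proof (rule polymap_eqI[where a = c])
  have "Phi c (Psi c u) = nsum Q (\<lambda>i. \<kappa> ((-1) ^ i * (c gchoose i)) \<otimes> Phi c (Fi [^] i \<otimes> (ad ^^ i) u)) (deg u)" for c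
    unfolding Psi_def
    by (subst ahom_nsum[OF abelian_group_axioms abelian_group_axioms Phi_ahom]) (use u in \<open>simp_all add: Phi_smult\<close>)
  then have *: "(\<lambda>c. Phi c (Psi c u)) = (\<lambda>c. nsum Q (\<lambda>i. \<kappa> ((-1) ^ i * (c gchoose i)) \<otimes> Phi c (Fi [^] i \<otimes> (ad ^^ i) u)) (deg u))"
    by (rule ext)
  have "scalar_poly (\<lambda>c. (-1) ^ i * ((c + 0) gchoose i))" for i
    by (intro scalar_poly_mult scalar_poly_const scalar_poly_gchoose)
  then show "polymap (\<lambda>c. Phi c (Psi c u))"
    unfolding * using u
    by (intro polymap_nsum) (simp add: scalar_poly_def polymap_Phi)
qed (use u in \<open>simp_all add: polymap_const Phi_nat Psi_nat m_assoc\<close>)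

text \<open>Formally F^(-c) u F^c F^(-n) = F^(-n) F^(-(c-n)) u F^(c-n). This is the origin of the
  parameter a - n in the formulas for the action.\<close>

lemma Psi_shift:
  assumes u: "u \<in> carrier Q"
  shows "Psi c u \<otimes> Fi [^] n = Fi [^] n \<otimes> Psi (c - of_nat n) u"
proof -
  \<comment> \<open>Written with b = c - n: at natural b both exponents are natural, and the
    identity is one between powers of F.\<close>
  have "Psi (b + of_nat n) u \<otimes> Fi [^] n = Fi [^] n \<otimes> Psi b u" for b
  proof (rule polymap_eqI[where a = b])
    show "Psi (of_nat m + of_nat n) u \<otimes> Fi [^] n = Fi [^] n \<otimes> Psi (of_nat m) u" for m
    proof -
      have "Psi (of_nat m + of_nat n) u = Fi [^] (m + n) \<otimes> (u \<otimes> F [^] (m + n))"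
        using Psi_nat[OF u, of "m + n"] by simp
      also have "\<dots> \<otimes> Fi [^] n = Fi [^] n \<otimes> Psi (of_nat m) u"
      proof -
        have "Fi [^] (m + n) = Fi [^] n \<otimes> Fi [^] m" "F [^] (m + n) = F [^] m \<otimes> F [^] n"
          by (simp_all add: nat_pow_mult add.commute)
        then show ?thesis using u by (simp add: Psi_nat m_assoc)
      qed
      finally show ?thesis .
    qed
  qed (use u in \<open>simp_all add: polymap_Psi polymap_Psi_shift polymap_rmult polymap_lmult\<close>)
  from this[of "c - of_nat n"] show ?thesis by simp
qed

text \<open>Applied to the unit, to the constants and to F itself.\<close>

lemma Psi_ad_zero:
  assumes u: "u \<in> carrier Q" and "ad u = \<zero>"
  shows "Psi c u = u"
proof -
  have "Psi c u = nsum Q (\<lambda>i. \<kappa> ((-1) ^ i * (c gchoose i)) \<otimes> (Fi [^] i \<otimes> (ad ^^ i) u)) 1"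
    by (rule Psi_eq[OF u deg_le]) (use assms(2) in simp)
  then show ?thesis using u by simp
qed

end

subsection \<open>Complex vector spaces\<close>

lemma CC_simps [simp]:
  "carrier CC = UNIV" "x \<otimes>\<^bsub>CC\<^esub> y = x * y" "\<one>\<^bsub>CC\<^esub> = 1" "\<zero>\<^bsub>CC\<^esub> = 0" "x \<oplus>\<^bsub>CC\<^esub> y = x + y"
  by (simp_all add: ring_of_type_algebra_def)

lemma CC_a_inv [simp]: "\<ominus>\<^bsub>CC\<^esub> x = - x"
proof -
  interpret cring CC by (rule cring_from_type_algebra)
  show ?thesis by (rule minus_equality) simp_all
qed

locale cspace = module CC M for M :: "(complex, 'v, 'x) module_scheme" (structure)
begin

lemma s_closed [simp, intro]: "x \<in> carrier M \<Longrightarrow> c \<odot> x \<in> carrier M"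
  using smult_closed[of c x] by simp

lemma s_add_l: "x \<in> carrier M \<Longrightarrow> (a + b) \<odot> x = a \<odot> x \<oplus> b \<odot> x"
  using smult_l_distr[of a b x] by simp

lemma s_add_r: "x \<in> carrier M \<Longrightarrow> y \<in> carrier M \<Longrightarrow> c \<odot> (x \<oplus> y) = c \<odot> x \<oplus> c \<odot> y"
  using smult_r_distr[of c x y] by simp

lemma s_assoc: "x \<in> carrier M \<Longrightarrow> a \<odot> (b \<odot> x) = (a * b) \<odot> x"
  using smult_assoc1[of a b x] by simp

lemma s_one [simp]: "x \<in> carrier M \<Longrightarrow> 1 \<odot> x = x"
  using smult_one[of x] by simp

lemma s_zero [simp]: "x \<in> carrier M \<Longrightarrow> 0 \<odot> x = \<zero>\<^bsub>M\<^esub>" "c \<odot> \<zero>\<^bsub>M\<^esub> = \<zero>\<^bsub>M\<^esub>"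
  using smult_l_null[of x] smult_r_null[of c] by simp_all

lemma s_neg: "x \<in> carrier M \<Longrightarrow> (- c) \<odot> x = \<ominus>\<^bsub>M\<^esub> (c \<odot> x)"
  using smult_l_minus[of c x] by simp

lemma neg_eq: "x \<in> carrier M \<Longrightarrow> \<ominus>\<^bsub>M\<^esub> x = (-1) \<odot> x"
  using s_neg[of x 1] by simp

lemma minus_eq_smult: "x \<in> carrier M \<Longrightarrow> y \<in> carrier M \<Longrightarrow> x \<ominus>\<^bsub>M\<^esub> y = x \<oplus>\<^bsub>M\<^esub> (-1) \<odot> y"
  by (simp add: M.minus_eq neg_eq)

lemma s_eq_zero: "x \<in> carrier M \<Longrightarrow> c \<odot> x = \<zero>\<^bsub>M\<^esub> \<Longrightarrow> c \<noteq> 0 \<Longrightarrow> x = \<zero>\<^bsub>M\<^esub>"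
  using s_assoc[of x "1 / c" c] by simp

lemma smult_ahom: "(\<lambda>x. c \<odot> x) \<in> ahom M M"
  by (rule ahomI) (simp_all add: s_add_r)

end

subsection \<open>Nilpotency of an inner derivation\<close>

context ring
begin

definition comm :: "'a \<Rightarrow> 'a \<Rightarrow> 'a" where "comm f u = f \<otimes> u \<ominus> u \<otimes> f"

lemma comm_ahom: "f \<in> carrier R \<Longrightarrow> comm f \<in> ahom R R"
  unfolding comm_def by (rule ahomI) (simp_all add: l_distr r_distr minus_eq minus_add a_ac)

lemma comm_closed [simp]: "f \<in> carrier R \<Longrightarrow> u \<in> carrier R \<Longrightarrow> comm f u \<in> carrier R"
  by (rule ahom_closed[OF comm_ahom])

lemma comm_pow_closed: "f \<in> carrier R \<Longrightarrow> u \<in> carrier R \<Longrightarrow> (comm f ^^ n) u \<in> carrier R"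
  by (rule ahom_closed[OF funpow_ahom[OF comm_ahom]])

lemma comm_pow_zero: "f \<in> carrier R \<Longrightarrow> (comm f ^^ n) \<zero> = \<zero>"
  by (rule ahom_zero[OF abelian_group_axioms abelian_group_axioms funpow_ahom[OF comm_ahom]])

lemma comm_pow_mono:
  assumes "f \<in> carrier R" "(comm f ^^ n) u = \<zero>" "n \<le> m"
  shows "(comm f ^^ m) u = \<zero>"
  using funpow_add_app[where f = "comm f" and m = "m - n" and n = n and x = u] assms by (simp add: comm_pow_zero)

lemma comm_mult:
  "f \<in> carrier R \<Longrightarrow> u \<in> carrier R \<Longrightarrow> v \<in> carrier R \<Longrightarrow> comm f (u \<otimes> v) = comm f u \<otimes> v \<oplus> u \<otimes> comm f v"
proof -
  assume c: "f \<in> carrier R" "u \<in> carrier R" "v \<in> carrier R"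
  have tele: "a \<ominus> b \<oplus> (b \<ominus> d) = a \<ominus> d" if "a \<in> carrier R" "b \<in> carrier R" "d \<in> carrier R" for a b d
    using that by (simp add: minus_eq a_assoc r_neg1)
  have "comm f u \<otimes> v = f \<otimes> (u \<otimes> v) \<ominus> u \<otimes> (f \<otimes> v)"
    "u \<otimes> comm f v = u \<otimes> (f \<otimes> v) \<ominus> u \<otimes> (v \<otimes> f)"
    using c by (simp_all add: comm_def minus_eq l_distr r_distr l_minus r_minus m_assoc)
  then have "comm f u \<otimes> v \<oplus> u \<otimes> comm f v = f \<otimes> (u \<otimes> v) \<ominus> u \<otimes> (v \<otimes> f)"
    using tele[of "f \<otimes> (u \<otimes> v)" "u \<otimes> (f \<otimes> v)" "u \<otimes> (v \<otimes> f)"] c by simp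
  then show "comm f (u \<otimes> v) = comm f u \<otimes> v \<oplus> u \<otimes> comm f v"
    using c by (simp add: comm_def[of f "u \<otimes> v"] m_assoc)
qed

lemma f_mult_eq: "f \<in> carrier R \<Longrightarrow> u \<in> carrier R \<Longrightarrow> f \<otimes> u = u \<otimes> f \<oplus> comm f u"
  unfolding comm_def by (simp add: minus_eq a_lcomm r_neg)

definition comm_nil :: "'a \<Rightarrow> 'a \<Rightarrow> bool" where "comm_nil f u \<longleftrightarrow> (\<exists>n. (comm f ^^ n) u = \<zero>)"

lemma comm_nil_add:
  assumes "f \<in> carrier R" "u \<in> carrier R" "v \<in> carrier R" "comm_nil f u" "comm_nil f v"
  shows "comm_nil f (u \<oplus> v)"
proof -
  obtain n m where "(comm f ^^ n) u = \<zero>" "(comm f ^^ m) v = \<zero>" using assms(4,5) by (auto simp: comm_nil_def)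
  then have "(comm f ^^ (n + m)) u = \<zero>" "(comm f ^^ (n + m)) v = \<zero>"
    using comm_pow_mono[OF assms(1)] by auto
  then have "(comm f ^^ (n + m)) (u \<oplus> v) = \<zero>"
    using assms by (simp add: ahom_add[OF funpow_ahom[OF comm_ahom]])
  then show ?thesis by (auto simp: comm_nil_def)
qed

text \<open>The commutator with f is a derivation, so the exponents of nilpotency add up.\<close>

lemma comm_nil_mult:
  assumes f: "f \<in> carrier R" and "u \<in> carrier R" "v \<in> carrier R" "comm_nil f u" "comm_nil f v"
  shows "comm_nil f (u \<otimes> v)"
proof -
  \<comment> \<open>Induction on k with n + m at most k: each of the two Leibniz terms lowers n or m
    by one, and a factor of exponent 0 is itself zero.\<close>
  have 1: "(comm f ^^ k) (u \<otimes> v) = \<zero>" if "n + m \<le> k" "u \<in> carrier R" "v \<in> carrier R" "(comm f ^^ n) u = \<zero>" "(comm f ^^ m) v = \<zero>"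
    for k n m u v
    using that
  proof (induction k arbitrary: n m u v)
    case 0
    then show ?case by simp
  next
    case (Suc k)
    show ?case
    proof (cases "n = 0 \<or> m = 0")
      case True
      then have "u \<otimes> v = \<zero>" using Suc.prems by auto
      then show ?thesis by (simp add: comm_pow_zero[OF f] del: funpow.simps)
    next
      case False
      then obtain n' m' where nm: "n = Suc n'" "m = Suc m'" by (metis not0_implies_Suc)
      have "(comm f ^^ n') (comm f u) = \<zero>" "(comm f ^^ m') (comm f v) = \<zero>"
        using Suc.prems nm by (simp_all add: funpow_Suc_right del: funpow.simps)
      then have "(comm f ^^ k) (comm f u \<otimes> v) = \<zero>" "(comm f ^^ k) (u \<otimes> comm f v) = \<zero>"
        using Suc.IH[of n' m "comm f u" v] Suc.IH[of n m' u "comm f v"] Suc.prems f nm by simp_all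
      moreover have "(comm f ^^ Suc k) (u \<otimes> v) = (comm f ^^ k) (comm f u \<otimes> v \<oplus> u \<otimes> comm f v)"
        unfolding funpow_Suc_right using comm_mult[OF f Suc.prems(2,3)] by simp
      moreover have "\<dots> = (comm f ^^ k) (comm f u \<otimes> v) \<oplus> (comm f ^^ k) (u \<otimes> comm f v)"
        using Suc.prems(2,3) f by (intro ahom_add[OF funpow_ahom[OF comm_ahom]]) simp_all
      ultimately show ?thesis by simp
    qed
  qed
  obtain n m where "(comm f ^^ n) u = \<zero>" "(comm f ^^ m) v = \<zero>"
    using assms(4,5) by (auto simp: comm_nil_def)
  then have "(comm f ^^ (n + m)) (u \<otimes> v) = \<zero>" using 1[of n m "n + m" u v] assms(2,3) by simp
  then show ?thesis unfolding comm_nil_def by blast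
qed

text \<open>Both conditions come from f r = r f + [f, r] by induction on the exponent that kills r:
  the commutator has a smaller exponent, and r f = 0 implies [f, r] f = 0.\<close>

lemma ore_of_comm_nil:
  assumes f: "f \<in> carrier R" and nil: "\<And>u. u \<in> carrier R \<Longrightarrow> comm_nil f u"
  shows "ore_localization R f"
proof (unfold_locales)
  have 1: "\<exists>r'. r' \<in> carrier R \<and> f [^] (n::nat) \<otimes> r = r' \<otimes> f" if "r \<in> carrier R" "(comm f ^^ n) r = \<zero>" for r n
    using that
  proof (induction n arbitrary: r)
    case 0
    then show ?case by (intro exI[of _ \<zero>]) (simp add: f)
  next
    case (Suc n)
    have z: "(comm f ^^ n) (comm f r) = \<zero>"
      using Suc.prems by (simp add: funpow_Suc_right del: funpow.simps)
    obtain r'' where r'': "r'' \<in> carrier R" "f [^] n \<otimes> comm f r = r'' \<otimes> f"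
      using Suc.IH[OF comm_closed[OF f Suc.prems(1)] z] by blast
    have "f [^] Suc n \<otimes> r = f [^] n \<otimes> (r \<otimes> f \<oplus> comm f r)"
      using f Suc.prems f_mult_eq[of f r] by (simp add: m_assoc)
    also have "\<dots> = (f [^] n \<otimes> r \<oplus> r'') \<otimes> f"
      using f Suc.prems r'' by (simp add: l_distr r_distr m_assoc)
    finally show ?case using f Suc.prems r'' by (intro exI[of _ "f [^] n \<otimes> r \<oplus> r''"]) simp
  qed
  have 2: "f [^] (n::nat) \<otimes> r = \<zero>" if "r \<in> carrier R" "(comm f ^^ n) r = \<zero>" "r \<otimes> f = \<zero>" for r n
    using that
  proof (induction n arbitrary: r)
    case (Suc n)
    have "comm f (r \<otimes> f) = comm f r \<otimes> f \<oplus> r \<otimes> comm f f"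
      using f Suc.prems by (intro comm_mult) simp_all
    moreover have "comm f f = \<zero>" using f by (simp add: comm_def minus_eq r_neg)
    ultimately have "comm f r \<otimes> f = \<zero>"
      using f Suc.prems comm_pow_zero[OF f, of 1] by simp
    then have "f [^] n \<otimes> comm f r = \<zero>"
      using Suc.IH[of "comm f r"] f Suc.prems by (simp add: funpow_Suc_right del: funpow.simps)
    then show ?case
      using f Suc.prems f_mult_eq[of f r] by (simp add: m_assoc)
  qed (use f in simp)
  show "\<exists>k r'. r' \<in> carrier R \<and> f [^] (k::nat) \<otimes> r = r' \<otimes> f" if "r \<in> carrier R" for r
    using 1[OF that] nil[OF that] by (auto simp: comm_nil_def)
  show "\<exists>k::nat. f [^] k \<otimes> r = \<zero>" if "r \<in> carrier R" "r \<otimes> f = \<zero>" for r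
    using 2[OF that(1) _ that(2)] nil[OF that(1)] by (auto simp: comm_nil_def)
qed (rule f)

end

subsection \<open>The free algebra\<close>

lemma free_alg_carrier: "p \<in> carrier (free_alg Z) \<longleftrightarrow> finite {w. p w \<noteq> 0} \<and> {w. p w \<noteq> 0} \<subseteq> lists Z"
  by (simp add: free_alg_def)

lemma free_alg_simps:
  "p \<otimes>\<^bsub>free_alg Z\<^esub> q = (\<lambda>w. \<Sum>i\<le>length w. p (take i w) * q (drop i w))"
  "\<one>\<^bsub>free_alg Z\<^esub> = (\<lambda>w. if w = [] then 1 else 0)"
  "\<zero>\<^bsub>free_alg Z\<^esub> = (\<lambda>w. 0)"
  "p \<oplus>\<^bsub>free_alg Z\<^esub> q = (\<lambda>w. p w + q w)"
  by (simp_all add: free_alg_def)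

lemma free_alg_mult_closed:
  assumes "p \<in> carrier (free_alg Z)" "q \<in> carrier (free_alg Z)"
  shows "p \<otimes>\<^bsub>free_alg Z\<^esub> q \<in> carrier (free_alg Z)"
proof -
  let ?P = "{w. p w \<noteq> 0}" and ?Q = "{w. q w \<noteq> 0}"
  have sub: "{w. (p \<otimes>\<^bsub>free_alg Z\<^esub> q) w \<noteq> 0} \<subseteq> (\<lambda>(u, v). u @ v) ` (?P \<times> ?Q)"
  proof
    fix w assume "w \<in> {w. (p \<otimes>\<^bsub>free_alg Z\<^esub> q) w \<noteq> 0}"
    then obtain i where "p (take i w) * q (drop i w) \<noteq> 0"
      unfolding free_alg_simps by (metis (mono_tags, lifting) mem_Collect_eq sum.not_neutral_contains_not_neutral)
    then have "(take i w, drop i w) \<in> ?P \<times> ?Q" by simp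
    then show "w \<in> (\<lambda>(u, v). u @ v) ` (?P \<times> ?Q)" by (rule rev_image_eqI) simp
  qed
  moreover have "finite ((\<lambda>(u, v). u @ v) ` (?P \<times> ?Q))"
    using assms by (simp add: free_alg_carrier)
  moreover have "(\<lambda>(u, v). u @ v) ` (?P \<times> ?Q) \<subseteq> lists Z"
  proof -
    have "set u \<subseteq> Z" "set v \<subseteq> Z" if "p u \<noteq> 0" "q v \<noteq> 0" for u v
      using assms that by (auto simp: free_alg_carrier)
    then show ?thesis by fastforce
  qed
  ultimately show ?thesis
    unfolding free_alg_carrier by (meson finite_subset order_trans)
qed

text \<open>Both sides sum over the ways of cutting the word into three pieces.\<close>

lemma free_alg_assoc:
  "(p \<otimes>\<^bsub>free_alg Z\<^esub> q) \<otimes>\<^bsub>free_alg Z\<^esub> r = p \<otimes>\<^bsub>free_alg Z\<^esub> (q \<otimes>\<^bsub>free_alg Z\<^esub> r)"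
proof
  fix w :: "'a list"
  let ?n = "length w"
  let ?g = "\<lambda>j k. p (take j w) * q (take k (drop j w)) * r (drop k (drop j w))"
  have "((p \<otimes>\<^bsub>free_alg Z\<^esub> q) \<otimes>\<^bsub>free_alg Z\<^esub> r) w = (\<Sum>i\<le>?n. \<Sum>j\<le>i. ?g j (i - j))"
    unfolding free_alg_simps
    by (intro sum.cong refl) (auto simp: sum_distrib_right min_def drop_take intro!: sum.cong)
  also have "\<dots> = (\<Sum>(j, k)\<in>{(j, k). j + k \<le> ?n}. ?g j k)"
    by (rule sum.triangle_reindex_eq[symmetric])
  also have "{(j, k). j + k \<le> ?n} = Sigma {..?n} (\<lambda>j. {..?n - j})"
    by auto
  also have "(\<Sum>(j, k)\<in>Sigma {..?n} (\<lambda>j. {..?n - j}). ?g j k) = (\<Sum>j\<le>?n. \<Sum>k\<le>?n - j. ?g j k)"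
    by (rule sum.Sigma[symmetric]) simp_all
  also have "\<dots> = (p \<otimes>\<^bsub>free_alg Z\<^esub> (q \<otimes>\<^bsub>free_alg Z\<^esub> r)) w"
    unfolding free_alg_simps by (simp add: sum_distrib_left mult.assoc)
  finally show "((p \<otimes>\<^bsub>free_alg Z\<^esub> q) \<otimes>\<^bsub>free_alg Z\<^esub> r) w = (p \<otimes>\<^bsub>free_alg Z\<^esub> (q \<otimes>\<^bsub>free_alg Z\<^esub> r)) w" .
qed

lemma free_alg_add_closed:
  assumes "p \<in> carrier (free_alg Z)" "q \<in> carrier (free_alg Z)"
  shows "(\<lambda>w. p w + q w) \<in> carrier (free_alg Z)"
proof -
  have "{w. p w + q w \<noteq> 0} \<subseteq> {w. p w \<noteq> 0} \<union> {w. q w \<noteq> 0}" by auto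
  with assms show ?thesis unfolding free_alg_carrier by (meson finite_UnI finite_subset le_sup_iff order_trans)
qed

lemma monomial_closed: "w \<in> lists Z \<Longrightarrow> monomial c w \<in> carrier (free_alg Z)"
  unfolding free_alg_carrier monomial_def by (auto intro: finite_subset[of _ "{w}"])

lemma monomial_eq_one: "\<one>\<^bsub>free_alg Z\<^esub> = monomial 1 []"
  by (auto simp: free_alg_simps monomial_def)

lemma monomial_mult: "monomial c u \<otimes>\<^bsub>free_alg Z\<^esub> monomial d v = monomial (c * d) (u @ v)"
proof
  fix w :: "'a list"
  have "(monomial c u \<otimes>\<^bsub>free_alg Z\<^esub> monomial d v) w =
      (\<Sum>i\<le>length w. if i = length u \<and> w = u @ v then c * d else 0)"
    unfolding free_alg_simps monomial_def
  proof (intro sum.cong refl)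
    fix i assume "i \<in> {..length w}"
    then have "take i w = u \<and> drop i w = v \<longleftrightarrow> i = length u \<and> w = u @ v"
      by (metis append_eq_conv_conj append_take_drop_id atMost_iff length_take min.absorb2)
    then show "(if take i w = u then c else 0) * (if drop i w = v then d else 0) =
        (if i = length u \<and> w = u @ v then c * d else 0)"
      by auto
  qed
  also have "\<dots> = monomial (c * d) (u @ v) w"
    by (cases "w = u @ v") (simp_all add: monomial_def sum.delta)
  finally show "(monomial c u \<otimes>\<^bsub>free_alg Z\<^esub> monomial d v) w = monomial (c * d) (u @ v) w" .
qed

lemma ring_free_alg: "ring (free_alg Z)"
proof (rule ringI)
  show "abelian_group (free_alg Z)"
  proof (rule abelian_groupI)
    show "\<zero>\<^bsub>free_alg Z\<^esub> \<in> carrier (free_alg Z)" by (simp add: free_alg_carrier free_alg_simps)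
    show "\<exists>q\<in>carrier (free_alg Z). q \<oplus>\<^bsub>free_alg Z\<^esub> p = \<zero>\<^bsub>free_alg Z\<^esub>" if "p \<in> carrier (free_alg Z)" for p
      by (rule bexI[of _ "\<lambda>w. - p w"]) (use that in \<open>auto simp: free_alg_carrier free_alg_simps\<close>)
  qed (auto simp: free_alg_simps free_alg_add_closed algebra_simps)
  show "Group.monoid (free_alg Z)"
  proof (rule monoidI)
    show "\<one>\<^bsub>free_alg Z\<^esub> \<in> carrier (free_alg Z)" by (simp add: monomial_eq_one monomial_closed)
    show "\<one>\<^bsub>free_alg Z\<^esub> \<otimes>\<^bsub>free_alg Z\<^esub> p = p" for p
    proof
      fix w :: "'a list"
      have "(\<one>\<^bsub>free_alg Z\<^esub> \<otimes>\<^bsub>free_alg Z\<^esub> p) w = (\<Sum>i\<le>length w. if i = 0 then p w else 0)"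
        unfolding free_alg_simps by (intro sum.cong) auto
      then show "(\<one>\<^bsub>free_alg Z\<^esub> \<otimes>\<^bsub>free_alg Z\<^esub> p) w = p w" by simp
    qed
    show "p \<otimes>\<^bsub>free_alg Z\<^esub> \<one>\<^bsub>free_alg Z\<^esub> = p" for p
    proof
      fix w :: "'a list"
      have "(p \<otimes>\<^bsub>free_alg Z\<^esub> \<one>\<^bsub>free_alg Z\<^esub>) w = (\<Sum>i\<le>length w. if i = length w then p w else 0)"
        unfolding free_alg_simps by (intro sum.cong) auto
      then show "(p \<otimes>\<^bsub>free_alg Z\<^esub> \<one>\<^bsub>free_alg Z\<^esub>) w = p w" by simp
    qed
  qed (simp_all add: free_alg_mult_closed free_alg_assoc)
qed (simp_all add: free_alg_simps fun_eq_iff sum.distrib algebra_simps)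

text \<open>The premise \<open>p w = 0\<close> says that the word is new, so nothing cancels;
  \<open>U_par_act\<close> uses this to pass a condition on the support to the two summands.\<close>

lemma free_alg_induct [consumes 1, case_names zero add]:
  assumes "p \<in> carrier (free_alg Z)"
    and "P (\<lambda>w. 0)"
    and "\<And>p c w. p \<in> carrier (free_alg Z) \<Longrightarrow> w \<in> lists Z \<Longrightarrow> p w = 0 \<Longrightarrow> P p \<Longrightarrow> P (\<lambda>u. p u + monomial c w u)"
  shows "P p"
proof -
  have "\<forall>p. finite S \<longrightarrow> {w. p w \<noteq> 0} \<subseteq> S \<longrightarrow> S \<subseteq> lists Z \<longrightarrow> P p" for S
  proof (induction S rule: infinite_finite_induct)
    case empty
    then show ?case using assms(2) by (auto simp: fun_eq_iff[symmetric] intro: back_subst[of P])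
  next
    case (insert w S)
    show ?case
    proof (intro allI impI)
      fix p :: "'a list \<Rightarrow> complex"
      assume p: "{w. p w \<noteq> 0} \<subseteq> insert w S" "insert w S \<subseteq> lists Z"
      let ?q = "p(w := 0)"
      have q: "{w. ?q w \<noteq> 0} \<subseteq> S" using p by auto
      then have "P ?q" using insert p by blast
      moreover have "?q \<in> carrier (free_alg Z)"
        using q insert.hyps p unfolding free_alg_carrier by (meson finite_subset insert_subset order_trans)
      ultimately have "P (\<lambda>u. ?q u + monomial (p w) w u)"
        using assms(3)[of ?q w "p w"] p(2) by fastforce
      moreover have "(\<lambda>u. ?q u + monomial (p w) w u) = p" by (auto simp: monomial_def)
      ultimately show "P p" by simp
    qed
  qed simp
  with assms(1) show ?thesis unfolding free_alg_carrier by blast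
qed

subsection \<open>The universal enveloping algebra\<close>

context lie_superalgebra
begin

abbreviation "FA \<equiv> free_alg (carrier L)"
abbreviation "UL \<equiv> U_alg L"
abbreviation "Uc c \<equiv> U_class L (monomial c [])"

lemma cspace_L: "cspace L"
  by unfold_locales

interpretation FA: ring FA by (rule ring_free_alg)

lemma par_submodule: "submodule (par L i) CC L"
  using grading by (simp add: graded_def)

lemma par_carrier: "x \<in> par L i \<Longrightarrow> x \<in> carrier L"
  using submoduleE(1)[OF par_submodule] by auto

lemma mono_closed: "w \<in> lists (carrier L) \<Longrightarrow> monomial c w \<in> carrier FA"
  by (rule monomial_closed)

lemma relations_closed: "U_relations L \<subseteq> carrier FA"
  unfolding U_relations_def Let_def
  by (auto intro!: FA.minus_closed mono_closed simp: par_carrier br_closed smult_closed)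

lemma U_ideal: "ideal (U_ideal L) FA"
  unfolding U_ideal_def by (rule FA.genideal_ideal[OF relations_closed])

interpretation I: ideal "U_ideal L" FA by (rule U_ideal)

lemma ring_UL: "ring UL"
  unfolding U_alg_def by (rule I.quotient_is_ring)

lemma U_class_hom: "U_class L \<in> ring_hom FA UL"
  unfolding U_class_def[abs_def] U_alg_def by (rule I.rcos_ring_hom)

sublocale UL: ring UL by (rule ring_UL)

lemma U_class_closed [simp]: "p \<in> carrier FA \<Longrightarrow> U_class L p \<in> carrier UL"
  by (rule ring_hom_closed[OF U_class_hom])

lemma U_class_add: "p \<in> carrier FA \<Longrightarrow> q \<in> carrier FA \<Longrightarrow>
    U_class L (\<lambda>w. p w + q w) = U_class L p \<oplus>\<^bsub>UL\<^esub> U_class L q"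
  using ring_hom_add[OF U_class_hom] by (simp add: free_alg_simps)

lemma U_class_mult: "p \<in> carrier FA \<Longrightarrow> q \<in> carrier FA \<Longrightarrow>
    U_class L (p \<otimes>\<^bsub>FA\<^esub> q) = U_class L p \<otimes>\<^bsub>UL\<^esub> U_class L q"
  by (rule ring_hom_mult[OF U_class_hom])

lemma U_class_ahom: "U_class L \<in> ahom FA UL"
  using U_class_hom by (auto simp: ring_hom_def ahom_def)

lemmas U_class_minus = ahom_minus[OF FA.abelian_group_axioms UL.abelian_group_axioms U_class_ahom]
lemmas U_class_zero = ahom_zero[OF FA.abelian_group_axioms UL.abelian_group_axioms U_class_ahom]

lemma U_class_surj: "u \<in> carrier UL \<Longrightarrow> \<exists>p\<in>carrier FA. u = U_class L p"
  by (auto simp: U_alg_def FactRing_def A_RCOSETS_def RCOSETS_def a_r_coset_def U_class_def)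

lemma U_class_mono: "u \<in> lists (carrier L) \<Longrightarrow> v \<in> lists (carrier L) \<Longrightarrow>
    U_class L (monomial (c * d) (u @ v)) = U_class L (monomial c u) \<otimes>\<^bsub>UL\<^esub> U_class L (monomial d v)"
  using U_class_mult[of "monomial c u" "monomial d v"] by (simp add: mono_closed monomial_mult)

lemma Uc_closed [simp]: "Uc c \<in> carrier UL"
  by (simp add: mono_closed)

lemma Uc_one: "Uc 1 = \<one>\<^bsub>UL\<^esub>"
  using ring_hom_one[OF U_class_hom] by (simp add: monomial_eq_one)

lemma Uc_mult: "Uc (c * d) = Uc c \<otimes>\<^bsub>UL\<^esub> Uc d"
  using U_class_mono[of "[]" "[]" c d] by simp

lemma Uc_add: "Uc (c + d) = Uc c \<oplus>\<^bsub>UL\<^esub> Uc d"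
proof -
  have *: "(\<lambda>w. monomial c [] w + monomial d [] w) = monomial (c + d) ([]::'a list)"
    by (auto simp: monomial_def)
  show ?thesis
    using U_class_add[of "monomial c []" "monomial d []"] unfolding * by (simp add: mono_closed)
qed

lemma U_gen_closed [simp]: "x \<in> carrier L \<Longrightarrow> U_gen L x \<in> carrier UL"
  by (simp add: U_gen_def mono_closed)

lemma U_class_Cons:
  assumes "x \<in> carrier L" "w \<in> lists (carrier L)"
  shows "U_class L (monomial c (x # w)) = U_gen L x \<otimes>\<^bsub>UL\<^esub> U_class L (monomial c w)"
  using U_class_mono[of "[x]" w 1 c] assms by (simp add: U_gen_def)

lemma U_class_scale:
  assumes "w \<in> lists (carrier L)"
  shows "U_class L (monomial c w) = Uc c \<otimes>\<^bsub>UL\<^esub> U_class L (monomial 1 w)"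
  using U_class_mono[of "[]" w c 1] assms by simp

lemma U_induct [consumes 1, case_names zero add]:
  assumes "u \<in> carrier UL"
    and zero: "P \<zero>\<^bsub>UL\<^esub>"
    and add: "\<And>u c w. u \<in> carrier UL \<Longrightarrow> w \<in> lists (carrier L) \<Longrightarrow> P u \<Longrightarrow> P (u \<oplus>\<^bsub>UL\<^esub> U_class L (monomial c w))"
  shows "P u"
proof -
  obtain p where p: "p \<in> carrier FA" "u = U_class L p" using U_class_surj[OF assms(1)] by auto
  have "P (U_class L p)" using p(1)
  proof (induction p rule: free_alg_induct)
    case zero
    then show ?case using assms(2) U_class_zero by (simp add: free_alg_simps)
  next
    case (add p c w)
    then show ?case using assms(3)[of "U_class L p" w c] by (simp add: U_class_add mono_closed)
  qed
  then show ?thesis by (simp add: p)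
qed

lemma Uc_central: "u \<in> carrier UL \<Longrightarrow> u \<otimes>\<^bsub>UL\<^esub> Uc c = Uc c \<otimes>\<^bsub>UL\<^esub> u"
proof (induction u rule: U_induct)
  case (add u d w)
  have "U_class L (monomial d w) \<otimes>\<^bsub>UL\<^esub> Uc c = Uc c \<otimes>\<^bsub>UL\<^esub> U_class L (monomial d w)"
    using U_class_mono[of w "[]" d c] U_class_mono[of "[]" w c d] add by (simp add: mult.commute)
  then show ?case using add by (simp add: UL.l_distr UL.r_distr mono_closed)
qed simp

lemma relation_zero:
  assumes "p \<in> U_relations L"
  shows "U_class L p = \<zero>\<^bsub>UL\<^esub>"
proof -
  have "p \<in> U_ideal L"
    using FA.genideal_self[OF relations_closed] assms by (auto simp: U_ideal_def)
  then show ?thesis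
    unfolding U_class_def U_alg_def FactRing_def by (simp add: I.a_rcos_const)
qed

lemma U_gen_add:
  assumes "x \<in> carrier L" "y \<in> carrier L"
  shows "U_gen L (x \<oplus>\<^bsub>L\<^esub> y) = U_gen L x \<oplus>\<^bsub>UL\<^esub> U_gen L y"
proof -
  have "U_class L (monomial 1 [x \<oplus>\<^bsub>L\<^esub> y] \<ominus>\<^bsub>FA\<^esub> monomial 1 [x] \<ominus>\<^bsub>FA\<^esub> monomial 1 [y]) = \<zero>\<^bsub>UL\<^esub>"
    using assms by (intro relation_zero) (auto simp: U_relations_def Let_def)
  then have "U_gen L (x \<oplus>\<^bsub>L\<^esub> y) \<ominus>\<^bsub>UL\<^esub> U_gen L x \<ominus>\<^bsub>UL\<^esub> U_gen L y = \<zero>\<^bsub>UL\<^esub>"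
    using assms by (simp add: U_class_minus mono_closed U_gen_def)
  then have "U_gen L (x \<oplus>\<^bsub>L\<^esub> y) \<ominus>\<^bsub>UL\<^esub> U_gen L x = U_gen L y"
    using assms by (simp add: UL.minus_eq_zero_iff)
  then have "U_gen L (x \<oplus>\<^bsub>L\<^esub> y) = U_gen L y \<oplus>\<^bsub>UL\<^esub> U_gen L x"
    using assms by (metis UL.add.inv_solve_right' UL.minus_eq U_gen_closed add.m_closed UL.minus_closed)
  then show ?thesis using assms by (simp add: UL.a_comm)
qed

lemma U_gen_smult:
  assumes "x \<in> carrier L"
  shows "U_gen L (c \<odot>\<^bsub>L\<^esub> x) = Uc c \<otimes>\<^bsub>UL\<^esub> U_gen L x"
proof -
  have "U_class L (monomial 1 [c \<odot>\<^bsub>L\<^esub> x] \<ominus>\<^bsub>FA\<^esub> monomial c [x]) = \<zero>\<^bsub>UL\<^esub>"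
    using assms by (intro relation_zero) (auto simp: U_relations_def Let_def)
  then have "U_gen L (c \<odot>\<^bsub>L\<^esub> x) = U_class L (monomial c [x])"
    using assms smult_closed[of c x] by (simp add: U_class_minus mono_closed U_gen_def UL.minus_eq_zero_iff)
  then show ?thesis using U_class_scale[of "[x]" c] assms by (simp add: U_gen_def)
qed

lemma U_gen_br:
  assumes "x \<in> par L i" "y \<in> par L j"
  shows "U_gen L (br L x y) = U_gen L x \<otimes>\<^bsub>UL\<^esub> U_gen L y \<ominus>\<^bsub>UL\<^esub> Uc (sign i j) \<otimes>\<^bsub>UL\<^esub> (U_gen L y \<otimes>\<^bsub>UL\<^esub> U_gen L x)"
proof -
  have xy: "x \<in> carrier L" "y \<in> carrier L" using assms par_carrier by auto
  have "U_class L (monomial 1 [x, y] \<ominus>\<^bsub>FA\<^esub> monomial (sign i j) [y, x] \<ominus>\<^bsub>FA\<^esub> monomial 1 [br L x y]) = \<zero>\<^bsub>UL\<^esub>"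
    using assms by (intro relation_zero) (auto simp: U_relations_def Let_def)
  then have "U_class L (monomial 1 [x, y]) \<ominus>\<^bsub>UL\<^esub> U_class L (monomial (sign i j) [y, x]) = U_gen L (br L x y)"
    using xy by (simp add: U_class_minus mono_closed U_gen_def UL.minus_eq_zero_iff br_closed)
  moreover have "U_class L (monomial 1 [x, y]) = U_gen L x \<otimes>\<^bsub>UL\<^esub> U_gen L y"
    using U_class_Cons[of x "[y]" 1] xy by (simp add: U_gen_def)
  moreover have "U_class L (monomial (sign i j) [y, x]) = Uc (sign i j) \<otimes>\<^bsub>UL\<^esub> (U_gen L y \<otimes>\<^bsub>UL\<^esub> U_gen L x)"
    using U_class_Cons[of y "[x]" 1] U_class_scale[of "[y, x]" "sign i j"] xy by (simp add: U_gen_def)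
  ultimately show ?thesis by simp
qed

lemma grade_decomp:
  assumes "x \<in> carrier L"
  obtains x0 x1 where "x0 \<in> par L 0" "x1 \<in> par L 1" "x = x0 \<oplus>\<^bsub>L\<^esub> x1"
  using grading assms by (auto simp: graded_def)

text \<open>For an even first argument the sign is 1 in either degree, so the superbracket is the
  commutator, and additivity covers inhomogeneous y.\<close>

lemma U_gen_br_even:
  assumes z: "z \<in> par L 0" and y: "y \<in> carrier L"
  shows "U_gen L (br L z y) = UL.comm (U_gen L z) (U_gen L y)"
proof -
  have zc: "z \<in> carrier L" using z par_carrier by auto
  have 1: "U_gen L (br L z y) = UL.comm (U_gen L z) (U_gen L y)" if "y \<in> par L j" for y j
    using U_gen_br[OF z that] zc par_carrier[OF that] by (simp add: sign_def Uc_one UL.comm_def)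
  obtain y0 y1 where yy: "y0 \<in> par L 0" "y1 \<in> par L 1" "y = y0 \<oplus>\<^bsub>L\<^esub> y1" by (rule grade_decomp[OF y])
  show ?thesis
    using par_carrier[OF yy(1)] par_carrier[OF yy(2)] zc 1[OF yy(1)] 1[OF yy(2)]
    by (simp add: yy(3) br_add_right U_gen_add br_closed ahom_add[OF UL.comm_ahom])
qed

lemma U_gen_ad_pow:
  assumes z: "z \<in> par L 0" and y: "y \<in> carrier L"
  shows "(br L z ^^ n) y \<in> carrier L" "U_gen L ((br L z ^^ n) y) = (UL.comm (U_gen L z) ^^ n) (U_gen L y)"
proof -
  have "(br L z ^^ n) y \<in> carrier L \<and> U_gen L ((br L z ^^ n) y) = (UL.comm (U_gen L z) ^^ n) (U_gen L y)"
    using par_carrier[OF z] y by (induction n) (simp_all add: br_closed U_gen_br_even[OF z])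
  then show "(br L z ^^ n) y \<in> carrier L" "U_gen L ((br L z ^^ n) y) = (UL.comm (U_gen L z) ^^ n) (U_gen L y)"
    by auto
qed

text \<open>Nilpotency on generators spreads to words by \<open>comm_nil_mult\<close> and to sums by
  \<open>comm_nil_add\<close>; through \<open>ore_of_comm_nil\<close> it makes the localization a
  ring.\<close>

lemma U_comm_nil:
  assumes z: "z \<in> par L 0" and nil: "\<And>x. x \<in> carrier L \<Longrightarrow> \<exists>k. (br L z ^^ k) x = \<zero>\<^bsub>L\<^esub>"
    and u: "u \<in> carrier UL"
  shows "UL.comm_nil (U_gen L z) u"
proof -
  have zc: "z \<in> carrier L" using z par_carrier by auto
  have zero: "U_gen L \<zero>\<^bsub>L\<^esub> = \<zero>\<^bsub>UL\<^esub>"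
    using U_gen_add[of "\<zero>\<^bsub>L\<^esub>" "\<zero>\<^bsub>L\<^esub>"] by (metis UL.add.r_cancel_one' U_gen_closed zero_closed r_zero)
  have g: "UL.comm_nil (U_gen L z) (U_gen L x)" if x: "x \<in> carrier L" for x
  proof -
    obtain k where "(br L z ^^ k) x = \<zero>\<^bsub>L\<^esub>" using nil[OF x] by auto
    then have "(UL.comm (U_gen L z) ^^ k) (U_gen L x) = \<zero>\<^bsub>UL\<^esub>"
      using U_gen_ad_pow(2)[OF z x, of k] zero by simp
    then show ?thesis by (auto simp: UL.comm_nil_def)
  qed
  have m: "UL.comm_nil (U_gen L z) (U_class L (monomial c w))" if "w \<in> lists (carrier L)" for c w
    using that
  proof (induction w)
    case Nil
    have "(UL.comm (U_gen L z) ^^ 1) (Uc c) = \<zero>\<^bsub>UL\<^esub>"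
      using zc by (simp add: UL.comm_def Uc_central UL.minus_eq UL.r_neg)
    then show ?case unfolding UL.comm_nil_def by blast
  next
    case (Cons x w)
    then show ?case using zc g[of x]
      by (simp add: U_class_Cons) (intro UL.comm_nil_mult; simp add: mono_closed)
  qed
  show ?thesis using u
  proof (induction u rule: U_induct)
    case zero
    then show ?case unfolding UL.comm_nil_def by (intro exI[of _ 0]) simp
  next
    case (add u c w)
    then show ?case using zc m[of w c] by (intro UL.comm_nil_add) (simp_all add: mono_closed)
  qed
qed

end

subsection \<open>Modules over a Lie superalgebra and over its enveloping algebra\<close>

text \<open>The bracket rule is written with addition and the scalar \<open>- sign i j\<close>: both
  operations carry over verbatim to records with another carrier, whereas subtraction involves an
  inverse taken in the carrier.\<close>

locale gmodule = L: lie_superalgebra L + N: cspace N for L :: "'g lsa" and N :: "('g, 'v) gmod" +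
  assumes act_closed: "\<And>x v. x \<in> carrier L \<Longrightarrow> v \<in> carrier N \<Longrightarrow> act N x v \<in> carrier N"
    and act_add_r: "\<And>x v w. x \<in> carrier L \<Longrightarrow> v \<in> carrier N \<Longrightarrow> w \<in> carrier N \<Longrightarrow>
      act N x (v \<oplus>\<^bsub>N\<^esub> w) = act N x v \<oplus>\<^bsub>N\<^esub> act N x w"
    and act_smult_r: "\<And>c x v. x \<in> carrier L \<Longrightarrow> v \<in> carrier N \<Longrightarrow> act N x (c \<odot>\<^bsub>N\<^esub> v) = c \<odot>\<^bsub>N\<^esub> act N x v"
    and act_add_l: "\<And>x y v. x \<in> carrier L \<Longrightarrow> y \<in> carrier L \<Longrightarrow> v \<in> carrier N \<Longrightarrow>
      act N (x \<oplus>\<^bsub>L\<^esub> y) v = act N x v \<oplus>\<^bsub>N\<^esub> act N y v"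
    and act_smult_l: "\<And>c x v. x \<in> carrier L \<Longrightarrow> v \<in> carrier N \<Longrightarrow> act N (c \<odot>\<^bsub>L\<^esub> x) v = c \<odot>\<^bsub>N\<^esub> act N x v"
    and act_br: "\<And>i j x y v. x \<in> par L i \<Longrightarrow> y \<in> par L j \<Longrightarrow> v \<in> carrier N \<Longrightarrow>
      act N (br L x y) v = act N x (act N y v) \<oplus>\<^bsub>N\<^esub> (- sign i j) \<odot>\<^bsub>N\<^esub> act N y (act N x v)"

lemma is_gmodule_iff:
  assumes "lie_superalgebra L"
  shows "is_gmodule gr L N \<longleftrightarrow> gmodule L N \<and>
    (gr \<longrightarrow> graded N \<and> (\<forall>i j. \<forall>x\<in>par L i. \<forall>v\<in>par N j. act N x v \<in> par N (i + j)))"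
proof -
  interpret L: lie_superalgebra L by fact
  have eq: "v \<ominus>\<^bsub>N\<^esub> s \<odot>\<^bsub>N\<^esub> w = v \<oplus>\<^bsub>N\<^esub> (- s) \<odot>\<^bsub>N\<^esub> w"
    if "module CC N" "v \<in> carrier N" "w \<in> carrier N" for v w s
  proof -
    interpret N: cspace N by (rule cspace.intro) fact
    show ?thesis using that by (simp add: N.M.minus_eq N.s_neg)
  qed
  show ?thesis
    unfolding is_gmodule_def gmodule_def gmodule_axioms_def cspace_def
    using assms L.par_carrier by (auto simp: eq)
qed

context gmodule
begin

lemma act_ahom: "x \<in> carrier L \<Longrightarrow> act N x \<in> ahom N N"
  by (rule ahomI) (simp_all add: act_closed act_add_r)

lemma act_zero: "x \<in> carrier L \<Longrightarrow> act N x \<zero>\<^bsub>N\<^esub> = \<zero>\<^bsub>N\<^esub>"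
  by (rule ahom_zero[OF N.M.abelian_group_axioms N.M.abelian_group_axioms act_ahom])

lemma act_pow_ahom: "x \<in> carrier L \<Longrightarrow> act N x ^^ n \<in> ahom N N"
  by (rule funpow_ahom[OF act_ahom])

lemma act_pow_closed: "x \<in> carrier L \<Longrightarrow> v \<in> carrier N \<Longrightarrow> (act N x ^^ n) v \<in> carrier N"
  by (rule ahom_closed[OF act_pow_ahom])

lemma act_pow_zero: "x \<in> carrier L \<Longrightarrow> (act N x ^^ n) \<zero>\<^bsub>N\<^esub> = \<zero>\<^bsub>N\<^esub>"
  by (rule ahom_zero[OF N.M.abelian_group_axioms N.M.abelian_group_axioms act_pow_ahom])

definition word_act :: "'g list \<Rightarrow> 'v \<Rightarrow> 'v" where "word_act w v = foldr (act N) w v"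

lemma word_act_simps [simp]: "word_act [] v = v" "word_act (x # w) v = act N x (word_act w v)"
  by (simp_all add: word_act_def)

lemma word_act_append: "word_act (u @ w) v = word_act u (word_act w v)"
  by (simp add: word_act_def)

lemma word_act_ahom: "w \<in> lists (carrier L) \<Longrightarrow> word_act w \<in> ahom N N"
proof (induction w)
  case Nil
  then show ?case by (simp add: ahomI)
next
  case (Cons x w)
  then show ?case using ahom_comp[OF Cons.IH act_ahom[of x]] by (simp add: word_act_def comp_def)
qed

lemma word_act_closed: "w \<in> lists (carrier L) \<Longrightarrow> v \<in> carrier N \<Longrightarrow> word_act w v \<in> carrier N"
  by (rule ahom_closed[OF word_act_ahom])

lemma word_act_smult: "w \<in> lists (carrier L) \<Longrightarrow> v \<in> carrier N \<Longrightarrow> word_act w (c \<odot>\<^bsub>N\<^esub> v) = c \<odot>\<^bsub>N\<^esub> word_act w v"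
  by (induction w) (simp_all add: act_smult_r word_act_closed)

lemma free_act_zero: "free_act N (\<lambda>w. 0) v = \<zero>\<^bsub>N\<^esub>"
  by (simp add: free_act_def)

lemma free_act_superset:
  assumes "finite S" "{w. p w \<noteq> 0} \<subseteq> S" "S \<subseteq> lists (carrier L)" "v \<in> carrier N"
  shows "free_act N p v = finsum N (\<lambda>w. p w \<odot>\<^bsub>N\<^esub> word_act w v) S"
  unfolding free_act_def word_act_def[symmetric]
  by (rule N.M.add.finprod_mono_neutral_cong_left)
    (use assms in \<open>auto simp: word_act_closed subset_iff\<close>)

lemma free_act_add:
  assumes p: "p \<in> carrier L.FA" and q: "q \<in> carrier L.FA" and v: "v \<in> carrier N"
  shows "free_act N (\<lambda>w. p w + q w) v = free_act N p v \<oplus>\<^bsub>N\<^esub> free_act N q v"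
proof -
  let ?S = "{w. p w \<noteq> 0} \<union> {w. q w \<noteq> 0}"
  have S: "finite ?S" "?S \<subseteq> lists (carrier L)" using p q by (auto simp: free_alg_carrier)
  have c: "(\<lambda>w. r w \<odot>\<^bsub>N\<^esub> word_act w v) \<in> ?S \<rightarrow> carrier N" for r
    using S(2) v word_act_closed by blast
  have "free_act N (\<lambda>w. p w + q w) v = finsum N (\<lambda>w. p w \<odot>\<^bsub>N\<^esub> word_act w v \<oplus>\<^bsub>N\<^esub> q w \<odot>\<^bsub>N\<^esub> word_act w v) ?S"
  proof (subst free_act_superset[OF S(1) _ S(2) v])
    show "finsum N (\<lambda>w. (p w + q w) \<odot>\<^bsub>N\<^esub> word_act w v) ?S
      = finsum N (\<lambda>w. p w \<odot>\<^bsub>N\<^esub> word_act w v \<oplus>\<^bsub>N\<^esub> q w \<odot>\<^bsub>N\<^esub> word_act w v) ?S"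
    proof (rule N.M.finsum_cong')
      show "(\<lambda>w. p w \<odot>\<^bsub>N\<^esub> word_act w v \<oplus>\<^bsub>N\<^esub> q w \<odot>\<^bsub>N\<^esub> word_act w v) \<in> ?S \<rightarrow> carrier N"
        using S(2) v word_act_closed by blast
      show "(p w + q w) \<odot>\<^bsub>N\<^esub> word_act w v = p w \<odot>\<^bsub>N\<^esub> word_act w v \<oplus>\<^bsub>N\<^esub> q w \<odot>\<^bsub>N\<^esub> word_act w v"
        if "w \<in> ?S" for w
        using that S(2) v word_act_closed by (intro N.s_add_l) blast
    qed simp
  qed auto
  also have "\<dots> = finsum N (\<lambda>w. p w \<odot>\<^bsub>N\<^esub> word_act w v) ?S \<oplus>\<^bsub>N\<^esub> finsum N (\<lambda>w. q w \<odot>\<^bsub>N\<^esub> word_act w v) ?S"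
    by (rule N.M.finsum_addf) (rule c)+
  also have "\<dots> = free_act N p v \<oplus>\<^bsub>N\<^esub> free_act N q v"
    using free_act_superset[OF S(1) _ S(2) v, of p] free_act_superset[OF S(1) _ S(2) v, of q] by auto
  finally show ?thesis .
qed

lemma free_act_monomial:
  assumes "w \<in> lists (carrier L)" "v \<in> carrier N"
  shows "free_act N (monomial c w) v = c \<odot>\<^bsub>N\<^esub> word_act w v"
proof -
  have "free_act N (monomial c w) v = finsum N (\<lambda>u. monomial c w u \<odot>\<^bsub>N\<^esub> word_act u v) {w}"
    by (rule free_act_superset) (use assms in \<open>auto simp: monomial_def\<close>)
  also have "\<dots> = monomial c w w \<odot>\<^bsub>N\<^esub> word_act w v"
    using N.M.finsum_insert[of "{}" w "\<lambda>u. monomial c w u \<odot>\<^bsub>N\<^esub> word_act u v"] word_act_closed[OF assms] by simp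
  finally show ?thesis by (simp add: monomial_def)
qed

lemma free_act_add_monomial:
  assumes "p \<in> carrier L.FA" "w \<in> lists (carrier L)" "v \<in> carrier N"
  shows "free_act N (\<lambda>u. p u + monomial c w u) v = free_act N p v \<oplus>\<^bsub>N\<^esub> c \<odot>\<^bsub>N\<^esub> word_act w v"
  using free_act_add[OF assms(1) L.mono_closed[OF assms(2)] assms(3)] free_act_monomial[OF assms(2,3)] by simp

lemma free_act_closed: "p \<in> carrier L.FA \<Longrightarrow> v \<in> carrier N \<Longrightarrow> free_act N p v \<in> carrier N"
  by (induction p rule: free_alg_induct)
    (simp_all add: free_act_zero free_act_add_monomial word_act_closed del: in_lists_conv_set)

lemma free_act_ahom: "p \<in> carrier L.FA \<Longrightarrow> free_act N p \<in> ahom N N"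
proof (induction p rule: free_alg_induct)
  case zero
  then show ?case by (rule ahomI) (simp_all add: free_act_zero)
next
  case (add p c w)
  show ?case
    by (rule ahomI) (use add in \<open>simp_all add: free_act_add_monomial free_act_closed word_act_closed
      ahom_add[OF add(4)] ahom_add[OF word_act_ahom] N.s_add_r N.M.a_ac del: in_lists_conv_set\<close>)
qed

lemma free_act_monomial_mult:
  assumes "q \<in> carrier L.FA" "w \<in> lists (carrier L)" "v \<in> carrier N"
  shows "free_act N (monomial c w \<otimes>\<^bsub>L.FA\<^esub> q) v = c \<odot>\<^bsub>N\<^esub> word_act w (free_act N q v)"
  using assms(1)
proof (induction q rule: free_alg_induct)
  case zero
  then show ?case
    using ahom_zero[OF N.M.abelian_group_axioms N.M.abelian_group_axioms word_act_ahom[OF assms(2)]]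
    by (simp add: free_alg_simps free_act_zero)
next
  case (add q d u)
  have "monomial c w \<otimes>\<^bsub>L.FA\<^esub> (\<lambda>x. q x + monomial d u x) = (\<lambda>x. (monomial c w \<otimes>\<^bsub>L.FA\<^esub> q) x + monomial (c * d) (w @ u) x)"
    unfolding monomial_mult[symmetric, where Z = "carrier L"]
    by (simp add: free_alg_simps sum.distrib algebra_simps)
  moreover have "w @ u \<in> lists (carrier L)" using add assms(2) by simp
  ultimately show ?case
    using add assms(2,3)
    by (simp add: free_act_add_monomial free_alg_mult_closed L.mono_closed word_act_append word_act_closed
      ahom_add[OF word_act_ahom] free_act_closed N.s_add_r word_act_smult N.s_assoc
      del: in_lists_conv_set append_in_lists_conv)
qed

lemma free_act_mult:
  assumes "p \<in> carrier L.FA" "q \<in> carrier L.FA" "v \<in> carrier N"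
  shows "free_act N (p \<otimes>\<^bsub>L.FA\<^esub> q) v = free_act N p (free_act N q v)"
  using assms(1)
proof (induction p rule: free_alg_induct)
  case zero
  then show ?case by (simp add: free_alg_simps free_act_zero)
next
  case (add p c w)
  have "(\<lambda>x. p x + monomial c w x) \<otimes>\<^bsub>L.FA\<^esub> q = (\<lambda>x. (p \<otimes>\<^bsub>L.FA\<^esub> q) x + (monomial c w \<otimes>\<^bsub>L.FA\<^esub> q) x)"
    by (simp add: free_alg_simps sum.distrib algebra_simps)
  then show ?case
    using add assms
    by (simp add: free_act_add free_act_add_monomial free_alg_mult_closed L.mono_closed free_act_monomial_mult
      free_act_closed free_act_monomial del: in_lists_conv_set)
qed

lemma free_act_minus:
  assumes "p \<in> carrier L.FA" "q \<in> carrier L.FA" "v \<in> carrier N"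
  shows "free_act N (p \<ominus>\<^bsub>L.FA\<^esub> q) v = free_act N p v \<ominus>\<^bsub>N\<^esub> free_act N q v"
proof -
  interpret FA: ring L.FA by (rule ring_free_alg)
  have "(\<lambda>p. free_act N p v) \<in> ahom L.FA N"
    by (rule ahomI) (use assms(3) in \<open>simp_all add: free_act_closed free_alg_simps free_act_add\<close>)
  then show ?thesis using assms by (intro ahom_minus[OF FA.abelian_group_axioms N.M.abelian_group_axioms])
qed

text \<open>The elements acting as zero on N form a two-sided ideal, and each defining relation lies
  in it by a module axiom.\<close>

lemma free_act_ideal:
  assumes "p \<in> U_ideal L" "v \<in> carrier N"
  shows "free_act N p v = \<zero>\<^bsub>N\<^esub>"
proof -
  interpret FA: ring L.FA by (rule ring_free_alg)
  let ?J = "{p \<in> carrier L.FA. \<forall>v\<in>carrier N. free_act N p v = \<zero>\<^bsub>N\<^esub>}"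
  have "ideal ?J L.FA"
  proof (rule idealI[OF ring_free_alg])
    show "subgroup ?J (add_monoid L.FA)"
    proof (rule FA.add.subgroupI)
      show "?J \<noteq> {}" using FA.zero_closed free_act_zero by (auto simp: free_alg_simps)
      show "\<ominus>\<^bsub>L.FA\<^esub> p \<in> ?J" if "p \<in> ?J" for p
        using that free_act_minus[of "\<zero>\<^bsub>L.FA\<^esub>" p] free_act_zero
        by (auto simp: FA.minus_eq N.M.minus_eq free_alg_simps(3) FA.zero_closed[unfolded free_alg_simps(3)]
            FA.l_zero[unfolded free_alg_simps(3)])
    qed (auto simp: free_alg_simps free_act_add free_alg_add_closed)
  qed (auto simp: free_act_mult free_act_closed free_alg_mult_closed
      ahom_zero[OF N.M.abelian_group_axioms N.M.abelian_group_axioms free_act_ahom])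
  moreover have "U_relations L \<subseteq> ?J"
  proof -
    have z: "x \<ominus>\<^bsub>N\<^esub> x = \<zero>\<^bsub>N\<^esub>" if "x \<in> carrier N" for x
      using that by (simp add: N.M.minus_eq N.M.r_neg)
    have z2: "(x \<oplus>\<^bsub>N\<^esub> y) \<ominus>\<^bsub>N\<^esub> x \<ominus>\<^bsub>N\<^esub> y = \<zero>\<^bsub>N\<^esub>" if "x \<in> carrier N" "y \<in> carrier N" for x y
      using that by (metis N.M.a_comm N.M.add.inv_solve_right' N.M.minus_closed N.M.minus_eq z N.M.add.m_closed)
    have z3: "x \<ominus>\<^bsub>N\<^esub> s \<odot>\<^bsub>N\<^esub> y \<ominus>\<^bsub>N\<^esub> (x \<oplus>\<^bsub>N\<^esub> (- s) \<odot>\<^bsub>N\<^esub> y) = \<zero>\<^bsub>N\<^esub>" if "x \<in> carrier N" "y \<in> carrier N" for x y s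
      using that z by (simp add: N.M.minus_eq N.s_neg)
    have "p \<in> ?J" if p: "p \<in> U_relations L" for p
    proof -
      have "free_act N p v = \<zero>\<^bsub>N\<^esub>" if "v \<in> carrier N" for v
        using p that unfolding U_relations_def Let_def
        by (auto simp: free_act_minus free_act_monomial L.mono_closed FA.minus_closed L.smult_closed L.br_closed
          L.par_carrier act_closed act_add_l act_smult_l act_br z z2 z3)
      then show ?thesis using p L.relations_closed by auto
    qed
    then show ?thesis by auto
  qed
  ultimately have "U_ideal L \<subseteq> ?J" unfolding U_ideal_def by (rule FA.genideal_minimal)
  then show ?thesis using assms by auto
qed

text \<open>The representative picked by \<open>U_act\<close> differs from p by an element of the
  ideal, which acts as zero.\<close>

lemma U_act_class:
  assumes p: "p \<in> carrier L.FA" and v: "v \<in> carrier N"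
  shows "U_act N (U_class L p) v = free_act N p v"
proof -
  interpret FA: ring L.FA by (rule ring_free_alg)
  interpret I: ideal "U_ideal L" L.FA by (rule L.U_ideal)
  have "p \<in> U_class L p" unfolding U_class_def by (rule I.a_rcos_self[OF p])
  then have "(SOME q. q \<in> U_class L p) \<in> U_class L p" by (rule someI[where P = "\<lambda>q. q \<in> U_class L p"])
  then obtain k where k: "k \<in> U_ideal L" "(SOME q. q \<in> U_class L p) = k \<oplus>\<^bsub>L.FA\<^esub> p"
    by (auto simp: U_class_def a_r_coset_def r_coset_def)
  show ?thesis
    unfolding U_act_def k(2) using p v k(1) I.Icarr[OF k(1)] free_act_closed[OF p v]
    by (simp add: free_alg_simps free_act_add free_act_ideal)
qed

lemma U_act_closed: "u \<in> carrier L.UL \<Longrightarrow> v \<in> carrier N \<Longrightarrow> U_act N u v \<in> carrier N"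
  using L.U_class_surj by (auto simp: U_act_class free_act_closed dest!: L.U_class_surj)

lemma U_act_add_r: "u \<in> carrier L.UL \<Longrightarrow> v \<in> carrier N \<Longrightarrow> w \<in> carrier N \<Longrightarrow>
    U_act N u (v \<oplus>\<^bsub>N\<^esub> w) = U_act N u v \<oplus>\<^bsub>N\<^esub> U_act N u w"
  by (auto simp: U_act_class ahom_add[OF free_act_ahom] dest!: L.U_class_surj)

lemma U_act_add_l: "u \<in> carrier L.UL \<Longrightarrow> u' \<in> carrier L.UL \<Longrightarrow> v \<in> carrier N \<Longrightarrow>
    U_act N (u \<oplus>\<^bsub>L.UL\<^esub> u') v = U_act N u v \<oplus>\<^bsub>N\<^esub> U_act N u' v"
  by (auto simp: U_act_class L.U_class_add[symmetric] free_alg_add_closed free_act_add dest!: L.U_class_surj)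

lemma U_act_mult: "u \<in> carrier L.UL \<Longrightarrow> u' \<in> carrier L.UL \<Longrightarrow> v \<in> carrier N \<Longrightarrow>
    U_act N (u \<otimes>\<^bsub>L.UL\<^esub> u') v = U_act N u (U_act N u' v)"
  by (auto simp: U_act_class L.U_class_mult[symmetric] free_alg_mult_closed free_act_mult free_act_closed
      dest!: L.U_class_surj)

lemma U_act_mono: "w \<in> lists (carrier L) \<Longrightarrow> v \<in> carrier N \<Longrightarrow> U_act N (U_class L (monomial c w)) v = c \<odot>\<^bsub>N\<^esub> word_act w v"
  by (simp add: U_act_class L.mono_closed free_act_monomial del: in_lists_conv_set)

lemma U_act_const: "v \<in> carrier N \<Longrightarrow> U_act N (L.Uc c) v = c \<odot>\<^bsub>N\<^esub> v"
  by (simp add: U_act_mono)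

lemma U_act_one: "v \<in> carrier N \<Longrightarrow> U_act N \<one>\<^bsub>L.UL\<^esub> v = v"
  using U_act_const[of v 1] by (simp add: L.Uc_one)

lemma U_act_gen: "x \<in> carrier L \<Longrightarrow> v \<in> carrier N \<Longrightarrow> U_act N (U_gen L x) v = act N x v"
  by (simp add: U_gen_def U_act_mono act_closed)

lemma U_act_gen_pow: "x \<in> carrier L \<Longrightarrow> v \<in> carrier N \<Longrightarrow>
    U_act N (U_gen L x [^]\<^bsub>L.UL\<^esub> (n::nat)) v = (act N x ^^ n) v"
  by (induction n arbitrary: v)
    (simp_all add: U_act_one U_act_mult U_act_gen act_closed funpow_Suc_right del: funpow.simps(2))

end

lemma gmod_hom_ahom: "\<phi> \<in> gmod_hom gr L M N \<Longrightarrow> \<phi> \<in> ahom M N"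
  by (rule ahomI) (auto simp: gmod_hom_def)

lemma gmod_hom_word_act:
  assumes "gmodule L M" "gmodule L N" and \<phi>: "\<phi> \<in> gmod_hom gr L M N" and w: "w \<in> lists (carrier L)" and v: "v \<in> carrier M"
  shows "\<phi> (gmodule.word_act M w v) = gmodule.word_act N w (\<phi> v)"
proof -
  interpret M: gmodule L M by fact
  interpret N: gmodule L N by fact
  show ?thesis using w
    by (induction w) (use \<phi> v M.word_act_closed in \<open>auto simp: gmod_hom_def\<close>)
qed

lemma gmod_hom_U_act:
  assumes "gmodule L M" "gmodule L N" and \<phi>: "\<phi> \<in> gmod_hom gr L M N" and u: "u \<in> carrier (U_alg L)" and v: "v \<in> carrier M"
  shows "\<phi> (U_act M u v) = U_act N u (\<phi> v)"
proof -
  interpret M: gmodule L M by fact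
  interpret N: gmodule L N by fact
  have hom: "\<phi> \<in> ahom M N" by (rule gmod_hom_ahom[OF \<phi>])
  note pv = ahom_closed[OF hom v]
  show ?thesis using u
  proof (induction u rule: M.L.U_induct)
    case zero
    have "U_act M \<zero>\<^bsub>U_alg L\<^esub> v = \<zero>\<^bsub>M\<^esub>" "U_act N \<zero>\<^bsub>U_alg L\<^esub> (\<phi> v) = \<zero>\<^bsub>N\<^esub>"
      using M.U_act_add_l[of "\<zero>\<^bsub>U_alg L\<^esub>" "\<zero>\<^bsub>U_alg L\<^esub>" v] N.U_act_add_l[of "\<zero>\<^bsub>U_alg L\<^esub>" "\<zero>\<^bsub>U_alg L\<^esub>" "\<phi> v"] v pv
        M.U_act_closed[of "\<zero>\<^bsub>U_alg L\<^esub>" v] N.U_act_closed[of "\<zero>\<^bsub>U_alg L\<^esub>" "\<phi> v"]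
      by simp_all
    then show ?case
      using ahom_zero[OF M.N.M.abelian_group_axioms N.N.M.abelian_group_axioms hom] by simp
  next
    case (add u c w)
    have "\<phi> (c \<odot>\<^bsub>M\<^esub> M.word_act w v) = c \<odot>\<^bsub>N\<^esub> N.word_act w (\<phi> v)"
      using \<phi> M.word_act_closed[OF add(2) v] gmod_hom_word_act[OF assms(1-3) add(2) v]
      by (auto simp: gmod_hom_def)
    then show ?case
      using add v pv M.word_act_closed[OF add(2) v]
      by (simp add: M.U_act_add_l N.U_act_add_l M.L.mono_closed M.U_act_mono N.U_act_mono
        ahom_add[OF hom] M.U_act_closed del: in_lists_conv_set)
  qed
qed

subsection \<open>Tensor products of bimodules\<close>

lemma with_smult_simps [simp]:
  "carrier (with_smult A s) = carrier A" "add (with_smult A s) = add A" "\<zero>\<^bsub>with_smult A s\<^esub> = \<zero>\<^bsub>A\<^esub>"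
  "module.smult (with_smult A s) = s"
  by (simp_all add: with_smult_def)

lemma abelian_group_cong:
  assumes "abelian_group A" "carrier B = carrier A" "add B = add A" "\<zero>\<^bsub>B\<^esub> = \<zero>\<^bsub>A\<^esub>"
  shows "abelian_group B"
proof -
  interpret A: abelian_group A by fact
  show ?thesis
  proof (rule abelian_groupI)
    show "\<exists>y\<in>carrier B. y \<oplus>\<^bsub>B\<^esub> x = \<zero>\<^bsub>B\<^esub>" if "x \<in> carrier B" for x
      using that A.l_neg[of x] A.a_inv_closed[of x] assms(2-4) by metis
  qed (simp_all add: assms(2-4) A.a_ac)
qed

lemma abelian_group_with_smult: "abelian_group A \<Longrightarrow> abelian_group (with_smult A s)"
  by (rule abelian_group_cong) simp_all

text \<open>The common shape of both tensor products: Q is a left module by multiplication and a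
  right module through g. For the inner product g is the canonical map of the enveloping algebra to
  its localization, for the outer one it is \<open>phi L f a\<close>.\<close>

locale bimodule_tensor = Q: ring Q for Q :: "('q, 'y) ring_scheme" +
  fixes R :: "('r, 'x) ring_scheme" and g :: "'r \<Rightarrow> 'q" and N :: "('r, 'n) module"
  assumes g_closed: "\<And>r. r \<in> carrier R \<Longrightarrow> g r \<in> carrier Q"
    and N_group: "abelian_group N"
    and N_smult: "\<And>r m. r \<in> carrier R \<Longrightarrow> m \<in> carrier N \<Longrightarrow> module.smult N r m \<in> carrier N"
begin

abbreviation "M \<equiv> with_smult Q (\<lambda>r m. m \<otimes>\<^bsub>Q\<^esub> g r)"

sublocale N: abelian_group N by (rule N_group)

sublocale tensor_product R M N
  by unfold_locales (simp_all add: g_closed N_smult)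

definition lmul :: "'q \<Rightarrow> ('q, 'n) tens \<Rightarrow> ('q, 'n) tens" where
  "lmul u = tensor_map R M N (\<lambda>w. u \<otimes>\<^bsub>Q\<^esub> w) (\<lambda>v. v)"

sublocale T: abelian_group "tensor R M N" by (rule abelian_group_T)

lemma lmul:
  assumes u: "u \<in> carrier Q"
  shows lmul_ahom: "lmul u \<in> ahom T T"
    and lmul_pt: "\<And>m n. m \<in> carrier Q \<Longrightarrow> n \<in> carrier N \<Longrightarrow> lmul u (pt m n) = pt (u \<otimes>\<^bsub>Q\<^esub> m) n"
proof -
  have \<alpha>: "(\<lambda>w. u \<otimes>\<^bsub>Q\<^esub> w) \<in> ahom M M" "(\<lambda>v. v) \<in> ahom N N"
    using u by (auto intro!: ahomI simp: Q.r_distr)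
  have bal: "pt (u \<otimes>\<^bsub>Q\<^esub> module.smult M r m) n = pt (u \<otimes>\<^bsub>Q\<^esub> m) (module.smult N r n)"
    if "m \<in> carrier M" "r \<in> carrier R" "n \<in> carrier N" for m r n
    using pt_balanced[of "u \<otimes>\<^bsub>Q\<^esub> m" r n] that u g_closed by (simp add: Q.m_assoc)
  show "lmul u \<in> ahom T T"
    unfolding lmul_def by (rule tensor_map(1)[OF tensor_product_axioms \<alpha> bal])
  show "lmul u (pt m n) = pt (u \<otimes>\<^bsub>Q\<^esub> m) n" if "m \<in> carrier Q" "n \<in> carrier N" for m n
    unfolding lmul_def using that by (intro tensor_map(2)[OF tensor_product_axioms \<alpha> bal]) simp_all
qed

lemma lmul_closed: "u \<in> carrier Q \<Longrightarrow> z \<in> carrier T \<Longrightarrow> lmul u z \<in> carrier T"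
  by (rule ahom_closed[OF lmul_ahom])

lemma lmul_add:
  assumes "u \<in> carrier Q" "u' \<in> carrier Q" "z \<in> carrier T"
  shows "lmul (u \<oplus>\<^bsub>Q\<^esub> u') z = lmul u z \<oplus>\<^bsub>T\<^esub> lmul u' z"
proof (rule ahom_eq_on_pure[OF abelian_group_T _ _ _ assms(3)])
  show "lmul (u \<oplus>\<^bsub>Q\<^esub> u') \<in> ahom T T" using assms by (simp add: lmul_ahom)
  show "(\<lambda>z. lmul u z \<oplus>\<^bsub>T\<^esub> lmul u' z) \<in> ahom T T"
    using assms by (intro ahomI) (simp_all add: lmul_closed ahom_add[OF lmul_ahom] T.a_ac)
  show "lmul (u \<oplus>\<^bsub>Q\<^esub> u') (pt m n) = lmul u (pt m n) \<oplus>\<^bsub>T\<^esub> lmul u' (pt m n)" if "m \<in> carrier M" "n \<in> carrier N" for m n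
    using that assms pt_add_left[of "u \<otimes>\<^bsub>Q\<^esub> m" "u' \<otimes>\<^bsub>Q\<^esub> m" n] by (simp add: lmul_pt Q.l_distr)
qed

lemma lmul_mult:
  assumes "u \<in> carrier Q" "u' \<in> carrier Q" "z \<in> carrier T"
  shows "lmul (u \<otimes>\<^bsub>Q\<^esub> u') z = lmul u (lmul u' z)"
proof (rule ahom_eq_on_pure[OF abelian_group_T _ _ _ assms(3)])
  show "lmul (u \<otimes>\<^bsub>Q\<^esub> u') \<in> ahom T T" using assms by (simp add: lmul_ahom)
  show "(\<lambda>z. lmul u (lmul u' z)) \<in> ahom T T"
    using assms by (intro ahom_comp[OF lmul_ahom lmul_ahom])
  show "lmul (u \<otimes>\<^bsub>Q\<^esub> u') (pt m n) = lmul u (lmul u' (pt m n))" if "m \<in> carrier M" "n \<in> carrier N" for m n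
    using that assms by (simp add: lmul_pt Q.m_assoc)
qed

lemma lmul_one:
  assumes "z \<in> carrier T"
  shows "lmul \<one>\<^bsub>Q\<^esub> z = z"
proof (rule ahom_eq_on_pure[OF abelian_group_T _ _ _ assms])
  show "lmul \<one>\<^bsub>Q\<^esub> \<in> ahom T T" by (simp add: lmul_ahom)
  show "(\<lambda>z. z) \<in> ahom T T" by (rule ahomI) simp_all
qed (simp add: lmul_pt)

lemma pt_zero_right: "m \<in> carrier Q \<Longrightarrow> pt m \<zero>\<^bsub>N\<^esub> = \<zero>\<^bsub>T\<^esub>"
  by (rule ahom_zero[OF N_group abelian_group_T])
    (auto intro!: ahomI simp: pt_closed pt_add_right)

lemma pt_minus_right:
  "m \<in> carrier Q \<Longrightarrow> v \<in> carrier N \<Longrightarrow> w \<in> carrier N \<Longrightarrow> pt m (v \<ominus>\<^bsub>N\<^esub> w) = pt m v \<ominus>\<^bsub>T\<^esub> pt m w"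
  by (rule ahom_minus[OF N_group abelian_group_T])
    (auto intro!: ahomI simp: pt_closed pt_add_right)

end

subsection \<open>The ring of fractions of the enveloping algebra\<close>

locale f_lie_superalgebra = lie_superalgebra L for L :: "'g lsa" +
  fixes f :: 'g
  assumes f_even: "f \<in> par L 0"
    and f_nil: "\<And>x. x \<in> carrier L \<Longrightarrow> \<exists>k. (br L f ^^ k) x = \<zero>\<^bsub>L\<^esub>"
begin

abbreviation "Uf \<equiv> Uf_alg L f"
abbreviation "fU \<equiv> U_gen L f"
abbreviation "fr \<equiv> left_frac UL fU"
abbreviation "uf \<equiv> Uf_of L f"

lemma f_closed [simp]: "f \<in> carrier L"
  using f_even par_carrier by auto

sublocale O: ore_localization UL fU
  by (rule UL.ore_of_comm_nil) (simp_all add: U_comm_nil[OF f_even f_nil])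

sublocale Q: ring Uf unfolding Uf_alg_def by (rule O.ring_Q)

lemma of_closed [simp]: "u \<in> carrier UL \<Longrightarrow> uf u \<in> carrier Uf"
  unfolding Uf_of_def Uf_alg_def by (rule O.fr_closed_Q)

lemma fr_closed [simp]: "u \<in> carrier UL \<Longrightarrow> fr n u \<in> carrier Uf"
  unfolding Uf_alg_def by (rule O.fr_closed_Q)

lemma of_hom: "uf \<in> ring_hom UL Uf"
  unfolding Uf_of_def[abs_def] Uf_alg_def by (rule O.of_hom)

lemma of_add: "u \<in> carrier UL \<Longrightarrow> u' \<in> carrier UL \<Longrightarrow> uf (u \<oplus>\<^bsub>UL\<^esub> u') = uf u \<oplus>\<^bsub>Uf\<^esub> uf u'"
  by (rule ring_hom_add[OF of_hom])

lemma of_mult: "u \<in> carrier UL \<Longrightarrow> u' \<in> carrier UL \<Longrightarrow> uf (u \<otimes>\<^bsub>UL\<^esub> u') = uf u \<otimes>\<^bsub>Uf\<^esub> uf u'"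
  by (rule ring_hom_mult[OF of_hom])

lemma of_one: "uf \<one>\<^bsub>UL\<^esub> = \<one>\<^bsub>Uf\<^esub>"
  by (rule ring_hom_one[OF of_hom])

lemma of_ahom: "uf \<in> ahom UL Uf"
  using of_hom by (auto simp: ring_hom_def ahom_def)

lemma of_zero: "uf \<zero>\<^bsub>UL\<^esub> = \<zero>\<^bsub>Uf\<^esub>"
  by (rule ahom_zero[OF UL.abelian_group_axioms Q.abelian_group_axioms of_ahom])

lemma of_minus: "u \<in> carrier UL \<Longrightarrow> u' \<in> carrier UL \<Longrightarrow> uf (u \<ominus>\<^bsub>UL\<^esub> u') = uf u \<ominus>\<^bsub>Uf\<^esub> uf u'"
  by (rule ahom_minus[OF UL.abelian_group_axioms Q.abelian_group_axioms of_ahom])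

abbreviation "FF \<equiv> Uf_gen L f f"
abbreviation "FI \<equiv> inv\<^bsub>Uf\<^esub> FF"

lemma FF_unit: "FF \<in> Units Uf"
  unfolding Uf_gen_def Uf_of_def Uf_alg_def by (rule O.f_unit)

lemma FI_closed [simp]: "FF \<in> carrier Uf" "FI \<in> carrier Uf"
  using FF_unit by (simp_all add: Q.Units_closed)

lemma fr_eq: "u \<in> carrier UL \<Longrightarrow> fr n u = FI [^]\<^bsub>Uf\<^esub> n \<otimes>\<^bsub>Uf\<^esub> uf u"
  unfolding Uf_gen_def Uf_of_def Uf_alg_def by (rule O.fr_eq_inv_mult)

lemma Uf_carrier: "w \<in> carrier Uf \<longleftrightarrow> (\<exists>n u. u \<in> carrier UL \<and> w = fr n u)"
  by (auto simp: Uf_alg_def localization_def)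

lemma const_def': "Uf_const L f c = uf (Uc c)"
  by (simp add: Uf_const_def)

lemma const_closed [simp]: "Uf_const L f c \<in> carrier Uf"
  by (simp add: const_def')

lemma FI_comm:
  assumes x: "x \<in> carrier Uf" and c: "x \<otimes>\<^bsub>Uf\<^esub> FF = FF \<otimes>\<^bsub>Uf\<^esub> x"
  shows "x \<otimes>\<^bsub>Uf\<^esub> FI [^]\<^bsub>Uf\<^esub> (n::nat) = FI [^]\<^bsub>Uf\<^esub> n \<otimes>\<^bsub>Uf\<^esub> x"
proof -
  have "x \<otimes>\<^bsub>Uf\<^esub> FI = FI \<otimes>\<^bsub>Uf\<^esub> (FF \<otimes>\<^bsub>Uf\<^esub> x) \<otimes>\<^bsub>Uf\<^esub> FI"
    using x FF_unit by (simp add: Q.m_assoc[symmetric])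
  also have "\<dots> = FI \<otimes>\<^bsub>Uf\<^esub> x"
    using x FF_unit by (simp add: c[symmetric] Q.m_assoc)
  finally have 1: "x \<otimes>\<^bsub>Uf\<^esub> FI = FI \<otimes>\<^bsub>Uf\<^esub> x" .
  show ?thesis
  proof (induction n)
    case (Suc n)
    have "x \<otimes>\<^bsub>Uf\<^esub> FI [^]\<^bsub>Uf\<^esub> Suc n = (x \<otimes>\<^bsub>Uf\<^esub> FI [^]\<^bsub>Uf\<^esub> n) \<otimes>\<^bsub>Uf\<^esub> FI"
      using x by (simp add: Q.m_assoc)
    also have "\<dots> = FI [^]\<^bsub>Uf\<^esub> n \<otimes>\<^bsub>Uf\<^esub> (x \<otimes>\<^bsub>Uf\<^esub> FI)"
      using x Suc by (simp add: Q.m_assoc)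
    finally show ?case using x by (simp add: 1 Q.m_assoc)
  qed (use x in simp)
qed

lemma const_central: "x \<in> carrier Uf \<Longrightarrow> x \<otimes>\<^bsub>Uf\<^esub> Uf_const L f c = Uf_const L f c \<otimes>\<^bsub>Uf\<^esub> x"
proof -
  assume "x \<in> carrier Uf"
  then obtain n u where u: "u \<in> carrier UL" "x = fr n u" by (auto simp: Uf_carrier)
  have 1: "uf u \<otimes>\<^bsub>Uf\<^esub> uf (Uc c) = uf (Uc c) \<otimes>\<^bsub>Uf\<^esub> uf u" if "u \<in> carrier UL" for u
    using that Uc_central[of u c] of_mult[of u "Uc c"] of_mult[of "Uc c" u] by simp
  have "uf (Uc c) \<otimes>\<^bsub>Uf\<^esub> FI [^]\<^bsub>Uf\<^esub> n = FI [^]\<^bsub>Uf\<^esub> n \<otimes>\<^bsub>Uf\<^esub> uf (Uc c)"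
    by (rule FI_comm) (simp_all add: Uf_gen_def 1)
  then show ?thesis
    using u(1) 1[OF u(1)] unfolding u(2) fr_eq[OF u(1)] const_def'
    by (simp add: Q.m_assoc) (simp add: Q.m_assoc[symmetric])
qed

text \<open>ad f kills f^(-n), hence acts on numerators alone; its local nilpotency thus passes to
  the localization.\<close>

lemma comm_fr:
  assumes u: "u \<in> carrier UL"
  shows "(Q.comm FF ^^ k) (fr n u) = fr n ((UL.comm fU ^^ k) u)"
proof (induction k)
  case (Suc k)
  have c: "(UL.comm fU ^^ k) u \<in> carrier UL" by (rule UL.comm_pow_closed) (simp_all add: u)
  have 1: "Q.comm FF (uf v) = uf (UL.comm fU v)" if "v \<in> carrier UL" for v
    using that by (simp add: Q.comm_def UL.comm_def Uf_gen_def of_minus of_mult)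
  have z: "Q.comm FF (FI [^]\<^bsub>Uf\<^esub> n) = \<zero>\<^bsub>Uf\<^esub>"
    using FI_comm[of FF n] by (simp add: Q.comm_def Q.minus_eq Q.r_neg)
  have "Q.comm FF (fr n v) = fr n (UL.comm fU v)" if "v \<in> carrier UL" for v
    using that by (simp add: fr_eq Q.comm_mult z 1)
  then show ?case using Suc c by simp
qed simp

sublocale P: complex_power Uf "Uf_const L f" FF
proof unfold_locales
  show "Uf_const L f (c + d) = Uf_const L f c \<oplus>\<^bsub>Uf\<^esub> Uf_const L f d" for c d
    by (simp add: const_def' Uc_add of_add)
  show "Uf_const L f (c * d) = Uf_const L f c \<otimes>\<^bsub>Uf\<^esub> Uf_const L f d" for c d
    by (simp add: const_def' Uc_mult of_mult)
  show "Uf_const L f 1 = \<one>\<^bsub>Uf\<^esub>"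
    by (simp add: const_def' Uc_one of_one)
  show "\<exists>n. ((\<lambda>u. FF \<otimes>\<^bsub>Uf\<^esub> u \<ominus>\<^bsub>Uf\<^esub> u \<otimes>\<^bsub>Uf\<^esub> FF) ^^ n) x = \<zero>\<^bsub>Uf\<^esub>" if x: "x \<in> carrier Uf" for x
  proof -
    obtain n u where u: "u \<in> carrier UL" "x = fr n u" using x by (auto simp: Uf_carrier)
    obtain k where "(UL.comm fU ^^ k) u = \<zero>\<^bsub>UL\<^esub>"
      using U_comm_nil[OF f_even f_nil u(1)] by (auto simp: UL.comm_nil_def)
    then have "(Q.comm FF ^^ k) x = \<zero>\<^bsub>Uf\<^esub>"
      using comm_fr[OF u(1), of k n] by (simp add: u fr_eq of_zero)
    then show ?thesis unfolding Q.comm_def[abs_def] by blast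
  qed
qed (simp_all add: const_central FF_unit)

text \<open>Once (ad f)^i u vanishes, all further iterates do, so the index set of the sum is the
  initial segment below \<open>P.deg u\<close> and the sum is the series
  \<open>P.Phi\<close>.\<close>

lemma phi_eq: "u \<in> carrier Uf \<Longrightarrow> phi L f a u = P.Phi a u"
proof -
  assume u: "u \<in> carrier Uf"
  have ad: "ad_f L f = P.ad" by (simp add: ad_f_def[abs_def] Let_def)
  have set: "{i. (P.ad ^^ i) u \<noteq> \<zero>\<^bsub>Uf\<^esub>} = {..<P.deg u}"
    using P.ad_deg[OF u] P.deg_le[of _ u] by (auto simp: not_le[symmetric] dest: not_le_imp_less)
  have "P.Phi a u = finsum Uf (\<lambda>i. Uf_const L f (a gchoose i) \<otimes>\<^bsub>Uf\<^esub> ((P.ad ^^ i) u \<otimes>\<^bsub>Uf\<^esub> FI [^]\<^bsub>Uf\<^esub> i)) {..<P.deg u}"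
    unfolding P.Phi_def by (rule Q.nsum_eq_finsum) (simp add: u)
  also have "\<dots> = phi L f a u"
    unfolding phi_def Let_def ad set
    by (rule Q.finsum_cong') (use u in \<open>auto simp: Q.m_assoc\<close>)
  finally show ?thesis by simp
qed

end

subsection \<open>Twisted localization\<close>

locale twisted_localization = f_lie_superalgebra L f + gmodule L N
  for L :: "'g lsa" and f :: 'g and N :: "('g, 'v) gmod" +
  fixes a :: complex
begin

lemma U_module_group: "abelian_group (U_module N)"
  unfolding U_module_def by (rule abelian_group_with_smult) (rule N.M.abelian_group_axioms)

lemma U_module_simps [simp]:
  "carrier (U_module N) = carrier N" "add (U_module N) = add N" "\<zero>\<^bsub>U_module N\<^esub> = \<zero>\<^bsub>N\<^esub>"
  "module.smult (U_module N) = U_act N"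
  by (simp_all add: U_module_def)

sublocale B1: bimodule_tensor Uf UL "uf" "U_module N"
  by (intro bimodule_tensor.intro bimodule_tensor_axioms.intro Q.ring_axioms U_module_group)
    (simp_all add: U_act_closed)

lemma Uf_over_U_eq: "Uf_over_U L f = B1.M"
  by (simp add: Uf_over_U_def)

lemma loc_mod_eq: "loc_mod L f N = with_smult B1.T B1.lmul"
  by (simp add: loc_mod_def Uf_over_U_eq B1.lmul_def[abs_def])

lemma loc_mod_simps [simp]:
  "carrier (loc_mod L f N) = carrier B1.T" "add (loc_mod L f N) = add B1.T" "\<zero>\<^bsub>loc_mod L f N\<^esub> = \<zero>\<^bsub>B1.T\<^esub>"
  "module.smult (loc_mod L f N) = B1.lmul"
  by (simp_all add: loc_mod_eq)

sublocale B2: bimodule_tensor Uf Uf "phi L f a" "loc_mod L f N"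
  by (intro bimodule_tensor.intro bimodule_tensor_axioms.intro Q.ring_axioms)
    (simp_all add: phi_eq B1.lmul_closed abelian_group_with_smult B1.abelian_group_T loc_mod_eq)

lemma Ufa_eq: "Ufa L f a = B2.M"
  by (simp add: Ufa_def)

abbreviation "fN \<equiv> act N f"

sublocale E: group_endo N fN
  by (intro group_endo.intro group_endo_axioms.intro N.M.abelian_group_axioms act_ahom) simp

definition tau :: "nat \<Rightarrow> 'v \<Rightarrow> ('g Uf, 'v) tens" where
  "tau n v = B1.pt (fr n \<one>\<^bsub>UL\<^esub>) v"

lemma tau_closed [simp]: "v \<in> carrier N \<Longrightarrow> tau n v \<in> carrier B1.T"
  by (simp add: tau_def B1.pt_closed)

lemma fr_one_mult: "u \<in> carrier UL \<Longrightarrow> fr n \<one>\<^bsub>UL\<^esub> \<otimes>\<^bsub>Uf\<^esub> uf u = fr n u"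
  by (simp add: fr_eq of_one)

lemma pt_fr: "u \<in> carrier UL \<Longrightarrow> v \<in> carrier N \<Longrightarrow> B1.pt (fr n u) v = tau n (U_act N u v)"
  unfolding tau_def using B1.pt_balanced[of "fr n \<one>\<^bsub>UL\<^esub>" u v] by (simp add: fr_one_mult)

lemma tau_shift:
  assumes v: "v \<in> carrier N"
  shows "tau (n + k) ((fN ^^ k) v) = tau n v"
proof -
  have "fr n \<one>\<^bsub>UL\<^esub> = fr (n + k) (fU [^]\<^bsub>UL\<^esub> k)"
    using O.E.fr_shift[of n k "\<one>\<^bsub>UL\<^esub>"] by (simp add: O.fr_eq O.funpow_f)
  then show ?thesis
    using v pt_fr[of "fU [^]\<^bsub>UL\<^esub> k" v "n + k"] by (simp add: tau_def U_act_gen_pow)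
qed

lemma tau_add: "v \<in> carrier N \<Longrightarrow> w \<in> carrier N \<Longrightarrow> tau n (v \<oplus>\<^bsub>N\<^esub> w) = tau n v \<oplus>\<^bsub>B1.T\<^esub> tau n w"
  unfolding tau_def using B1.pt_add_right[of "fr n \<one>\<^bsub>UL\<^esub>" v w] by simp

lemma tau_minus:
  "v \<in> carrier N \<Longrightarrow> w \<in> carrier N \<Longrightarrow> tau n (v \<ominus>\<^bsub>N\<^esub> w) = tau n v \<ominus>\<^bsub>B1.T\<^esub> tau n w"
  by (rule ahom_minus[OF N.M.abelian_group_axioms B1.abelian_group_T]) (auto intro!: ahomI simp: tau_add)

lemma tau_zero: "tau n \<zero>\<^bsub>N\<^esub> = \<zero>\<^bsub>B1.T\<^esub>"
  by (rule ahom_zero[OF N.M.abelian_group_axioms B1.abelian_group_T]) (auto intro!: ahomI simp: tau_add)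

text \<open>The second factor absorbs numerators, f^(-n) r \<otimes> v = f^(-n) \<otimes> r v, and
  differences are brought to a common denominator.\<close>

lemma tau_surj: "z \<in> carrier B1.T \<Longrightarrow> \<exists>n v. v \<in> carrier N \<and> z = tau n v"
proof (induction z rule: B1.tensor_induct)
  case zero
  then show ?case using tau_zero[of 0] by (metis N.M.zero_closed)
next
  case (pure m v)
  then obtain n u where "u \<in> carrier UL" "m = fr n u" by (auto simp: Uf_carrier)
  then show ?case using pure pt_fr[of u v n] U_act_closed[of u v] by auto
next
  case (diff x y)
  then obtain n v m w where 1: "v \<in> carrier N" "w \<in> carrier N" "x = tau n v" "y = tau m w" by auto
  then have "x = tau (n + m) ((fN ^^ m) v)" "y = tau (n + m) ((fN ^^ n) w)"
    using tau_shift[of v n m] tau_shift[of w m n] by (simp_all add: add.commute)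
  then have "x \<ominus>\<^bsub>B1.T\<^esub> y = tau (n + m) ((fN ^^ m) v \<ominus>\<^bsub>N\<^esub> (fN ^^ n) w)"
    using 1 by (simp add: tau_minus)
  then show ?case using 1 by (metis E.pow_closed N.M.minus_closed)
qed

text \<open>The harder half maps f^(-n) r \<otimes> v to the fraction f^(-n) (r v) in
  \<open>E.Fr\<close>; balance is associativity of the action, and vanishing in \<open>E.Fr\<close>
  is explicit.\<close>

lemma tau_zero_iff:
  assumes v: "v \<in> carrier N"
  shows "tau n v = \<zero>\<^bsub>B1.T\<^esub> \<longleftrightarrow> (\<exists>k. (fN ^^ k) v = \<zero>\<^bsub>N\<^esub>)"
proof
  assume "\<exists>k. (fN ^^ k) v = \<zero>\<^bsub>N\<^esub>"
  then show "tau n v = \<zero>\<^bsub>B1.T\<^esub>" using tau_shift[OF v, of n] tau_zero by metis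
next
  assume z: "tau n v = \<zero>\<^bsub>B1.T\<^esub>"
  \<comment> \<open>For fixed v this respects the passage from f^(-m) r to f^(-m-1) f r, so it lifts
    to the localization as \<open>b\<close>.\<close>
  define g where "g v = (\<lambda>m r. E.fr m (U_act N r v))" for v
  have g: "g v (Suc m) (fU \<otimes>\<^bsub>UL\<^esub> r) = g v m r" if "r \<in> carrier UL" "v \<in> carrier N" for m r v
    using E.fr_shift[of m 1 "U_act N r v"] that by (simp add: g_def U_act_mult U_act_gen U_act_closed)
  have gh: "g v m \<in> ahom UL E.Fr" if "v \<in> carrier N" for v m
    unfolding g_def using that by (intro ahomI) (simp_all add: U_act_closed U_act_add_l E.fr_add_same)
  define b where "b w v = O.E.lift (g v) w" for w v
  have b: "b (fr m r) v = E.fr m (U_act N r v)" if "r \<in> carrier UL" "v \<in> carrier N" for m r v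
    unfolding b_def O.fr_eq[OF that(1)] using that by (subst O.E.lift_fr) (simp_all add: g, simp add: g_def)
  have bh: "(\<lambda>w. b w v) \<in> ahom O.E.Fr E.Fr" if "v \<in> carrier N" for v
    unfolding b_def using that by (intro O.E.lift_ahom gh g)
  have cF: "carrier Uf = carrier O.E.Fr" unfolding Uf_alg_def by (rule O.Q_carrier)
  have aF: "x \<oplus>\<^bsub>Uf\<^esub> y = x \<oplus>\<^bsub>O.E.Fr\<^esub> y" if "x \<in> carrier O.E.Fr" "y \<in> carrier O.E.Fr" for x y
    unfolding Uf_alg_def by (rule O.Q_add[OF that])
  obtain \<epsilon> where \<epsilon>: "\<epsilon> \<in> ahom B1.T E.Fr"
    "\<And>m n. m \<in> carrier B1.M \<Longrightarrow> n \<in> carrier (U_module N) \<Longrightarrow> \<epsilon> (B1.pt m n) = b m n"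
  proof (rule B1.tensor_lift[OF E.abelian_group_X])
    fix m v assume "m \<in> carrier B1.M" "v \<in> carrier (U_module N)"
    then show "b m v \<in> carrier E.Fr" using ahom_closed[OF bh] by (simp add: cF)
  next
    fix m m' v assume "m \<in> carrier B1.M" "m' \<in> carrier B1.M" "v \<in> carrier (U_module N)"
    then show "b (m \<oplus>\<^bsub>B1.M\<^esub> m') v = b m v \<oplus>\<^bsub>E.Fr\<^esub> b m' v"
      using ahom_add[OF bh] by (simp add: cF aF)
  next
    fix m v v' assume *: "m \<in> carrier B1.M" "v \<in> carrier (U_module N)" "v' \<in> carrier (U_module N)"
    then obtain n u where "u \<in> carrier UL" "m = fr n u" by (auto simp: Uf_carrier)
    then show "b m (v \<oplus>\<^bsub>U_module N\<^esub> v') = b m v \<oplus>\<^bsub>E.Fr\<^esub> b m v'"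
      using * by (simp add: b U_act_add_r E.fr_add_same U_act_closed)
  next
    fix m u v assume *: "m \<in> carrier B1.M" "u \<in> carrier UL" "v \<in> carrier (U_module N)"
    then obtain n u' where "u' \<in> carrier UL" "m = fr n u'" by (auto simp: Uf_carrier)
    moreover from this * have "m \<otimes>\<^bsub>Uf\<^esub> uf u = fr n (u' \<otimes>\<^bsub>UL\<^esub> u)"
      by (simp add: fr_eq of_mult Q.m_assoc)
    ultimately show "b (module.smult B1.M u m) v = b m (module.smult (U_module N) u v)"
      using * by (simp add: b U_act_mult U_act_closed)
  qed blast
  have "E.fr n v = \<epsilon> (tau n v)"
    unfolding tau_def using v by (simp add: \<epsilon>(2) b U_act_one)
  also have "\<dots> = \<zero>\<^bsub>E.Fr\<^esub>"
    unfolding z by (rule ahom_zero[OF B1.abelian_group_T E.abelian_group_X \<epsilon>(1)])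
  finally show "\<exists>k. (fN ^^ k) v = \<zero>\<^bsub>N\<^esub>" by (simp add: E.fr_zero_iff)
qed

lemma lmul_tau:
  assumes "r \<in> carrier UL" "v \<in> carrier N"
  shows "B1.lmul (FI [^]\<^bsub>Uf\<^esub> n \<otimes>\<^bsub>Uf\<^esub> uf r) (tau 0 v) = tau n (U_act N r v)"
proof -
  have "B1.lmul (FI [^]\<^bsub>Uf\<^esub> n \<otimes>\<^bsub>Uf\<^esub> uf r) (tau 0 v) = B1.pt (fr n r) v"
    unfolding tau_def using assms
    by (subst B1.lmul_pt) (simp_all add: fr_eq of_one Q.m_assoc)
  then show ?thesis using assms by (simp add: pt_fr)
qed

lemma tau_eq_lmul: "v \<in> carrier N \<Longrightarrow> tau n v = B1.lmul (FI [^]\<^bsub>Uf\<^esub> n) (tau 0 v)"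
  using lmul_tau[of "\<one>\<^bsub>UL\<^esub>" v n] by (simp add: of_one U_act_one)

definition tw :: "nat \<Rightarrow> 'v \<Rightarrow> ('g, 'v) twisted" where
  "tw n v = B2.pt \<one>\<^bsub>Uf\<^esub> (tau n v)"

lemma tw_closed [simp]: "v \<in> carrier N \<Longrightarrow> tw n v \<in> carrier B2.T"
  by (simp add: tw_def B2.pt_closed)

text \<open>Formally u f^a = f^a (f^(-a) u f^a): u is \<open>phi L f a\<close> of
  \<open>P.Psi a u\<close>, and that factor is moved across the tensor sign.\<close>

lemma pt_eq_pt_one:
  assumes "u \<in> carrier Uf" "z \<in> carrier B1.T"
  shows "B2.pt u z = B2.pt \<one>\<^bsub>Uf\<^esub> (B1.lmul (P.Psi a u) z)"
  using B2.pt_balanced[of "\<one>\<^bsub>Uf\<^esub>" "P.Psi a u" z] assms by (simp add: phi_eq P.Phi_Psi)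

lemma tw_surj: "d \<in> carrier B2.T \<Longrightarrow> \<exists>n v. v \<in> carrier N \<and> d = tw n v"
proof -
  assume "d \<in> carrier B2.T"
  then have "\<exists>z\<in>carrier B1.T. d = B2.pt \<one>\<^bsub>Uf\<^esub> z"
  proof (induction d rule: B2.tensor_induct)
    case zero
    then show ?case using B2.pt_zero_right[of "\<one>\<^bsub>Uf\<^esub>"] by (metis B1.T.zero_closed Q.one_closed loc_mod_simps(3))
  next
    case (pure u z)
    then show ?case using pt_eq_pt_one[of u z] by (auto simp: B1.lmul_closed)
  next
    case (diff x y)
    then obtain z z' where *: "z \<in> carrier B1.T" "z' \<in> carrier B1.T" "x = B2.pt \<one>\<^bsub>Uf\<^esub> z" "y = B2.pt \<one>\<^bsub>Uf\<^esub> z'" by auto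
    then have "x \<ominus>\<^bsub>B2.T\<^esub> y = B2.pt \<one>\<^bsub>Uf\<^esub> (z \<ominus>\<^bsub>loc_mod L f N\<^esub> z')"
      using B2.pt_minus_right[of "\<one>\<^bsub>Uf\<^esub>" z z'] by simp
    moreover have "z \<ominus>\<^bsub>loc_mod L f N\<^esub> z' \<in> carrier B1.T"
      using * B2.N.minus_closed[of z z'] by simp
    ultimately show ?case by blast
  qed
  then show ?thesis using tau_surj unfolding tw_def by blast
qed

lemma tw_shift: "v \<in> carrier N \<Longrightarrow> tw (n + k) ((fN ^^ k) v) = tw n v"
  by (simp add: tw_def tau_shift)

lemma tw_add: "v \<in> carrier N \<Longrightarrow> w \<in> carrier N \<Longrightarrow> tw n (v \<oplus>\<^bsub>N\<^esub> w) = tw n v \<oplus>\<^bsub>B2.T\<^esub> tw n w"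
  using B2.pt_add_right[of "\<one>\<^bsub>Uf\<^esub>" "tau n v" "tau n w"] by (simp add: tw_def tau_add)

lemma tw_ahom: "tw n \<in> ahom N B2.T"
  by (rule ahomI) (simp_all add: tw_add)

lemma tw_zero: "tw n \<zero>\<^bsub>N\<^esub> = \<zero>\<^bsub>B2.T\<^esub>"
  by (rule ahom_zero[OF N.M.abelian_group_axioms B2.abelian_group_T tw_ahom])

text \<open>The harder half uses the retraction that sends u f^a \<otimes> z to
  \<open>P.Psi a u\<close> z. It is balanced since \<open>P.Psi a\<close> is multiplicative and
  undoes \<open>phi L f a\<close>, and it sends f^a \<otimes> z back to z.\<close>

lemma tw_zero_iff:
  assumes v: "v \<in> carrier N"
  shows "tw n v = \<zero>\<^bsub>B2.T\<^esub> \<longleftrightarrow> (\<exists>k. (fN ^^ k) v = \<zero>\<^bsub>N\<^esub>)"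
proof
  assume "\<exists>k. (fN ^^ k) v = \<zero>\<^bsub>N\<^esub>"
  then show "tw n v = \<zero>\<^bsub>B2.T\<^esub>" using tw_shift[OF v, of n] tw_zero by metis
next
  assume z: "tw n v = \<zero>\<^bsub>B2.T\<^esub>"
  define b where "b u z = B1.lmul (P.Psi a u) z" for u z
  obtain \<theta> where \<theta>: "\<theta> \<in> ahom B2.T B1.T"
    "\<And>u z. u \<in> carrier B2.M \<Longrightarrow> z \<in> carrier (loc_mod L f N) \<Longrightarrow> \<theta> (B2.pt u z) = b u z"
  proof (rule B2.tensor_lift[OF B1.abelian_group_T])
    fix u z assume *: "u \<in> carrier B2.M" "z \<in> carrier (loc_mod L f N)"
    then show "b u z \<in> carrier B1.T" by (simp add: b_def B1.lmul_closed)
    fix u' assume "u' \<in> carrier B2.M"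
    then show "b (u \<oplus>\<^bsub>B2.M\<^esub> u') z = b u z \<oplus>\<^bsub>B1.T\<^esub> b u' z"
      using * by (simp add: b_def P.Psi_add B1.lmul_add)
  next
    fix u z z' assume *: "u \<in> carrier B2.M" "z \<in> carrier (loc_mod L f N)" "z' \<in> carrier (loc_mod L f N)"
    then show "b u (z \<oplus>\<^bsub>loc_mod L f N\<^esub> z') = b u z \<oplus>\<^bsub>B1.T\<^esub> b u z'"
      by (simp add: b_def ahom_add[OF B1.lmul_ahom])
  next
    fix u r z assume *: "u \<in> carrier B2.M" "r \<in> carrier Uf" "z \<in> carrier (loc_mod L f N)"
    then show "b (module.smult B2.M r u) z = b u (module.smult (loc_mod L f N) r z)"
      by (simp add: b_def phi_eq P.Psi_mult P.Psi_Phi B1.lmul_mult)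
  qed blast
  have one: "P.Psi a \<one>\<^bsub>Uf\<^esub> = \<one>\<^bsub>Uf\<^esub>"
    by (rule P.Psi_ad_zero) (simp_all add: Q.minus_eq Q.r_neg)
  have "tau n v = \<theta> (tw n v)"
    unfolding tw_def using v by (simp add: \<theta>(2) b_def one B1.lmul_one)
  also have "\<dots> = \<zero>\<^bsub>B1.T\<^esub>"
    unfolding z by (rule ahom_zero[OF B2.abelian_group_T B1.abelian_group_T \<theta>(1)])
  finally show "\<exists>k. (fN ^^ k) v = \<zero>\<^bsub>N\<^esub>" by (simp add: tau_zero_iff v)
qed

lemma pt_one_lmul: "u \<in> carrier Uf \<Longrightarrow> z \<in> carrier B1.T \<Longrightarrow>
    B2.lmul u (B2.pt \<one>\<^bsub>Uf\<^esub> z) = B2.pt \<one>\<^bsub>Uf\<^esub> (B1.lmul (P.Psi a u) z)"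
  using B2.lmul_pt[of u "\<one>\<^bsub>Uf\<^esub>" z] pt_eq_pt_one[of u z] by simp

lemma const_tw: "v \<in> carrier N \<Longrightarrow> B2.lmul (Uf_const L f c) (tw n v) = tw n (c \<odot>\<^bsub>N\<^esub> v)"
proof -
  assume v: "v \<in> carrier N"
  have "P.Psi a (Uf_const L f c) = Uf_const L f c"
    by (rule P.Psi_ad_zero) (simp_all add: const_central Q.minus_eq Q.r_neg)
  then have "B2.lmul (Uf_const L f c) (tw n v) = B2.pt \<one>\<^bsub>Uf\<^esub> (B1.lmul (Uf_const L f c) (B1.lmul (FI [^]\<^bsub>Uf\<^esub> n) (tau 0 v)))"
    using v by (simp add: tw_def pt_one_lmul tau_eq_lmul[symmetric])
  also have "\<dots> = B2.pt \<one>\<^bsub>Uf\<^esub> (B1.lmul (FI [^]\<^bsub>Uf\<^esub> n \<otimes>\<^bsub>Uf\<^esub> uf (Uc c)) (tau 0 v))"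
    using v by (simp add: B1.lmul_mult[symmetric] const_central[symmetric]) (simp add: const_def')
  finally show ?thesis using v by (simp add: lmul_tau U_act_const tw_def)
qed

lemma FF_tw: "v \<in> carrier N \<Longrightarrow> B2.lmul FF (tw n v) = tw n (fN v)"
proof -
  assume v: "v \<in> carrier N"
  have "P.Psi a FF = FF"
    by (rule P.Psi_ad_zero) (simp_all add: Q.minus_eq Q.r_neg)
  then have "B2.lmul FF (tw n v) = B2.pt \<one>\<^bsub>Uf\<^esub> (B1.lmul FF (B1.lmul (FI [^]\<^bsub>Uf\<^esub> n) (tau 0 v)))"
    using v by (simp add: tw_def pt_one_lmul tau_eq_lmul[symmetric])
  also have "\<dots> = B2.pt \<one>\<^bsub>Uf\<^esub> (B1.lmul (FI [^]\<^bsub>Uf\<^esub> n \<otimes>\<^bsub>Uf\<^esub> FF) (tau 0 v))"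
    using v FI_comm[of FF n] by (simp add: B1.lmul_mult[symmetric])
  finally show ?thesis
    using v lmul_tau[of fU v n, folded Uf_gen_def] by (simp add: U_act_gen tw_def)
qed

lemma FI_tw: "v \<in> carrier N \<Longrightarrow> B2.lmul FI (tw n v) = tw (Suc n) v"
proof -
  assume v: "v \<in> carrier N"
  have "tw n v = tw (Suc n) (fN v)" using tw_shift[OF v, of n 1] by simp
  also have "\<dots> = B2.lmul FF (tw (Suc n) v)" using v by (simp add: FF_tw)
  finally have "B2.lmul FI (tw n v) = B2.lmul (FI \<otimes>\<^bsub>Uf\<^esub> FF) (tw (Suc n) v)"
    using v B2.lmul_mult[of FI FF "tw (Suc n) v"] by simp
  then show ?thesis using v FF_unit by (simp add: B2.lmul_one)
qed

lemma gen_closed [simp]: "x \<in> carrier L \<Longrightarrow> Uf_gen L f x \<in> carrier Uf"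
  by (simp add: Uf_gen_def)

lemma ad_gen:
  assumes x: "x \<in> carrier L"
  shows "(P.ad ^^ j) (Uf_gen L f x) = uf (U_gen L ((br L f ^^ j) x))"
proof -
  have "P.ad = Q.comm FF" by (simp add: Q.comm_def[abs_def])
  moreover have "fr 0 u = uf u" if "u \<in> carrier UL" for u
    using fr_eq[OF that, of 0] that by simp
  ultimately show ?thesis
    using comm_fr[of "U_gen L x" j 0] x U_gen_ad_pow[OF f_even x, of j]
      UL.comm_pow_closed[of fU "U_gen L x" j]
    by (simp add: Uf_gen_def)
qed

text \<open>Moving x past f^a and then past f^(-n) replaces it by
  \<open>P.Psi (a - of_nat n)\<close> of x; the terms of this series carry (ad f)^j x, again an
  element of the Lie superalgebra, which acts on v. Any d with (ad f)^d x = 0 may serve as the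
  length of the sum.\<close>

lemma act_tw:
  assumes x: "x \<in> carrier L" and d: "(br L f ^^ d) x = \<zero>\<^bsub>L\<^esub>" and v: "v \<in> carrier N"
  shows "B2.lmul (Uf_gen L f x) (tw n v) =
    nsum B2.T (\<lambda>j. tw (n + j) (((-1) ^ j * ((a - of_nat n) gchoose j)) \<odot>\<^bsub>N\<^esub> act N ((br L f ^^ j) x) v)) d"
proof -
  let ?c = "\<lambda>j. (-1) ^ j * ((a - of_nat n) gchoose j)"
  let ?x = "\<lambda>j. (br L f ^^ j) x"
  have xj: "?x j \<in> carrier L" for j by (rule U_gen_ad_pow(1)[OF f_even x])
  have zero: "U_gen L \<zero>\<^bsub>L\<^esub> = \<zero>\<^bsub>UL\<^esub>"
    using U_gen_add[of "\<zero>\<^bsub>L\<^esub>" "\<zero>\<^bsub>L\<^esub>"] by (metis UL.add.r_cancel_one' U_gen_closed zero_closed r_zero)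
  have deg: "P.deg (Uf_gen L f x) \<le> d"
    by (rule P.deg_le) (simp add: ad_gen[OF x] d zero of_zero)
  have "P.Psi a (Uf_gen L f x) \<otimes>\<^bsub>Uf\<^esub> FI [^]\<^bsub>Uf\<^esub> n = FI [^]\<^bsub>Uf\<^esub> n \<otimes>\<^bsub>Uf\<^esub> P.Psi (a - of_nat n) (Uf_gen L f x)"
    by (rule P.Psi_shift) (simp add: x)
  also have "\<dots> = nsum Uf (\<lambda>j. FI [^]\<^bsub>Uf\<^esub> n \<otimes>\<^bsub>Uf\<^esub> (Uf_const L f (?c j) \<otimes>\<^bsub>Uf\<^esub> (FI [^]\<^bsub>Uf\<^esub> j \<otimes>\<^bsub>Uf\<^esub> uf (U_gen L (?x j))))) d"
    using x xj by (subst P.Psi_eq[OF _ deg], simp, simp only: ad_gen[OF x], subst P.nsum_lmult) simp_all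
  also have "\<dots> = nsum Uf (\<lambda>j. FI [^]\<^bsub>Uf\<^esub> (n + j) \<otimes>\<^bsub>Uf\<^esub> uf (Uc (?c j) \<otimes>\<^bsub>UL\<^esub> U_gen L (?x j))) d"
  proof (intro nsum_cong)
    fix j
    let ?i = "FI [^]\<^bsub>Uf\<^esub> n" and ?k = "FI [^]\<^bsub>Uf\<^esub> j" and ?g = "uf (U_gen L (?x j))"
    have "?k \<otimes>\<^bsub>Uf\<^esub> (Uf_const L f (?c j) \<otimes>\<^bsub>Uf\<^esub> ?g) = Uf_const L f (?c j) \<otimes>\<^bsub>Uf\<^esub> (?k \<otimes>\<^bsub>Uf\<^esub> ?g)"
      using xj by (intro P.\<kappa>_lcomm) simp_all
    then show "?i \<otimes>\<^bsub>Uf\<^esub> (Uf_const L f (?c j) \<otimes>\<^bsub>Uf\<^esub> (?k \<otimes>\<^bsub>Uf\<^esub> ?g))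
      = FI [^]\<^bsub>Uf\<^esub> (n + j) \<otimes>\<^bsub>Uf\<^esub> uf (Uc (?c j) \<otimes>\<^bsub>UL\<^esub> U_gen L (?x j))"
      using xj by (simp add: of_mult const_def' Q.nat_pow_mult[symmetric] Q.m_assoc)
  qed
  finally have *: "P.Psi a (Uf_gen L f x) \<otimes>\<^bsub>Uf\<^esub> FI [^]\<^bsub>Uf\<^esub> n = \<dots>" .
  have "B2.lmul (Uf_gen L f x) (tw n v) = B2.pt \<one>\<^bsub>Uf\<^esub> (B1.lmul (P.Psi a (Uf_gen L f x)) (B1.lmul (FI [^]\<^bsub>Uf\<^esub> n) (tau 0 v)))"
    using v x by (simp add: tw_def pt_one_lmul tau_eq_lmul[symmetric])
  also have "\<dots> = B2.pt \<one>\<^bsub>Uf\<^esub> (B1.lmul (P.Psi a (Uf_gen L f x) \<otimes>\<^bsub>Uf\<^esub> FI [^]\<^bsub>Uf\<^esub> n) (tau 0 v))"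
    using v x by (simp add: B1.lmul_mult)
  also have "\<dots> = nsum B2.T (\<lambda>j. B2.pt \<one>\<^bsub>Uf\<^esub> (B1.lmul (FI [^]\<^bsub>Uf\<^esub> (n + j) \<otimes>\<^bsub>Uf\<^esub> uf (Uc (?c j) \<otimes>\<^bsub>UL\<^esub> U_gen L (?x j))) (tau 0 v))) d"
    unfolding *
  proof (rule ahom_nsum[OF Q.abelian_group_axioms B2.abelian_group_T])
    show "(\<lambda>u. B2.pt \<one>\<^bsub>Uf\<^esub> (B1.lmul u (tau 0 v))) \<in> ahom Uf B2.T"
      using v B2.pt_add_right[of "\<one>\<^bsub>Uf\<^esub>"]
      by (intro ahomI) (simp_all add: B1.lmul_add B1.lmul_closed B2.pt_closed)
  qed (use xj in simp)
  also have "\<dots> = nsum B2.T (\<lambda>j. tw (n + j) (?c j \<odot>\<^bsub>N\<^esub> act N (?x j) v)) d"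
    using v xj by (intro nsum_cong) (simp add: lmul_tau tw_def U_act_mult U_act_const U_act_gen act_closed)
  finally show ?thesis .
qed

end

section \<open>The grading of the twisted localization\<close>

context gmodule
begin

text \<open>Stated for an abstract family P because it serves twice: for the components of N, and
  for the candidates \<open>Par\<close> in the twisted localization before these are known to be its
  components.\<close>

lemma U_par_act:
  assumes P: "\<And>i. P i \<subseteq> carrier N" "\<And>i. \<zero>\<^bsub>N\<^esub> \<in> P i"
    "\<And>i v w. v \<in> P i \<Longrightarrow> w \<in> P i \<Longrightarrow> v \<oplus>\<^bsub>N\<^esub> w \<in> P i" "\<And>i c v. v \<in> P i \<Longrightarrow> c \<odot>\<^bsub>N\<^esub> v \<in> P i"
    "\<And>i j x v. x \<in> par L j \<Longrightarrow> v \<in> P i \<Longrightarrow> act N x v \<in> P (j + i)"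
    and u: "u \<in> U_par L j" and v: "v \<in> P i"
  shows "U_act N u v \<in> P (j + i)"
proof -
  let ?hom = "\<lambda>w j. \<exists>js. list_all2 (\<lambda>x j. x \<in> par L j) w js \<and> sum_list js = j"
  have w: "word_act w v \<in> P (j + i)" if "?hom w j" for w j
    using that
  proof (induction w arbitrary: j)
    case Nil
    then show ?case using v by auto
  next
    case (Cons x w)
    then obtain k js where "x \<in> par L k" "list_all2 (\<lambda>x j. x \<in> par L j) w js" "j = k + sum_list js"
      by (auto simp: list_all2_Cons1)
    then have "act N x (word_act w v) \<in> P (k + (sum_list js + i))" by (intro P(5) Cons.IH) blast+
    then show ?case by (simp only: word_act_simps \<open>j = k + sum_list js\<close> add.assoc)
  qed
  obtain p where p: "p \<in> carrier L.FA" "u = U_class L p" "\<forall>w. p w \<noteq> 0 \<longrightarrow> ?hom w j"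
    using u by (auto simp: U_par_def)
  have "(\<forall>w. p w \<noteq> 0 \<longrightarrow> ?hom w j) \<longrightarrow> free_act N p v \<in> P (j + i)"
    using p(1)
  proof (induction p rule: free_alg_induct)
    case zero
    then show ?case by (simp add: free_act_zero P(2))
  next
    case (add p c w)
    show ?case
    proof
      assume h: "\<forall>x. p x + monomial c w x \<noteq> 0 \<longrightarrow> ?hom x j"
      have "\<forall>x. p x \<noteq> 0 \<longrightarrow> ?hom x j"
      proof (intro allI impI)
        fix x assume "p x \<noteq> 0"
        then have "p x + monomial c w x \<noteq> 0" using add(3) by (auto simp: monomial_def)
        then show "?hom x j" using h by blast
      qed
      then have 1: "free_act N p v \<in> P (j + i)" using add(4) by blast
      have "c \<odot>\<^bsub>N\<^esub> word_act w v \<in> P (j + i)"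
      proof (cases "c = 0")
        case True
        then show ?thesis using word_act_closed[OF add(2), of v] v P(1)[of i] P(2) by (auto simp: subset_iff)
      next
        case False
        then have "p w + monomial c w w \<noteq> 0" using add(3) by (simp add: monomial_def)
        then have "?hom w j" using h by blast
        then show ?thesis by (intro P(4) w)
      qed
      then show "free_act N (\<lambda>u. p u + monomial c w u) v \<in> P (j + i)"
        using 1 v P(1)[of i] add by (subst free_act_add_monomial) (auto intro!: P(3) simp del: in_lists_conv_set)
    qed
  qed
  moreover have "v \<in> carrier N" using v P(1) by auto
  ultimately show ?thesis using p by (simp add: U_act_class)
qed

end

context twisted_localization
begin

abbreviation "D \<equiv> D_obj L f a N"

lemma D_left_mult_eq: "D_left_mult L f a N u = B2.lmul u"
  by (simp add: D_left_mult_def B2.lmul_def Ufa_eq)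

lemma D_simps [simp]:
  "carrier D = carrier B2.T" "add D = add B2.T" "\<zero>\<^bsub>D\<^esub> = \<zero>\<^bsub>B2.T\<^esub>"
  "c \<odot>\<^bsub>D\<^esub> z = B2.lmul (Uf_const L f c) z" "act D x = B2.lmul (Uf_gen L f x)"
  "par D i = D_par L f a N i"
  by (simp_all add: D_obj_def Let_def D_left_mult_eq Ufa_eq)

lemma abelian_group_D: "abelian_group D"
  by (rule abelian_group_cong[OF B2.abelian_group_T]) simp_all

lemma lmul_const_comm: "x \<in> carrier Uf \<Longrightarrow> z \<in> carrier B2.T \<Longrightarrow>
    B2.lmul x (B2.lmul (Uf_const L f c) z) = B2.lmul (Uf_const L f c) (B2.lmul x z)"
  by (simp add: B2.lmul_mult[symmetric] const_central)

lemma gmodule_D: "gmodule L D"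
proof (intro gmodule.intro gmodule_axioms.intro cspace.intro)
  show "lie_superalgebra L" by (rule lie_superalgebra_axioms)
  show "module CC D"
  proof (rule moduleI)
    show "cring CC" by (rule cring_from_type_algebra)
    show "abelian_group D" by (rule abelian_group_D)
  qed (simp_all add: B2.lmul_closed P.\<kappa>_add P.\<kappa>_mult B2.lmul_add B2.lmul_mult B2.lmul_one
      ahom_add[OF B2.lmul_ahom])
  show "act D (br L x y) v = act D x (act D y v) \<oplus>\<^bsub>D\<^esub> (- sign i j) \<odot>\<^bsub>D\<^esub> act D y (act D x v)"
    if "x \<in> par L i" "y \<in> par L j" "v \<in> carrier D" for i j x y v
  proof -
    note xy = par_carrier[OF that(1)] par_carrier[OF that(2)]
    have "Uf_gen L f (br L x y) = Uf_gen L f x \<otimes>\<^bsub>Uf\<^esub> Uf_gen L f y \<oplus>\<^bsub>Uf\<^esub>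
        Uf_const L f (- sign i j) \<otimes>\<^bsub>Uf\<^esub> (Uf_gen L f y \<otimes>\<^bsub>Uf\<^esub> Uf_gen L f x)"
      using xy by (simp add: Uf_gen_def U_gen_br[OF that(1,2)] of_minus of_mult const_def'[symmetric]
          P.\<kappa>_neg Q.minus_eq Q.l_minus)
    then show ?thesis using that xy by (simp add: B2.lmul_add B2.lmul_mult)
  qed
qed (simp_all add: B2.lmul_closed B2.lmul_add[symmetric] B2.lmul_mult ahom_add[OF B2.lmul_ahom]
    Uf_gen_def U_gen_add U_gen_smult of_add of_mult lmul_const_comm const_def'[symmetric])

lemma tw_one_tensor: "v \<in> carrier N \<Longrightarrow> twisted_tensor L f a N \<one>\<^bsub>Uf\<^esub> v = tw 0 v"
proof -
  assume v: "v \<in> carrier N"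
  have "fr 0 \<one>\<^bsub>UL\<^esub> = \<one>\<^bsub>Uf\<^esub>" by (simp add: fr_eq of_one)
  then show ?thesis
    by (simp add: twisted_tensor_def tw_def tau_def Ufa_eq Uf_over_U_eq)
qed

lemma twisted_tensor_fpow:
  assumes v: "v \<in> carrier N"
  shows "twisted_tensor L f a N (fpow L f (int j)) v = tw 0 ((fN ^^ j) v)"
proof -
  have one: "fr 0 \<one>\<^bsub>UL\<^esub> = \<one>\<^bsub>Uf\<^esub>" by (simp add: fr_eq of_one)
  have "twisted_tensor L f a N (fpow L f (int j)) v = B2.pt (FF [^]\<^bsub>Uf\<^esub> j) (tau 0 v)"
    by (simp add: twisted_tensor_def tau_def Ufa_eq Uf_over_U_eq one fpow_def int_pow_int)
  also have "\<dots> = B2.lmul (FF [^]\<^bsub>Uf\<^esub> j) (tw 0 v)"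
    using v by (simp add: tw_def B2.lmul_pt)
  also have "\<dots> = tw 0 ((fN ^^ j) v)"
    using v
  proof (induction j arbitrary: v)
    case 0
    then show ?case by (simp add: B2.lmul_one)
  next
    case (Suc j)
    have "act N f v \<in> carrier N" using Suc.prems by (simp add: act_closed)
    then show ?case
      using Suc by (simp add: B2.lmul_mult FF_tw funpow_Suc_right del: funpow.simps)
  qed
  finally show ?thesis .
qed

lemma tw_smult: "v \<in> carrier N \<Longrightarrow> c \<odot>\<^bsub>D\<^esub> tw n v = tw n (c \<odot>\<^bsub>N\<^esub> v)"
  by (simp add: const_tw)

lemma act_D_tw:
  assumes "x \<in> carrier L" "(br L f ^^ d) x = \<zero>\<^bsub>L\<^esub>" "v \<in> carrier N"
  shows "act D x (tw n v) =
    nsum D (\<lambda>j. tw (n + j) (((-1) ^ j * ((a - of_nat n) gchoose j)) \<odot>\<^bsub>N\<^esub> act N ((br L f ^^ j) x) v)) d"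
proof -
  have n: "nsum D g k = nsum B2.T g k" for g k by (induction k) simp_all
  show ?thesis using act_tw[OF assms, of n] by (simp add: n)
qed

lemma common_denominator_tw:
  assumes "z \<in> carrier D" "y \<in> carrier D"
  obtains n v w where "v \<in> carrier N" "w \<in> carrier N" "z = tw n v" "y = tw n w"
proof -
  obtain n v m w where *: "v \<in> carrier N" "z = tw n v" "w \<in> carrier N" "y = tw m w"
    using assms tw_surj by (metis D_simps(1))
  then have "z = tw (n + m) ((fN ^^ m) v)" "y = tw (n + m) ((fN ^^ n) w)"
    using tw_shift[of v n m] tw_shift[of w m n] by (simp_all add: add.commute)
  with * show thesis using that E.pow_closed by metis
qed

end

locale graded_twisted_localization = twisted_localization L f N a
  for L :: "'g lsa" and f :: 'g and N :: "('g, 'v) gmod" and a :: complex +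
  assumes N_graded: "graded N"
    and act_par: "\<And>x v i j. x \<in> par L i \<Longrightarrow> v \<in> par N j \<Longrightarrow> act N x v \<in> par N (i + j)"
begin

lemma parN_submodule: "submodule (par N i) CC N"
  using N_graded by (simp add: graded_def)

lemma parN_facts:
  "v \<in> par N i \<Longrightarrow> v \<in> carrier N"
  "\<zero>\<^bsub>N\<^esub> \<in> par N i"
  "v \<in> par N i \<Longrightarrow> w \<in> par N i \<Longrightarrow> v \<oplus>\<^bsub>N\<^esub> w \<in> par N i"
  "v \<in> par N i \<Longrightarrow> c \<odot>\<^bsub>N\<^esub> v \<in> par N i"
proof -
  note E = N.submoduleE[OF parN_submodule[of i]]
  show "v \<in> par N i \<Longrightarrow> v \<in> carrier N" using E(1) by auto
  show s: "v \<in> par N i \<Longrightarrow> c \<odot>\<^bsub>N\<^esub> v \<in> par N i" for v c using E(4)[of c v] by simp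
  obtain u where u: "u \<in> par N i" using E(2) by auto
  then have "u \<in> carrier N" using E(1) by auto
  then show "\<zero>\<^bsub>N\<^esub> \<in> par N i" using s[OF u, of 0] by simp
  show "v \<in> par N i \<Longrightarrow> w \<in> par N i \<Longrightarrow> v \<oplus>\<^bsub>N\<^esub> w \<in> par N i" by (rule E(5))
qed

lemma f_pow_par: "v \<in> par N i \<Longrightarrow> (fN ^^ n) v \<in> par N i"
proof (induction n)
  case (Suc n)
  then show ?case using act_par[OF f_even, of "(fN ^^ n) v" i] by (simp only: funpow.simps comp_def add_0)
qed simp

text \<open>The candidate for \<open>D_par\<close>, which is defined as the subgroup generated by
  all homogeneous pure tensors; f^a and the powers of f are even, so the parity is that of
  v.\<close>

definition Par :: "bit \<Rightarrow> ('g, 'v) twisted set" where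
  "Par i = {tw n v | n v. v \<in> par N i}"

lemma ParI: "v \<in> par N i \<Longrightarrow> tw n v \<in> Par i"
  by (auto simp: Par_def)

lemma Par_carrier: "z \<in> Par i \<Longrightarrow> z \<in> carrier B2.T"
  using parN_facts(1) by (auto simp: Par_def)

lemma Par_zero: "\<zero>\<^bsub>B2.T\<^esub> \<in> Par i"
  using ParI[OF parN_facts(2), of 0 i] by (simp add: tw_zero)

lemma Par_add:
  assumes "z \<in> Par i" "y \<in> Par i"
  shows "z \<oplus>\<^bsub>B2.T\<^esub> y \<in> Par i"
proof -
  obtain n v m w where *: "v \<in> par N i" "z = tw n v" "w \<in> par N i" "y = tw m w"
    using assms by (auto simp: Par_def)
  note c = parN_facts(1)[OF *(1)] parN_facts(1)[OF *(3)]
  have "z = tw (n + m) ((fN ^^ m) v)" "y = tw (n + m) ((fN ^^ n) w)"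
    using * c tw_shift[of v n m] tw_shift[of w m n] by (simp_all add: add.commute)
  then have "z \<oplus>\<^bsub>B2.T\<^esub> y = tw (n + m) ((fN ^^ m) v \<oplus>\<^bsub>N\<^esub> (fN ^^ n) w)"
    using c by (simp add: tw_add)
  then show ?thesis using * f_pow_par parN_facts(3) by (simp add: ParI)
qed

lemma Par_smult: "z \<in> Par i \<Longrightarrow> B2.lmul (Uf_const L f c) z \<in> Par i"
proof -
  assume "z \<in> Par i"
  then obtain n v where "v \<in> par N i" "z = tw n v" by (auto simp: Par_def)
  then show ?thesis using parN_facts(1,4) by (simp add: const_tw ParI)
qed

lemma Par_act:
  assumes x: "x \<in> par L j" and z: "z \<in> Par i"
  shows "B2.lmul (Uf_gen L f x) z \<in> Par (j + i)"
proof -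
  obtain n v where v: "v \<in> par N i" "z = tw n v" using z by (auto simp: Par_def)
  note xc = par_carrier[OF x]
  obtain d where d: "(br L f ^^ d) x = \<zero>\<^bsub>L\<^esub>" using f_nil[OF xc] by auto
  have xk: "(br L f ^^ k) x \<in> par L j" for k
  proof (induction k)
    case (Suc k)
    then show ?case using br_par[OF f_even, of "(br L f ^^ k) x" j] by (simp only: funpow.simps comp_def add_0)
  qed (simp add: x)
  have t: "tw (n + k) (c \<odot>\<^bsub>N\<^esub> act N ((br L f ^^ k) x) v) \<in> Par (j + i)" for c k
    by (intro ParI parN_facts(4) act_par xk v(1))
  have s: "nsum B2.T g k \<in> Par l" if "\<And>k. g k \<in> Par l" for g k l
    by (induction k) (simp_all add: Par_zero Par_add that)
  show ?thesis unfolding v(2) act_tw[OF xc d parN_facts(1)[OF v(1)]] by (rule s) (rule t)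
qed

text \<open>The element is f^(-n) r with r homogeneous: r acts through the module structure of
  \<open>D\<close>, to which \<open>U_par_act\<close> applies, and f^(-n) only raises
  denominators.\<close>

lemma Uf_par_lmul:
  assumes u: "u \<in> Uf_par L f j" and z: "z \<in> Par i"
  shows "B2.lmul u z \<in> Par (j + i)"
proof -
  interpret D: gmodule L D by (rule gmodule_D)
  obtain n r where r: "r \<in> U_par L j" "u = fr n r" using u by (auto simp: Uf_par_def)
  have rc: "r \<in> carrier UL" using r(1) by (auto simp: U_par_def)
  have "U_act D r z \<in> Par (j + i)"
  proof (rule D.U_par_act[where P = Par, OF _ _ _ _ _ r(1) z])
    show "act D x v \<in> Par (j + i)" if "x \<in> par L j" "v \<in> Par i" for x v i j
      using Par_act[OF that] by simp
  qed (auto simp: Par_carrier Par_zero Par_add Par_smult)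
  moreover have "U_act D r z = B2.lmul (Uf_of L f r) z" using rc
  proof (induction r rule: U_induct)
    case zero
    have "B2.lmul \<zero>\<^bsub>Uf\<^esub> z = \<zero>\<^bsub>B2.T\<^esub>"
      using B2.lmul_add[of "\<zero>\<^bsub>Uf\<^esub>" "\<zero>\<^bsub>Uf\<^esub>" z] B2.lmul_closed[of "\<zero>\<^bsub>Uf\<^esub>" z] Par_carrier[OF z] by simp
    moreover have "U_act D \<zero>\<^bsub>UL\<^esub> z = \<zero>\<^bsub>B2.T\<^esub>"
      using D.U_act_add_l[of "\<zero>\<^bsub>UL\<^esub>" "\<zero>\<^bsub>UL\<^esub>" z] D.U_act_closed[of "\<zero>\<^bsub>UL\<^esub>" z] Par_carrier[OF z] by simp
    ultimately show ?case by (simp add: of_zero)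
  next
    case (add u c w)
    have w: "D.word_act w z = B2.lmul (Uf_of L f (U_class L (monomial 1 w))) z" using add(2)
    proof (induction w)
      case Nil
      then show ?case using Par_carrier[OF z] by (simp add: Uc_one of_one B2.lmul_one)
    next
      case (Cons x w)
      then show ?case using Par_carrier[OF z]
        by (simp add: U_class_Cons of_mult mono_closed B2.lmul_mult Uf_gen_def[symmetric])
    qed
    have "Uf_of L f (U_class L (monomial c w)) = Uf_const L f c \<otimes>\<^bsub>Uf\<^esub> Uf_of L f (U_class L (monomial 1 w))"
      using U_class_scale[OF add(2), of c] add(2) by (simp add: of_mult const_def' mono_closed)
    then show ?case
      using add Par_carrier[OF z]
      by (simp add: D.U_act_add_l mono_closed of_add B2.lmul_add B2.lmul_mult D.U_act_mono w del: in_lists_conv_set)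
  qed
  ultimately have 1: "B2.lmul (Uf_of L f r) z \<in> Par (j + i)" by simp
  have FI: "B2.lmul (FI [^]\<^bsub>Uf\<^esub> n) y \<in> Par k" if "y \<in> Par k" for y k
    using that
  proof (induction n arbitrary: y)
    case 0
    then show ?case using Par_carrier by (simp add: B2.lmul_one)
  next
    case (Suc n)
    obtain m v where v: "v \<in> par N k" "y = tw m v" using Suc.prems by (auto simp: Par_def)
    have "B2.lmul FI y \<in> Par k" using v parN_facts(1) by (auto simp: FI_tw intro: ParI)
    then show ?case using Suc Par_carrier[OF Suc.prems] by (simp add: B2.lmul_mult)
  qed
  show ?thesis
    unfolding r(2) fr_eq[OF rc] using rc FI[OF 1] Par_carrier[OF z] by (simp add: B2.lmul_mult)
qed

text \<open>Each generator u f^a \<otimes> w \<otimes> v is u applied to \<open>tw m\<close> of a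
  homogeneous vector; conversely \<open>tw n v\<close> is the generator with u = 1 and w =
  f^(-n).\<close>

lemma D_par_eq: "D_par L f a N i = Par i"
proof -
  let ?G = "{B2.pt u (B1.pt w v) | u w v j k l. u \<in> Uf_par L f j \<and> w \<in> Uf_par L f k \<and> v \<in> par N l \<and> j + k + l = i}"
  have D: "D_par L f a N i = generate (add_monoid B2.T) ?G"
    by (simp add: D_par_def Ufa_eq Uf_over_U_eq)
  have sub: "subgroup (Par i) (add_monoid B2.T)"
  proof (rule B2.T.add.subgroupI)
    show "\<ominus>\<^bsub>B2.T\<^esub> z \<in> Par i" if z: "z \<in> Par i" for z
    proof -
      interpret D: gmodule L D by (rule gmodule_D)
      have "B2.lmul (Uf_const L f (-1)) z = \<ominus>\<^bsub>D\<^esub> z"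
        using D.N.neg_eq[of z] Par_carrier[OF z] by simp
      moreover have "\<ominus>\<^bsub>D\<^esub> z = \<ominus>\<^bsub>B2.T\<^esub> z"
        using D.N.M.l_neg[of z] Par_carrier[OF z] D.N.M.a_inv_closed[of z]
        by (intro B2.T.minus_equality[symmetric]) simp_all
      ultimately show ?thesis using Par_smult[OF z, of "-1"] by simp
    qed
  qed (use Par_carrier Par_zero[of i] Par_add in auto)
  have one: "\<one>\<^bsub>UL\<^esub> \<in> U_par L 0"
    unfolding U_par_def
  proof (intro CollectI exI[of _ "monomial 1 []"] conjI allI impI)
    show "\<one>\<^bsub>UL\<^esub> = U_class L (monomial 1 [])" by (simp add: Uc_one)
    show "monomial 1 [] \<in> carrier FA" by (simp add: mono_closed)
    show "\<exists>js. list_all2 (\<lambda>x j. x \<in> par L j) w js \<and> sum_list js = 0" if "monomial 1 [] w \<noteq> 0" for w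
      using that by (auto simp: monomial_def intro!: exI[of _ "[]"] split: if_splits)
  qed
  have G: "?G \<subseteq> Par i"
  proof
    fix z assume "z \<in> ?G"
    then obtain u w v j k l where z: "z = B2.pt u (B1.pt w v)" "u \<in> Uf_par L f j" "w \<in> Uf_par L f k"
      "v \<in> par N l" "j + k + l = i" by blast
    obtain m r where r: "r \<in> U_par L k" "w = fr m r" using z(3) by (auto simp: Uf_par_def)
    have rc: "r \<in> carrier UL" using r(1) by (auto simp: U_par_def)
    have uc: "u \<in> carrier Uf" using z(2) by (auto simp: Uf_par_def U_par_def)
    have v': "U_act N r v \<in> par N (k + l)"
    proof (rule U_par_act[where P = "par N", OF _ _ _ _ _ r(1) z(4)])
      show "act N x v \<in> par N (j + i)" if "x \<in> par L j" "v \<in> par N i" for x v i j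
        by (rule act_par[OF that])
    qed (use parN_facts in auto)
    have "z = B2.lmul u (tw m (U_act N r v))"
      using z(1) rc uc parN_facts(1)[OF z(4)] U_act_closed[OF rc parN_facts(1)[OF z(4)]]
      by (simp add: r(2) pt_fr tw_def B2.lmul_pt)
    then show "z \<in> Par i"
      using Uf_par_lmul[OF z(2) ParI[OF v', of m]] z(5) by (simp only: add.assoc)
  qed
  show ?thesis
  proof
    show "D_par L f a N i \<subseteq> Par i"
      unfolding D by (rule B2.T.add.generate_subgroup_incl[OF G sub])
    show "Par i \<subseteq> D_par L f a N i"
    proof
      fix z assume "z \<in> Par i"
      then obtain n v where v: "v \<in> par N i" "z = tw n v" by (auto simp: Par_def)
      have f1: "fr m \<one>\<^bsub>UL\<^esub> \<in> Uf_par L f 0" for m using one by (auto simp: Uf_par_def)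
      have "\<one>\<^bsub>Uf\<^esub> = fr 0 \<one>\<^bsub>UL\<^esub>" by (simp add: fr_eq of_one)
      then have "z \<in> ?G" unfolding v(2) tw_def tau_def using f1 v(1) by force
      then show "z \<in> D_par L f a N i" unfolding D by (rule generate.incl)
    qed
  qed
qed

lemma graded_D: "graded D"
  unfolding graded_def
proof (intro conjI allI ballI)
  interpret D: gmodule L D by (rule gmodule_D)
  fix i
  show "submodule (par D i) CC D"
  proof (rule D.N.submoduleI)
    show "\<ominus>\<^bsub>D\<^esub> z \<in> par D i" if "z \<in> par D i" for z
      using that Par_smult[of z i "-1"] D.N.neg_eq[of z] Par_carrier by (simp add: D_par_eq)
  qed (auto simp: D_par_eq Par_carrier Par_zero Par_add Par_smult)
next
  fix z assume "z \<in> carrier D"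
  then have "z \<in> carrier B2.T" by simp
  then obtain n v where v: "v \<in> carrier N" "z = tw n v" using tw_surj by blast
  obtain v0 v1 where *: "v0 \<in> par N 0" "v1 \<in> par N 1" "v = v0 \<oplus>\<^bsub>N\<^esub> v1"
    using N_graded v(1) by (auto simp: graded_def)
  show "\<exists>z0\<in>par D 0. \<exists>z1\<in>par D 1. z = z0 \<oplus>\<^bsub>D\<^esub> z1"
    by (rule bexI[of _ "tw n v0"], rule bexI[of _ "tw n v1"])
      (use * v parN_facts(1) in \<open>auto simp: D_par_eq tw_add intro: ParI\<close>)
next
  show "par D 0 \<inter> par D 1 \<subseteq> {\<zero>\<^bsub>D\<^esub>}"
  proof
    fix z assume "z \<in> par D 0 \<inter> par D 1"
    then have "z \<in> Par 0" "z \<in> Par 1" by (simp_all add: D_par_eq)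
    then obtain n v m w where *: "v \<in> par N 0" "z = tw n v" "w \<in> par N 1" "z = tw m w"
      unfolding Par_def by blast
    note c = parN_facts(1)[OF *(1)] parN_facts(1)[OF *(3)]
    \<comment> \<open>An equality between an even and an odd \<open>tw\<close> descends to N after
      applying a power of f, which preserves parity; the common vector then lies in both components
      of N.\<close>
    let ?v = "(fN ^^ m) v" and ?w = "(fN ^^ n) w"
    have z: "z = tw (n + m) ?v" "z = tw (n + m) ?w"
      using * c tw_shift[of v n m] tw_shift[of w m n] by (simp_all add: add.commute)
    have "tw (n + m) (?v \<ominus>\<^bsub>N\<^esub> ?w) = tw (n + m) ?v \<ominus>\<^bsub>B2.T\<^esub> tw (n + m) ?w"
      using c by (intro ahom_minus[OF N.M.abelian_group_axioms B2.abelian_group_T tw_ahom]) simp_all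
    also have "\<dots> = \<zero>\<^bsub>B2.T\<^esub>"
      using z(2) c by (simp add: z(1)[symmetric] B2.T.minus_eq B2.T.r_neg)
    finally obtain k where "(fN ^^ k) (?v \<ominus>\<^bsub>N\<^esub> ?w) = \<zero>\<^bsub>N\<^esub>"
      using c tw_zero_iff[of "?v \<ominus>\<^bsub>N\<^esub> ?w" "n + m"] by auto
    then have "(fN ^^ k) ?v \<ominus>\<^bsub>N\<^esub> (fN ^^ k) ?w = \<zero>\<^bsub>N\<^esub>"
      using c by (simp add: ahom_minus[OF N.M.abelian_group_axioms N.M.abelian_group_axioms E.pow_endo])
    then have "(fN ^^ k) ?v = (fN ^^ k) ?w" using c by (simp add: N.M.minus_eq_zero_iff)
    moreover have "(fN ^^ k) ?v \<in> par N 0" "(fN ^^ k) ?w \<in> par N 1" using * by (simp_all add: f_pow_par)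
    ultimately have "(fN ^^ k) ?v = \<zero>\<^bsub>N\<^esub>" using N_graded by (auto simp: graded_def)
    then show "z \<in> {\<zero>\<^bsub>D\<^esub>}" using z(1) c by (auto simp: tw_zero_iff)
  qed
qed

lemma act_par_D: "x \<in> par L i \<Longrightarrow> z \<in> par D j \<Longrightarrow> act D x z \<in> par D (i + j)"
  by (simp only: D_simps D_par_eq Par_act)

end

section \<open>Twisted localization of homomorphisms\<close>

lemma D_mor_tw:
  assumes M: "twisted_localization L f M" and N: "twisted_localization L f N"
    and \<phi>: "\<phi> \<in> gmod_hom gr L M N"
  shows "D_mor L f a M N \<phi> \<in> ahom (D_obj L f a M) (D_obj L f a N)"
    and "\<And>n v. v \<in> carrier M \<Longrightarrow>
      D_mor L f a M N \<phi> (twisted_localization.tw L f M a n v) = twisted_localization.tw L f N a n (\<phi> v)"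
proof -
  interpret M: twisted_localization L f M a by (rule M)
  interpret N: twisted_localization L f N a by (rule N)
  let ?\<beta> = "tensor_map M.UL N.B1.M (U_module N) (\<lambda>w. w) \<phi>"
  have \<phi>h: "\<phi> \<in> ahom M N" by (rule gmod_hom_ahom[OF \<phi>])
  have 1: "(\<lambda>w. w) \<in> ahom M.B1.M N.B1.M" "\<phi> \<in> ahom (U_module M) (U_module N)"
    "(\<lambda>w. w) \<in> ahom M.B2.M N.B2.M"
    by (auto intro!: ahomI simp: ahom_closed[OF \<phi>h] ahom_add[OF \<phi>h])
  have b1: "N.B1.pt (module.smult M.B1.M r m) (\<phi> n) = N.B1.pt m (\<phi> (module.smult (U_module M) r n))"
    if "m \<in> carrier M.B1.M" "r \<in> carrier M.UL" "n \<in> carrier (U_module M)" for m r n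
    using N.B1.pt_balanced[of m r "\<phi> n"] that ahom_closed[OF \<phi>h]
    by (simp add: gmod_hom_U_act[OF M.gmodule_axioms N.gmodule_axioms \<phi>])
  note \<beta> = M.B1.tensor_map[OF N.B1.tensor_product_axioms 1(1,2) b1]
  \<comment> \<open>The inner map commutes with the left action of the localization; this is the
    balance condition of the outer tensor product.\<close>
  have \<beta>l: "?\<beta> (M.B1.lmul r z) = N.B1.lmul r (?\<beta> z)" if r: "r \<in> carrier M.Uf" and z: "z \<in> carrier M.B1.T" for r z
  proof (rule M.B1.ahom_eq_on_pure[OF N.B1.abelian_group_T _ _ _ z])
    show "(\<lambda>z. ?\<beta> (M.B1.lmul r z)) \<in> ahom M.B1.T N.B1.T" by (rule ahom_comp[OF M.B1.lmul_ahom[OF r] \<beta>(1)])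
    show "(\<lambda>z. N.B1.lmul r (?\<beta> z)) \<in> ahom M.B1.T N.B1.T" by (rule ahom_comp[OF \<beta>(1) N.B1.lmul_ahom[OF r]])
    show "?\<beta> (M.B1.lmul r (M.B1.pt m n)) = N.B1.lmul r (?\<beta> (M.B1.pt m n))"
      if "m \<in> carrier M.B1.M" "n \<in> carrier (U_module M)" for m n
      using that r ahom_closed[OF \<phi>h] \<beta>(2)[of m n] \<beta>(2)[of "r \<otimes>\<^bsub>M.Uf\<^esub> m" n] by (simp add: M.B1.lmul_pt N.B1.lmul_pt)
  qed
  have 2: "?\<beta> \<in> ahom (loc_mod L f M) (loc_mod L f N)"
    using \<beta>(1) by (auto intro!: ahomI simp: ahom_closed ahom_add)
  have b2: "N.B2.pt (module.smult M.B2.M r m) (?\<beta> n) = N.B2.pt m (?\<beta> (module.smult (loc_mod L f M) r n))"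
    if "m \<in> carrier M.B2.M" "r \<in> carrier M.Uf" "n \<in> carrier (loc_mod L f M)" for m r n
    using N.B2.pt_balanced[of m r "?\<beta> n"] that ahom_closed[OF \<beta>(1)] by (simp add: \<beta>l)
  note D = M.B2.tensor_map[OF N.B2.tensor_product_axioms 1(3) 2 b2]
  have eq: "D_mor L f a M N \<phi> = tensor_map M.Uf N.B2.M (loc_mod L f N) (\<lambda>w. w) ?\<beta>"
    by (simp add: D_mor_def N.Ufa_eq N.Uf_over_U_eq)
  show "D_mor L f a M N \<phi> \<in> ahom M.D N.D"
    unfolding eq using D(1) by (auto intro!: ahomI simp: ahom_closed ahom_add)
  show "D_mor L f a M N \<phi> (M.tw n v) = N.tw n (\<phi> v)" if "v \<in> carrier M" for n v
    unfolding eq M.tw_def N.tw_def using that D(2)[of "\<one>\<^bsub>M.Uf\<^esub>" "M.tau n v"]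
    \<beta>(2)[of "M.fr n \<one>\<^bsub>M.UL\<^esub>" v]
    by (simp add: M.tau_def N.tau_def M.B1.pt_closed)
qed

subsection \<open>Linear algebra in complex vector spaces\<close>

lemma (in abelian_group) nsum_split:
  "(\<And>i. i < m + n \<Longrightarrow> g i \<in> carrier G) \<Longrightarrow> nsum G g (m + n) = nsum G g m \<oplus> nsum G (\<lambda>k. g (m + k)) n"
  by (induction n) (simp_all add: a_assoc)

context cspace
begin

text \<open>Closure under scalars takes the place of closure under negatives, so the condition
  avoids the additive inverse of the record and transfers between records that share their
  operations.\<close>

definition subsp :: "'v set \<Rightarrow> bool" where
  "subsp W \<longleftrightarrow> W \<subseteq> carrier M \<and> \<zero>\<^bsub>M\<^esub> \<in> W \<and> (\<forall>v\<in>W. \<forall>w\<in>W. v \<oplus>\<^bsub>M\<^esub> w \<in> W) \<and> (\<forall>c. \<forall>v\<in>W. c \<odot> v \<in> W)"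

lemma subspD:
  assumes "subsp W"
  shows "\<And>v. v \<in> W \<Longrightarrow> v \<in> carrier M" "\<zero>\<^bsub>M\<^esub> \<in> W"
    "\<And>v w. v \<in> W \<Longrightarrow> w \<in> W \<Longrightarrow> v \<oplus>\<^bsub>M\<^esub> w \<in> W" "\<And>c v. v \<in> W \<Longrightarrow> c \<odot> v \<in> W"
  using assms by (auto simp: subsp_def)

lemma submodule_iff: "submodule W CC M \<longleftrightarrow> subsp W"
proof
  assume W: "submodule W CC M"
  note E = submoduleE[OF W]
  have s: "c \<odot> v \<in> W" if "v \<in> W" for c v using E(4)[of c v] that by simp
  obtain u where u: "u \<in> W" using E(2) by auto
  then have "\<zero>\<^bsub>M\<^esub> \<in> W" using s[OF u, of 0] E(1) by (simp add: subset_iff)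
  then show "subsp W" using E(1,5) s by (auto simp: subsp_def)
next
  assume W: "subsp W"
  show "submodule W CC M"
  proof (rule submoduleI)
    show "\<ominus>\<^bsub>M\<^esub> v \<in> W" if "v \<in> W" for v
      using subspD(1,4)[OF W] that neg_eq by metis
  qed (use W in \<open>auto simp: subsp_def\<close>)
qed

lemma subsp_cancel: "subsp W \<Longrightarrow> v \<in> carrier M \<Longrightarrow> w \<in> W \<Longrightarrow> v \<oplus>\<^bsub>M\<^esub> w \<in> W \<Longrightarrow> v \<in> W"
proof -
  assume W: "subsp W" and v: "v \<in> carrier M" and w: "w \<in> W" "v \<oplus>\<^bsub>M\<^esub> w \<in> W"
  have "(v \<oplus>\<^bsub>M\<^esub> w) \<oplus>\<^bsub>M\<^esub> (-1) \<odot> w \<in> W" by (intro subspD(3,4)[OF W] w)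
  moreover have "(v \<oplus>\<^bsub>M\<^esub> w) \<oplus>\<^bsub>M\<^esub> (-1) \<odot> w = v"
    using v subspD(1)[OF W w(1)] by (simp add: neg_eq[symmetric] M.a_assoc M.r_neg)
  ultimately show ?thesis by simp
qed

lemma subsp_cancel_smult: "subsp W \<Longrightarrow> v \<in> carrier M \<Longrightarrow> c \<odot> v \<in> W \<Longrightarrow> c \<noteq> 0 \<Longrightarrow> v \<in> W"
  using subspD(4)[of W "c \<odot> v" "1 / c"] by (simp add: s_assoc)

lemma subsp_carrier: "subsp (carrier M)"
  by (auto simp: subsp_def)

lemma subsp_zero: "subsp {\<zero>\<^bsub>M\<^esub>}"
  by (auto simp: subsp_def)

abbreviation "spn \<equiv> lin_span M"

lemma subsp_span: "A \<subseteq> carrier M \<Longrightarrow> subsp (spn A)"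
  unfolding lin_span_def submodule_iff using subsp_carrier by (fastforce simp: subsp_def)

lemma span_incl: "A \<subseteq> spn A"
  unfolding lin_span_def by auto

lemma span_minimal: "subsp W \<Longrightarrow> A \<subseteq> W \<Longrightarrow> spn A \<subseteq> W"
  unfolding lin_span_def submodule_iff by auto

lemma span_mono: "A \<subseteq> B \<Longrightarrow> spn A \<subseteq> spn B"
  unfolding lin_span_def by auto

lemma span_carrier: "A \<subseteq> carrier M \<Longrightarrow> v \<in> spn A \<Longrightarrow> v \<in> carrier M"
  using span_minimal[OF subsp_carrier] by auto

lemma span_insert:
  assumes b: "b \<in> carrier M" and B: "B \<subseteq> carrier M" and v: "v \<in> spn (insert b B)"
  shows "\<exists>c w. w \<in> spn B \<and> v = c \<odot> b \<oplus>\<^bsub>M\<^esub> w"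
proof -
  note S = subsp_span[OF B]
  let ?W = "{c \<odot> b \<oplus>\<^bsub>M\<^esub> w | c w. w \<in> spn B}"
  have "subsp ?W"
    unfolding subsp_def
  proof (intro conjI ballI allI)
    show "?W \<subseteq> carrier M" using b subspD(1)[OF S] by auto
    show "\<zero>\<^bsub>M\<^esub> \<in> ?W" using b subspD(2)[OF S] by (auto intro!: exI[of _ 0] exI[of _ "\<zero>\<^bsub>M\<^esub>"])
    show "v \<oplus>\<^bsub>M\<^esub> w \<in> ?W" if asm: "v \<in> ?W" "w \<in> ?W" for v w
    proof -
      obtain c v' d w' where *: "v' \<in> spn B" "w' \<in> spn B" "v = c \<odot> b \<oplus>\<^bsub>M\<^esub> v'" "w = d \<odot> b \<oplus>\<^bsub>M\<^esub> w'"
        using asm by auto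
      then have "v \<oplus>\<^bsub>M\<^esub> w = (c + d) \<odot> b \<oplus>\<^bsub>M\<^esub> (v' \<oplus>\<^bsub>M\<^esub> w')"
        using b subspD(1)[OF S] by (simp add: s_add_l M.a_ac)
      then show ?thesis using * subspD(3)[OF S] by blast
    qed
    show "c \<odot> v \<in> ?W" if asm: "v \<in> ?W" for c v
    proof -
      obtain d v' where *: "v' \<in> spn B" "v = d \<odot> b \<oplus>\<^bsub>M\<^esub> v'" using asm by auto
      then have "c \<odot> v = (c * d) \<odot> b \<oplus>\<^bsub>M\<^esub> c \<odot> v'"
        using b subspD(1)[OF S] by (simp add: s_add_r s_assoc)
      then show ?thesis using * subspD(4)[OF S] by blast
    qed
  qed
  moreover have "insert b B \<subseteq> ?W"
  proof -
    have "b = 1 \<odot> b \<oplus>\<^bsub>M\<^esub> \<zero>\<^bsub>M\<^esub>" using b by simp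
    moreover have "x = 0 \<odot> b \<oplus>\<^bsub>M\<^esub> x" if "x \<in> B" for x using b B that by auto
    ultimately show ?thesis using subspD(2)[OF S] span_incl[of B] by blast
  qed
  ultimately show ?thesis using span_minimal v by blast
qed

lemma nsum_subsp: "subsp W \<Longrightarrow> (\<And>i. i < d \<Longrightarrow> g i \<in> W) \<Longrightarrow> nsum M g d \<in> W"
  by (induction d) (simp_all add: subspD)

lemma nsum_smult_const: "x \<in> carrier M \<Longrightarrow> nsum M (\<lambda>k. c k \<odot> x) n = (\<Sum>k<n. c k) \<odot> x"
  by (induction n) (simp_all add: s_add_l)

text \<open>Gaussian elimination of one generator b at a time: an entry \<open>u p\<close> with
  non-zero b-coefficient clears b from all later entries, and a relation among these comes from the
  smaller span.\<close>

lemma linear_dependence: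
  assumes "finite B" "B \<subseteq> carrier M" "\<And>k::nat. u k \<in> spn B"
  shows "\<exists>n c. (\<exists>k<n. c k \<noteq> 0) \<and> nsum M (\<lambda>k. c k \<odot> u k) n = \<zero>\<^bsub>M\<^esub>"
  using assms
proof (induction B arbitrary: u rule: finite_induct)
  case empty
  have "u 0 = \<zero>\<^bsub>M\<^esub>" using empty(2)[of 0] span_minimal[OF subsp_zero, of "{}"] by auto
  then show ?case by (intro exI[of _ 1] exI[of _ "\<lambda>_. 1"]) simp
next
  case (insert b B)
  have B: "b \<in> carrier M" "B \<subseteq> carrier M" using insert.prems(1) by auto
  note S = subsp_span[OF B(2)]
  have u: "u k \<in> carrier M" for k using span_carrier[OF insert.prems(1,2)] .
  obtain s w where sw: "\<And>k. w k \<in> spn B" "\<And>k. u k = s k \<odot> b \<oplus>\<^bsub>M\<^esub> w k"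
    using span_insert[OF B insert.prems(2)] by metis
  note w = subspD(1)[OF S sw(1)]
  show ?case
  proof (cases "\<forall>k. s k = 0")
    case True
    then have "u k \<in> spn B" for k using sw B w by simp
    then show ?thesis using insert.IH[OF B(2)] by blast
  next
    case False
    then obtain p where p: "s p \<noteq> 0" by auto
    let ?r = "\<lambda>k. - (s (Suc p + k) / s p)"
    let ?u = "\<lambda>k. u (Suc p + k) \<oplus>\<^bsub>M\<^esub> ?r k \<odot> u p"
    have "?u k \<in> spn B" for k
    proof -
      have "?u k = (s (Suc p + k) + ?r k * s p) \<odot> b \<oplus>\<^bsub>M\<^esub> (w (Suc p + k) \<oplus>\<^bsub>M\<^esub> ?r k \<odot> w p)"
        using B(1) w by (simp only: sw(2) s_add_l s_add_r s_assoc s_closed M.a_ac M.a_closed)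
      also have "s (Suc p + k) + ?r k * s p = 0" using p by simp
      finally show ?thesis using B(1) w sw(1) by (simp add: subspD(3,4)[OF S])
    qed
    then obtain n c where nc: "\<exists>k<n. c k \<noteq> 0" "nsum M (\<lambda>k. c k \<odot> ?u k) n = \<zero>\<^bsub>M\<^esub>"
      using insert.IH[OF B(2), of ?u] by blast
    have "nsum M (\<lambda>k. c k \<odot> ?u k) n = nsum M (\<lambda>k. c k \<odot> u (Suc p + k) \<oplus>\<^bsub>M\<^esub> (c k * ?r k) \<odot> u p) n"
      using u by (intro nsum_cong) (simp add: s_add_r s_assoc)
    also have "\<dots> = nsum M (\<lambda>k. c k \<odot> u (Suc p + k)) n \<oplus>\<^bsub>M\<^esub> (\<Sum>k<n. c k * ?r k) \<odot> u p"
      using u by (simp add: M.nsum_add nsum_smult_const)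
    finally have rel: "nsum M (\<lambda>k. c k \<odot> u (Suc p + k)) n \<oplus>\<^bsub>M\<^esub> (\<Sum>k<n. c k * ?r k) \<odot> u p = \<zero>\<^bsub>M\<^esub>"
      using nc(2) by simp
    \<comment> \<open>The relation pulled back to u: zeros before the pivot, the accumulated
      multipliers at the pivot, c after it.\<close>
    define c' where "c' i = (if i < p then 0 else if i = p then (\<Sum>k<n. c k * ?r k) else c (i - Suc p))" for i
    have "nsum M (\<lambda>k. c' k \<odot> u k) (Suc p + n) = nsum M (\<lambda>k. c' k \<odot> u k) (Suc p) \<oplus>\<^bsub>M\<^esub> nsum M (\<lambda>k. c' (Suc p + k) \<odot> u (Suc p + k)) n"
      using u by (intro M.nsum_split) simp
    also have "nsum M (\<lambda>k. c' k \<odot> u k) (Suc p) = (\<Sum>k<n. c k * ?r k) \<odot> u p"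
      using u by (simp add: c'_def M.nsum_zero)
    also have "nsum M (\<lambda>k. c' (Suc p + k) \<odot> u (Suc p + k)) n = nsum M (\<lambda>k. c k \<odot> u (Suc p + k)) n"
      by (intro nsum_cong) (simp add: c'_def)
    finally have "nsum M (\<lambda>k. c' k \<odot> u k) (Suc p + n) = \<zero>\<^bsub>M\<^esub>"
      using rel u by (simp add: M.a_comm)
    moreover obtain k where "k < n" "c k \<noteq> 0" using nc(1) by auto
    then have "Suc p + k < Suc p + n" "c' (Suc p + k) \<noteq> 0" by (simp_all add: c'_def)
    ultimately show ?thesis by blast
  qed
qed

section \<open>Linear operators and finite-dimensional orbits\<close>

definition lin :: "('v \<Rightarrow> 'v) \<Rightarrow> bool" where
  "lin T \<longleftrightarrow> T \<in> ahom M M \<and> (\<forall>c. \<forall>v\<in>carrier M. T (c \<odot> v) = c \<odot> T v)"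

lemma linD:
  assumes "lin T"
  shows "T \<in> ahom M M" "\<And>v. v \<in> carrier M \<Longrightarrow> T v \<in> carrier M"
    "\<And>v w. v \<in> carrier M \<Longrightarrow> w \<in> carrier M \<Longrightarrow> T (v \<oplus>\<^bsub>M\<^esub> w) = T v \<oplus>\<^bsub>M\<^esub> T w"
    "\<And>c v. v \<in> carrier M \<Longrightarrow> T (c \<odot> v) = c \<odot> T v" "T \<zero>\<^bsub>M\<^esub> = \<zero>\<^bsub>M\<^esub>"
  using assms ahom_closed[of T M M] ahom_add[of T M M] ahom_zero[OF M.abelian_group_axioms M.abelian_group_axioms, of T]
  by (auto simp: lin_def)

lemma lin_pow: "lin T \<Longrightarrow> lin (T ^^ n)"
proof (induction n)
  case 0
  then show ?case by (auto simp: lin_def ahom_def)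
next
  case (Suc n)
  note n = Suc.IH[OF Suc.prems]
  show ?case
    unfolding lin_def
  proof (intro conjI allI ballI)
    show "T ^^ Suc n \<in> ahom M M" by (rule funpow_ahom[OF linD(1)[OF Suc.prems]])
    show "(T ^^ Suc n) (c \<odot> v) = c \<odot> (T ^^ Suc n) v" if "v \<in> carrier M" for c v
      using linD(4)[OF n that] linD(4)[OF Suc.prems linD(2)[OF n that]] by simp
  qed
qed

lemma span_stable:
  assumes T: "lin T" and W: "subsp W" and A: "A \<subseteq> carrier M" "\<And>a. a \<in> A \<Longrightarrow> T a \<in> W" and v: "v \<in> spn A"
  shows "T v \<in> W"
proof -
  have "subsp {v \<in> carrier M. T v \<in> W}"
    using linD[OF T] subspD[OF W] by (auto simp: subsp_def)
  from span_minimal[OF this, of A] show ?thesis using A v by auto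
qed

text \<open>Equivalent to finite dimension of the span of the T-orbit of v by
  \<open>efin_iff\<close>. The stable span may be larger than that of the orbit, so the notion
  passes easily to sums and to images under intertwining maps.\<close>

definition efin :: "('v \<Rightarrow> 'v) \<Rightarrow> 'v \<Rightarrow> bool" where
  "efin T v \<longleftrightarrow> (\<exists>B. finite B \<and> B \<subseteq> carrier M \<and> v \<in> spn B \<and> (\<forall>b\<in>B. T b \<in> spn B))"

lemma efin_pow:
  assumes T: "lin T" and B: "B \<subseteq> carrier M" "v \<in> spn B" "\<And>b. b \<in> B \<Longrightarrow> T b \<in> spn B"
  shows "(T ^^ k) v \<in> spn B"
  by (induction k) (use B span_stable[OF T subsp_span[OF B(1)] B(1,3)] in auto)

text \<open>The relation of \<open>linear_dependence\<close>, cut off after its last non-zero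
  coefficient: then \<open>u n\<close> depends on the earlier entries.\<close>

lemma minimal_relation:
  assumes "finite B" "B \<subseteq> carrier M" "\<And>k::nat. u k \<in> spn B"
  shows "\<exists>n c. c n \<noteq> 0 \<and> nsum M (\<lambda>k. c k \<odot> u k) (Suc n) = \<zero>\<^bsub>M\<^esub>"
proof -
  have u: "u k \<in> carrier M" for k using span_carrier[OF assms(2,3)] .
  obtain n and c :: "nat \<Rightarrow> complex" where nc: "(\<exists>k<n. c k \<noteq> 0) \<and> nsum M (\<lambda>k. c k \<odot> u k) n = \<zero>\<^bsub>M\<^esub>"
    using linear_dependence[OF assms(1,2), of u, OF assms(3)] by (elim exE)
  then have "\<exists>k<n. c k \<noteq> 0" "nsum M (\<lambda>k. c k \<odot> u k) n = \<zero>\<^bsub>M\<^esub>" by simp_all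
  then show ?thesis
  proof (induction n)
    case (Suc n)
    show ?case
    proof (cases "c n = 0")
      case True
      then have "\<exists>k<n. c k \<noteq> 0" using Suc.prems(1) by (metis less_antisym)
      moreover have "nsum M (\<lambda>k. c k \<odot> u k) n = \<zero>\<^bsub>M\<^esub>"
        using Suc.prems(2) True u by simp
      ultimately show ?thesis by (rule Suc.IH)
    qed (use Suc in blast)
  qed simp
qed

text \<open>For the converse, the orbit lies in a finite span, so some T^n v depends on the lower
  powers; these n vectors span a T-stable space, which contains the whole orbit.\<close>

lemma efin_iff:
  assumes T: "lin T" and v: "v \<in> carrier M"
  shows "fin_dim M (spn (range (\<lambda>k. (T ^^ k) v))) \<longleftrightarrow> efin T v"
proof
  let ?R = "range (\<lambda>k. (T ^^ k) v)"
  have R: "?R \<subseteq> carrier M" using linD(2)[OF lin_pow[OF T]] v by auto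
  {
    assume "fin_dim M (spn ?R)"
    then obtain B where B: "finite B" "B \<subseteq> spn ?R" "spn ?R = spn B" by (auto simp: fin_dim_def)
    have "B \<subseteq> carrier M" using B(2) span_carrier[OF R] by auto
    moreover have "v \<in> spn B" using B(3) span_incl[of ?R] funpow_0[of T v] by (metis rangeI subsetD)
    moreover have "T b \<in> spn B" if "b \<in> B" for b
    proof -
      have "T ((T ^^ k) v) \<in> ?R" for k using rangeI[of "\<lambda>k. (T ^^ k) v" "Suc k"] by simp
      then have "T r \<in> spn ?R" if "r \<in> ?R" for r using that span_incl[of ?R] by auto
      then show ?thesis using span_stable[OF T subsp_span[OF R] R] B that by auto
    qed
    ultimately show "efin T v" using B(1) by (auto simp: efin_def)
  }
  assume "efin T v"
  then obtain B where B: "finite B" "B \<subseteq> carrier M" "v \<in> spn B" "\<And>b. b \<in> B \<Longrightarrow> T b \<in> spn B"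
    by (auto simp: efin_def)
  have pw: "(T ^^ k) v \<in> spn B" for k by (rule efin_pow[OF T B(2,3,4)])
  obtain n c where nc: "c n \<noteq> 0" "nsum M (\<lambda>k. c k \<odot> (T ^^ k) v) (Suc n) = \<zero>\<^bsub>M\<^esub>"
    using minimal_relation[where u = "\<lambda>k. (T ^^ k) v", OF B(1,2) pw] by (elim exE conjE)
  let ?S = "(\<lambda>k. (T ^^ k) v) ` {..<n}"
  have S: "?S \<subseteq> carrier M" using R by auto
  note W = subsp_span[OF S]
  have "nsum M (\<lambda>k. c k \<odot> (T ^^ k) v) n \<in> spn ?S"
    using span_incl[of ?S] by (intro nsum_subsp[OF W] subspD(4)[OF W]) auto
  moreover have Tn: "(T ^^ k) v \<in> carrier M" for k using linD(2)[OF lin_pow[OF T] v] .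
  ultimately have "c n \<odot> (T ^^ n) v \<in> spn ?S"
    using subsp_cancel[OF W, of "c n \<odot> (T ^^ n) v" "nsum M (\<lambda>k. c k \<odot> (T ^^ k) v) n"] nc(2) R
      subspD(1,2)[OF W] by (simp add: M.a_comm)
  then have n: "(T ^^ n) v \<in> spn ?S" using subsp_cancel_smult[OF W Tn _ nc(1)] by blast
  have st: "T b \<in> spn ?S" if asm: "b \<in> ?S" for b
  proof -
    obtain k where k: "k < n" "b = (T ^^ k) v" using asm by auto
    show ?thesis
    proof (cases "Suc k = n")
      case False
      then have "T b \<in> ?S" using k by (auto intro!: image_eqI[of _ _ "Suc k"])
      then show ?thesis by (rule subsetD[OF span_incl])
    qed (use n k in auto)
  qed
  have "(T ^^ k) v \<in> spn ?S" for k
  \<comment> \<open>For n = 0 the set of generators is empty and the relation says that v itself is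
    zero.\<close>
  proof (cases "n = 0")
    case True
    then have "v = \<zero>\<^bsub>M\<^esub>" using n span_minimal[OF subsp_zero, of "{}"] by auto
    then show ?thesis using linD(5)[OF lin_pow[OF T]] subspD(2)[OF W] by simp
  next
    case False
    then have "v \<in> ?S" by (auto intro!: image_eqI[of _ _ 0])
    then have "v \<in> spn ?S" by (rule subsetD[OF span_incl])
    then show ?thesis by (rule efin_pow[OF T S _ st])
  qed
  then have "spn ?R = spn ?S"
    using span_minimal[OF W, of ?R] span_mono[of ?S ?R] by auto
  then show "fin_dim M (spn ?R)"
    unfolding fin_dim_def using span_incl[of ?S] by (intro exI[of _ ?S]) auto
qed

lemma efin_add: "v \<in> carrier M \<Longrightarrow> w \<in> carrier M \<Longrightarrow> efin T v \<Longrightarrow> efin T w \<Longrightarrow> efin T (v \<oplus>\<^bsub>M\<^esub> w)"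
proof -
  assume "efin T v" "efin T w"
  then obtain B C where B: "finite B" "B \<subseteq> carrier M" "v \<in> spn B" "\<forall>b\<in>B. T b \<in> spn B"
    and C: "finite C" "C \<subseteq> carrier M" "w \<in> spn C" "\<forall>b\<in>C. T b \<in> spn C"
    by (auto simp: efin_def)
  have "spn B \<subseteq> spn (B \<union> C)" "spn C \<subseteq> spn (B \<union> C)" by (auto intro!: span_mono)
  then show "efin T (v \<oplus>\<^bsub>M\<^esub> w)"
    unfolding efin_def using B C subspD(3)[OF subsp_span, of "B \<union> C"]
    by (intro exI[of _ "B \<union> C"]) blast
qed

lemma efin_smult: "efin T v \<Longrightarrow> efin T (c \<odot> v)"
  unfolding efin_def using subspD(4)[OF subsp_span] by blast

lemma efin_zero: "efin T \<zero>\<^bsub>M\<^esub>"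
  unfolding efin_def using subspD(2)[OF subsp_span, of "{}"] by (intro exI[of _ "{}"]) simp

lemma subsp_efin: "subsp {v \<in> carrier M. efin T v}"
  using efin_add efin_smult efin_zero by (auto simp: subsp_def)

lemma efin_nilpotent:
  assumes T: "lin T" and v: "v \<in> carrier M" "(T ^^ n) v = \<zero>\<^bsub>M\<^esub>"
  shows "efin T v"
proof -
  let ?S = "(\<lambda>k. (T ^^ k) v) ` {..n}"
  have S: "?S \<subseteq> carrier M" using linD(2)[OF lin_pow[OF T]] v by auto
  have "T b \<in> spn ?S" if asm: "b \<in> ?S" for b
  proof -
    obtain k where k: "k \<le> n" "b = (T ^^ k) v" using asm by auto
    show ?thesis
    proof (cases "k = n")
      case True
      then have "T b = \<zero>\<^bsub>M\<^esub>" using k(2) v(2) linD(5)[OF T] by simp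
      then show ?thesis using subspD(2)[OF subsp_span[OF S]] by simp
    next
      case False
      then have "T b \<in> ?S" using k by (auto intro!: image_eqI[of _ _ "Suc k"])
      then show ?thesis by (rule subsetD[OF span_incl])
    qed
  qed
  moreover have "v \<in> spn ?S" using span_incl[of ?S] by (auto intro!: image_eqI[of _ _ 0])
  ultimately show ?thesis using S unfolding efin_def by (intro exI[of _ ?S]) auto
qed

text \<open>The product of the operators T - \<alpha>, kept as a list of roots: multiplicities are
  allowed, and coprimality becomes disjointness of sets. The last entry of the list acts
  first.\<close>

primrec pr :: "('v \<Rightarrow> 'v) \<Rightarrow> complex list \<Rightarrow> 'v \<Rightarrow> 'v" where
  "pr T [] w = w"
| "pr T (\<alpha> # \<alpha>s) w = T (pr T \<alpha>s w) \<oplus>\<^bsub>M\<^esub> (- \<alpha>) \<odot> pr T \<alpha>s w"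

lemma pr_lin: "lin T \<Longrightarrow> lin (pr T \<alpha>s)"
proof (induction \<alpha>s)
  case Nil
  then show ?case by (auto simp: lin_def ahom_def)
next
  case (Cons \<alpha> \<alpha>s)
  note a = linD[OF Cons.prems] and b = linD[OF Cons.IH[OF Cons.prems]]
  show ?case
    unfolding lin_def
    by (intro conjI ahomI allI ballI) (simp_all add: a b s_add_r s_assoc M.a_ac mult.commute)
qed

lemma pr_append: "pr T (xs @ ys) w = pr T xs (pr T ys w)"
  by (induction xs) simp_all

lemma pr_stable:
  assumes "lin T" "subsp B" "\<And>v. v \<in> B \<Longrightarrow> T v \<in> B" "w \<in> B"
  shows "pr T \<alpha>s w \<in> B"
  by (induction \<alpha>s) (use assms subspD in auto)

lemma pr_step_comm:
  assumes T: "lin T" and w: "w \<in> carrier M"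
  shows "pr T \<alpha>s (T w \<oplus>\<^bsub>M\<^esub> (- \<beta>) \<odot> w) = T (pr T \<alpha>s w) \<oplus>\<^bsub>M\<^esub> (- \<beta>) \<odot> pr T \<alpha>s w"
proof (induction \<alpha>s)
  case (Cons \<alpha> \<alpha>s)
  note a = linD[OF T] and b = linD[OF pr_lin[OF T, of \<alpha>s]]
  have "pr T \<alpha>s w \<in> carrier M" using b w by simp
  then show ?case using Cons by (simp add: a s_add_r s_assoc M.a_ac mult.commute)
qed simp

lemma pr_comm:
  assumes T: "lin T" and w: "w \<in> carrier M"
  shows "pr T xs (pr T ys w) = pr T ys (pr T xs w)"
proof (induction ys)
  case (Cons y ys)
  then show ?case using pr_step_comm[OF T, of "pr T ys w" xs y] linD(2)[OF pr_lin[OF T] w] by simp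
qed simp

lemma pr_rev:
  assumes T: "lin T" and w: "w \<in> carrier M"
  shows "pr T (rev xs) w = pr T xs w"
proof (induction xs)
  case (Cons x xs)
  then show ?case using pr_comm[OF T w, of "rev xs" "[x]"] by (simp add: pr_append)
qed simp

text \<open>Modulo \<open>B\<close> the vector \<open>pr T \<alpha>s w\<close> is an eigenvector of \<open>T\<close>, on which
  the second product acts by a non-zero scalar.\<close>

lemma coprime_annihilators:
  assumes T: "lin T" and B: "subsp B" "\<And>v. v \<in> B \<Longrightarrow> T v \<in> B"
    and w: "w \<in> carrier M" "pr T \<alpha>s w \<in> B" "pr T \<beta>s w \<in> B" and disj: "set \<alpha>s \<inter> set \<beta>s = {}"
  shows "w \<in> B"
  using w(2) disj
proof (induction \<alpha>s)
  case (Cons \<alpha> \<alpha>s)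
  define u where "u = pr T \<alpha>s w"
  have u: "u \<in> carrier M" using linD(2)[OF pr_lin[OF T] w(1)] by (simp add: u_def)
  have au: "T u \<oplus>\<^bsub>M\<^esub> (- \<alpha>) \<odot> u \<in> B" using Cons.prems by (simp add: u_def)
  have bu: "pr T \<beta>s u \<in> B"
    unfolding u_def pr_comm[OF T w(1), of \<beta>s \<alpha>s] by (rule pr_stable[OF T B w(3)])
  have "\<exists>z\<in>B. pr T bs u = prod_list (map (\<lambda>\<beta>. \<alpha> - \<beta>) bs) \<odot> u \<oplus>\<^bsub>M\<^esub> z" for bs
  proof (induction bs)
    case Nil
    then show ?case using u subspD(2)[OF B(1)] by (intro bexI[of _ "\<zero>\<^bsub>M\<^esub>"]) simp_all
  next
    case (Cons b bs)
    then obtain z where z: "z \<in> B" "pr T bs u = prod_list (map (\<lambda>\<beta>. \<alpha> - \<beta>) bs) \<odot> u \<oplus>\<^bsub>M\<^esub> z" by blast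
    let ?p = "prod_list (map (\<lambda>\<beta>. \<alpha> - \<beta>) bs)"
    let ?z = "?p \<odot> (T u \<oplus>\<^bsub>M\<^esub> (- \<alpha>) \<odot> u) \<oplus>\<^bsub>M\<^esub> (T z \<oplus>\<^bsub>M\<^esub> (- b) \<odot> z)"
    have zc: "z \<in> carrier M" by (rule subspD(1)[OF B(1) z(1)])
    define x where "x = T u \<oplus>\<^bsub>M\<^esub> (- \<alpha>) \<odot> u"
    have x: "x \<in> carrier M" using u linD(2)[OF T u] by (simp add: x_def)
    have Tu: "T u = \<alpha> \<odot> u \<oplus>\<^bsub>M\<^esub> x"
      using u linD(2)[OF T u] by (simp add: x_def s_neg M.a_lcomm[of "\<alpha> \<odot> u"] M.r_neg)
    have sc: "((\<alpha> - b) * ?p) \<odot> u = (?p * \<alpha>) \<odot> u \<oplus>\<^bsub>M\<^esub> (- (b * ?p)) \<odot> u"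
      using u by (simp add: s_add_l[symmetric] algebra_simps)
    have "pr T (b # bs) u = ((\<alpha> - b) * ?p) \<odot> u \<oplus>\<^bsub>M\<^esub> ?z"
      unfolding x_def[symmetric] sc using u zc x linD(2)[OF T zc]
      by (simp add: z(2) linD[OF T] Tu s_add_r s_assoc M.a_ac)
    moreover have "?z \<in> B" using au z(1) B(2) subspD[OF B(1)] by simp
    ultimately show ?case by auto
  qed
  from this[of \<beta>s] obtain z where z: "z \<in> B" "pr T \<beta>s u = prod_list (map (\<lambda>\<beta>. \<alpha> - \<beta>) \<beta>s) \<odot> u \<oplus>\<^bsub>M\<^esub> z" by blast
  have "prod_list (map (\<lambda>\<beta>. \<alpha> - \<beta>) \<beta>s) \<odot> u \<in> B"
    using subsp_cancel[OF B(1) _ z(1)] z(2) bu u by simp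
  moreover have "prod_list (map (\<lambda>\<beta>. \<alpha> - \<beta>) \<beta>s) \<noteq> 0"
    using Cons.prems(2) by (auto simp: prod_list_zero_iff)
  ultimately have "u \<in> B" by (rule subsp_cancel_smult[OF B(1) u])
  then show ?case using Cons by (simp add: u_def)
qed (use w in simp)

text \<open>The value of a polynomial at T; it serves to turn a linear relation between the T^k b
  into a product of linear factors, by the fundamental theorem of algebra.\<close>

definition poly_op :: "('v \<Rightarrow> 'v) \<Rightarrow> complex poly \<Rightarrow> 'v \<Rightarrow> 'v" where
  "poly_op T p v = fold_coeffs (\<lambda>c w. c \<odot> v \<oplus>\<^bsub>M\<^esub> T w) p \<zero>\<^bsub>M\<^esub>"

lemma poly_op_zero: "poly_op T 0 v = \<zero>\<^bsub>M\<^esub>"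
  by (simp add: poly_op_def)

lemma poly_op_pCons: "lin T \<Longrightarrow> v \<in> carrier M \<Longrightarrow> poly_op T (pCons c p) v = c \<odot> v \<oplus>\<^bsub>M\<^esub> T (poly_op T p v)"
  by (cases "p = 0 \<and> c = 0") (auto simp: poly_op_def linD)

lemma poly_op_closed: "lin T \<Longrightarrow> v \<in> carrier M \<Longrightarrow> poly_op T p v \<in> carrier M"
  by (induction p) (simp_all add: poly_op_zero poly_op_pCons linD)

lemma poly_op_add: "lin T \<Longrightarrow> v \<in> carrier M \<Longrightarrow> poly_op T (p + q) v = poly_op T p v \<oplus>\<^bsub>M\<^esub> poly_op T q v"
  by (induction p q rule: poly_induct2)
    (simp_all add: poly_op_zero poly_op_pCons linD poly_op_closed s_add_l M.a_ac)

lemma poly_op_smult: "lin T \<Longrightarrow> v \<in> carrier M \<Longrightarrow> poly_op T (Polynomial.smult c p) v = c \<odot> poly_op T p v"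
  by (induction p) (simp_all add: poly_op_zero poly_op_pCons linD poly_op_closed s_add_r s_assoc)

lemma poly_op_pr:
  assumes T: "lin T" and "p \<noteq> 0"
  shows "\<exists>c \<alpha>s. c \<noteq> 0 \<and> (\<forall>v\<in>carrier M. poly_op T p v = c \<odot> pr T \<alpha>s v)"
  using assms(2)
proof (induction "degree p" arbitrary: p)
  case 0
  then obtain c where "p = [:c:]" "c \<noteq> 0" by (metis degree_eq_zeroE pCons_0_0)
  then show ?case using T by (intro exI[of _ c] exI[of _ "[]"]) (simp add: poly_op_pCons poly_op_zero linD)
next
  case (Suc n)
  obtain \<alpha> where "poly p \<alpha> = 0"
    using fundamental_theorem_of_algebra[of p] Suc.hyps(2) constant_degree[of p] by auto
  then obtain q where q: "p = [:- \<alpha>, 1:] * q" by (meson dvdE poly_eq_0_iff_dvd)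
  then have q0: "q \<noteq> 0" using Suc.prems by auto
  have "degree p = 1 + degree q"
    unfolding q using degree_mult_eq[of "[:- \<alpha>, 1:]" q] q0 by (simp del: mult_pCons_left)
  then have "degree q = n" using Suc.hyps(2) by simp
  with q0 obtain c \<alpha>s where c: "c \<noteq> 0" "\<forall>v\<in>carrier M. poly_op T q v = c \<odot> pr T \<alpha>s v"
    using Suc.hyps(1)[of q] by blast
  have "poly_op T p v = c \<odot> pr T (\<alpha> # \<alpha>s) v" if v: "v \<in> carrier M" for v
  proof -
    have "p = Polynomial.smult (- \<alpha>) q + pCons 0 q" by (simp add: q)
    then have "poly_op T p v = (- \<alpha>) \<odot> poly_op T q v \<oplus>\<^bsub>M\<^esub> T (poly_op T q v)"
      using v T by (simp only: poly_op_add poly_op_smult poly_op_pCons s_zero M.l_zero linD poly_op_closed)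
    then show ?thesis using c(2) v linD[OF T] linD(2)[OF pr_lin[OF T] v]
      by (simp add: s_add_r s_assoc M.a_comm mult.commute)
  qed
  then show ?case using c(1) by blast
qed

lemma poly_op_monom: "lin T \<Longrightarrow> v \<in> carrier M \<Longrightarrow> poly_op T (Polynomial.monom c k) v = c \<odot> (T ^^ k) v"
  by (induction k) (simp_all add: Polynomial.monom_0 Polynomial.monom_Suc poly_op_pCons poly_op_zero linD linD(2)[OF lin_pow])

text \<open>Each generator satisfies a linear relation, hence is killed by some \<open>pr\<close>;
  since such products commute, the concatenation of the lists kills all generators.\<close>

lemma annihilator_exists:
  assumes T: "lin T" and B: "finite B" "B \<subseteq> carrier M" "\<And>b. b \<in> B \<Longrightarrow> T b \<in> spn B"
  shows "\<exists>\<alpha>s. \<forall>v\<in>spn B. pr T \<alpha>s v = \<zero>\<^bsub>M\<^esub>"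
proof -
  have 1: "\<exists>\<alpha>s. pr T \<alpha>s b = \<zero>\<^bsub>M\<^esub>" if b: "b \<in> B" for b
  proof -
    have bc: "b \<in> carrier M" using b B by auto
    have "b \<in> spn B" using b span_incl by auto
    then have pw: "(T ^^ k) b \<in> spn B" for k by (rule efin_pow[OF T B(2) _ B(3)])
    obtain n c where nc: "c n \<noteq> 0" "nsum M (\<lambda>k. c k \<odot> (T ^^ k) b) (Suc n) = \<zero>\<^bsub>M\<^esub>"
      using minimal_relation[where u = "\<lambda>k. (T ^^ k) b", OF B(1,2) pw] by (elim exE conjE)
    let ?p = "\<lambda>m. \<Sum>k<m. Polynomial.monom (c k) k"
    have po: "poly_op T (?p m) b = nsum M (\<lambda>k. c k \<odot> (T ^^ k) b) m" for m
      by (induction m) (simp_all add: poly_op_zero poly_op_add[OF T bc] poly_op_monom[OF T bc])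
    have z: "poly_op T (?p (Suc n)) b = \<zero>\<^bsub>M\<^esub>" unfolding po by (rule nc(2))
    have "Polynomial.coeff (?p (Suc n)) n = c n"
      by (simp add: Polynomial.coeff_sum)
    then have "?p (Suc n) \<noteq> 0" using nc(1) by (metis Polynomial.coeff_0)
    then obtain d \<alpha>s where "d \<noteq> 0" "poly_op T (?p (Suc n)) b = d \<odot> pr T \<alpha>s b"
      using poly_op_pr[OF T] bc by blast
    then show ?thesis using z s_eq_zero[of "pr T \<alpha>s b" d] linD(2)[OF pr_lin[OF T] bc] by auto
  qed
  have "\<exists>\<alpha>s. \<forall>b\<in>C. pr T \<alpha>s b = \<zero>\<^bsub>M\<^esub>" if "finite C" "C \<subseteq> B" for C
    using that
  proof (induction C rule: finite_induct)
    case (insert b C)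
    then obtain \<alpha>s \<beta>s where *: "\<forall>b\<in>C. pr T \<alpha>s b = \<zero>\<^bsub>M\<^esub>" "pr T \<beta>s b = \<zero>\<^bsub>M\<^esub>"
      using 1[of b] by auto
    have "pr T (\<alpha>s @ \<beta>s) x = \<zero>\<^bsub>M\<^esub>" if "x \<in> insert b C" for x
    proof (cases "x = b")
      case False
      then have "x \<in> C" "x \<in> carrier M" using that insert B by auto
      then show ?thesis using * pr_comm[OF T, of x \<alpha>s \<beta>s] linD(5)[OF pr_lin[OF T]] by (simp add: pr_append)
    qed (use * linD(5)[OF pr_lin[OF T]] in \<open>simp add: pr_append\<close>)
    then show ?case by blast
  qed auto
  then obtain \<alpha>s where a: "\<forall>b\<in>B. pr T \<alpha>s b = \<zero>\<^bsub>M\<^esub>" using B(1) by blast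
  have "pr T \<alpha>s v \<in> {\<zero>\<^bsub>M\<^esub>}" if "v \<in> spn B" for v
    by (rule span_stable[OF pr_lin[OF T] subsp_zero B(2) _ that]) (use a in simp)
  then show ?thesis by blast
qed

text \<open>Let the list \<alpha>s of roots of H annihilate the span. It annihilates F^k v, and so
  does its translate by k \<delta>, since F^k shifts the roots. For a suitable k the two lists are
  disjoint, and \<open>coprime_annihilators\<close> gives F^k v = 0.\<close>

lemma shift_operator_nilpotent:
  assumes H: "lin H" and F: "lin F" and comm: "\<And>v. v \<in> carrier M \<Longrightarrow> H (F v) = F (H v) \<oplus>\<^bsub>M\<^esub> \<delta> \<odot> F v"
    and \<delta>: "\<delta> \<noteq> 0" and B: "finite B" "B \<subseteq> carrier M" "\<And>b. b \<in> B \<Longrightarrow> H b \<in> spn B" "\<And>b. b \<in> B \<Longrightarrow> F b \<in> spn B"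
    and v: "v \<in> spn B"
  shows "\<exists>k. (F ^^ k) v = \<zero>\<^bsub>M\<^esub>"
proof -
  obtain \<alpha>s where a: "\<And>v. v \<in> spn B \<Longrightarrow> pr H \<alpha>s v = \<zero>\<^bsub>M\<^esub>"
    using annihilator_exists[OF H B(1-3)] by blast
  have vc: "v \<in> carrier M" by (rule span_carrier[OF B(2) v])
  have sh: "pr H (map (\<lambda>\<alpha>. \<alpha> + \<delta>) xs) (F w) = F (pr H xs w)" if w: "w \<in> carrier M" for xs w
  proof (induction xs)
    case (Cons x xs)
    have "pr H xs w \<in> carrier M" by (rule linD(2)[OF pr_lin[OF H] w])
    then show ?case using Cons
      by (simp add: comm linD[OF H] linD[OF F] s_add_l[symmetric] M.a_assoc)
  qed simp
  have shk: "pr H (map (\<lambda>\<alpha>. \<alpha> + of_nat k * \<delta>) xs) ((F ^^ k) w) = (F ^^ k) (pr H xs w)" if w: "w \<in> carrier M" for xs w k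
  proof (induction k)
    case (Suc k)
    have m: "map (\<lambda>\<alpha>. \<alpha> + of_nat (Suc k) * \<delta>) xs = map (\<lambda>\<alpha>. \<alpha> + \<delta>) (map (\<lambda>\<alpha>. \<alpha> + of_nat k * \<delta>) xs)"
      by (simp add: algebra_simps)
    have "pr H (map (\<lambda>\<alpha>. \<alpha> + \<delta>) (map (\<lambda>\<alpha>. \<alpha> + of_nat k * \<delta>) xs)) (F ((F ^^ k) w))
        = F (pr H (map (\<lambda>\<alpha>. \<alpha> + of_nat k * \<delta>) xs) ((F ^^ k) w))"
      by (rule sh) (rule linD(2)[OF lin_pow[OF F] w])
    then show ?case unfolding m Suc by simp
  qed simp
  \<comment> \<open>As \<delta> is not zero, a pair of roots determines k, so only finitely many k
    make the two lists meet.\<close>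
  have "finite {k::nat. \<exists>x\<in>set \<alpha>s. \<exists>y\<in>set \<alpha>s. x = y + of_nat k * \<delta>}"
  proof (rule finite_subset)
    show "{k::nat. \<exists>x\<in>set \<alpha>s. \<exists>y\<in>set \<alpha>s. x = y + of_nat k * \<delta>} \<subseteq> (\<lambda>(x, y). THE k::nat. of_nat k = (x - y) / \<delta>) ` (set \<alpha>s \<times> set \<alpha>s)"
    proof
      fix k :: nat assume "k \<in> {k::nat. \<exists>x\<in>set \<alpha>s. \<exists>y\<in>set \<alpha>s. x = y + of_nat k * \<delta>}"
      then obtain x y where "x \<in> set \<alpha>s" "y \<in> set \<alpha>s" "x = y + of_nat k * \<delta>" by auto
      moreover from this have "(x - y) / \<delta> = of_nat k" using \<delta> by simp
      ultimately show "k \<in> (\<lambda>(x, y). THE k::nat. of_nat k = (x - y) / \<delta>) ` (set \<alpha>s \<times> set \<alpha>s)"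
        by (intro image_eqI[of _ _ "(x, y)"]) auto
    qed
  qed simp
  then obtain k :: nat where k: "k \<notin> {k::nat. \<exists>x\<in>set \<alpha>s. \<exists>y\<in>set \<alpha>s. x = y + of_nat k * \<delta>}"
    using infinite_UNIV_nat by (metis (no_types, lifting) ex_new_if_finite)
  have "(F ^^ k) v \<in> {\<zero>\<^bsub>M\<^esub>}"
  proof (rule coprime_annihilators[OF H subsp_zero])
    show "(F ^^ k) v \<in> carrier M" by (rule linD(2)[OF lin_pow[OF F] vc])
    show "pr H \<alpha>s ((F ^^ k) v) \<in> {\<zero>\<^bsub>M\<^esub>}" using a[OF efin_pow[OF F B(2) v B(4)]] by simp
    show "pr H (map (\<lambda>\<alpha>. \<alpha> + of_nat k * \<delta>) \<alpha>s) ((F ^^ k) v) \<in> {\<zero>\<^bsub>M\<^esub>}"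
      using shk[OF vc, of k \<alpha>s] a[OF v] linD(5)[OF lin_pow[OF F]] by simp
    show "set \<alpha>s \<inter> set (map (\<lambda>\<alpha>. \<alpha> + of_nat k * \<delta>) \<alpha>s) = {}" using k by auto
  qed (simp add: linD[OF H])
  then show ?thesis by auto
qed

text \<open>Applying T - \<open>ev j\<close> to the sum removes the j-th component and multiplies
  the others by non-zero scalars, which reduces the claim to a smaller index set.\<close>

lemma eigen_components:
  assumes T: "lin T" and B: "subsp B" "\<And>v. v \<in> B \<Longrightarrow> T v \<in> B"
    and "finite I" "inj_on ev I" "\<And>i. i \<in> I \<Longrightarrow> g i \<in> carrier M" "\<And>i. i \<in> I \<Longrightarrow> T (g i) = ev i \<odot> g i"
    and "finsum M g I \<in> B" "i \<in> I"
  shows "g i \<in> B"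
  using assms(4-9)
proof (induction I arbitrary: g i rule: finite_induct)
  case (insert j I)
  have gj: "g j \<in> carrier M" and gI: "g \<in> I \<rightarrow> carrier M" using insert by auto
  let ?s = "finsum M g I"
  have s: "?s \<in> carrier M" by (rule M.finsum_closed[OF gI])
  have z: "finsum M g (insert j I) = g j \<oplus>\<^bsub>M\<^esub> ?s" using insert gj gI by simp
  have Ts: "T ?s = finsum M (\<lambda>i. T (g i)) I"
    by (rule ahom_finsum[OF M.abelian_group_axioms M.abelian_group_axioms linD(1)[OF T] gI])
  have "T (g j \<oplus>\<^bsub>M\<^esub> ?s) \<oplus>\<^bsub>M\<^esub> (- ev j) \<odot> (g j \<oplus>\<^bsub>M\<^esub> ?s) \<in> B"
    using insert.prems(4) B subspD[OF B(1)] unfolding z by simp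
  also have "T (g j \<oplus>\<^bsub>M\<^esub> ?s) \<oplus>\<^bsub>M\<^esub> (- ev j) \<odot> (g j \<oplus>\<^bsub>M\<^esub> ?s) = T ?s \<oplus>\<^bsub>M\<^esub> (- ev j) \<odot> ?s"
    using s gj insert.prems(3)[of j] linD(2)[OF T s]
    by (simp add: linD[OF T] s_add_r s_neg M.a_ac M.r_neg2)
  also have "\<dots> = finsum M (\<lambda>i. (ev i - ev j) \<odot> g i) I"
  proof -
    have "(- ev j) \<odot> ?s = finsum M (\<lambda>i. (- ev j) \<odot> g i) I"
      by (rule ahom_finsum[OF M.abelian_group_axioms M.abelian_group_axioms smult_ahom gI])
    then have "T ?s \<oplus>\<^bsub>M\<^esub> (- ev j) \<odot> ?s = finsum M (\<lambda>i. T (g i) \<oplus>\<^bsub>M\<^esub> (- ev j) \<odot> g i) I"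
      unfolding Ts using gI linD(2)[OF T] by (subst M.finsum_addf) (auto simp: Pi_def)
    also have "\<dots> = finsum M (\<lambda>i. (ev i - ev j) \<odot> g i) I"
      using gI insert.prems(3) s_add_l by (intro M.finsum_cong') (auto simp: Pi_def s_add_l[symmetric])
    finally show ?thesis .
  qed
  finally have B': "finsum M (\<lambda>i. (ev i - ev j) \<odot> g i) I \<in> B" .
  have 1: "g k \<in> B" if k: "k \<in> I" for k
  proof -
    have "(ev k - ev j) \<odot> g k \<in> B"
    proof (rule insert.IH[OF _ _ _ B' k])
      show "inj_on ev I" using insert.prems(1) by auto
      show "(ev i - ev j) \<odot> g i \<in> carrier M" if "i \<in> I" for i using that gI by auto
      show "T ((ev i - ev j) \<odot> g i) = ev i \<odot> ((ev i - ev j) \<odot> g i)" if "i \<in> I" for i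
        using that gI insert.prems(3)[of i] linD(4)[OF T, of "g i"] by (auto simp: s_assoc mult.commute Pi_iff)
    qed
    moreover have "ev k \<noteq> ev j" using insert.prems(1) insert.hyps k by (auto simp: inj_on_def)
    moreover have "g k \<in> carrier M" using gI k by auto
    ultimately show ?thesis using subsp_cancel_smult[OF B(1), of "g k" "ev k - ev j"] by simp
  qed
  have "finsum M g J \<in> B" if "finite J" "J \<subseteq> I" for J
    using that
  proof (induction J rule: finite_induct)
    case (insert k J)
    then show ?case using 1 gI subspD(3)[OF B(1)] by (subst M.finsum_insert) (auto simp: Pi_def)
  qed (simp add: subspD(2)[OF B(1)])
  then have "?s \<in> B" using insert.hyps by blast
  then have "g j \<in> B" using subsp_cancel[OF B(1) gj] insert.prems(4) z by simp
  then show ?case using 1 insert.prems(5) by auto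
qed simp

text \<open>The family g consists of weight vectors at every integer, also outside I, so weight
  statements about \<open>g n\<close> hold unconditionally. To add two decompositions, both families
  are padded by zero vectors.\<close>

lemma weight_decomposition:
  assumes "v \<in> spn {v \<in> carrier M. \<exists>n::int. T v = (b + of_int n) \<odot> v}" and T: "lin T"
  shows "\<exists>I g. finite I \<and> (\<forall>n. g n \<in> carrier M \<and> T (g n) = (b + of_int n) \<odot> g n) \<and> v = finsum M g I"
proof -
  let ?A = "{v \<in> carrier M. \<exists>n::int. T v = (b + of_int n) \<odot> v}"
  let ?P = "\<lambda>I g. finite I \<and> (\<forall>n. g n \<in> carrier M \<and> T (g n) = (b + of_int n) \<odot> g n)"
  let ?W = "{finsum M g I | I g. ?P I g}"
  have one: "v \<in> ?W" if "v \<in> carrier M" "T v = (b + of_int n) \<odot> v" for v n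
  proof -
    have "v = finsum M (\<lambda>m. if m = n then v else \<zero>\<^bsub>M\<^esub>) {n}"
      using that(1) M.finsum_insert[of "{}" n "\<lambda>m. if m = n then v else \<zero>\<^bsub>M\<^esub>"] by simp
    then show ?thesis using that by (intro CollectI exI[of _ "{n}"] exI[of _ "\<lambda>m. if m = n then v else \<zero>\<^bsub>M\<^esub>"]) (simp add: linD[OF T])
  qed
  have "subsp ?W"
    unfolding subsp_def
  proof (intro conjI ballI allI)
    show "?W \<subseteq> carrier M" by (auto intro!: M.finsum_closed)
    show "\<zero>\<^bsub>M\<^esub> \<in> ?W" using one[of "\<zero>\<^bsub>M\<^esub>" 0] linD(5)[OF T] by simp
    show "v \<oplus>\<^bsub>M\<^esub> w \<in> ?W" if vw: "v \<in> ?W" "w \<in> ?W" for v w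
    proof -
      obtain I g J g' where *: "?P I g" "v = finsum M g I" "?P J g'" "w = finsum M g' J" using vw by blast
      let ?g = "\<lambda>n. if n \<in> I then g n else \<zero>\<^bsub>M\<^esub>" and ?g' = "\<lambda>n. if n \<in> J then g' n else \<zero>\<^bsub>M\<^esub>"
      have c: "?g \<in> I \<union> J \<rightarrow> carrier M" "?g' \<in> I \<union> J \<rightarrow> carrier M" using * by auto
      have "v = finsum M ?g (I \<union> J)" "w = finsum M ?g' (I \<union> J)"
        unfolding *(2,4) using * c by (auto intro!: M.add.finprod_mono_neutral_cong_left)
      then have "v \<oplus>\<^bsub>M\<^esub> w = finsum M (\<lambda>n. ?g n \<oplus>\<^bsub>M\<^esub> ?g' n) (I \<union> J)"
        using M.finsum_addf[OF c] by simp
      moreover have "?P (I \<union> J) (\<lambda>n. ?g n \<oplus>\<^bsub>M\<^esub> ?g' n)" using * by (auto simp: linD[OF T] s_add_r)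
      ultimately show ?thesis by blast
    qed
    show "c \<odot> v \<in> ?W" if asm: "v \<in> ?W" for c v
    proof -
      obtain I g where *: "?P I g" "v = finsum M g I" using asm by blast
      have "c \<odot> v = finsum M (\<lambda>n. c \<odot> g n) I"
        unfolding *(2) by (rule ahom_finsum[OF M.abelian_group_axioms M.abelian_group_axioms smult_ahom]) (use * in auto)
      moreover have "?P I (\<lambda>n. c \<odot> g n)" using * by (auto simp: linD[OF T] s_assoc mult.commute)
      ultimately show ?thesis by blast
    qed
  qed
  from span_minimal[OF this, of ?A] one have "spn ?A \<subseteq> ?W" by blast
  then show ?thesis using assms(1) by blast
qed

end

lemma (in cspace) finsum_subsp:
  assumes W: "subsp W" and "finite I" "\<And>i. i \<in> I \<Longrightarrow> g i \<in> W"
  shows "finsum M g I \<in> W"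
  using assms(2,3)
proof (induction I rule: finite_induct)
  case (insert i I)
  then have "g \<in> I \<rightarrow> carrier M" "g i \<in> carrier M" using subspD(1)[OF W] by auto
  then show ?case using insert subspD(3)[OF W] by simp
qed (simp add: subspD(2)[OF W])

lemma (in cspace) coset_add_left:
  assumes B: "subsp B" and b: "b \<in> B" and v: "v \<in> carrier M"
  shows "B +>\<^bsub>M\<^esub> (b \<oplus>\<^bsub>M\<^esub> v) = B +>\<^bsub>M\<^esub> v"
proof -
  note s = subspD[OF B]
  have "\<exists>c\<in>B. x \<oplus>\<^bsub>M\<^esub> v = c \<oplus>\<^bsub>M\<^esub> (b \<oplus>\<^bsub>M\<^esub> v)" if "x \<in> B" for x
  proof (rule bexI[of _ "x \<oplus>\<^bsub>M\<^esub> (-1) \<odot> b"])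
    show "x \<oplus>\<^bsub>M\<^esub> v = x \<oplus>\<^bsub>M\<^esub> (-1) \<odot> b \<oplus>\<^bsub>M\<^esub> (b \<oplus>\<^bsub>M\<^esub> v)"
      using that b v s(1) by (simp add: neg_eq[symmetric] M.a_assoc M.r_neg1)
  qed (intro s that b)
  moreover have "\<exists>c\<in>B. x \<oplus>\<^bsub>M\<^esub> (b \<oplus>\<^bsub>M\<^esub> v) = c \<oplus>\<^bsub>M\<^esub> v" if "x \<in> B" for x
    by (rule bexI[of _ "x \<oplus>\<^bsub>M\<^esub> b"]) (use that b v s in \<open>simp_all add: M.a_assoc\<close>)
  ultimately show ?thesis by (fastforce simp: a_r_coset_def' )
qed

lemma (in cspace) coset_eq_iff:
  assumes B: "subsp B" and v: "v \<in> carrier M"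
  shows "B +>\<^bsub>M\<^esub> v = B \<longleftrightarrow> v \<in> B"
proof
  note s = subspD[OF B]
  have "\<zero>\<^bsub>M\<^esub> \<oplus>\<^bsub>M\<^esub> v \<in> B +>\<^bsub>M\<^esub> v" using s(2) by (auto simp: a_r_coset_def')
  then show "B +>\<^bsub>M\<^esub> v = B \<Longrightarrow> v \<in> B" using v by simp
  have "B +>\<^bsub>M\<^esub> \<zero>\<^bsub>M\<^esub> = B" using s(1) by (auto simp: a_r_coset_def')
  then show "v \<in> B \<Longrightarrow> B +>\<^bsub>M\<^esub> v = B" using coset_add_left[OF B, of v "\<zero>\<^bsub>M\<^esub>"] v by simp
qed

text \<open>The iterated operator is the action stored in \<open>subquotient\<close>, a union over
  the representatives of a coset; stability of B makes this union a single coset.\<close>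

lemma (in cspace) subquotient_pow:
  assumes T: "lin T" and B: "subsp B" "\<And>v. v \<in> B \<Longrightarrow> T v \<in> B" and w: "w \<in> carrier M"
  shows "((\<lambda>Z. \<Union>v\<in>Z. B +>\<^bsub>M\<^esub> T v) ^^ k) (B +>\<^bsub>M\<^esub> w) = B +>\<^bsub>M\<^esub> (T ^^ k) w"
proof (induction k)
  case (Suc k)
  let ?u = "(T ^^ k) w"
  have u: "?u \<in> carrier M" by (rule linD(2)[OF lin_pow[OF T] w])
  have "B +>\<^bsub>M\<^esub> T (b \<oplus>\<^bsub>M\<^esub> ?u) = B +>\<^bsub>M\<^esub> T ?u" if "b \<in> B" for b
    using coset_add_left[OF B(1) B(2)[OF that], of "T ?u"] u subspD(1)[OF B(1) that] by (simp add: linD[OF T])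
  then have "(\<Union>v\<in>B +>\<^bsub>M\<^esub> ?u. B +>\<^bsub>M\<^esub> T v) = B +>\<^bsub>M\<^esub> T ?u"
    using subspD(2)[OF B(1)] by (auto simp: a_r_coset_def'[of M B ?u])
  then show ?case using Suc by simp
qed simp

lemma efin_map:
  assumes M: "cspace M" and N: "cspace N" and \<phi>: "\<phi> \<in> ahom M N" "\<And>c v. v \<in> carrier M \<Longrightarrow> \<phi> (c \<odot>\<^bsub>M\<^esub> v) = c \<odot>\<^bsub>N\<^esub> \<phi> v"
    and comm: "\<And>v. v \<in> carrier M \<Longrightarrow> \<phi> (T v) = S (\<phi> v)" and v: "cspace.efin M T v"
  shows "cspace.efin N S (\<phi> v)"
proof -
  interpret M: cspace M by fact
  interpret N: cspace N by fact
  obtain B where B: "finite B" "B \<subseteq> carrier M" "v \<in> M.spn B" "\<forall>b\<in>B. T b \<in> M.spn B"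
    using v by (auto simp: M.efin_def)
  have c: "\<phi> ` B \<subseteq> carrier N" using B(2) ahom_closed[OF \<phi>(1)] by auto
  note S = N.subsp_span[OF c]
  have "M.subsp {v \<in> carrier M. \<phi> v \<in> N.spn (\<phi> ` B)}"
    unfolding M.subsp_def using N.subspD[OF S] ahom_add[OF \<phi>(1)] \<phi>(2)
      ahom_zero[OF M.M.abelian_group_axioms N.M.abelian_group_axioms \<phi>(1)] by auto
  from M.span_minimal[OF this, of B] have 1: "\<phi> w \<in> N.spn (\<phi> ` B)" if "w \<in> M.spn B" for w
    using B(2) N.span_incl[of "\<phi> ` B"] that by blast
  show ?thesis
    unfolding N.efin_def
  proof (intro exI[of _ "\<phi> ` B"] conjI ballI)
    show "S b \<in> N.spn (\<phi> ` B)" if "b \<in> \<phi> ` B" for b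
      using that B 1 comm by (auto simp: comm[symmetric] subset_iff)
  qed (use B c 1 in auto)
qed

subsection \<open>Modules over a Lie superalgebra containing sl(2)\<close>

context gmodule
begin

lemma act_lin: "x \<in> carrier L \<Longrightarrow> N.lin (act N x)"
  by (simp add: N.lin_def act_ahom act_smult_r)

lemma act_comm:
  assumes z: "z \<in> par L 0" and y: "y \<in> carrier L" and v: "v \<in> carrier N"
  shows "act N z (act N y v) = act N y (act N z v) \<oplus>\<^bsub>N\<^esub> act N (br L z y) v"
proof -
  note zc = L.par_carrier[OF z]
  have 1: "act N z (act N y v) = act N y (act N z v) \<oplus>\<^bsub>N\<^esub> act N (br L z y) v" if y: "y \<in> par L j" for y j
  proof -
    note yc = L.par_carrier[OF y]
    have "act N (br L z y) v = act N z (act N y v) \<oplus>\<^bsub>N\<^esub> \<ominus>\<^bsub>N\<^esub> act N y (act N z v)"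
      using act_br[OF z y v] v zc yc by (simp add: sign_def N.neg_eq act_closed)
    then show ?thesis
      using v zc yc N.M.a_lcomm[of "act N y (act N z v)" "act N z (act N y v)" "\<ominus>\<^bsub>N\<^esub> act N y (act N z v)"]
      by (simp add: act_closed N.M.r_neg)
  qed
  obtain y0 y1 where yy: "y0 \<in> par L 0" "y1 \<in> par L 1" "y = y0 \<oplus>\<^bsub>L\<^esub> y1" by (rule L.grade_decomp[OF y])
  note c = L.par_carrier[OF yy(1)] L.par_carrier[OF yy(2)]
  show ?thesis
    using c zc v 1[OF yy(1)] 1[OF yy(2)]
    by (simp add: yy(3) L.br_add_right act_add_l act_add_r act_closed L.br_closed N.M.a_ac)
qed

text \<open>Since z x_i b = x_i z b + x_(i+1) b for x_i = (ad z)^i x, the vectors x_i b with i up to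
  d and b in a generating set B of a z-stable span again generate a z-stable span. For z = e this
  makes the Enright functor produce submodules.\<close>

lemma efin_act:
  assumes z: "z \<in> par L 0" and nil: "(br L z ^^ d) x = \<zero>\<^bsub>L\<^esub>" and x: "x \<in> carrier L" and v: "N.efin (act N z) v"
  shows "N.efin (act N z) (act N x v)"
proof -
  note zc = L.par_carrier[OF z]
  let ?x = "\<lambda>i. (br L z ^^ i) x"
  have xi: "?x i \<in> carrier L" for i using L.U_gen_ad_pow(1)[OF z x] .
  obtain B where B: "finite B" "B \<subseteq> carrier N" "v \<in> N.spn B" "\<And>b. b \<in> B \<Longrightarrow> act N z b \<in> N.spn B"
    using v by (auto simp: N.efin_def)
  let ?C = "(\<lambda>(i, b). act N (?x i) b) ` ({..d} \<times> B)"
  have C: "?C \<subseteq> carrier N" using B(2) xi by (auto intro!: act_closed)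
  note S = N.subsp_span[OF C]
  have inC: "act N (?x i) w \<in> N.spn ?C" if "i \<le> d" "w \<in> N.spn B" for i w
  proof (rule N.span_stable[OF act_lin[OF xi] S B(2) _ that(2)])
    show "act N (?x i) b \<in> N.spn ?C" if "b \<in> B" for b
      by (rule subsetD[OF N.span_incl]) (use that \<open>i \<le> d\<close> in auto)
  qed
  have "act N z c \<in> N.spn ?C" if c: "c \<in> ?C" for c
  proof -
    obtain i b where ib: "i \<le> d" "b \<in> B" "c = act N (?x i) b" using c by auto
    then have bc: "b \<in> carrier N" using B(2) by auto
    have "act N z c = act N (?x i) (act N z b) \<oplus>\<^bsub>N\<^esub> act N (?x (Suc i)) b"
      unfolding ib(3) using act_comm[OF z xi bc] by simp
    moreover have "act N (?x i) (act N z b) \<in> N.spn ?C" by (rule inC[OF ib(1) B(4)[OF ib(2)]])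
    moreover have "act N (?x (Suc i)) b \<in> N.spn ?C"
    proof (cases "i = d")
      case True
      then have "?x (Suc i) = br L z \<zero>\<^bsub>L\<^esub>" using nil by simp
      also have "\<dots> = \<zero>\<^bsub>L\<^esub>"
        using L.br_smult_right[of z "\<zero>\<^bsub>L\<^esub>" 0] zc L.br_closed[of z "\<zero>\<^bsub>L\<^esub>"] cspace.s_zero[OF L.cspace_L] by simp
      finally have "act N (?x (Suc i)) b = \<zero>\<^bsub>N\<^esub>"
        using act_smult_l[of "\<zero>\<^bsub>L\<^esub>" b 0] bc act_closed[of "\<zero>\<^bsub>L\<^esub>" b] cspace.s_zero[OF L.cspace_L] by simp
      then show ?thesis using N.subspD(2)[OF S] by simp
    next
      case False
      then show ?thesis using ib N.span_incl[of B] by (intro inC) auto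
    qed
    ultimately show ?thesis using N.subspD(3)[OF S] by simp
  qed
  then show ?thesis
    unfolding N.efin_def using B C inC[of 0 v] by (intro exI[of _ ?C]) auto
qed

end

lemma sub_gmod_simps [simp]:
  "carrier (sub_gmod M W) = W" "add (sub_gmod M W) = add M" "\<zero>\<^bsub>sub_gmod M W\<^esub> = \<zero>\<^bsub>M\<^esub>"
  "module.smult (sub_gmod M W) = module.smult M" "act (sub_gmod M W) = act M" "par (sub_gmod M W) i = W \<inter> par M i"
  by (simp_all add: sub_gmod_def)

lemma res_gmod_simps [simp]:
  "carrier (res_gmod L M) = carrier M" "add (res_gmod L M) = add M" "\<zero>\<^bsub>res_gmod L M\<^esub> = \<zero>\<^bsub>M\<^esub>"
  "module.smult (res_gmod L M) = module.smult M" "x \<in> carrier L \<Longrightarrow> act (res_gmod L M) x = act M x"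
  "par (res_gmod L M) = par M"
  by (simp_all add: res_gmod_def)

lemma module_CC_subsp:
  assumes M: "cspace M" and W: "cspace.subsp M W"
    and eq: "carrier K = W" "add K = add M" "\<zero>\<^bsub>K\<^esub> = \<zero>\<^bsub>M\<^esub>" "module.smult K = module.smult M"
  shows "module CC K"
proof -
  interpret M: cspace M by fact
  note W' = M.subspD[OF W]
  show ?thesis
  proof (rule moduleI)
    show "cring CC" by (rule cring_from_type_algebra)
    have neg: "(-1) \<odot>\<^bsub>M\<^esub> x \<oplus>\<^bsub>M\<^esub> x = \<zero>\<^bsub>M\<^esub>" if "x \<in> carrier M" for x
      using that by (simp add: M.neg_eq[symmetric] M.M.l_neg)
    show "abelian_group K"
    proof (rule abelian_groupI)
      show "\<exists>y\<in>carrier K. y \<oplus>\<^bsub>K\<^esub> x = \<zero>\<^bsub>K\<^esub>" if "x \<in> carrier K" for x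
        by (rule bexI[of _ "(-1) \<odot>\<^bsub>M\<^esub> x"])
          (use that W' in \<open>simp_all add: eq neg\<close>)
    qed (use W' in \<open>simp_all add: eq M.M.a_ac\<close>)
  qed (use W' in \<open>simp_all add: eq M.s_add_l M.s_add_r M.s_assoc\<close>)
qed

lemma sub_gmod_gmodule:
  assumes "gmodule L M" and W: "cspace.subsp M W" and st: "\<And>x v. x \<in> carrier L \<Longrightarrow> v \<in> W \<Longrightarrow> act M x v \<in> W"
  shows "gmodule L (sub_gmod M W)"
proof -
  interpret M: gmodule L M by fact
  note W' = M.N.subspD[OF W]
  show ?thesis
  proof (intro gmodule.intro gmodule_axioms.intro cspace.intro)
    show "lie_superalgebra L" by (rule M.L.lie_superalgebra_axioms)
    show "module CC (sub_gmod M W)"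
      by (rule module_CC_subsp[OF M.N.cspace_axioms W]) simp_all
  qed (use W' st in \<open>simp_all add: M.act_add_r M.act_smult_r M.act_add_l M.act_smult_l M.act_br\<close>)
qed

lemma graded_sub_gmod:
  assumes "gmodule L M" "graded M" and W: "cspace.subsp M W"
    and dec: "\<And>w. w \<in> W \<Longrightarrow> \<exists>w0\<in>W \<inter> par M 0. \<exists>w1\<in>W \<inter> par M 1. w = w0 \<oplus>\<^bsub>M\<^esub> w1"
    and C: "cspace (sub_gmod M W)"
  shows "graded (sub_gmod M W)"
proof -
  interpret M: gmodule L M by fact
  interpret C: cspace "sub_gmod M W" by fact
  have p: "M.N.subsp (par M i)" for i
    using assms(2) M.N.submodule_iff by (auto simp: graded_def)
  have "C.subsp (W \<inter> par M i)" for i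
    unfolding C.subsp_def using M.N.subspD[OF p[of i]] M.N.subspD[OF W] by auto
  then show ?thesis
    using assms(2) dec C.submodule_iff by (auto simp: graded_def)
qed

text \<open>Local finiteness enters in the form of local nilpotency of ad e and ad f, which a
  subalgebra inherits at once.\<close>

locale sl2_superalgebra = lie_superalgebra L for L :: "'g lsa" +
  fixes e h f :: 'g
  assumes efh_even: "e \<in> par L 0" "h \<in> par L 0" "f \<in> par L 0"
    and he: "br L h e = 2 \<odot>\<^bsub>L\<^esub> e" and hf: "br L h f = (-2) \<odot>\<^bsub>L\<^esub> f" and ef: "br L e f = h"
    and e_nil: "\<And>x. x \<in> carrier L \<Longrightarrow> \<exists>k. (br L e ^^ k) x = \<zero>\<^bsub>L\<^esub>"
    and ad_f_nil: "\<And>x. x \<in> carrier L \<Longrightarrow> \<exists>k. (br L f ^^ k) x = \<zero>\<^bsub>L\<^esub>"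
begin

lemma efh_closed: "e \<in> carrier L" "h \<in> carrier L" "f \<in> carrier L"
  using efh_even par_carrier by auto

sublocale f_lie_superalgebra L f
  by unfold_locales (use efh_even ad_f_nil in auto)

sublocale cL: cspace L by (rule cspace_L)

lemma skew_even: "x \<in> par L 0 \<Longrightarrow> y \<in> par L 0 \<Longrightarrow> br L x y = (-1) \<odot>\<^bsub>L\<^esub> br L y x"
  using br_skew[of x 0 y 0] br_closed[of y x] par_carrier[of x 0] par_carrier[of y 0]
  by (simp add: sign_def cL.neg_eq)

lemma fe: "br L f e = (-1) \<odot>\<^bsub>L\<^esub> h"
  using skew_even[OF efh_even(3,1)] ef by simp

lemma fh: "br L f h = 2 \<odot>\<^bsub>L\<^esub> f"
  using skew_even[OF efh_even(3,2)] hf efh_closed by (simp add: cL.s_assoc)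

lemma ff: "br L f f = \<zero>\<^bsub>L\<^esub>"
proof -
  have c: "br L f f \<in> carrier L" using efh_closed br_closed by simp
  have "2 \<odot>\<^bsub>L\<^esub> br L f f = br L f f \<oplus>\<^bsub>L\<^esub> br L f f"
    using c cL.s_add_l[of "br L f f" 1 1] by simp
  also have "\<dots> = br L f f \<oplus>\<^bsub>L\<^esub> (-1) \<odot>\<^bsub>L\<^esub> br L f f"
    using skew_even[OF efh_even(3,3)] by simp
  also have "\<dots> = \<zero>\<^bsub>L\<^esub>" using c by (simp add: cL.neg_eq[symmetric] M.r_neg)
  finally show ?thesis using cL.s_eq_zero[OF c, of 2] by simp
qed

end

text \<open>On a finite-dimensional stable space ad e and ad f shift the spectrum of ad h by 2 and
  -2, so \<open>shift_operator_nilpotent\<close> applies to both.\<close>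

lemma sl2_superalgebraI:
  assumes "lie_superalgebra L" "sl2_in L e h f" "sl2_locally_finite L e h f"
  shows "sl2_superalgebra L e h f"
proof -
  interpret lie_superalgebra L by fact
  interpret c: cspace L by (rule cspace_L)
  have ev: "e \<in> par L 0" "h \<in> par L 0" "f \<in> par L 0"
    and rel: "br L h e = 2 \<odot>\<^bsub>L\<^esub> e" "br L h f = (-2) \<odot>\<^bsub>L\<^esub> f" "br L e f = h"
    using assms(2) by (auto simp: sl2_in_def)
  note cl = par_carrier[OF ev(1)] par_carrier[OF ev(2)] par_carrier[OF ev(3)]
  have lin: "c.lin (br L y)" if "y \<in> carrier L" for y
    unfolding c.lin_def using that by (auto intro!: ahomI simp: br_closed br_add_right br_smult_right)
  have nil: "\<exists>k. (br L z ^^ k) x = \<zero>\<^bsub>L\<^esub>"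
    if z: "z \<in> {e, f}" and hz: "br L h z = \<delta> \<odot>\<^bsub>L\<^esub> z" "\<delta> \<noteq> 0" and x: "x \<in> carrier L" for z \<delta> x
  proof -
    obtain W where W: "submodule W CC L" "fin_dim L W" "x \<in> W" "\<forall>y\<in>{e, h, f}. \<forall>w\<in>W. br L y w \<in> W"
      using assms(3) x by (auto simp: sl2_locally_finite_def)
    obtain B where B: "finite B" "B \<subseteq> W" "W = c.spn B" using W(2) by (auto simp: fin_dim_def)
    have Bc: "B \<subseteq> carrier L" using W(1) B(2) c.submodule_iff c.subspD(1) by blast
    have zc: "z \<in> carrier L" "z \<in> par L 0" using z cl ev by auto
    show ?thesis
    proof (rule c.shift_operator_nilpotent[OF lin[OF cl(2)] lin[OF zc(1)] _ hz(2) B(1) Bc])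
      show "br L h (br L z v) = br L z (br L h v) \<oplus>\<^bsub>L\<^esub> \<delta> \<odot>\<^bsub>L\<^esub> br L z v" if v: "v \<in> carrier L" for v
      proof -
        have "br L h (br L z v) = br L (br L h z) v \<oplus>\<^bsub>L\<^esub> br L z (br L h v)"
          using br_jacobi[OF ev(2) zc(2) v] v zc cl by (simp add: sign_def br_closed)
        then show ?thesis using v zc cl by (simp add: hz(1) br_smult_left br_closed M.a_comm)
      qed
      show "br L h b \<in> c.spn B" if "b \<in> B" for b using W(4) B that by auto
      show "br L z b \<in> c.spn B" if "b \<in> B" for b using W(4) B that z by auto
      show "x \<in> c.spn B" using W(3) B(3) by simp
    qed
  qed
  show ?thesis
    by unfold_locales (use ev rel nil[of e 2] nil[of f "-2"] in auto)
qed

lemma lie_superalgebra_sub: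
  assumes "lie_superalgebra L" "is_subalgebra L S"
  shows "lie_superalgebra (sub_lsa L S)"
proof -
  interpret lie_superalgebra L by fact
  interpret c: cspace L by (rule cspace_L)
  let ?L = "sub_lsa L S"
  have S: "c.subsp S" "graded ?L" "\<And>x y. x \<in> S \<Longrightarrow> y \<in> S \<Longrightarrow> br L x y \<in> S"
    using assms(2) c.submodule_iff by (auto simp: is_subalgebra_def)
  note S' = c.subspD[OF S(1)]
  have simps [simp]: "carrier ?L = S" "add ?L = add L" "\<zero>\<^bsub>?L\<^esub> = \<zero>\<^bsub>L\<^esub>" "module.smult ?L = module.smult L"
    "br ?L = br L" "par ?L i = S \<inter> par L i" for i
    by (simp_all add: sub_lsa_def)
  have m: "module CC ?L" by (rule module_CC_subsp[OF c.cspace_axioms S(1)]) simp_all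
  interpret c': cspace ?L by (rule cspace.intro) (rule m)
  show ?thesis
  proof (intro lie_superalgebra.intro lie_superalgebra_axioms.intro m S(2))
    show "br ?L x y = \<ominus>\<^bsub>?L\<^esub> (sign i j \<odot>\<^bsub>?L\<^esub> br ?L y x)" if "x \<in> par ?L i" "y \<in> par ?L j" for x y i j
      using that S' S(3) br_skew[of x i y j] c'.neg_eq[of "sign i j \<odot>\<^bsub>L\<^esub> br L y x"] c.neg_eq[of "sign i j \<odot>\<^bsub>L\<^esub> br L y x"]
      by auto
  qed (use S' S(3) br_par in \<open>auto simp: br_add_left br_add_right br_smult_left br_smult_right br_jacobi\<close>)
qed

lemma sub_lsa_simps [simp]:
  "carrier (sub_lsa L S) = S" "add (sub_lsa L S) = add L" "\<zero>\<^bsub>sub_lsa L S\<^esub> = \<zero>\<^bsub>L\<^esub>"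
  "module.smult (sub_lsa L S) = module.smult L"
  "br (sub_lsa L S) = br L" "par (sub_lsa L S) i = S \<inter> par L i"
  by (simp_all add: sub_lsa_def)

lemma sl2_superalgebra_sub:
  assumes "sl2_superalgebra L e h f" "is_subalgebra L S" "{e, h, f} \<subseteq> S"
  shows "sl2_superalgebra (sub_lsa L S) e h f"
proof -
  interpret sl2_superalgebra L e h f by fact
  have "S \<subseteq> carrier L" using assms(2) cL.submodule_iff cL.subspD(1) by (auto simp: is_subalgebra_def)
  then show ?thesis
    by (intro sl2_superalgebra.intro sl2_superalgebra_axioms.intro lie_superalgebra_sub[OF lie_superalgebra_axioms assms(2)])
      (use assms(3) efh_even he hf ef e_nil ad_f_nil in auto)
qed

lemma is_gmodule_res:
  assumes "lie_superalgebra L" "is_subalgebra L S" and N: "is_gmodule gr L N"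
  shows "is_gmodule gr (sub_lsa L S) (res_gmod (sub_lsa L S) N)"
proof -
  interpret gmodule L N using N is_gmodule_iff[OF assms(1)] by auto
  interpret cL: cspace L by (rule L.cspace_L)
  let ?L = "sub_lsa L S" and ?N = "res_gmod (sub_lsa L S) N"
  have S: "cL.subsp S" "\<And>x y. x \<in> S \<Longrightarrow> y \<in> S \<Longrightarrow> br L x y \<in> S"
    using assms(2) cL.submodule_iff by (auto simp: is_subalgebra_def)
  note S' = cL.subspD[OF S(1)]
  have "gmodule ?L ?N"
  proof (intro gmodule.intro gmodule_axioms.intro cspace.intro)
    show "lie_superalgebra ?L" by (rule lie_superalgebra_sub[OF assms(1,2)])
    show "module CC ?N" by (rule module_CC_subsp[OF N.cspace_axioms N.subsp_carrier]) simp_all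
  qed (use S' S(2) in \<open>auto simp: act_closed act_add_r act_smult_r act_add_l act_smult_l act_br\<close>)
  moreover have "graded ?N" if "graded N"
  proof -
    interpret c: cspace ?N
      by (rule cspace.intro, rule module_CC_subsp[OF N.cspace_axioms N.subsp_carrier]) simp_all
    have "c.subsp W \<longleftrightarrow> N.subsp W" for W by (simp add: c.subsp_def N.subsp_def)
    then show ?thesis using that c.submodule_iff N.submodule_iff by (simp add: graded_def)
  qed
  ultimately show ?thesis
    using N unfolding is_gmodule_iff[OF lie_superalgebra_sub[OF assms(1,2)]] is_gmodule_iff[OF assms(1)]
    by auto
qed

text \<open>The sum of the \<nu> + 2 j for j from 1 to i, that is, the amount by which fe drops when
  it is moved to the right past e^i on weight \<nu>. On a weight space fe differs from a multiple of
  the Casimir element by a scalar.\<close>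

definition casimir_root :: "complex \<Rightarrow> nat \<Rightarrow> complex" where
  "casimir_root \<nu> i = of_nat i * (\<nu> + of_nat i + 1)"

section \<open>Weight vectors and powers of e and f\<close>

locale sl2_module = sl2_superalgebra L e h f + gmodule L N
  for L :: "'g lsa" and e h f :: 'g and N :: "('g, 'v) gmod"
begin

text \<open>The zero vector has every weight, so the rules for e, f, sums and multiples hold without
  case distinctions.\<close>

definition wt :: "complex \<Rightarrow> 'v \<Rightarrow> bool" where
  "wt \<nu> v \<longleftrightarrow> v \<in> carrier N \<and> act N h v = \<nu> \<odot>\<^bsub>N\<^esub> v"

lemma wtD: "wt \<nu> v \<Longrightarrow> v \<in> carrier N" "wt \<nu> v \<Longrightarrow> act N h v = \<nu> \<odot>\<^bsub>N\<^esub> v"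
  by (simp_all add: wt_def)

lemma wt_smult: "wt \<nu> v \<Longrightarrow> wt \<nu> (c \<odot>\<^bsub>N\<^esub> v)"
  by (simp add: wt_def act_smult_r efh_closed N.s_assoc mult.commute)

lemma wt_add: "wt \<nu> v \<Longrightarrow> wt \<nu> w \<Longrightarrow> wt \<nu> (v \<oplus>\<^bsub>N\<^esub> w)"
  by (simp add: wt_def act_add_r efh_closed N.s_add_r)

lemma wt_e:
  assumes "wt \<nu> v" shows "wt (\<nu> + 2) (act N e v)"
  unfolding wt_def using act_comm[OF efh_even(2) efh_closed(1) wtD(1)[OF assms]] wtD[OF assms] efh_closed
  by (simp add: act_closed he act_smult_l act_smult_r N.s_add_l)

lemma wt_f:
  assumes "wt \<nu> v" shows "wt (\<nu> - 2) (act N f v)"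
  unfolding wt_def using act_comm[OF efh_even(2) efh_closed(3) wtD(1)[OF assms]] wtD[OF assms] efh_closed
    N.s_add_l[of "act N f v" \<nu> "-2"]
  by (simp add: act_closed hf act_smult_l act_smult_r)

lemma wt_e_pow: "wt \<nu> v \<Longrightarrow> wt (\<nu> + 2 * of_nat n) ((act N e ^^ n) v)"
proof (induction n)
  case (Suc n)
  then show ?case using wt_e[of "\<nu> + 2 * of_nat n" "(act N e ^^ n) v"] by (simp add: algebra_simps)
qed simp

lemma wt_f_pow: "wt \<nu> v \<Longrightarrow> wt (\<nu> - 2 * of_nat n) ((act N f ^^ n) v)"
proof (induction n)
  case (Suc n)
  then show ?case using wt_f[of "\<nu> - 2 * of_nat n" "(act N f ^^ n) v"] by (simp add: algebra_simps)
qed simp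

definition fe_op :: "'v \<Rightarrow> 'v" where "fe_op v = act N f (act N e v)"

lemma fe_lin: "N.lin fe_op"
  unfolding N.lin_def fe_op_def[abs_def]
  using ahom_comp[OF act_ahom[OF efh_closed(1)] act_ahom[OF efh_closed(3)]]
  by (simp add: act_smult_r efh_closed act_closed)

lemma wt_fe: "wt \<nu> v \<Longrightarrow> wt \<nu> (fe_op v)"
  using wt_f[OF wt_e, of \<nu> v] by (simp add: fe_op_def)

lemma ef_eq: "v \<in> carrier N \<Longrightarrow> act N e (act N f v) = fe_op v \<oplus>\<^bsub>N\<^esub> act N h v"
  using act_comm[OF efh_even(1) efh_closed(3), of v] by (simp add: ef fe_op_def)

lemma fe_e:
  assumes v: "wt \<nu> v"
  shows "fe_op (act N e v) = act N e (fe_op v) \<oplus>\<^bsub>N\<^esub> (- (\<nu> + 2)) \<odot>\<^bsub>N\<^esub> act N e v"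
proof -
  have c: "act N e v \<in> carrier N" using wtD(1)[OF wt_e[OF v]] .
  have "act N e (fe_op v) = fe_op (act N e v) \<oplus>\<^bsub>N\<^esub> (\<nu> + 2) \<odot>\<^bsub>N\<^esub> act N e v"
    using ef_eq[OF c] wtD(2)[OF wt_e[OF v]] by (simp add: fe_op_def)
  then show ?thesis using c N.linD(2)[OF fe_lin c] by (simp add: N.M.a_assoc N.s_add_l[symmetric])
qed

text \<open>Moving fe past one more e costs the weight \<nu> + 2 k + 2 of e^(k+1) v; these weights
  add up to \<open>casimir_root\<close>.\<close>

lemma fe_e_pow:
  assumes v: "wt \<nu> v"
  shows "fe_op ((act N e ^^ k) v) = (act N e ^^ k) (fe_op v \<oplus>\<^bsub>N\<^esub> (- casimir_root \<nu> k) \<odot>\<^bsub>N\<^esub> v)"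
proof -
  have vc: "v \<in> carrier N" "fe_op v \<in> carrier N" using wtD(1)[OF v] wtD(1)[OF wt_fe[OF v]] by auto
  have lin: "N.lin (act N e ^^ k)" for k by (rule N.lin_pow[OF act_lin[OF efh_closed(1)]])
  show ?thesis
  proof (induction k)
    case 0
    then show ?case using vc by (simp add: casimir_root_def)
  next
    case (Suc k)
    let ?u = "(act N e ^^ k) v" and ?t = "(act N e ^^ k) (fe_op v)"
    have c: "?u \<in> carrier N" "?t \<in> carrier N" using vc N.linD(2)[OF lin] by auto
    have r: "casimir_root \<nu> (Suc k) = casimir_root \<nu> k + (\<nu> + 2 * of_nat k + 2)"
      by (simp add: casimir_root_def algebra_simps)
    have "fe_op (act N e ?u) = act N e (fe_op ?u) \<oplus>\<^bsub>N\<^esub> (- (\<nu> + 2 * of_nat k + 2)) \<odot>\<^bsub>N\<^esub> act N e ?u"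
      by (rule fe_e[OF wt_e_pow[OF v]])
    also have "act N e (fe_op ?u) = act N e ?t \<oplus>\<^bsub>N\<^esub> (- casimir_root \<nu> k) \<odot>\<^bsub>N\<^esub> act N e ?u"
      unfolding Suc using vc c by (simp add: N.linD[OF lin] act_add_r act_smult_r efh_closed)
    also have "act N e ?t \<oplus>\<^bsub>N\<^esub> (- casimir_root \<nu> k) \<odot>\<^bsub>N\<^esub> act N e ?u \<oplus>\<^bsub>N\<^esub> (- (\<nu> + 2 * of_nat k + 2)) \<odot>\<^bsub>N\<^esub> act N e ?u
       = act N e ?t \<oplus>\<^bsub>N\<^esub> (- casimir_root \<nu> (Suc k)) \<odot>\<^bsub>N\<^esub> act N e ?u"
      using c unfolding r by (simp add: N.M.a_assoc act_closed efh_closed N.s_add_l[symmetric])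
    also have "\<dots> = (act N e ^^ Suc k) (fe_op v \<oplus>\<^bsub>N\<^esub> (- casimir_root \<nu> (Suc k)) \<odot>\<^bsub>N\<^esub> v)"
      using vc by (simp only: N.linD[OF lin] N.s_closed) simp
    finally show ?case by simp
  qed
qed

text \<open>One pair is peeled off from the middle: f^(k+1) e^(k+1) v = f^k (fe) e^k v = f^k e^k (fe
  - \<open>casimir_root \<nu> k\<close>) v, and the vector that f^k e^k acts on has the weight of
  v.\<close>

lemma f_pow_e_pow:
  "wt \<nu> v \<Longrightarrow> (act N f ^^ k) ((act N e ^^ k) v) = N.pr fe_op (map (casimir_root \<nu>) [0..<k]) v"
proof (induction k arbitrary: v)
  case (Suc k)
  let ?w = "fe_op v \<oplus>\<^bsub>N\<^esub> (- casimir_root \<nu> k) \<odot>\<^bsub>N\<^esub> v"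
  have w: "wt \<nu> ?w" by (intro wt_add wt_smult wt_fe Suc.prems)
  have "(act N f ^^ Suc k) ((act N e ^^ Suc k) v) = (act N f ^^ k) (fe_op ((act N e ^^ k) v))"
    unfolding funpow_Suc_right[of k "act N f"] fe_op_def by simp
  also have "\<dots> = (act N f ^^ k) ((act N e ^^ k) ?w)" by (simp only: fe_e_pow[OF Suc.prems])
  also have "\<dots> = N.pr fe_op (map (casimir_root \<nu>) [0..<k]) ?w" by (rule Suc.IH[OF w])
  also have "\<dots> = N.pr fe_op (map (casimir_root \<nu>) [0..<Suc k]) v" by (simp add: N.pr_append)
  finally show ?case .
qed simp

text \<open>One such scalar is (n + 1) (\<nu> + n); \<open>e_nil_f_pow\<close> uses its
  existence.\<close>

lemma e_pow_f:
  "wt \<nu> v \<Longrightarrow> \<exists>c. (act N e ^^ Suc n) (act N f v) = act N f ((act N e ^^ Suc n) v) \<oplus>\<^bsub>N\<^esub> c \<odot>\<^bsub>N\<^esub> (act N e ^^ n) v"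
proof (induction n arbitrary: v \<nu>)
  case 0
  then show ?case using ef_eq[of v] wtD[OF 0] by (auto simp: fe_op_def)
next
  case (Suc n)
  have lin: "N.lin (act N e ^^ k)" for k by (rule N.lin_pow[OF act_lin[OF efh_closed(1)]])
  obtain c where c: "(act N e ^^ Suc n) (act N f (act N e v)) =
      act N f ((act N e ^^ Suc n) (act N e v)) \<oplus>\<^bsub>N\<^esub> c \<odot>\<^bsub>N\<^esub> (act N e ^^ n) (act N e v)"
    using Suc.IH[OF wt_e[OF Suc.prems]] by blast
  have vc: "v \<in> carrier N" "act N e v \<in> carrier N" "fe_op v \<in> carrier N"
    using wtD(1)[OF Suc.prems] wtD(1)[OF wt_fe[OF Suc.prems]] efh_closed by (auto intro: act_closed)
  have p: "(act N e ^^ k) (act N e v) = (act N e ^^ Suc k) v" for k by (simp add: funpow_swap1)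
  have "(act N e ^^ Suc (Suc n)) (act N f v) = (act N e ^^ Suc n) (fe_op v \<oplus>\<^bsub>N\<^esub> \<nu> \<odot>\<^bsub>N\<^esub> v)"
    using ef_eq[OF vc(1)] wtD(2)[OF Suc.prems] by (simp only: funpow_Suc_right comp_def)
  also have "\<dots> = (act N e ^^ Suc n) (fe_op v) \<oplus>\<^bsub>N\<^esub> \<nu> \<odot>\<^bsub>N\<^esub> (act N e ^^ Suc n) v"
    using vc by (simp only: N.linD[OF lin] N.s_closed)
  also have "(act N e ^^ Suc n) (fe_op v) = act N f ((act N e ^^ Suc (Suc n)) v) \<oplus>\<^bsub>N\<^esub> c \<odot>\<^bsub>N\<^esub> (act N e ^^ Suc n) v"
    using c unfolding p fe_op_def .
  also have "act N f ((act N e ^^ Suc (Suc n)) v) \<oplus>\<^bsub>N\<^esub> c \<odot>\<^bsub>N\<^esub> (act N e ^^ Suc n) v \<oplus>\<^bsub>N\<^esub> \<nu> \<odot>\<^bsub>N\<^esub> (act N e ^^ Suc n) v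
      = act N f ((act N e ^^ Suc (Suc n)) v) \<oplus>\<^bsub>N\<^esub> (c + \<nu>) \<odot>\<^bsub>N\<^esub> (act N e ^^ Suc n) v"
    using N.linD(2)[OF lin vc(1), of "Suc n"] N.linD(2)[OF lin vc(1), of "Suc (Suc n)"]
    by (simp add: N.M.a_assoc N.s_add_l act_closed efh_closed del: funpow.simps)
  finally show ?case by blast
qed

text \<open>Each application of f raises the exponent of nilpotency by at most one, since e^(m+1) f
  w is a combination of f e^(m+1) w and e^m w.\<close>

lemma e_nil_f_pow:
  assumes "wt \<nu> v" "(act N e ^^ k) v = \<zero>\<^bsub>N\<^esub>"
  shows "(act N e ^^ (k + j)) ((act N f ^^ j) v) = \<zero>\<^bsub>N\<^esub>"
proof (induction j)
  case 0
  then show ?case using assms by simp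
next
  case (Suc j)
  let ?w = "(act N f ^^ j) v"
  obtain c where "(act N e ^^ Suc (k + j)) (act N f ?w) =
      act N f ((act N e ^^ Suc (k + j)) ?w) \<oplus>\<^bsub>N\<^esub> c \<odot>\<^bsub>N\<^esub> (act N e ^^ (k + j)) ?w"
    using e_pow_f[OF wt_f_pow[OF assms(1)]] by blast
  then show ?case using Suc act_zero efh_closed by simp
qed

text \<open>A linear relation between the e^k u is a sum of vectors of the distinct weights \<nu> +
  2 k, so each term vanishes separately, in particular the last one, whose coefficient is not
  zero.\<close>

lemma wt_efin_nilpotent:
  assumes u: "wt \<nu> u" and fin: "N.efin (act N e) u"
  shows "\<exists>k. (act N e ^^ k) u = \<zero>\<^bsub>N\<^esub>"
proof -
  have lin: "N.lin (act N e)" by (rule act_lin[OF efh_closed(1)])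
  obtain B where B: "finite B" "B \<subseteq> carrier N" "u \<in> N.spn B" "\<And>b. b \<in> B \<Longrightarrow> act N e b \<in> N.spn B"
    using fin by (auto simp: N.efin_def)
  have pw: "(act N e ^^ k) u \<in> N.spn B" for k by (rule N.efin_pow[OF lin B(2,3,4)])
  obtain n c where nc: "c n \<noteq> 0" "nsum N (\<lambda>k. c k \<odot>\<^bsub>N\<^esub> (act N e ^^ k) u) (Suc n) = \<zero>\<^bsub>N\<^esub>"
    using N.minimal_relation[where u = "\<lambda>k. (act N e ^^ k) u", OF B(1,2) pw] by (elim exE conjE)
  have cl: "(act N e ^^ k) u \<in> carrier N" for k by (rule wtD(1)[OF wt_e_pow[OF u]])
  have "c n \<odot>\<^bsub>N\<^esub> (act N e ^^ n) u \<in> {\<zero>\<^bsub>N\<^esub>}"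
  proof (rule N.eigen_components[OF act_lin[OF efh_closed(2)] N.subsp_zero, where I = "{..<Suc n}"
        and ev = "\<lambda>k. \<nu> + 2 * of_nat k" and g = "\<lambda>k. c k \<odot>\<^bsub>N\<^esub> (act N e ^^ k) u"])
    show "inj_on (\<lambda>k. \<nu> + 2 * of_nat k) {..<Suc n}" by (auto simp: inj_on_def)
    show "act N h (c k \<odot>\<^bsub>N\<^esub> (act N e ^^ k) u) = (\<nu> + 2 * of_nat k) \<odot>\<^bsub>N\<^esub> (c k \<odot>\<^bsub>N\<^esub> (act N e ^^ k) u)" for k
      by (rule wtD(2)[OF wt_smult[OF wt_e_pow[OF u]]])
    show "finsum N (\<lambda>k. c k \<odot>\<^bsub>N\<^esub> (act N e ^^ k) u) {..<Suc n} \<in> {\<zero>\<^bsub>N\<^esub>}"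
      using nc(2) N.M.nsum_eq_finsum[of "Suc n" "\<lambda>k. c k \<odot>\<^bsub>N\<^esub> (act N e ^^ k) u"] cl by simp
  qed (use cl act_zero efh_closed in auto)
  then show ?thesis using N.s_eq_zero[OF cl _ nc(1)] by blast
qed

lemma subsp_e_nilpotent: "N.subsp {v \<in> carrier N. \<exists>k. (act N e ^^ k) v = \<zero>\<^bsub>N\<^esub>}"
proof -
  have mono: "(act N e ^^ (m + k)) v = \<zero>\<^bsub>N\<^esub>" if "(act N e ^^ k) v = \<zero>\<^bsub>N\<^esub>" for m k v
    using funpow_add_app[where f = "act N e" and m = m and n = k and x = v] that act_pow_zero[OF efh_closed(1)] by simp
  have lin: "N.lin (act N e ^^ k)" for k by (rule N.lin_pow[OF act_lin[OF efh_closed(1)]])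
  show ?thesis
    unfolding N.subsp_def
  proof (intro conjI ballI allI)
    fix v w assume "v \<in> {v \<in> carrier N. \<exists>k. (act N e ^^ k) v = \<zero>\<^bsub>N\<^esub>}" "w \<in> {v \<in> carrier N. \<exists>k. (act N e ^^ k) v = \<zero>\<^bsub>N\<^esub>}"
    then obtain k l where *: "v \<in> carrier N" "w \<in> carrier N" "(act N e ^^ k) v = \<zero>\<^bsub>N\<^esub>" "(act N e ^^ l) w = \<zero>\<^bsub>N\<^esub>" by auto
    have "(act N e ^^ (k + l)) (v \<oplus>\<^bsub>N\<^esub> w) = \<zero>\<^bsub>N\<^esub>"
      using * mono[OF *(3), of l] mono[OF *(4), of k] by (simp add: N.linD[OF lin] add.commute)
    then show "v \<oplus>\<^bsub>N\<^esub> w \<in> {v \<in> carrier N. \<exists>k. (act N e ^^ k) v = \<zero>\<^bsub>N\<^esub>}" using * by blast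
  next
    fix c v assume "v \<in> {v \<in> carrier N. \<exists>k. (act N e ^^ k) v = \<zero>\<^bsub>N\<^esub>}"
    then obtain k where *: "v \<in> carrier N" "(act N e ^^ k) v = \<zero>\<^bsub>N\<^esub>" by auto
    then have "(act N e ^^ k) (c \<odot>\<^bsub>N\<^esub> v) = \<zero>\<^bsub>N\<^esub>" by (simp add: N.linD[OF lin])
    then show "c \<odot>\<^bsub>N\<^esub> v \<in> {v \<in> carrier N. \<exists>k. (act N e ^^ k) v = \<zero>\<^bsub>N\<^esub>}" using * by blast
  qed (auto intro: exI[of _ 0])
qed

end

subsection \<open>The Enright functor\<close>

text \<open>The projection to the even component commutes with the even z, so
  \<open>efin_map\<close> applies to it; the odd component follows by subtraction.\<close>

lemma graded_component_efin:
  assumes "gmodule L M" "graded M" and par: "\<And>x v i j. x \<in> par L i \<Longrightarrow> v \<in> par M j \<Longrightarrow> act M x v \<in> par M (i + j)"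
    and z: "z \<in> par L 0" and w: "w0 \<in> par M 0" "w1 \<in> par M 1"
    and fin: "cspace.efin M (act M z) (w0 \<oplus>\<^bsub>M\<^esub> w1)"
  shows "cspace.efin M (act M z) w0" "cspace.efin M (act M z) w1"
proof -
  interpret M: gmodule L M by fact
  have P: "M.N.subsp (par M i)" for i
    using assms(2) M.N.submodule_iff by (auto simp: graded_def)
  note P' = M.N.subspD[OF P]
  have zpar: "act M z v \<in> par M i" if "v \<in> par M i" for v i
    using par[OF z that] by (simp only: add_0)
  have uniq: "v0 = w0" if vw: "v0 \<in> par M 0" "v1 \<in> par M 1" "w0 \<in> par M 0" "w1 \<in> par M 1" "v0 \<oplus>\<^bsub>M\<^esub> v1 = w0 \<oplus>\<^bsub>M\<^esub> w1"
    for v0 v1 w0 w1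
  proof -
    note c = P'(1)[OF vw(1)] P'(1)[OF vw(2)] P'(1)[OF vw(3)] P'(1)[OF vw(4)]
    have "v0 \<oplus>\<^bsub>M\<^esub> (-1) \<odot>\<^bsub>M\<^esub> w0 = w1 \<oplus>\<^bsub>M\<^esub> (-1) \<odot>\<^bsub>M\<^esub> v1"
    proof -
      have "v0 \<oplus>\<^bsub>M\<^esub> \<ominus>\<^bsub>M\<^esub> w0 = \<ominus>\<^bsub>M\<^esub> w0 \<oplus>\<^bsub>M\<^esub> ((v0 \<oplus>\<^bsub>M\<^esub> v1) \<oplus>\<^bsub>M\<^esub> \<ominus>\<^bsub>M\<^esub> v1)"
        using c by (simp add: M.N.M.a_assoc M.N.M.r_neg) (simp add: M.N.M.a_comm)
      also have "\<dots> = w1 \<oplus>\<^bsub>M\<^esub> \<ominus>\<^bsub>M\<^esub> v1"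
        unfolding vw(5) using c by (simp add: M.N.M.a_assoc M.N.M.r_neg1)
      finally show ?thesis using c by (simp add: M.N.neg_eq)
    qed
    moreover have "v0 \<oplus>\<^bsub>M\<^esub> (-1) \<odot>\<^bsub>M\<^esub> w0 \<in> par M 0" "w1 \<oplus>\<^bsub>M\<^esub> (-1) \<odot>\<^bsub>M\<^esub> v1 \<in> par M 1"
      by (intro P'(3,4) vw)+
    ultimately have "v0 \<oplus>\<^bsub>M\<^esub> (-1) \<odot>\<^bsub>M\<^esub> w0 \<in> par M 0 \<inter> par M 1" by simp
    then have "v0 \<oplus>\<^bsub>M\<^esub> (-1) \<odot>\<^bsub>M\<^esub> w0 = \<zero>\<^bsub>M\<^esub>" using assms(2) by (auto simp: graded_def)
    then show ?thesis using c M.N.minus_eq_smult M.N.M.minus_eq_zero_iff by metis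
  qed
  have ex: "\<exists>v0. v0 \<in> par M 0 \<and> (\<exists>v1\<in>par M 1. v = v0 \<oplus>\<^bsub>M\<^esub> v1)" if "v \<in> carrier M" for v
    using assms(2) that unfolding graded_def Bex_def by blast
  define \<pi> where "\<pi> v = (SOME v0. v0 \<in> par M 0 \<and> (\<exists>v1\<in>par M 1. v = v0 \<oplus>\<^bsub>M\<^esub> v1))" for v
  have \<pi>: "\<pi> (v0 \<oplus>\<^bsub>M\<^esub> v1) = v0" if v: "v0 \<in> par M 0" "v1 \<in> par M 1" for v0 v1
  proof -
    have "\<pi> (v0 \<oplus>\<^bsub>M\<^esub> v1) \<in> par M 0 \<and> (\<exists>u\<in>par M 1. v0 \<oplus>\<^bsub>M\<^esub> v1 = \<pi> (v0 \<oplus>\<^bsub>M\<^esub> v1) \<oplus>\<^bsub>M\<^esub> u)"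
      unfolding \<pi>_def by (rule someI_ex, rule ex) (use v P' in blast)
    then show ?thesis using uniq v by metis
  qed
  have dec: "\<exists>v0\<in>par M 0. \<exists>v1\<in>par M 1. v = v0 \<oplus>\<^bsub>M\<^esub> v1" if "v \<in> carrier M" for v
    using assms(2) that by (auto simp: graded_def)
  have zc: "z \<in> carrier L" by (rule M.L.par_carrier[OF z])
  have "cspace.efin M (act M z) (\<pi> (w0 \<oplus>\<^bsub>M\<^esub> w1))"
  proof (rule efin_map[OF M.N.cspace_axioms M.N.cspace_axioms _ _ _ fin])
    show "\<pi> \<in> ahom M M"
    proof (rule ahomI)
      show "\<pi> v \<in> carrier M" if "v \<in> carrier M" for v
        using dec[OF that] \<pi> P'(1) by auto
      show "\<pi> (v \<oplus>\<^bsub>M\<^esub> w) = \<pi> v \<oplus>\<^bsub>M\<^esub> \<pi> w" if vw: "v \<in> carrier M" "w \<in> carrier M" for v w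
      proof -
        obtain v0 v1 w0 w1 where *: "v0 \<in> par M 0" "v1 \<in> par M 1" "v = v0 \<oplus>\<^bsub>M\<^esub> v1"
          "w0 \<in> par M 0" "w1 \<in> par M 1" "w = w0 \<oplus>\<^bsub>M\<^esub> w1" using dec[OF vw(1)] dec[OF vw(2)] by blast
        have "v \<oplus>\<^bsub>M\<^esub> w = (v0 \<oplus>\<^bsub>M\<^esub> w0) \<oplus>\<^bsub>M\<^esub> (v1 \<oplus>\<^bsub>M\<^esub> w1)"
          using * P'(1) by (simp add: M.N.M.a_ac)
        then show ?thesis using * P'(3) by (simp add: \<pi>)
      qed
    qed
    show "\<pi> (c \<odot>\<^bsub>M\<^esub> v) = c \<odot>\<^bsub>M\<^esub> \<pi> v" if v: "v \<in> carrier M" for c v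
    proof -
      obtain v0 v1 where *: "v0 \<in> par M 0" "v1 \<in> par M 1" "v = v0 \<oplus>\<^bsub>M\<^esub> v1" using dec[OF v] by blast
      then have "c \<odot>\<^bsub>M\<^esub> v = c \<odot>\<^bsub>M\<^esub> v0 \<oplus>\<^bsub>M\<^esub> c \<odot>\<^bsub>M\<^esub> v1" using P'(1) by (simp add: M.N.s_add_r)
      then show ?thesis using * P'(4) by (simp add: \<pi>)
    qed
    show "\<pi> (act M z v) = act M z (\<pi> v)" if v: "v \<in> carrier M" for v
    proof -
      obtain v0 v1 where *: "v0 \<in> par M 0" "v1 \<in> par M 1" "v = v0 \<oplus>\<^bsub>M\<^esub> v1" using dec[OF v] by blast
      then have "act M z v = act M z v0 \<oplus>\<^bsub>M\<^esub> act M z v1" using P'(1) zc by (simp add: M.act_add_r)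
      then show ?thesis using * zpar by (simp add: \<pi>)
    qed
  qed
  then show w0: "cspace.efin M (act M z) w0" by (simp add: \<pi> w)
  have c: "w0 \<in> carrier M" "w1 \<in> carrier M" using P'(1) w by auto
  have "w1 \<in> {v \<in> carrier M. M.N.efin (act M z) v}"
    by (rule M.N.subsp_cancel[OF M.N.subsp_efin c(2), of w0])
      (use c w0 fin in \<open>simp_all add: M.N.M.a_comm\<close>)
  then show "cspace.efin M (act M z) w1" by simp
qed

context twisted_localization
begin

declare D_simps [simp del]

lemma tw_in_D [simp]: "v \<in> carrier N \<Longrightarrow> tw n v \<in> carrier D"
  by (simp add: D_simps)

lemma tw_surj_D: "z \<in> carrier D \<Longrightarrow> \<exists>n v. v \<in> carrier N \<and> z = tw n v"
  using tw_surj by (simp add: D_simps)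

lemma tw_add_D: "v \<in> carrier N \<Longrightarrow> w \<in> carrier N \<Longrightarrow> tw n (v \<oplus>\<^bsub>N\<^esub> w) = tw n v \<oplus>\<^bsub>D\<^esub> tw n w"
  by (simp add: tw_add D_simps)

lemma tw_ahom_D: "tw n \<in> ahom N D"
  by (rule ahomI) (simp_all add: tw_add_D)

lemma tw_zero_D: "tw n \<zero>\<^bsub>N\<^esub> = \<zero>\<^bsub>D\<^esub>"
  by (simp add: tw_zero D_simps)

lemma tw_zero_iff_D: "v \<in> carrier N \<Longrightarrow> tw n v = \<zero>\<^bsub>D\<^esub> \<longleftrightarrow> (\<exists>k. (fN ^^ k) v = \<zero>\<^bsub>N\<^esub>)"
  by (simp add: tw_zero_iff D_simps)

lemma f_tw: "v \<in> carrier N \<Longrightarrow> act D f (tw n v) = tw n (fN v)"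
  by (simp add: FF_tw D_simps)

lemma tw_Suc: "v \<in> carrier N \<Longrightarrow> tw (Suc n) (fN v) = tw n v"
  using tw_shift[of v n 1] by simp

text \<open>Subtraction over the common denominator n + m reduces this to
  \<open>tw_zero_iff_D\<close>. The criterion involves the action of f on N alone, which is why it
  agrees for a Lie superalgebra and for a subalgebra containing f.\<close>

lemma tw_eq_iff:
  assumes v: "v \<in> carrier N" and w: "w \<in> carrier N"
  shows "tw n v = tw m w \<longleftrightarrow> (\<exists>k. (fN ^^ (k + m)) v = (fN ^^ (k + n)) w)"
proof -
  interpret D: gmodule L D by (rule gmodule_D)
  let ?v = "(fN ^^ m) v" and ?w = "(fN ^^ n) w"
  have c: "?v \<in> carrier N" "?w \<in> carrier N" using v w by simp_all
  have "tw n v = tw (n + m) ?v" "tw m w = tw (n + m) ?w"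
    using tw_shift[OF v, of n m] tw_shift[OF w, of m n] by (simp_all add: add.commute)
  then have "tw n v = tw m w \<longleftrightarrow> tw (n + m) ?v \<ominus>\<^bsub>D\<^esub> tw (n + m) ?w = \<zero>\<^bsub>D\<^esub>"
    using c D.N.M.minus_eq_zero_iff[of "tw (n + m) ?v" "tw (n + m) ?w"] by simp
  also have "tw (n + m) ?v \<ominus>\<^bsub>D\<^esub> tw (n + m) ?w = tw (n + m) (?v \<ominus>\<^bsub>N\<^esub> ?w)"
    using c by (intro ahom_minus[OF N.M.abelian_group_axioms D.N.M.abelian_group_axioms tw_ahom_D, symmetric])
  also have "\<dots> = \<zero>\<^bsub>D\<^esub> \<longleftrightarrow> (\<exists>k. (fN ^^ k) (?v \<ominus>\<^bsub>N\<^esub> ?w) = \<zero>\<^bsub>N\<^esub>)"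
    using c by (simp add: tw_zero_iff_D)
  also have "\<dots> \<longleftrightarrow> (\<exists>k. (fN ^^ k) ?v = (fN ^^ k) ?w)"
    using c by (simp add: ahom_minus[OF N.M.abelian_group_axioms N.M.abelian_group_axioms E.pow_endo] N.M.minus_eq_zero_iff)
  finally show ?thesis by (simp add: funpow_add_app)
qed

end

section \<open>The action of sl(2) on the twisted localization\<close>

locale sl2_twisted = sl2_module L e h f N + twisted_localization L f N a
  for L :: "'g lsa" and e h f :: 'g and N :: "('g, 'v) gmod" and a :: complex
begin

sublocale DM: sl2_module L e h f D
  by (intro sl2_module.intro sl2_superalgebra_axioms gmodule_D)

abbreviation "W \<equiv> {z \<in> carrier D. DM.N.efin (act D e) z}"

lemma C_eq: "C_obj L e f a N = sub_gmod D W"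
  unfolding C_obj_def Let_def using DM.N.efin_iff[OF DM.act_lin[OF efh_closed(1)]]
  by (metis (no_types, lifting))

lemma W_subsp: "DM.N.subsp W"
  by (rule DM.N.subsp_efin)

lemma W_stable: "x \<in> carrier L \<Longrightarrow> z \<in> W \<Longrightarrow> act D x z \<in> W"
  using e_nil[of x] DM.efin_act[OF efh_even(1), of _ x z] DM.act_closed[of x z] by blast

lemma gmodule_C: "gmodule L (C_obj L e f a N)"
  unfolding C_eq by (rule sub_gmod_gmodule[OF DM.gmodule_axioms W_subsp W_stable])

text \<open>The numerator of a fraction killed by f is killed by a power of f, so the fraction is
  zero. This serves to cancel f^K in f^K e^K w = 0.\<close>

lemma f_inj: "z \<in> carrier D \<Longrightarrow> act D f z = \<zero>\<^bsub>D\<^esub> \<Longrightarrow> z = \<zero>\<^bsub>D\<^esub>"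
proof -
  assume z: "z \<in> carrier D" and 0: "act D f z = \<zero>\<^bsub>D\<^esub>"
  obtain n v where v: "v \<in> carrier N" "z = tw n v" using tw_surj_D[OF z] by blast
  then obtain k where "(fN ^^ k) (fN v) = \<zero>\<^bsub>N\<^esub>"
    using 0 efh_closed by (auto simp: f_tw tw_zero_iff_D act_closed)
  then have "(fN ^^ Suc k) v = \<zero>\<^bsub>N\<^esub>" by (simp only: funpow_Suc_right comp_def)
  then show ?thesis using v tw_zero_iff_D by blast
qed

lemma f_pow_inj: "z \<in> carrier D \<Longrightarrow> (act D f ^^ n) z = \<zero>\<^bsub>D\<^esub> \<Longrightarrow> z = \<zero>\<^bsub>D\<^esub>"
proof (induction n)
  case (Suc n)
  then show ?case using f_inj[of "(act D f ^^ n) z"] DM.act_pow_closed efh_closed by simp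
qed simp

text \<open>Two terms of the series survive: h itself and [f, h] = 2 f, whose f cancels one
  denominator.\<close>

lemma wt_tw:
  assumes v: "wt \<mu> v"
  shows "DM.wt (\<mu> - 2 * (a - of_nat n)) (tw n v)"
proof -
  let ?c = "a - of_nat n"
  note vc = wtD(1)[OF v]
  have b: "(br L f ^^ 2) h = \<zero>\<^bsub>L\<^esub>"
    using efh_closed fh ff br_smult_right[of f f 2] cL.s_zero by (simp add: numeral_2_eq_2)
  have "act D h (tw n v) = nsum D (\<lambda>j. tw (n + j) (((-1) ^ j * (?c gchoose j)) \<odot>\<^bsub>N\<^esub> act N ((br L f ^^ j) h) v)) 2"
    by (rule act_D_tw[OF efh_closed(2) b vc])
  also have "\<dots> = tw n (act N h v) \<oplus>\<^bsub>D\<^esub> tw (Suc n) ((- ?c) \<odot>\<^bsub>N\<^esub> act N (2 \<odot>\<^bsub>L\<^esub> f) v)"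
    using vc efh_closed by (simp add: numeral_2_eq_2 fh act_closed)
  also have "act N (2 \<odot>\<^bsub>L\<^esub> f) v = 2 \<odot>\<^bsub>N\<^esub> fN v" using vc efh_closed by (simp add: act_smult_l)
  also have "(- ?c) \<odot>\<^bsub>N\<^esub> (2 \<odot>\<^bsub>N\<^esub> fN v) = fN ((- 2 * ?c) \<odot>\<^bsub>N\<^esub> v)"
    using vc efh_closed by (simp add: act_smult_r N.s_assoc act_closed algebra_simps)
  also have "tw (Suc n) (fN ((- 2 * ?c) \<odot>\<^bsub>N\<^esub> v)) = tw n ((- 2 * ?c) \<odot>\<^bsub>N\<^esub> v)"
    using vc by (simp add: tw_Suc)
  also have "tw n (act N h v) \<oplus>\<^bsub>D\<^esub> tw n ((- 2 * ?c) \<odot>\<^bsub>N\<^esub> v) = tw n ((\<mu> - 2 * ?c) \<odot>\<^bsub>N\<^esub> v)"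
    using tw_add_D[of "\<mu> \<odot>\<^bsub>N\<^esub> v" "(- 2 * ?c) \<odot>\<^bsub>N\<^esub> v" n] vc
    by (simp only: wtD(2)[OF v] N.s_add_l[OF vc, symmetric] N.s_closed mult_minus_left diff_conv_add_uminus)
  finally show ?thesis using vc unfolding DM.wt_def by (simp only: tw_smult tw_in_D simp_thms)
qed

text \<open>Three terms survive: e, then [f, e] = -h and (ad f)^2 e = -2 f. With c = a - n the last
  two contribute c \<mu> and -c (c - 1) over the same denominator, together c (\<mu> + 1 -
  c).\<close>

lemma e_tw:
  assumes v: "wt \<mu> v"
  shows "act D e (tw n v) = tw n (act N e v) \<oplus>\<^bsub>D\<^esub>
    tw (Suc n) (((a - of_nat n) * (\<mu> + 1 - (a - of_nat n))) \<odot>\<^bsub>N\<^esub> v)"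
proof -
  let ?c = "a - of_nat n"
  note vc = wtD(1)[OF v]
  have b1: "br L f e = (-1) \<odot>\<^bsub>L\<^esub> h" by (rule fe)
  have b2: "br L f ((-1) \<odot>\<^bsub>L\<^esub> h) = (-2) \<odot>\<^bsub>L\<^esub> f"
    using efh_closed fh by (simp add: br_smult_right cL.s_assoc)
  have b3: "br L f ((-2) \<odot>\<^bsub>L\<^esub> f) = \<zero>\<^bsub>L\<^esub>"
    using efh_closed ff cL.s_zero by (simp add: br_smult_right)
  have b: "(br L f ^^ 3) e = \<zero>\<^bsub>L\<^esub>" by (simp add: numeral_3_eq_3 b1 b2 b3)
  have g2: "?c gchoose Suc (Suc 0) = ?c * (?c - 1) / 2"
    using gbinomial_prod_rev[of ?c 2] by (simp add: numeral_2_eq_2)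
  have "act D e (tw n v) = nsum D (\<lambda>j. tw (n + j) (((-1) ^ j * (?c gchoose j)) \<odot>\<^bsub>N\<^esub> act N ((br L f ^^ j) e) v)) 3"
    by (rule act_D_tw[OF efh_closed(1) b vc])
  also have "\<dots> = tw n (act N e v) \<oplus>\<^bsub>D\<^esub> tw (Suc n) ((- ?c) \<odot>\<^bsub>N\<^esub> act N ((-1) \<odot>\<^bsub>L\<^esub> h) v) \<oplus>\<^bsub>D\<^esub>
      tw (Suc (Suc n)) ((?c gchoose Suc (Suc 0)) \<odot>\<^bsub>N\<^esub> act N ((-2) \<odot>\<^bsub>L\<^esub> f) v)"
    using vc efh_closed by (simp add: numeral_3_eq_3 b1 b2 act_closed)
  also have "(- ?c) \<odot>\<^bsub>N\<^esub> act N ((-1) \<odot>\<^bsub>L\<^esub> h) v = (?c * \<mu>) \<odot>\<^bsub>N\<^esub> v"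
    using vc efh_closed wtD(2)[OF v] by (simp add: act_smult_l N.s_assoc act_closed algebra_simps)
  also have "(?c gchoose Suc (Suc 0)) \<odot>\<^bsub>N\<^esub> act N ((-2) \<odot>\<^bsub>L\<^esub> f) v = fN ((- (?c * (?c - 1))) \<odot>\<^bsub>N\<^esub> v)"
    using vc efh_closed unfolding g2 by (simp add: act_smult_l act_smult_r N.s_assoc act_closed)
  also have "tw (Suc (Suc n)) (fN ((- (?c * (?c - 1))) \<odot>\<^bsub>N\<^esub> v)) = tw (Suc n) ((- (?c * (?c - 1))) \<odot>\<^bsub>N\<^esub> v)"
    using vc by (intro tw_Suc) simp
  also have "tw n (act N e v) \<oplus>\<^bsub>D\<^esub> tw (Suc n) ((?c * \<mu>) \<odot>\<^bsub>N\<^esub> v) \<oplus>\<^bsub>D\<^esub> tw (Suc n) ((- (?c * (?c - 1))) \<odot>\<^bsub>N\<^esub> v)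
    = tw n (act N e v) \<oplus>\<^bsub>D\<^esub> tw (Suc n) ((?c * \<mu> + - (?c * (?c - 1))) \<odot>\<^bsub>N\<^esub> v)"
    using vc efh_closed by (simp only: N.s_add_l tw_add_D N.s_closed DM.N.M.a_assoc tw_in_D act_closed)
  also have "?c * \<mu> + - (?c * (?c - 1)) = ?c * (\<mu> + 1 - ?c)" by (simp add: algebra_simps)
  finally show ?thesis .
qed

lemma fe_tw:
  assumes v: "wt \<mu> v"
  shows "DM.fe_op (tw n v) = tw n (fe_op v \<oplus>\<^bsub>N\<^esub> ((a - of_nat n) * (\<mu> + 1 - (a - of_nat n))) \<odot>\<^bsub>N\<^esub> v)"
proof -
  let ?s = "(a - of_nat n) * (\<mu> + 1 - (a - of_nat n))"
  have c: "v \<in> carrier N" "act N e v \<in> carrier N" "fe_op v \<in> carrier N"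
    using wtD(1)[OF v] wtD(1)[OF wt_fe[OF v]] efh_closed by (auto intro: act_closed)
  have "DM.fe_op (tw n v) = act D f (tw n (act N e v)) \<oplus>\<^bsub>D\<^esub> act D f (tw (Suc n) (?s \<odot>\<^bsub>N\<^esub> v))"
    unfolding DM.fe_op_def e_tw[OF v] using c efh_closed by (intro DM.act_add_r) simp_all
  also have "act D f (tw n (act N e v)) = tw n (fe_op v)" using c by (simp add: f_tw fe_op_def)
  also have "act D f (tw (Suc n) (?s \<odot>\<^bsub>N\<^esub> v)) = tw n (?s \<odot>\<^bsub>N\<^esub> v)" using c by (simp add: f_tw tw_Suc)
  finally show ?thesis using c by (simp add: tw_add_D)
qed

lemma wt_pr: "wt \<mu> v \<Longrightarrow> wt \<mu> (N.pr fe_op \<beta>s v)"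
  by (induction \<beta>s) (simp_all add: wt_add wt_smult wt_fe)

text \<open>By \<open>fe_tw\<close> the operator fe acts on \<open>tw n v\<close> as fe on v plus a
  scalar that depends on a, n and \<mu>. As fe keeps the weight, this scalar is the same at each
  factor and translates every root.\<close>

lemma pr_tw:
  assumes v: "wt \<mu> v"
  shows "DM.N.pr DM.fe_op (map (\<lambda>\<beta>. \<beta> + (a - of_nat n) * (\<mu> + 1 - (a - of_nat n))) \<beta>s) (tw n v) = tw n (N.pr fe_op \<beta>s v)"
proof (induction \<beta>s)
  case (Cons \<beta> \<beta>s)
  let ?s = "(a - of_nat n) * (\<mu> + 1 - (a - of_nat n))" and ?u = "N.pr fe_op \<beta>s v"
  have u: "wt \<mu> ?u" by (rule wt_pr[OF v])
  have c: "?u \<in> carrier N" "fe_op ?u \<in> carrier N" using wtD(1)[OF u] wtD(1)[OF wt_fe[OF u]] by auto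
  have "DM.fe_op (tw n ?u) \<oplus>\<^bsub>D\<^esub> (- (\<beta> + ?s)) \<odot>\<^bsub>D\<^esub> tw n ?u = tw n (fe_op ?u \<oplus>\<^bsub>N\<^esub> ?s \<odot>\<^bsub>N\<^esub> ?u \<oplus>\<^bsub>N\<^esub> (- (\<beta> + ?s)) \<odot>\<^bsub>N\<^esub> ?u)"
    using c by (simp add: fe_tw[OF u] tw_smult tw_add_D)
  also have "fe_op ?u \<oplus>\<^bsub>N\<^esub> ?s \<odot>\<^bsub>N\<^esub> ?u \<oplus>\<^bsub>N\<^esub> (- (\<beta> + ?s)) \<odot>\<^bsub>N\<^esub> ?u = fe_op ?u \<oplus>\<^bsub>N\<^esub> (- \<beta>) \<odot>\<^bsub>N\<^esub> ?u"
    using c by (simp add: N.M.a_assoc N.s_add_l[symmetric])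
  finally show ?case using Cons by simp
qed simp

text \<open>For \<open>c = a - n\<close> the vector \<open>f\<^sup>a \<otimes> f\<^sup>-\<^sup>n \<otimes> v\<close> has weight \<open>\<mu> - 2c\<close>; the first kind of root comes
  from \<open>f\<^sup>K e\<^sup>K\<close> acting on it, the second one from \<open>f\<^sup>k e\<^sup>k\<close> acting on \<open>v\<close>.\<close>

lemma casimir_root_diff:
  "casimir_root (\<mu> - 2 * c) i - (casimir_root \<mu> j + c * (\<mu> + 1 - c)) =
    - (c - of_nat i + of_nat j) * (\<mu> + 1 + of_nat j - (c - of_nat i))"
  by (simp add: casimir_root_def algebra_simps)

lemma annihilator_tw:
  assumes v: "wt \<mu> v" and k: "(act N e ^^ k) v = \<zero>\<^bsub>N\<^esub>"
  shows "DM.N.pr DM.fe_op (map (\<lambda>j. casimir_root \<mu> j + (a - of_nat n) * (\<mu> + 1 - (a - of_nat n))) [0..<k]) (tw n v) = \<zero>\<^bsub>D\<^esub>"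
proof -
  have "N.pr fe_op (map (casimir_root \<mu>) [0..<k]) v = \<zero>\<^bsub>N\<^esub>"
    using act_pow_zero[OF efh_closed(3)] by (simp only: f_pow_e_pow[OF v, symmetric] k)
  then show ?thesis
    using pr_tw[OF v, of n "map (casimir_root \<mu>) [0..<k]"] by (simp only: map_map comp_def tw_zero_D)
qed

lemma e_nilpotent_tw:
  assumes v: "wt \<mu> v" and k: "(act N e ^^ k) v = \<zero>\<^bsub>N\<^esub>" and K: "a - \<mu> = of_nat K" "k \<le> K"
  shows "(act D e ^^ K) (tw 0 v) = \<zero>\<^bsub>D\<^esub>"
proof -
  let ?w = "tw 0 v" and ?r = "casimir_root (\<mu> - 2 * a)" and ?b = "\<lambda>j. casimir_root \<mu> j + a * (\<mu> + 1 - a)"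
  note vc = wtD(1)[OF v]
  have w: "DM.wt (\<mu> - 2 * a) ?w" using wt_tw[OF v, of 0] by simp
  have lin: "DM.N.lin (DM.N.pr DM.fe_op xs)" for xs by (rule DM.N.pr_lin[OF DM.fe_lin])
  \<comment> \<open>For a - \<mu> = K the second factor in \<open>casimir_root_diff\<close> vanishes
    at i = K - 1 - j, an index below K because j < k and k is at most K.\<close>
  have eq: "?b j = ?r (K - 1 - j)" if "j < k" for j
  proof -
    have "(of_nat (K - 1 - j) :: complex) = of_nat K - 1 - of_nat j"
      using that K(2) by (simp add: of_nat_diff)
    then have "\<mu> + 1 + of_nat j - (a - of_nat (K - 1 - j)) = 0"
      using K(1) by (simp only:) (simp add: algebra_simps)
    then have "?r (K - 1 - j) - ?b j = 0" by (simp only: casimir_root_diff mult_zero_right)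
    then show ?thesis by simp
  qed
  \<comment> \<open>So the last k roots of the first product are those of the second one in reverse
    order; \<open>DM.N.pr_rev\<close> absorbs the reversal.\<close>
  have "map ?r [0..<K] = map ?r [0..<K - k] @ rev (map ?b [0..<k])"
  proof (rule nth_equalityI)
    show "map ?r [0..<K] ! i = (map ?r [0..<K - k] @ rev (map ?b [0..<k])) ! i" if "i < length (map ?r [0..<K])" for i
    proof (cases "i < K - k")
      case False
      then have "i - (K - k) < k" using that K(2) by simp
      then have "(map ?r [0..<K - k] @ rev (map ?b [0..<k])) ! i = ?b (k - 1 - (i - (K - k)))"
        using False K(2) nth_upt[of 0 "K - Suc i" k] by (simp add: nth_append rev_nth)
      also have "\<dots> = ?r (K - 1 - (k - 1 - (i - (K - k))))" using that False K(2) by (intro eq) simp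
      also have "K - 1 - (k - 1 - (i - (K - k))) = i" using that False K(2) by simp
      finally show ?thesis using that by simp
    qed (use that in \<open>simp add: nth_append\<close>)
  qed (use K in simp)
  moreover have "DM.N.pr DM.fe_op (map ?b [0..<k]) ?w = \<zero>\<^bsub>D\<^esub>"
    using annihilator_tw[OF v k, of 0] by simp
  ultimately have "DM.N.pr DM.fe_op (map ?r [0..<K]) ?w = \<zero>\<^bsub>D\<^esub>"
    using vc DM.N.linD(5)[OF lin] by (simp add: DM.N.pr_append DM.N.pr_rev[OF DM.fe_lin] del: map_append)
  then have "(act D f ^^ K) ((act D e ^^ K) ?w) = \<zero>\<^bsub>D\<^esub>"
    using DM.f_pow_e_pow[OF w, of K] by simp
  moreover have "(act D e ^^ K) ?w \<in> carrier D" using vc by (intro DM.act_pow_closed efh_closed) simp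
  ultimately show ?thesis by (rule f_pow_inj[rotated])
qed

lemma e_nilpotent_quotient:
  assumes v: "wt \<mu> v" and k: "(act N e ^^ k) v = \<zero>\<^bsub>N\<^esub>"
    and B: "DM.N.subsp B" "\<And>x z. x \<in> carrier L \<Longrightarrow> z \<in> B \<Longrightarrow> act D x z \<in> B"
    and K: "(act D e ^^ K) (tw n v) \<in> B" and a: "a \<notin> \<int>" "a - \<mu> \<notin> \<int>"
  shows "tw n v \<in> B"
proof (rule DM.N.coprime_annihilators[OF DM.fe_lin B(1)])
  let ?c = "a - of_nat n"
  show "DM.fe_op z \<in> B" if "z \<in> B" for z
    unfolding DM.fe_op_def by (intro B(2) efh_closed that)
  show "tw n v \<in> carrier D" using wtD(1)[OF v] by simp
  have Bf: "(act D f ^^ m) z \<in> B" if "z \<in> B" for m z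
    by (induction m) (use that B(2) efh_closed in auto)
  show "DM.N.pr DM.fe_op (map (casimir_root (\<mu> - 2 * ?c)) [0..<K]) (tw n v) \<in> B"
    unfolding DM.f_pow_e_pow[OF wt_tw[OF v, of n], symmetric] by (rule Bf[OF K])
  show "DM.N.pr DM.fe_op (map (\<lambda>j. casimir_root \<mu> j + ?c * (\<mu> + 1 - ?c)) [0..<k]) (tw n v) \<in> B"
    using annihilator_tw[OF v k, of n] DM.N.subspD(2)[OF B(1)] by simp
  \<comment> \<open>By \<open>casimir_root_diff\<close> a coincidence is the vanishing of one of two
    linear factors: the first one makes a an integer, the second one a - \<mu>.\<close>
  have "casimir_root (\<mu> - 2 * ?c) i \<noteq> casimir_root \<mu> j + ?c * (\<mu> + 1 - ?c)" for i j
  proof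
    assume "casimir_root (\<mu> - 2 * ?c) i = casimir_root \<mu> j + ?c * (\<mu> + 1 - ?c)"
    then have "- (?c - of_nat i + of_nat j) * (\<mu> + 1 + of_nat j - (?c - of_nat i)) = 0"
      by (simp only: casimir_root_diff[symmetric] diff_self)
    then consider "?c - of_nat i + of_nat j = 0" | "\<mu> + 1 + of_nat j - (?c - of_nat i) = 0"
      by (simp only: mult_eq_0_iff neg_equal_0_iff_equal) blast
    then show False
    proof cases
      case 1
      then have "a = of_int (int n + int i - int j)" by (simp add: algebra_simps)
      then show False using a(1) by (metis Ints_of_int)
    next
      case 2
      then have "a - \<mu> = of_int (1 + int j + int n + int i)" by (simp add: algebra_simps)
      then show False using a(2) by (metis Ints_of_int)
    qed
  qed
  then show "set (map (casimir_root (\<mu> - 2 * ?c)) [0..<K]) \<inter> set (map (\<lambda>j. casimir_root \<mu> j + ?c * (\<mu> + 1 - ?c)) [0..<k]) = {}"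
    by auto
qed

lemma C_simps [simp]:
  "carrier (C_obj L e f a N) = W" "add (C_obj L e f a N) = add D" "\<zero>\<^bsub>C_obj L e f a N\<^esub> = \<zero>\<^bsub>D\<^esub>"
  "module.smult (C_obj L e f a N) = module.smult D" "act (C_obj L e f a N) = act D"
  "par (C_obj L e f a N) i = W \<inter> par D i"
  by (simp_all add: C_eq)

end

section \<open>The Enright functor on modules and homomorphisms\<close>

lemma sl2_twistedI:
  assumes "sl2_superalgebra L e h f" "is_gmodule gr L N"
  shows "sl2_twisted L e h f N"
proof -
  interpret sl2_superalgebra L e h f by fact
  interpret gmodule L N using assms(2) is_gmodule_iff[OF lie_superalgebra_axioms] by blast
  show ?thesis
    by (intro sl2_twisted.intro sl2_module.intro twisted_localization.intro sl2_superalgebra_axioms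
        gmodule_axioms f_lie_superalgebra_axioms)
qed

lemma graded_twistedI:
  assumes "sl2_superalgebra L e h f" "is_gmodule True L N"
  shows "graded_twisted_localization L f N"
proof -
  interpret sl2_superalgebra L e h f by fact
  interpret gmodule L N using assms(2) is_gmodule_iff[OF lie_superalgebra_axioms] by blast
  show ?thesis
    using assms(2) is_gmodule_iff[OF lie_superalgebra_axioms, of True N]
    by (intro graded_twisted_localization.intro graded_twisted_localization_axioms.intro twisted_localization.intro
        gmodule_axioms f_lie_superalgebra_axioms) auto
qed

lemma is_gmodule_C:
  assumes "sl2_superalgebra L e h f" "is_gmodule gr L N"
  shows "is_gmodule gr L (C_obj L e f a N)"
proof -
  interpret sl2_twisted L e h f N a by (rule sl2_twistedI[OF assms])
  interpret C: gmodule L "C_obj L e f a N" by (rule gmodule_C)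
  have "graded (C_obj L e f a N) \<and> (\<forall>i j. \<forall>x\<in>par L i. \<forall>v\<in>par (C_obj L e f a N) j. act (C_obj L e f a N) x v \<in> par (C_obj L e f a N) (i + j))" if gr
  proof
    interpret G: graded_twisted_localization L f N a
      by (rule graded_twistedI[OF assms(1)]) (use assms(2) that in simp)
    have ap: "act D x v \<in> par D (i + j)" if "x \<in> par L i" "v \<in> par D j" for x v i j
      by (rule G.act_par_D[OF that])
    show "graded (C_obj L e f a N)"
      unfolding C_eq
    proof (rule graded_sub_gmod[OF DM.gmodule_axioms G.graded_D W_subsp])
      fix w assume w: "w \<in> W"
      then obtain w0 w1 where *: "w0 \<in> par D 0" "w1 \<in> par D 1" "w = w0 \<oplus>\<^bsub>D\<^esub> w1"
        using G.graded_D by (auto simp: graded_def)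
      have "DM.N.efin (act D e) w0" "DM.N.efin (act D e) w1"
        using graded_component_efin[OF DM.gmodule_axioms G.graded_D ap efh_even(1) *(1,2)] w *(3) by auto
      moreover have "w0 \<in> carrier D" "w1 \<in> carrier D"
        using * G.graded_D DM.N.submodule_iff DM.N.subspD(1) by (auto simp: graded_def)
      ultimately show "\<exists>w0\<in>W \<inter> par D 0. \<exists>w1\<in>W \<inter> par D 1. w = w0 \<oplus>\<^bsub>D\<^esub> w1" using * by blast
    next
      show "cspace (sub_gmod D W)" using C.N.cspace_axioms by (simp only: C_eq)
    qed
    show "\<forall>i j. \<forall>x\<in>par L i. \<forall>v\<in>par (C_obj L e f a N) j. act (C_obj L e f a N) x v \<in> par (C_obj L e f a N) (i + j)"
    proof (intro allI ballI)
      fix i j x v assume xv: "x \<in> par L i" "v \<in> par (C_obj L e f a N) j"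
      then show "act (C_obj L e f a N) x v \<in> par (C_obj L e f a N) (i + j)"
        using ap[of x i v j] W_stable[OF par_carrier[OF xv(1)], of v] by (simp only: C_simps Int_iff)
    qed
  qed
  then show ?thesis
    unfolding is_gmodule_iff[OF lie_superalgebra_axioms] using gmodule_C by blast
qed

lemma gmod_homD:
  assumes "\<phi> \<in> gmod_hom gr L M N"
  shows "\<And>v. v \<in> carrier M \<Longrightarrow> \<phi> v \<in> carrier N"
    "\<And>v w. v \<in> carrier M \<Longrightarrow> w \<in> carrier M \<Longrightarrow> \<phi> (v \<oplus>\<^bsub>M\<^esub> w) = \<phi> v \<oplus>\<^bsub>N\<^esub> \<phi> w"
    "\<And>c v. v \<in> carrier M \<Longrightarrow> \<phi> (c \<odot>\<^bsub>M\<^esub> v) = c \<odot>\<^bsub>N\<^esub> \<phi> v"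
    "\<And>x v. x \<in> carrier L \<Longrightarrow> v \<in> carrier M \<Longrightarrow> \<phi> (act M x v) = act N x (\<phi> v)"
    "\<And>i v. gr \<Longrightarrow> v \<in> par M i \<Longrightarrow> \<phi> v \<in> par N i"
  using assms by (auto simp: gmod_hom_def)

lemma gmod_homI:
  assumes "\<phi> \<in> ahom M N" "\<And>c v. v \<in> carrier M \<Longrightarrow> \<phi> (c \<odot>\<^bsub>M\<^esub> v) = c \<odot>\<^bsub>N\<^esub> \<phi> v"
    "\<And>x v. x \<in> carrier L \<Longrightarrow> v \<in> carrier M \<Longrightarrow> \<phi> (act M x v) = act N x (\<phi> v)"
    "\<And>i v. gr \<Longrightarrow> v \<in> par M i \<Longrightarrow> \<phi> v \<in> par N i"
  shows "\<phi> \<in> gmod_hom gr L M N"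
  using assms by (auto simp: gmod_hom_def ahom_def)

text \<open>In the graded case surjectivity is required degree by degree, since that is what makes
  the inverse preserve degrees.\<close>

lemma gmod_isoI:
  assumes "gmodule L M" and \<eta>: "\<eta> \<in> gmod_hom gr L M N" and bij: "bij_betw \<eta> (carrier M) (carrier N)"
    and par: "\<And>i. gr \<Longrightarrow> par M i \<subseteq> carrier M" "\<And>i. gr \<Longrightarrow> par N i \<subseteq> \<eta> ` par M i"
  shows "\<eta> \<in> gmod_iso gr L M N"
proof -
  interpret M: gmodule L M by fact
  let ?i = "inv_into (carrier M) \<eta>"
  note h = gmod_homD[OF \<eta>]
  have inv: "?i (\<eta> v) = v" if "v \<in> carrier M" for v
    using that bij by (simp add: bij_betw_def)
  have img: "\<exists>v. v \<in> carrier M \<and> w = \<eta> v" if "w \<in> carrier N" for w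
    using that bij by (auto simp: bij_betw_def)
  have "?i \<in> gmod_hom gr L N M"
  proof (intro gmod_homI ahomI)
    fix w assume "w \<in> carrier N"
    then obtain v where v: "v \<in> carrier M" "w = \<eta> v" using img by blast
    show "?i w \<in> carrier M" using v by (simp add: inv)
    show "?i (c \<odot>\<^bsub>N\<^esub> w) = c \<odot>\<^bsub>M\<^esub> ?i w" for c using v h(3)[of v c] inv[of "c \<odot>\<^bsub>M\<^esub> v"] by (simp add: inv)
    show "?i (act N x w) = act M x (?i w)" if "x \<in> carrier L" for x
      using v that h(4)[of x v] inv[of "act M x v"] by (simp add: inv M.act_closed)
    fix w' assume "w' \<in> carrier N"
    then obtain v' where v': "v' \<in> carrier M" "w' = \<eta> v'" using img by blast
    show "?i (w \<oplus>\<^bsub>N\<^esub> w') = ?i w \<oplus>\<^bsub>M\<^esub> ?i w'"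
      using v v' h(2)[of v v'] inv[of "v \<oplus>\<^bsub>M\<^esub> v'"] by (simp add: inv)
  next
    fix i w assume gr "w \<in> par N i"
    then obtain v where "v \<in> par M i" "w = \<eta> v" using par(2) by blast
    then show "?i w \<in> par M i" using par(1)[OF \<open>gr\<close>, of i] inv[of v] by auto
  qed
  then show ?thesis using \<eta> bij by (simp add: gmod_iso_def)
qed

text \<open>The series \<open>act_D_tw\<close> has the same coefficients for M and for N, so
  compatibility with x reduces termwise to that of \<phi> with (ad f)^j x.\<close>

lemma D_mor_hom:
  assumes S: "sl2_superalgebra L e h f" and M: "is_gmodule gr L M" and N: "is_gmodule gr L N"
    and \<phi>: "\<phi> \<in> gmod_hom gr L M N"
  shows "D_mor L f a M N \<phi> \<in> gmod_hom gr L (D_obj L f a M) (D_obj L f a N)"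
proof -
  interpret M: sl2_twisted L e h f M a by (rule sl2_twistedI[OF S M])
  interpret N: sl2_twisted L e h f N a by (rule sl2_twistedI[OF S N])
  note dm = D_mor_tw[OF M.twisted_localization_axioms N.twisted_localization_axioms \<phi>, where a = a]
  note h = gmod_homD[OF \<phi>]
  let ?F = "D_mor L f a M N \<phi>"
  show ?thesis
  proof (intro gmod_homI dm(1))
    fix z assume z: "z \<in> carrier M.D"
    then obtain n v where v: "v \<in> carrier M" "z = M.tw n v" using M.tw_surj_D by blast
    show "?F (c \<odot>\<^bsub>M.D\<^esub> z) = c \<odot>\<^bsub>N.D\<^esub> ?F z" for c
      using v h(1)[OF v(1)] by (simp add: dm(2) h(3) M.tw_smult N.tw_smult)
    fix x assume x: "x \<in> carrier L"
    obtain d where d: "(br L f ^^ d) x = \<zero>\<^bsub>L\<^esub>" using M.f_nil[OF x] by blast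
    have xj: "(br L f ^^ j) x \<in> carrier L" for j by (rule M.U_gen_ad_pow(1)[OF M.f_even x])
    have "?F (act M.D x z) = nsum N.D (\<lambda>j. ?F (M.tw (n + j) (((-1) ^ j * ((a - of_nat n) gchoose j)) \<odot>\<^bsub>M\<^esub> act M ((br L f ^^ j) x) v))) d"
      unfolding v(2) M.act_D_tw[OF x d v(1)]
      by (rule ahom_nsum[OF M.DM.N.M.abelian_group_axioms N.DM.N.M.abelian_group_axioms dm(1)])
        (use v xj in \<open>simp add: M.act_closed\<close>)
    also have "\<dots> = act N.D x (?F z)"
      unfolding v(2) dm(2)[OF v(1)] N.act_D_tw[OF x d h(1)[OF v(1)]]
      using v xj by (intro nsum_cong) (simp add: dm(2) h M.act_closed)
    finally show "?F (act M.D x z) = act N.D x (?F z)" .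
  next
    fix i z assume gr and z: "z \<in> par M.D i"
    interpret GM: graded_twisted_localization L f M a
      by (rule graded_twistedI[OF S]) (use M \<open>gr\<close> in simp)
    interpret GN: graded_twisted_localization L f N a
      by (rule graded_twistedI[OF S]) (use N \<open>gr\<close> in simp)
    obtain n v where "v \<in> par M i" "z = M.tw n v" using z by (auto simp: M.D_simps GM.D_par_eq GM.Par_def)
    then show "?F z \<in> par N.D i"
      using GM.parN_facts(1) h(5)[OF \<open>gr\<close>] by (auto simp: N.D_simps GN.D_par_eq dm(2) intro: GN.ParI)
  qed
qed

lemma C_mor_tw:
  assumes "sl2_twisted L e h f M" "sl2_twisted L e h f N" "\<phi> \<in> gmod_hom gr L M N" "v \<in> carrier M"
    and W: "twisted_localization.tw L f M a n v \<in> carrier (C_obj L e f a M)"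
  shows "C_mor L e f a M N \<phi> (twisted_localization.tw L f M a n v) = twisted_localization.tw L f N a n (\<phi> v)"
  using D_mor_tw(2)[OF sl2_twisted.axioms(2) sl2_twisted.axioms(2), OF assms(1,2,3,4)] W
  by (simp add: C_mor_def)

lemma C_mor_hom:
  assumes S: "sl2_superalgebra L e h f" and M: "is_gmodule gr L M" and N: "is_gmodule gr L N"
    and \<phi>: "\<phi> \<in> gmod_hom gr L M N"
  shows "C_mor L e f a M N \<phi> \<in> gmod_hom gr L (C_obj L e f a M) (C_obj L e f a N)"
proof -
  interpret M: sl2_twisted L e h f M a by (rule sl2_twistedI[OF S M])
  interpret N: sl2_twisted L e h f N a by (rule sl2_twistedI[OF S N])
  let ?F = "D_mor L f a M N \<phi>"
  note F = D_mor_hom[OF S M N \<phi>, where a = a]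
  note h = gmod_homD[OF F]
  have W: "?F z \<in> N.W" if "z \<in> M.W" for z
    using efin_map[OF M.DM.N.cspace_axioms N.DM.N.cspace_axioms gmod_hom_ahom[OF F] h(3), where T = "act M.D e" and S = "act N.D e" and v = z]
      that h(1)[of z] h(4)[OF M.efh_closed(1)] by simp
  have eq: "C_mor L e f a M N \<phi> z = ?F z" if "z \<in> M.W" for z using that by (simp add: C_mor_def)
  note s = M.DM.N.subspD[OF M.W_subsp]
  show ?thesis
  proof (intro gmod_homI ahomI)
    fix z assume "z \<in> carrier (C_obj L e f a M)"
    then have z: "z \<in> M.W" by simp
    then show "C_mor L e f a M N \<phi> z \<in> carrier (C_obj L e f a N)" using W[OF z] by (simp only: eq N.C_simps)
    show "C_mor L e f a M N \<phi> (c \<odot>\<^bsub>C_obj L e f a M\<^esub> z) = c \<odot>\<^bsub>C_obj L e f a N\<^esub> C_mor L e f a M N \<phi> z" for c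
      using s(4)[OF z, of c] h(3)[OF s(1)[OF z], of c] by (simp only: M.C_simps N.C_simps eq z)
    show "C_mor L e f a M N \<phi> (act (C_obj L e f a M) x z) = act (C_obj L e f a N) x (C_mor L e f a M N \<phi> z)"
      if "x \<in> carrier L" for x
      using M.W_stable[OF that z] h(4)[OF that s(1)[OF z]] by (simp only: M.C_simps N.C_simps eq z)
    fix w assume "w \<in> carrier (C_obj L e f a M)"
    then have w: "w \<in> M.W" by simp
    show "C_mor L e f a M N \<phi> (z \<oplus>\<^bsub>C_obj L e f a M\<^esub> w) = C_mor L e f a M N \<phi> z \<oplus>\<^bsub>C_obj L e f a N\<^esub> C_mor L e f a M N \<phi> w"
      using s(3)[OF z w] h(2)[OF s(1)[OF z] s(1)[OF w]] by (simp only: M.C_simps N.C_simps eq z w)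
  next
    fix i z assume gr "z \<in> par (C_obj L e f a M) i"
    then have "z \<in> M.W" "z \<in> par M.D i" by simp_all
    then show "C_mor L e f a M N \<phi> z \<in> par (C_obj L e f a N) i"
      using W[of z] h(5)[OF \<open>gr\<close>, of z i] by (simp only: N.C_simps eq Int_iff)
  qed
qed

lemma is_functorD:
  assumes "is_functor gr L P L' Q F Fm"
  shows "\<And>M. P M \<Longrightarrow> Q (F M)"
    "\<And>M N \<phi>. P M \<Longrightarrow> P N \<Longrightarrow> \<phi> \<in> gmod_hom gr L M N \<Longrightarrow> Fm M N \<phi> \<in> gmod_hom gr L' (F M) (F N)"
    "\<And>M N \<phi> \<psi> w. P M \<Longrightarrow> P N \<Longrightarrow> \<phi> \<in> gmod_hom gr L M N \<Longrightarrow> \<psi> \<in> gmod_hom gr L M N \<Longrightarrow>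
      (\<And>v. v \<in> carrier M \<Longrightarrow> \<phi> v = \<psi> v) \<Longrightarrow> w \<in> carrier (F M) \<Longrightarrow> Fm M N \<phi> w = Fm M N \<psi> w"
    "\<And>M w. P M \<Longrightarrow> w \<in> carrier (F M) \<Longrightarrow> Fm M M (\<lambda>v. v) w = w"
    "\<And>M N K \<phi> \<psi> w. P M \<Longrightarrow> P N \<Longrightarrow> P K \<Longrightarrow> \<phi> \<in> gmod_hom gr L M N \<Longrightarrow> \<psi> \<in> gmod_hom gr L N K \<Longrightarrow>
      w \<in> carrier (F M) \<Longrightarrow> Fm M K (\<psi> \<circ> \<phi>) w = Fm N K \<psi> (Fm M N \<phi> w)"
proof -
  note F = assms[unfolded is_functor_def]
  show "\<And>M. P M \<Longrightarrow> Q (F M)" using F[THEN conjunct1] by blast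
  show "\<And>M N \<phi>. P M \<Longrightarrow> P N \<Longrightarrow> \<phi> \<in> gmod_hom gr L M N \<Longrightarrow> Fm M N \<phi> \<in> gmod_hom gr L' (F M) (F N)"
    using F[THEN conjunct2, THEN conjunct1] by blast
  show "\<And>M N \<phi> \<psi> w. P M \<Longrightarrow> P N \<Longrightarrow> \<phi> \<in> gmod_hom gr L M N \<Longrightarrow> \<psi> \<in> gmod_hom gr L M N \<Longrightarrow>
      (\<And>v. v \<in> carrier M \<Longrightarrow> \<phi> v = \<psi> v) \<Longrightarrow> w \<in> carrier (F M) \<Longrightarrow> Fm M N \<phi> w = Fm M N \<psi> w"
    by (rule F[THEN conjunct2, THEN conjunct2, THEN conjunct1, rule_format]) blast+
  show "\<And>M w. P M \<Longrightarrow> w \<in> carrier (F M) \<Longrightarrow> Fm M M (\<lambda>v. v) w = w"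
    using F[THEN conjunct2, THEN conjunct2, THEN conjunct2, THEN conjunct1] by blast
  show "\<And>M N K \<phi> \<psi> w. P M \<Longrightarrow> P N \<Longrightarrow> P K \<Longrightarrow> \<phi> \<in> gmod_hom gr L M N \<Longrightarrow> \<psi> \<in> gmod_hom gr L N K \<Longrightarrow>
      w \<in> carrier (F M) \<Longrightarrow> Fm M K (\<psi> \<circ> \<phi>) w = Fm N K \<psi> (Fm M N \<phi> w)"
    by (rule F[THEN conjunct2, THEN conjunct2, THEN conjunct2, THEN conjunct2, rule_format]) blast
qed

lemma is_functorI:
  assumes "\<And>M. P M \<Longrightarrow> Q (F M)"
    "\<And>M N \<phi>. P M \<Longrightarrow> P N \<Longrightarrow> \<phi> \<in> gmod_hom gr L M N \<Longrightarrow> Fm M N \<phi> \<in> gmod_hom gr L' (F M) (F N)"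
    "\<And>M N \<phi> \<psi> w. P M \<Longrightarrow> P N \<Longrightarrow> \<phi> \<in> gmod_hom gr L M N \<Longrightarrow> \<psi> \<in> gmod_hom gr L M N \<Longrightarrow>
      (\<And>v. v \<in> carrier M \<Longrightarrow> \<phi> v = \<psi> v) \<Longrightarrow> w \<in> carrier (F M) \<Longrightarrow> Fm M N \<phi> w = Fm M N \<psi> w"
    "\<And>M w. P M \<Longrightarrow> w \<in> carrier (F M) \<Longrightarrow> Fm M M (\<lambda>v. v) w = w"
    "\<And>M N K \<phi> \<psi> w. P M \<Longrightarrow> P N \<Longrightarrow> P K \<Longrightarrow> \<phi> \<in> gmod_hom gr L M N \<Longrightarrow> \<psi> \<in> gmod_hom gr L N K \<Longrightarrow>
      w \<in> carrier (F M) \<Longrightarrow> Fm M K (\<psi> \<circ> \<phi>) w = Fm N K \<psi> (Fm M N \<phi> w)"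
  shows "is_functor gr L P L' Q F Fm"
  unfolding is_functor_def
proof (intro conjI allI impI ballI, goal_cases)
  case (1 M)
  then show ?case by (rule assms(1))
next
  case (2 M N \<phi>)
  then show ?case by (elim conjE) (rule assms(2))
next
  case (3 M N \<phi> \<psi> w)
  then show ?case by (elim conjE) (rule assms(3), assumption+, erule bspec)
next
  case (4 M w)
  then show ?case by (rule assms(4))
next
  case (5 M N K \<phi> \<psi> w)
  then show ?case by (elim conjE) (rule assms(5))
qed

text \<open>Every element is some \<open>tw n v\<close>, and a homomorphism acts on it by being
  applied to v, so the functor laws become trivial laws for maps on the modules themselves.\<close>

lemma C_functor:
  fixes L :: "'g lsa" and P :: "('g, 'v) gmod \<Rightarrow> bool"
  assumes S: "sl2_superalgebra L e h f" and P: "\<And>M. P M \<Longrightarrow> is_gmodule gr L M"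
    and Q: "\<And>M. P M \<Longrightarrow> Q (C_obj L e f a M)"
  shows "is_functor gr L P L Q (C_obj L e f a) (C_mor L e f a)"
proof -
  have tw: "\<exists>n v. v \<in> carrier M \<and> w = twisted_localization.tw L f M a n v" if "P M" "w \<in> carrier (C_obj L e f a M)" for M w
  proof -
    interpret M: sl2_twisted L e h f M a by (rule sl2_twistedI[OF S P[OF that(1)]])
    show ?thesis using that(2) M.tw_surj_D by simp
  qed
  have mor: "C_mor L e f a M N \<phi> (twisted_localization.tw L f M a n v) = twisted_localization.tw L f N a n (\<phi> v)"
    if "P M" "P N" "\<phi> \<in> gmod_hom gr L M N" "v \<in> carrier M"
      "twisted_localization.tw L f M a n v \<in> carrier (C_obj L e f a M)" for M N \<phi> n v
    using that by (intro C_mor_tw[where gr = gr and h = h] sl2_twistedI[OF S P])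
  show ?thesis
  proof (rule is_functorI)
    show "C_mor L e f a M N \<phi> \<in> gmod_hom gr L (C_obj L e f a M) (C_obj L e f a N)"
      if "P M" "P N" "\<phi> \<in> gmod_hom gr L M N" for M N \<phi>
      using that by (intro C_mor_hom[OF S] P)
  next
    fix M N :: "('g, 'v) gmod" and \<phi> \<psi> w
    assume *: "P M" "P N" "\<phi> \<in> gmod_hom gr L M N" "\<psi> \<in> gmod_hom gr L M N" "\<And>v. v \<in> carrier M \<Longrightarrow> \<phi> v = \<psi> v"
      "w \<in> carrier (C_obj L e f a M)"
    obtain n v where v: "v \<in> carrier M" "w = twisted_localization.tw L f M a n v" using tw[OF *(1,6)] by blast
    show "C_mor L e f a M N \<phi> w = C_mor L e f a M N \<psi> w"
      using * v by (simp add: mor)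
  next
    fix M :: "('g, 'v) gmod" and w
    assume *: "P M" "w \<in> carrier (C_obj L e f a M)"
    obtain n v where v: "v \<in> carrier M" "w = twisted_localization.tw L f M a n v" using tw[OF *] by blast
    have "(\<lambda>v. v) \<in> gmod_hom gr L M M" by (simp add: gmod_hom_def)
    then show "C_mor L e f a M M (\<lambda>v. v) w = w" using * v by (simp add: mor)
  next
    fix M N K :: "('g, 'v) gmod" and \<phi> \<psi> w
    assume *: "P M" "P N" "P K" "\<phi> \<in> gmod_hom gr L M N" "\<psi> \<in> gmod_hom gr L N K"
      "w \<in> carrier (C_obj L e f a M)"
    obtain n v where v: "v \<in> carrier M" "w = twisted_localization.tw L f M a n v" using tw[OF *(1,6)] by blast
    have c: "\<psi> \<circ> \<phi> \<in> gmod_hom gr L M K"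
      using gmod_homD[OF *(4)] gmod_homD[OF *(5)] by (intro gmod_homI ahomI) simp_all
    have W: "C_mor L e f a M N \<phi> w \<in> carrier (C_obj L e f a N)"
      by (rule gmod_homD(1)[OF C_mor_hom[OF S P[OF *(1)] P[OF *(2)] *(4)] *(6)])
    have 1: "C_mor L e f a M N \<phi> w = twisted_localization.tw L f N a n (\<phi> v)"
      using * v by (simp add: mor)
    then have "C_mor L e f a N K \<psi> (C_mor L e f a M N \<phi> w) = twisted_localization.tw L f K a n (\<psi> (\<phi> v))"
      using W mor[OF *(2,3,5)] gmod_homD(1)[OF *(4) v(1)] by simp
    then show "C_mor L e f a M K (\<psi> \<circ> \<phi>) w = C_mor L e f a N K \<psi> (C_mor L e f a M N \<phi> w)"
      using * v mor[OF *(1,3) c] by simp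
  qed (use Q in auto)
qed

section \<open>Compatibility with restriction to a subalgebra\<close>

lemma gmod_hom_res:
  assumes "\<phi> \<in> gmod_hom gr L M N" "carrier L' \<subseteq> carrier L"
  shows "\<phi> \<in> gmod_hom gr L' (res_gmod L' M) (res_gmod L' N)"
  using assms by (auto simp: gmod_hom_def)

lemma functor_res_comp:
  assumes F: "is_functor gr L P L Q F Fm" and sub: "carrier L' \<subseteq> carrier L" and Q: "\<And>M. Q M \<Longrightarrow> Q' (res_gmod L' M)"
  shows "is_functor gr L P L' Q' (\<lambda>M. res_gmod L' (F M)) Fm"
proof (rule is_functorI, goal_cases)
  case (1 M)
  then show ?case by (rule Q[OF is_functorD(1)[OF F]])
next
  case (2 M N \<phi>)
  then show ?case by (rule gmod_hom_res[OF is_functorD(2)[OF F] sub])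
next
  case (3 M N \<phi> \<psi> w)
  then show ?case unfolding res_gmod_simps by (rule is_functorD(3)[OF F])
next
  case (4 M w)
  then show ?case unfolding res_gmod_simps by (rule is_functorD(4)[OF F])
next
  case (5 M N K \<phi> \<psi> w)
  then show ?case unfolding res_gmod_simps by (rule is_functorD(5)[OF F])
qed

lemma functor_comp_res:
  assumes F: "is_functor gr L' P' L' Q F Fm" and sub: "carrier L' \<subseteq> carrier L" and P: "\<And>M. P M \<Longrightarrow> P' (res_gmod L' M)"
  shows "is_functor gr L P L' Q (\<lambda>M. F (res_gmod L' M)) (\<lambda>M N. Fm (res_gmod L' M) (res_gmod L' N))"
proof (rule is_functorI, goal_cases)
  case (1 M)
  then show ?case by (rule is_functorD(1)[OF F P])
next
  case (2 M N \<phi>)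
  then show ?case by (rule is_functorD(2)[OF F P P gmod_hom_res[OF _ sub]])
next
  case (3 M N \<phi> \<psi> w)
  show ?case
    by (rule is_functorD(3)[OF F P P gmod_hom_res[OF _ sub] gmod_hom_res[OF _ sub]])
      (use 3 in \<open>simp_all only: res_gmod_simps\<close>)
next
  case (4 M w)
  then show ?case by (rule is_functorD(4)[OF F P])
next
  case (5 M N K \<phi> \<psi> w)
  then show ?case by (rule is_functorD(5)[OF F P P P gmod_hom_res[OF _ sub] gmod_hom_res[OF _ sub]])
qed

text \<open>The map sends each \<open>tw n v\<close> over L to the one over the subalgebra with the
  same n and v. It is well defined and injective by \<open>tw_eq_iff\<close>, and it respects x in S
  because the series of x involves only the (ad f)^j x, all of which lie in S. Its values on
  \<open>tw\<close> are kept in the conclusion for the sake of naturality.\<close>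

lemma C_res_iso:
  assumes S: "sl2_superalgebra L e h f" and sub: "is_subalgebra L S" "{e, h, f} \<subseteq> S" and N: "is_gmodule gr L N"
  shows "\<exists>\<eta>. \<eta> \<in> gmod_iso gr (sub_lsa L S) (res_gmod (sub_lsa L S) (C_obj L e f a N))
        (C_obj (sub_lsa L S) e f a (res_gmod (sub_lsa L S) N)) \<and>
      (\<forall>n. \<forall>v\<in>carrier N. \<eta> (twisted_localization.tw L f N a n v) =
        twisted_localization.tw (sub_lsa L S) f (res_gmod (sub_lsa L S) N) a n v)"
proof -
  let ?L = "sub_lsa L S"
  let ?N = "res_gmod ?L N"
  interpret N: sl2_twisted L e h f N a by (rule sl2_twistedI[OF S N])
  have R: "is_gmodule gr ?L ?N" by (rule is_gmodule_res[OF N.lie_superalgebra_axioms sub(1) N])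
  have S': "sl2_superalgebra ?L e h f" by (rule sl2_superalgebra_sub[OF S sub])
  interpret R: sl2_twisted ?L e h f ?N a by (rule sl2_twistedI[OF S' R])
  have SL: "x \<in> carrier L" if "x \<in> S" for x
    using that sub(1) N.cL.submodule_iff N.cL.subspD(1) by (auto simp: is_subalgebra_def)
  have eS: "e \<in> S" "f \<in> S" using sub(2) by auto
  have af: "act ?N f = act N f" using eS(2) by simp
  have tw_eq: "N.tw n v = N.tw m w \<longleftrightarrow> R.tw n v = R.tw m w" if "v \<in> carrier N" "w \<in> carrier N" for n v m w
    using N.tw_eq_iff[OF that] R.tw_eq_iff[of v w n m] that by (simp add: af)
  define \<eta> where "\<eta> z = (SOME y. \<exists>n. \<exists>v\<in>carrier N. z = N.tw n v \<and> y = R.tw n v)" for z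
  have \<eta>: "\<eta> (N.tw n v) = R.tw n v" if v: "v \<in> carrier N" for n v
  proof -
    have "\<exists>m. \<exists>w\<in>carrier N. N.tw n v = N.tw m w \<and> \<eta> (N.tw n v) = R.tw m w"
      unfolding \<eta>_def by (rule someI_ex) (use v in blast)
    then show ?thesis using tw_eq[OF v] by metis
  qed
  have R_tw: "R.tw n v \<in> carrier R.D" if "v \<in> carrier N" for n v
    using that by simp
  have ah: "\<eta> \<in> ahom N.D R.D"
  proof (rule ahomI)
    show "\<eta> z \<in> carrier R.D" if "z \<in> carrier N.D" for z
      using N.tw_surj_D[OF that] R_tw \<eta> by metis
    show "\<eta> (z \<oplus>\<^bsub>N.D\<^esub> y) = \<eta> z \<oplus>\<^bsub>R.D\<^esub> \<eta> y" if zy: "z \<in> carrier N.D" "y \<in> carrier N.D" for z y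
    proof -
      obtain n v w where *: "v \<in> carrier N" "w \<in> carrier N" "z = N.tw n v" "y = N.tw n w"
        by (rule N.common_denominator_tw[OF zy])
      have "z \<oplus>\<^bsub>N.D\<^esub> y = N.tw n (v \<oplus>\<^bsub>N\<^esub> w)" using * by (simp add: N.tw_add_D)
      then show ?thesis using * R.tw_add_D[of v w n] by (simp add: \<eta>)
    qed
  qed
  have hom: "\<eta> \<in> gmod_hom gr ?L (res_gmod ?L N.D) R.D"
  proof (intro gmod_homI)
    show "\<eta> \<in> ahom (res_gmod ?L N.D) R.D" using ah by (simp add: ahom_def)
    fix z assume "z \<in> carrier (res_gmod ?L N.D)"
    then have "z \<in> carrier N.D" by simp
    then obtain n v where v: "v \<in> carrier N" "z = N.tw n v" using N.tw_surj_D by blast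
    show "\<eta> (c \<odot>\<^bsub>res_gmod ?L N.D\<^esub> z) = c \<odot>\<^bsub>R.D\<^esub> \<eta> z" for c
      using v N.tw_smult[of v c n] R.tw_smult[of v c n] by (simp add: \<eta>)
    fix x assume "x \<in> carrier ?L"
    then have x: "x \<in> S" by simp
    obtain d where d: "(br L f ^^ d) x = \<zero>\<^bsub>L\<^esub>" using N.f_nil[OF SL[OF x]] by blast
    have xj: "(br L f ^^ j) x \<in> S" for j
      using sub(1) eS(2) x by (induction j) (auto simp: is_subalgebra_def)
    have "\<eta> (act N.D x z) = nsum R.D (\<lambda>j. \<eta> (N.tw (n + j) (((-1) ^ j * ((a - of_nat n) gchoose j)) \<odot>\<^bsub>N\<^esub> act N ((br L f ^^ j) x) v))) d"
      unfolding v(2) N.act_D_tw[OF SL[OF x] d v(1)]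
      by (rule ahom_nsum[OF N.DM.N.M.abelian_group_axioms R.DM.N.M.abelian_group_axioms ah])
        (use v xj SL in \<open>simp add: N.act_closed\<close>)
    also have "\<dots> = act R.D x (\<eta> z)"
      unfolding v(2) \<eta>[OF v(1)]
      using v xj SL x d R.act_D_tw[of x d v n] by (simp add: \<eta> N.act_closed)
    finally show "\<eta> (act (res_gmod ?L N.D) x z) = act R.D x (\<eta> z)" using x by simp
  next
    fix i z assume gr "z \<in> par (res_gmod ?L N.D) i"
    interpret GN: graded_twisted_localization L f N a
      by (rule graded_twistedI[OF S]) (use N \<open>gr\<close> in simp)
    interpret GR: graded_twisted_localization ?L f ?N a
      by (rule graded_twistedI[OF S']) (use R \<open>gr\<close> in simp)
    obtain n v where v: "v \<in> par N i" "z = N.tw n v"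
      using \<open>z \<in> par (res_gmod ?L N.D) i\<close> by (auto simp: N.D_simps GN.D_par_eq GN.Par_def)
    then show "\<eta> z \<in> par R.D i"
      using GN.parN_facts(1) GR.ParI[of v i n] by (simp add: R.D_simps GR.D_par_eq \<eta>)
  qed
  have bij: "bij_betw \<eta> (carrier N.D) (carrier R.D)"
    unfolding bij_betw_def
  proof
    show "inj_on \<eta> (carrier N.D)"
    proof (rule inj_onI)
      fix z y assume *: "z \<in> carrier N.D" "y \<in> carrier N.D" "\<eta> z = \<eta> y"
      obtain n v m w where "v \<in> carrier N" "z = N.tw n v" "w \<in> carrier N" "y = N.tw m w"
        using N.tw_surj_D *(1,2) by metis
      then show "z = y" using *(3) tw_eq[of v w n m] by (simp add: \<eta>)
    qed
    show "\<eta> ` carrier N.D = carrier R.D"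
    proof
      show "\<eta> ` carrier N.D \<subseteq> carrier R.D" using gmod_homD(1)[OF hom] by auto
      show "carrier R.D \<subseteq> \<eta> ` carrier N.D"
      proof
        fix y assume "y \<in> carrier R.D"
        then obtain n v where "v \<in> carrier N" "y = R.tw n v" using R.tw_surj_D[of y] by auto
        then show "y \<in> \<eta> ` carrier N.D" by (intro image_eqI[of _ _ "N.tw n v"]) (simp_all add: \<eta>)
      qed
    qed
  qed
  have resD: "gmodule ?L (res_gmod ?L N.D)"
  proof -
    have "is_gmodule False ?L (res_gmod ?L N.D)"
      by (rule is_gmodule_res[OF N.lie_superalgebra_axioms sub(1)])
        (simp add: is_gmodule_iff[OF N.lie_superalgebra_axioms] N.DM.gmodule_axioms)
    then show ?thesis by (simp add: is_gmodule_iff[OF R.lie_superalgebra_axioms])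
  qed
  interpret RD: gmodule ?L "res_gmod ?L N.D" by (rule resD)
  have iso: "\<eta> \<in> gmod_iso gr ?L (res_gmod ?L N.D) R.D"
  proof (rule gmod_isoI[OF resD hom])
    show "bij_betw \<eta> (carrier (res_gmod ?L N.D)) (carrier R.D)" using bij by simp
    fix i assume gr
    interpret GN: graded_twisted_localization L f N a
      by (rule graded_twistedI[OF S]) (use N \<open>gr\<close> in simp)
    interpret GR: graded_twisted_localization ?L f ?N a
      by (rule graded_twistedI[OF S']) (use R \<open>gr\<close> in simp)
    show "par (res_gmod ?L N.D) i \<subseteq> carrier (res_gmod ?L N.D)"
      using GN.Par_carrier by (auto simp: N.D_simps GN.D_par_eq)
    show "par R.D i \<subseteq> \<eta> ` par (res_gmod ?L N.D) i"
    proof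
      fix y assume "y \<in> par R.D i"
      then obtain n v where v: "v \<in> par N i" "y = R.tw n v"
        by (auto simp: R.D_simps GR.D_par_eq GR.Par_def)
      then show "y \<in> \<eta> ` par (res_gmod ?L N.D) i"
        using GN.parN_facts(1)[OF v(1)] GN.ParI[OF v(1), of n]
        by (intro image_eqI[of _ _ "N.tw n v"]) (simp_all add: \<eta> N.D_simps GN.D_par_eq)
    qed
  qed
  let ?\<theta> = "inv_into (carrier N.D) \<eta>"
  have inv: "?\<theta> \<in> gmod_hom gr ?L R.D (res_gmod ?L N.D)" using iso by (simp add: gmod_iso_def)
  have \<theta>\<eta>: "?\<theta> (\<eta> z) = z" if "z \<in> carrier N.D" for z using that bij by (simp add: bij_betw_def)
  have \<eta>\<theta>: "?\<theta> y \<in> carrier N.D" "\<eta> (?\<theta> y) = y" if "y \<in> carrier R.D" for y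
    using that bij inv_into_into[of y \<eta> "carrier N.D"] f_inv_into_f[of y \<eta> "carrier N.D"] by (simp_all add: bij_betw_def)
  note h = gmod_homD[OF hom, unfolded res_gmod_simps] and i = gmod_homD[OF inv, unfolded res_gmod_simps]
  have eS': "e \<in> carrier ?L" using eS by simp
  have ae: "act (res_gmod ?L N.D) e = act N.D e" using eS by simp
  \<comment> \<open>Both \<eta> and its inverse commute with e, so they preserve e-finiteness and
    restrict to mutually inverse maps between the Enright submodules.\<close>
  have \<eta>W: "\<eta> z \<in> R.W" if "z \<in> N.W" for z
  proof -
    have "R.DM.N.efin (act R.D e) (\<eta> z)"
    proof (rule efin_map[OF N.DM.N.cspace_axioms R.DM.N.cspace_axioms, where T = "act N.D e" and \<phi> = \<eta>])
      show "\<eta> \<in> ahom N.D R.D" by (rule ah)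
      show "\<eta> (act N.D e v) = act R.D e (\<eta> v)" if "v \<in> carrier N.D" for v
        using h(4)[OF eS' that] by (simp add: ae)
    qed (use that h in auto)
    then show ?thesis using that h(1) by simp
  qed
  have \<theta>W: "?\<theta> y \<in> N.W" if "y \<in> R.W" for y
  proof -
    have "N.DM.N.efin (act N.D e) (?\<theta> y)"
    proof (rule efin_map[OF R.DM.N.cspace_axioms N.DM.N.cspace_axioms, where T = "act R.D e" and \<phi> = ?\<theta>])
      show "?\<theta> \<in> ahom R.D N.D" by (intro ahomI i)
      show "?\<theta> (act R.D e v) = act N.D e (?\<theta> v)" if "v \<in> carrier R.D" for v
        using i(4)[OF eS' that] by (simp add: ae)
    qed (use that i in auto)
    then show ?thesis using that i(1) by simp
  qed
  have C: "is_gmodule gr ?L (res_gmod ?L (C_obj L e f a N))"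
    by (rule is_gmodule_res[OF N.lie_superalgebra_axioms sub(1) is_gmodule_C[OF S N]])
  have "\<eta> \<in> gmod_iso gr ?L (res_gmod ?L (C_obj L e f a N)) (C_obj ?L e f a ?N)"
  proof (rule gmod_isoI)
    show "gmodule ?L (res_gmod ?L (C_obj L e f a N))" using C is_gmodule_iff[OF R.lie_superalgebra_axioms] by blast
    show "\<eta> \<in> gmod_hom gr ?L (res_gmod ?L (C_obj L e f a N)) (C_obj ?L e f a ?N)"
    proof (intro gmod_homI ahomI)
      fix x v assume "x \<in> carrier ?L" "v \<in> carrier (res_gmod ?L (C_obj L e f a N))"
      then show "\<eta> (act (res_gmod ?L (C_obj L e f a N)) x v) = act (C_obj ?L e f a ?N) x (\<eta> v)"
        using h(4)[of x v] by simp
    next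
      fix i v assume gr "v \<in> par (res_gmod ?L (C_obj L e f a N)) i"
      then show "\<eta> v \<in> par (C_obj ?L e f a ?N) i" using \<eta>W[of v] h(5)[OF \<open>gr\<close>, of v i] by simp
    qed (use \<eta>W h in simp_all)
    show "bij_betw \<eta> (carrier (res_gmod ?L (C_obj L e f a N))) (carrier (C_obj ?L e f a ?N))"
      unfolding res_gmod_simps N.C_simps R.C_simps
    proof (rule bij_betw_byWitness[where f' = ?\<theta>])
      show "\<forall>z\<in>N.W. ?\<theta> (\<eta> z) = z" using \<theta>\<eta> by auto
      show "\<forall>y\<in>R.W. \<eta> (?\<theta> y) = y" using \<eta>\<theta>(2) by auto
    qed (use \<eta>W \<theta>W in blast)+
    fix i assume gr
    show "par (res_gmod ?L (C_obj L e f a N)) i \<subseteq> carrier (res_gmod ?L (C_obj L e f a N))" by auto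
    show "par (C_obj ?L e f a ?N) i \<subseteq> \<eta> ` par (res_gmod ?L (C_obj L e f a N)) i"
    proof
      fix y assume "y \<in> par (C_obj ?L e f a ?N) i"
      then have y: "y \<in> R.W" "y \<in> par R.D i" by simp_all
      then have "?\<theta> y \<in> N.W \<inter> par N.D i" "y = \<eta> (?\<theta> y)" using \<theta>W[OF y(1)] i(5)[OF \<open>gr\<close> y(2)] \<eta>\<theta>(2)[of y] by auto
      then show "y \<in> \<eta> ` par (res_gmod ?L (C_obj L e f a N)) i"
        unfolding res_gmod_simps N.C_simps by (rule rev_image_eqI)
    qed
  qed
  then show ?thesis using \<eta> by blast
qed

lemma C_res_naturally_isomorphic:
  fixes L :: "'g lsa"
  assumes S: "sl2_superalgebra L e h f" and sub: "is_subalgebra L S" "{e, h, f} \<subseteq> S"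
  shows "naturally_isomorphic gr L (is_gmodule gr L :: ('g, 'v) gmod \<Rightarrow> bool) (sub_lsa L S)
    (\<lambda>N. res_gmod (sub_lsa L S) (C_obj L e f a N)) (\<lambda>M N \<phi>. C_mor L e f a M N \<phi>)
    (\<lambda>N. C_obj (sub_lsa L S) e f a (res_gmod (sub_lsa L S) N))
    (\<lambda>M N \<phi>. C_mor (sub_lsa L S) e f a (res_gmod (sub_lsa L S) M) (res_gmod (sub_lsa L S) N) \<phi>)"
proof -
  let ?L = "sub_lsa L S"
  interpret sl2_superalgebra L e h f by fact
  have S': "sl2_superalgebra ?L e h f" by (rule sl2_superalgebra_sub[OF S sub])
  have SL: "carrier ?L \<subseteq> carrier L"
    using sub(1) cL.submodule_iff cL.subspD(1) by (auto simp: is_subalgebra_def)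
  note res = is_gmodule_res[OF lie_superalgebra_axioms sub(1)]
  have "\<exists>\<eta>. \<forall>N::('g, 'v) gmod. is_gmodule gr L N \<longrightarrow>
      \<eta> N \<in> gmod_iso gr ?L (res_gmod ?L (C_obj L e f a N)) (C_obj ?L e f a (res_gmod ?L N)) \<and>
      (\<forall>n. \<forall>v\<in>carrier N. \<eta> N (twisted_localization.tw L f N a n v) =
        twisted_localization.tw ?L f (res_gmod ?L N) a n v)"
  proof (intro choice allI)
    fix N :: "('g, 'v) gmod"
    show "\<exists>\<eta>. is_gmodule gr L N \<longrightarrow>
      \<eta> \<in> gmod_iso gr ?L (res_gmod ?L (C_obj L e f a N)) (C_obj ?L e f a (res_gmod ?L N)) \<and>
      (\<forall>n. \<forall>v\<in>carrier N. \<eta> (twisted_localization.tw L f N a n v) =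
        twisted_localization.tw ?L f (res_gmod ?L N) a n v)"
      using C_res_iso[OF S sub, where a = a and N = N and gr = gr] by (cases "is_gmodule gr L N") simp_all
  qed
  then obtain \<eta> :: "('g, 'v) gmod \<Rightarrow> ('g, 'v) twisted \<Rightarrow> ('g, 'v) twisted"
    where \<eta>: "\<And>N. is_gmodule gr L N \<Longrightarrow>
        \<eta> N \<in> gmod_iso gr ?L (res_gmod ?L (C_obj L e f a N)) (C_obj ?L e f a (res_gmod ?L N))"
      "\<And>N n v. is_gmodule gr L N \<Longrightarrow> v \<in> carrier N \<Longrightarrow> \<eta> N (twisted_localization.tw L f N a n v) =
        twisted_localization.tw ?L f (res_gmod ?L N) a n v" by blast
  have nat: "\<eta> N (C_mor L e f a M N \<phi> w) = C_mor ?L e f a (res_gmod ?L M) (res_gmod ?L N) \<phi> (\<eta> M w)"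
    if M: "is_gmodule gr L M" and N: "is_gmodule gr L N" and \<phi>: "\<phi> \<in> gmod_hom gr L M N"
      and w: "w \<in> carrier (res_gmod ?L (C_obj L e f a M))" for M N :: "('g, 'v) gmod" and \<phi> w
  proof -
    interpret M: sl2_twisted L e h f M a by (rule sl2_twistedI[OF S M])
    interpret N: sl2_twisted L e h f N a by (rule sl2_twistedI[OF S N])
    note M' = sl2_twistedI[OF S' res[OF M]] and N' = sl2_twistedI[OF S' res[OF N]]
    obtain n v where v: "v \<in> carrier M" "w = M.tw n v" using M.tw_surj_D[of w] w by auto
    have "C_mor L e f a M N \<phi> w = N.tw n (\<phi> v)"
      unfolding v(2) using w v by (intro C_mor_tw[OF M.sl2_twisted_axioms N.sl2_twisted_axioms \<phi>]) simp_all
    then have 1: "\<eta> N (C_mor L e f a M N \<phi> w) = twisted_localization.tw ?L f (res_gmod ?L N) a n (\<phi> v)"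
      using \<eta>(2)[OF N] gmod_homD(1)[OF \<phi> v(1)] by simp
    have "\<eta> M w \<in> carrier (C_obj ?L e f a (res_gmod ?L M))"
      using gmod_homD(1)[of "\<eta> M", OF _ w] \<eta>(1)[OF M] by (auto simp: gmod_iso_def)
    then show ?thesis
      unfolding 1 unfolding v(2) \<eta>(2)[OF M v(1)]
      by (intro C_mor_tw[OF M' N' gmod_hom_res[OF \<phi> SL], symmetric]) (use v in simp)
  qed
  have F: "is_functor gr L (is_gmodule gr L :: ('g, 'v) gmod \<Rightarrow> bool) ?L (is_gmodule gr ?L)
      (\<lambda>N. res_gmod ?L (C_obj L e f a N)) (\<lambda>M N \<phi>. C_mor L e f a M N \<phi>)"
  proof (rule functor_res_comp[where Q = "is_gmodule gr L"])
    show "is_functor gr L (is_gmodule gr L :: ('g, 'v) gmod \<Rightarrow> bool) L (is_gmodule gr L) (C_obj L e f a) (C_mor L e f a)"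
      by (rule C_functor[OF S]) (auto intro: is_gmodule_C[OF S])
  qed (use SL res in auto)
  have G: "is_functor gr L (is_gmodule gr L :: ('g, 'v) gmod \<Rightarrow> bool) ?L (is_gmodule gr ?L)
      (\<lambda>N. C_obj ?L e f a (res_gmod ?L N))
      (\<lambda>M N \<phi>. C_mor ?L e f a (res_gmod ?L M) (res_gmod ?L N) \<phi>)"
  proof (rule functor_comp_res[where P' = "is_gmodule gr ?L"])
    show "is_functor gr ?L (is_gmodule gr ?L :: ('g, 'v) gmod \<Rightarrow> bool) ?L (is_gmodule gr ?L) (C_obj ?L e f a) (C_mor ?L e f a)"
      by (rule C_functor[OF S']) (auto intro: is_gmodule_C[OF S'])
  qed (use SL res in auto)
  show ?thesis
    unfolding naturally_isomorphic_def using F G \<eta>(1) nat by (intro conjI exI[of _ \<eta>]) auto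
qed

section \<open>Weights of the Enright functor, its target category and left exactness\<close>

context sl2_twisted
begin

text \<open>Over a common denominator m the components \<open>tw m (g n)\<close> have the distinct
  weights b + n - 2 (a - m), so \<open>eigen_components\<close> applies to every h-stable subspace
  B. It is used for the e-finite part and for the submodule A in (iii).\<close>

lemma tw_weight_components:
  assumes cat: "carrier N = N.spn {v \<in> carrier N. \<exists>n::int. act N h v = (b + of_int n) \<odot>\<^bsub>N\<^esub> v}" and z: "z \<in> carrier D"
  obtains m I g where "finite I" "\<And>n. wt (b + of_int n) (g n)" "z = finsum D (\<lambda>n. tw m (g n)) I"
    "\<And>B n. DM.N.subsp B \<Longrightarrow> (\<And>v. v \<in> B \<Longrightarrow> act D h v \<in> B) \<Longrightarrow> z \<in> B \<Longrightarrow> n \<in> I \<Longrightarrow> tw m (g n) \<in> B"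
proof -
  obtain m v where v: "v \<in> carrier N" "z = tw m v" using tw_surj_D[OF z] by blast
  then have "v \<in> N.spn {v \<in> carrier N. \<exists>n::int. act N h v = (b + of_int n) \<odot>\<^bsub>N\<^esub> v}" using cat by blast
  from N.weight_decomposition[OF this act_lin[OF efh_closed(2)]]
  obtain I g where g: "finite I" "\<And>n. g n \<in> carrier N \<and> act N h (g n) = (b + of_int n) \<odot>\<^bsub>N\<^esub> g n" "v = finsum N g I"
    by blast
  have w: "wt (b + of_int n) (g n)" for n using g(2) by (simp add: wt_def)
  have z': "z = finsum D (\<lambda>n. tw m (g n)) I"
    unfolding v(2) g(3)
    by (rule ahom_finsum[OF N.M.abelian_group_axioms DM.N.M.abelian_group_axioms tw_ahom_D]) (use g(2) in auto)
  show thesis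
  proof (rule that[OF g(1) w z'])
    fix B n assume B: "DM.N.subsp B" "\<And>v. v \<in> B \<Longrightarrow> act D h v \<in> B" "z \<in> B" "n \<in> I"
    show "tw m (g n) \<in> B"
    proof (rule DM.N.eigen_components[OF DM.act_lin[OF efh_closed(2)] B(1,2) g(1)])
      show "inj_on (\<lambda>n. b + of_int n - 2 * (a - of_nat m)) I" by (auto simp: inj_on_def)
      show "act D h (tw m (g n)) = (b + of_int n - 2 * (a - of_nat m)) \<odot>\<^bsub>D\<^esub> tw m (g n)" for n
        by (rule DM.wtD(2)[OF wt_tw[OF w]])
    qed (use B(3,4) z' g(2) in simp_all)
  qed
qed

text \<open>The weight components of z are e-finite themselves, and an e-finite weight vector is
  killed by a power of e.\<close>

lemma C_e_nilpotent:
  assumes cat: "carrier N = N.spn {v \<in> carrier N. \<exists>n::int. act N h v = (b + of_int n) \<odot>\<^bsub>N\<^esub> v}" and z: "z \<in> W"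
  shows "\<exists>k. (act D e ^^ k) z = \<zero>\<^bsub>D\<^esub>"
proof -
  have "z \<in> carrier D" using z by simp
  then obtain m I g where g: "finite I" "\<And>n. wt (b + of_int n) (g n)" "z = finsum D (\<lambda>n. tw m (g n)) I"
    "\<And>B n. DM.N.subsp B \<Longrightarrow> (\<And>v. v \<in> B \<Longrightarrow> act D h v \<in> B) \<Longrightarrow> z \<in> B \<Longrightarrow> n \<in> I \<Longrightarrow> tw m (g n) \<in> B"
    by (rule tw_weight_components[OF cat]) blast
  have "tw m (g n) \<in> {v \<in> carrier D. \<exists>k. (act D e ^^ k) v = \<zero>\<^bsub>D\<^esub>}" if "n \<in> I" for n
  proof -
    have "tw m (g n) \<in> W" by (rule g(4)[OF W_subsp W_stable[OF efh_closed(2)] z that])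
    then show ?thesis using DM.wt_efin_nilpotent[OF wt_tw[OF g(2)]] by simp
  qed
  then have "z \<in> {v \<in> carrier D. \<exists>k. (act D e ^^ k) v = \<zero>\<^bsub>D\<^esub>}"
    unfolding g(3) by (rule DM.N.finsum_subsp[OF DM.subsp_e_nilpotent g(1)])
  then show ?thesis by simp
qed

lemma C_weight_span:
  assumes cat: "carrier N = N.spn {v \<in> carrier N. \<exists>n::int. act N h v = (a + of_int n) \<odot>\<^bsub>N\<^esub> v}"
  shows "carrier (C_obj L e f a N) = lin_span (C_obj L e f a N)
    {v \<in> carrier (C_obj L e f a N). \<exists>n::int. act (C_obj L e f a N) h v = (- a + of_int n) \<odot>\<^bsub>C_obj L e f a N\<^esub> v}"
    (is "_ = lin_span _ ?A")
proof -
  interpret C: gmodule L "C_obj L e f a N" by (rule gmodule_C)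
  have A: "?A \<subseteq> carrier (C_obj L e f a N)" by blast
  have sp: "C.N.subsp (C.N.spn ?A)" by (rule C.N.subsp_span[OF A])
  then have sp': "DM.N.subsp (C.N.spn ?A)"
    using C.N.subspD(1)[OF sp] unfolding C.N.subsp_def DM.N.subsp_def C_simps by blast
  have "z \<in> C.N.spn ?A" if z: "z \<in> W" for z
  proof -
    have "z \<in> carrier D" using z by simp
    then obtain m I g where g: "finite I" "\<And>n. wt (a + of_int n) (g n)" "z = finsum D (\<lambda>n. tw m (g n)) I"
      "\<And>B n. DM.N.subsp B \<Longrightarrow> (\<And>v. v \<in> B \<Longrightarrow> act D h v \<in> B) \<Longrightarrow> z \<in> B \<Longrightarrow> n \<in> I \<Longrightarrow> tw m (g n) \<in> B"
      by (rule tw_weight_components[OF cat]) blast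
    have "tw m (g n) \<in> C.N.spn ?A" if "n \<in> I" for n
    proof -
      have u: "tw m (g n) \<in> W" by (rule g(4)[OF W_subsp W_stable[OF efh_closed(2)] z that])
      \<comment> \<open>The sign of a changes here: the weights of N lie in a + Z, and the twist by
        f^a subtracts 2 a.\<close>
      have "a + of_int n - 2 * (a - of_nat m) = - a + of_int (n + 2 * int m)" by (simp add: algebra_simps)
      then have "act D h (tw m (g n)) = (- a + of_int (n + 2 * int m)) \<odot>\<^bsub>D\<^esub> tw m (g n)"
        using DM.wtD(2)[OF wt_tw[OF g(2)[of n], of m]] by (simp only:)
      then have "tw m (g n) \<in> ?A" using u unfolding C_simps by blast
      then show ?thesis by (rule subsetD[OF C.N.span_incl])
    qed
    then show ?thesis unfolding g(3) by (rule DM.N.finsum_subsp[OF sp' g(1)])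
  qed
  then show ?thesis using C.N.span_carrier[OF A] unfolding C_simps by blast
qed

end

lemma cat_M_D: "cat_M gr L h b N \<Longrightarrow> is_gmodule gr L N"
  "cat_M gr L h b N \<Longrightarrow> carrier N = lin_span N {v \<in> carrier N. \<exists>n::int. act N h v = (b + of_int n) \<odot>\<^bsub>N\<^esub> v}"
  by (simp_all add: cat_M_def)

lemma C_cat_Me:
  assumes S: "sl2_superalgebra L e h f" and N: "cat_M gr L h a N"
  shows "cat_Me gr L e h (- a) (C_obj L e f a N)"
proof -
  interpret sl2_twisted L e h f N a by (rule sl2_twistedI[OF S cat_M_D(1)[OF N]])
  show ?thesis
    unfolding cat_Me_def cat_M_def locally_nilpotent_def
    using is_gmodule_C[OF S cat_M_D(1)[OF N]] C_weight_span[OF cat_M_D(2)[OF N]]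
      C_e_nilpotent[OF cat_M_D(2)[OF N]] unfolding C_simps by blast
qed

lemma C_additive:
  assumes S: "sl2_superalgebra L e h f" and P: "\<And>M. P M \<Longrightarrow> is_gmodule gr L M"
  shows "additive_functor gr L P (C_obj L e f a) (C_mor L e f a)"
  unfolding additive_functor_def
proof (intro allI impI ballI, elim conjE)
  fix M N \<phi> \<psi> w
  assume *: "P M" "P N" "\<phi> \<in> gmod_hom gr L M N" "\<psi> \<in> gmod_hom gr L M N" "w \<in> carrier (C_obj L e f a M)"
  interpret M: sl2_twisted L e h f M a by (rule sl2_twistedI[OF S P[OF *(1)]])
  interpret N: sl2_twisted L e h f N a by (rule sl2_twistedI[OF S P[OF *(2)]])
  note h = gmod_homD[OF *(3)] gmod_homD[OF *(4)]
  \<comment> \<open>The flag \<open>False\<close> leaves out the condition on parity; the formula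
    \<open>C_mor_tw\<close> holds for either flag.\<close>
  have sum: "(\<lambda>v. \<phi> v \<oplus>\<^bsub>N\<^esub> \<psi> v) \<in> gmod_hom False L M N"
    by (intro gmod_homI ahomI) (simp_all add: h N.N.M.a_ac N.N.s_add_r N.act_add_r)
  obtain n v where v: "v \<in> carrier M" "w = M.tw n v" using M.tw_surj_D[of w] *(5) by auto
  note m = C_mor_tw[OF M.sl2_twisted_axioms N.sl2_twisted_axioms _ v(1) *(5)[unfolded v(2)]]
  show "C_mor L e f a M N (\<lambda>v. \<phi> v \<oplus>\<^bsub>N\<^esub> \<psi> v) w =
      C_mor L e f a M N \<phi> w \<oplus>\<^bsub>C_obj L e f a N\<^esub> C_mor L e f a M N \<psi> w"
    unfolding v(2) m[OF *(3)] m[OF *(4)] m[OF sum] N.C_simps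
    using h v by (intro N.tw_add_D) simp_all
qed

text \<open>The point is to lift an element y = \<open>B.tw n v\<close> of the kernel. Some f^k v is
  annihilated by \<psi>, hence equals \<phi> u, and \<open>A.tw (n + k) u\<close> is sent to y. It
  is e-finite because a power of e kills y by \<open>C_e_nilpotent\<close> and localization keeps
  \<phi> injective.\<close>

lemma C_left_exact:
  assumes S: "sl2_superalgebra L e h f"
  shows "left_exact_functor gr L (cat_M gr L h a) (C_obj L e f a) (C_mor L e f a)"
  unfolding left_exact_functor_def
proof (intro allI impI, elim conjE)
  fix A B C \<phi> \<psi>
  assume *: "cat_M gr L h a A" "cat_M gr L h a B" "cat_M gr L h a C"
    "\<phi> \<in> gmod_hom gr L A B" "\<psi> \<in> gmod_hom gr L B C" and ex: "left_exact_seq A B C \<phi> \<psi>"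
  note P = cat_M_D(1)[OF *(1)] cat_M_D(1)[OF *(2)] cat_M_D(1)[OF *(3)]
  interpret A: sl2_twisted L e h f A a by (rule sl2_twistedI[OF S P(1)])
  interpret B: sl2_twisted L e h f B a by (rule sl2_twistedI[OF S P(2)])
  interpret C: sl2_twisted L e h f C a by (rule sl2_twistedI[OF S P(3)])
  note h = gmod_homD[OF *(4)] and h' = gmod_homD[OF *(5)]
  note m = C_mor_tw[OF A.sl2_twisted_axioms B.sl2_twisted_axioms *(4)]
    and m' = C_mor_tw[OF B.sl2_twisted_axioms C.sl2_twisted_axioms *(5)]
  have inj: "inj_on \<phi> (carrier A)" and im: "\<And>v. v \<in> carrier B \<Longrightarrow> \<psi> v = \<zero>\<^bsub>C\<^esub> \<longleftrightarrow> v \<in> \<phi> ` carrier A"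
    using ex by (auto simp: left_exact_seq_def)
  have \<phi>f: "(act B f ^^ k) (\<phi> v) = \<phi> ((act A f ^^ k) v)" if "v \<in> carrier A" for k v
    by (induction k) (use that h(4) A.efh_closed in \<open>simp_all add: A.act_pow_closed\<close>)
  have \<psi>f: "(act C f ^^ k) (\<psi> v) = \<psi> ((act B f ^^ k) v)" if "v \<in> carrier B" for k v
    by (induction k) (use that h'(4) A.efh_closed in \<open>simp_all add: B.act_pow_closed\<close>)
  \<comment> \<open>Equality of fractions is tested in the modules after applying powers of f, where
    \<phi> is injective.\<close>
  have tw_inj: "A.tw n v = A.tw k w" if vw: "v \<in> carrier A" "w \<in> carrier A" "B.tw n (\<phi> v) = B.tw k (\<phi> w)" for n k v w
  proof -
    obtain l where "(act B f ^^ (l + k)) (\<phi> v) = (act B f ^^ (l + n)) (\<phi> w)"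
      using vw(3) B.tw_eq_iff[OF h(1)[OF vw(1)] h(1)[OF vw(2)]] by blast
    then have "(act A f ^^ (l + k)) v = (act A f ^^ (l + n)) w"
      using inj vw(1,2) A.efh_closed unfolding \<phi>f[OF vw(1)] \<phi>f[OF vw(2)] by (simp add: inj_on_eq_iff A.act_pow_closed)
    then show ?thesis using A.tw_eq_iff[OF vw(1,2)] by blast
  qed
  note F = D_mor_hom[OF S P(1,2) *(4), where a = a]
  note dm = D_mor_tw(2)[OF A.twisted_localization_axioms B.twisted_localization_axioms *(4), where a = a]
  let ?D = "D_mor L f a A B \<phi>"
  have D_inj: "z = \<zero>\<^bsub>A.D\<^esub>" if z: "z \<in> carrier A.D" "?D z = \<zero>\<^bsub>B.D\<^esub>" for z
  proof -
    obtain n v where v: "v \<in> carrier A" "z = A.tw n v" using A.tw_surj_D[OF z(1)] by blast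
    have "B.tw n (\<phi> v) = B.tw n (\<phi> \<zero>\<^bsub>A\<^esub>)"
      using z(2) v(2) dm[OF v(1)] ahom_zero[OF A.N.M.abelian_group_axioms B.N.M.abelian_group_axioms gmod_hom_ahom[OF *(4)]]
      by (simp add: B.tw_zero_D)
    then show ?thesis using tw_inj[OF v(1), of "\<zero>\<^bsub>A\<^esub>" n n] v(2) by (simp add: A.tw_zero_D)
  qed
  have De: "(act B.D e ^^ k) (?D z) = ?D ((act A.D e ^^ k) z)" if "z \<in> carrier A.D" for k z
    by (induction k) (use that gmod_homD(4)[OF F] A.efh_closed in \<open>simp_all add: A.DM.act_pow_closed\<close>)
  show "left_exact_seq (C_obj L e f a A) (C_obj L e f a B) (C_obj L e f a C) (C_mor L e f a A B \<phi>) (C_mor L e f a B C \<psi>)"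
    unfolding left_exact_seq_def
  proof (intro conjI equalityI subsetI)
    show "inj_on (C_mor L e f a A B \<phi>) (carrier (C_obj L e f a A))"
    proof (rule inj_onI)
      fix z y assume zy: "z \<in> carrier (C_obj L e f a A)" "y \<in> carrier (C_obj L e f a A)"
        "C_mor L e f a A B \<phi> z = C_mor L e f a A B \<phi> y"
      have zy': "z \<in> carrier A.D" "y \<in> carrier A.D" using zy(1,2) by simp_all
      obtain n v k w where *: "v \<in> carrier A" "z = A.tw n v" "w \<in> carrier A" "y = A.tw k w"
        using A.tw_surj_D[OF zy'(1)] A.tw_surj_D[OF zy'(2)] by blast
      have "B.tw n (\<phi> v) = B.tw k (\<phi> w)"
        using zy(3) m[OF *(1) zy(1)[unfolded *(2)]] m[OF *(3) zy(2)[unfolded *(4)]] *(2,4) by simp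
      then show "z = y" unfolding *(2,4) by (rule tw_inj[OF *(1,3)])
    qed
    fix y
    {
      assume "y \<in> C_mor L e f a A B \<phi> ` carrier (C_obj L e f a A)"
      then obtain z where z: "z \<in> carrier (C_obj L e f a A)" "y = C_mor L e f a A B \<phi> z" by blast
      have y: "y \<in> carrier (C_obj L e f a B)"
        unfolding z(2) by (rule gmod_homD(1)[OF C_mor_hom[OF S P(1,2) *(4)] z(1)])
      obtain n v where v: "v \<in> carrier A" "z = A.tw n v" using A.tw_surj_D[of z] z(1) by auto
      have y': "y = B.tw n (\<phi> v)" using z(2) m[OF v(1) z(1)[unfolded v(2)]] v(2) by simp
      have "C_mor L e f a B C \<psi> y = C.tw n (\<psi> (\<phi> v))"
        unfolding y' by (rule m'[OF h(1)[OF v(1)] y[unfolded y']])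
      also have "\<psi> (\<phi> v) = \<zero>\<^bsub>C\<^esub>" using im[OF h(1)[OF v(1)]] v(1) by blast
      finally show "y \<in> {v \<in> carrier (C_obj L e f a B). C_mor L e f a B C \<psi> v = \<zero>\<^bsub>C_obj L e f a C\<^esub>}"
        using y by (simp add: C.tw_zero_D)
    }
    {
      assume "y \<in> {v \<in> carrier (C_obj L e f a B). C_mor L e f a B C \<psi> v = \<zero>\<^bsub>C_obj L e f a C\<^esub>}"
      then have y: "y \<in> carrier (C_obj L e f a B)" "C_mor L e f a B C \<psi> y = \<zero>\<^bsub>C.D\<^esub>" by simp_all
      obtain n v where v: "v \<in> carrier B" "y = B.tw n v" using B.tw_surj_D[of y] y(1) by auto
      have "C.tw n (\<psi> v) = \<zero>\<^bsub>C.D\<^esub>" using y(2) m'[OF v(1) y(1)[unfolded v(2)]] v(2) by simp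
      then obtain k where "(act C f ^^ k) (\<psi> v) = \<zero>\<^bsub>C\<^esub>" using C.tw_zero_iff_D[OF h'(1)[OF v(1)]] by blast
      then have "(act B f ^^ k) v \<in> \<phi> ` carrier A"
        using im[of "(act B f ^^ k) v"] v(1) A.efh_closed by (simp add: \<psi>f B.act_pow_closed)
      then obtain u where u: "u \<in> carrier A" "(act B f ^^ k) v = \<phi> u" by blast
      let ?z = "A.tw (n + k) u"
      have zc: "?z \<in> carrier A.D" using u(1) by simp
      have yz: "y = ?D ?z" using B.tw_shift[OF v(1), of n k] u v(2) by (simp add: dm)
      obtain l where "(act B.D e ^^ l) y = \<zero>\<^bsub>B.D\<^esub>"
        using B.C_e_nilpotent[OF cat_M_D(2)[OF *(2)]] y(1) by auto
      then have "(act A.D e ^^ l) ?z = \<zero>\<^bsub>A.D\<^esub>"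
        using De[OF zc] yz A.efh_closed zc by (intro D_inj A.DM.act_pow_closed) simp_all
      then have "A.DM.N.efin (act A.D e) ?z"
        by (rule A.DM.N.efin_nilpotent[OF A.DM.act_lin[OF A.efh_closed(1)] zc])
      then have zC: "?z \<in> carrier (C_obj L e f a A)" using zc by simp
      then have "y = C_mor L e f a A B \<phi> ?z" using yz by (simp add: C_mor_def)
      then show "y \<in> C_mor L e f a A B \<phi> ` carrier (C_obj L e f a A)" using zC by blast
    }
  qed
qed

text \<open>A vector w of A outside B is split into weight components, each of which lies in A.
  Nilpotency of e modulo B and on V puts every component into B by
  \<open>e_nilpotent_quotient\<close>, a contradiction.\<close>

lemma subquotient_e_nilpotent:
  assumes S: "sl2_superalgebra L e h f" and V: "cat_Me gr L e h b V"
    and A: "is_gsubmodule gr L (D_obj L f a V) A" and B: "is_gsubmodule gr L (D_obj L f a V) B"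
    and ne: "carrier (subquotient (D_obj L f a V) A B) \<noteq> {\<zero>\<^bsub>subquotient (D_obj L f a V) A B\<^esub>}"
    and nil: "locally_nilpotent (subquotient (D_obj L f a V) A B) e"
  shows "a - b \<in> \<int> \<or> a \<in> \<int>"
proof (rule ccontr)
  assume neg: "\<not> (a - b \<in> \<int> \<or> a \<in> \<int>)"
  have cat: "cat_M gr L h b V" and loc: "locally_nilpotent V e" using V by (auto simp: cat_Me_def)
  interpret sl2_twisted L e h f V a by (rule sl2_twistedI[OF S cat_M_D(1)[OF cat]])
  have As: "DM.N.subsp A" "\<And>x v. x \<in> carrier L \<Longrightarrow> v \<in> A \<Longrightarrow> act D x v \<in> A"
    using A DM.N.submodule_iff by (auto simp: is_gsubmodule_def)
  have Bs: "DM.N.subsp B" "\<And>x v. x \<in> carrier L \<Longrightarrow> v \<in> B \<Longrightarrow> act D x v \<in> B"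
    using B DM.N.submodule_iff by (auto simp: is_gsubmodule_def)
  note Ac = DM.N.subspD(1)[OF As(1)]
  have q: "act (subquotient D A B) e = (\<lambda>Z. \<Union>v\<in>Z. B +>\<^bsub>D\<^esub> act D e v)" "\<zero>\<^bsub>subquotient D A B\<^esub> = B"
    "carrier (subquotient D A B) = (\<lambda>v. B +>\<^bsub>D\<^esub> v) ` A"
    by (simp_all add: subquotient_def)
  have eK: "\<exists>K. (act D e ^^ K) w \<in> B" if w: "w \<in> A" for w
  proof -
    obtain K where "(act (subquotient D A B) e ^^ K) (B +>\<^bsub>D\<^esub> w) = B"
      using nil w by (auto simp: locally_nilpotent_def q)
    moreover have "(act (subquotient D A B) e ^^ K) (B +>\<^bsub>D\<^esub> w) = B +>\<^bsub>D\<^esub> (act D e ^^ K) w"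
      unfolding q by (rule DM.N.subquotient_pow[OF DM.act_lin[OF efh_closed(1)] Bs(1) Bs(2)[OF efh_closed(1)] Ac[OF w]])
    ultimately have "B +>\<^bsub>D\<^esub> (act D e ^^ K) w = B" by simp
    then show ?thesis
      using DM.N.coset_eq_iff[OF Bs(1) DM.act_pow_closed[OF efh_closed(1) Ac[OF w]]] by blast
  qed
  have "\<exists>w\<in>A. w \<notin> B"
  proof (rule ccontr)
    assume "\<not> (\<exists>w\<in>A. w \<notin> B)"
    then have "B +>\<^bsub>D\<^esub> w = B" if "w \<in> A" for w
      using that DM.N.coset_eq_iff[OF Bs(1) Ac[OF that]] by blast
    then show False using ne DM.N.subspD(2)[OF As(1)] unfolding q by force
  qed
  then obtain w where w: "w \<in> A" "w \<notin> B" by blast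
  obtain m I g where g: "finite I" "\<And>n. wt (b + of_int n) (g n)" "w = finsum D (\<lambda>n. tw m (g n)) I"
    "\<And>B n. DM.N.subsp B \<Longrightarrow> (\<And>v. v \<in> B \<Longrightarrow> act D h v \<in> B) \<Longrightarrow> w \<in> B \<Longrightarrow> n \<in> I \<Longrightarrow> tw m (g n) \<in> B"
    by (rule tw_weight_components[OF cat_M_D(2)[OF cat] Ac[OF w(1)]]) blast
  have "tw m (g n) \<in> B" if n: "n \<in> I" for n
  proof -
    have "tw m (g n) \<in> A" by (rule g(4)[OF As(1) As(2)[OF efh_closed(2)] w(1) n])
    then obtain K where K: "(act D e ^^ K) (tw m (g n)) \<in> B" using eK by blast
    obtain k where k: "(act V e ^^ k) (g n) = \<zero>\<^bsub>V\<^esub>"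
      using loc wtD(1)[OF g(2)[of n]] by (auto simp: locally_nilpotent_def)
    \<comment> \<open>The weight of \<open>g n\<close> is b + n, which differs from b by an
      integer.\<close>
    have "a - (b + of_int n) \<notin> \<int>"
    proof
      assume "a - (b + of_int n) \<in> \<int>"
      then have "a - (b + of_int n) + of_int n \<in> \<int>" by (intro Ints_add Ints_of_int)
      then show False using neg by simp
    qed
    then show ?thesis using neg by (intro e_nilpotent_quotient[OF g(2) k Bs K]) auto
  qed
  then have "w \<in> B" unfolding g(3) by (rule DM.N.finsum_subsp[OF Bs(1) g(1)])
  then show False using w(2) by simp
qed

text \<open>At exponent 0 and denominator 0 all binomials but the first vanish, so
  \<open>tw 0\<close> commutes with the whole Lie superalgebra. Nilpotency of e thus passes from v
  to \<open>tw 0 v\<close>, and the kernel is given by \<open>tw_zero_iff_D\<close>.\<close>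

lemma C_unit:
  assumes S: "sl2_superalgebra L e h f" and N: "cat_Me gr L e h b N"
  shows "twisted_tensor L f 0 N \<one>\<^bsub>Uf_alg L f\<^esub> \<in> gmod_hom gr L N (C_obj L e f 0 N)"
    and "{v \<in> carrier N. twisted_tensor L f 0 N \<one>\<^bsub>Uf_alg L f\<^esub> v = \<zero>\<^bsub>C_obj L e f 0 N\<^esub>} = f_torsion N f"
proof -
  have cat: "cat_M gr L h b N" and loc: "locally_nilpotent N e" using N by (auto simp: cat_Me_def)
  interpret sl2_twisted L e h f N 0 by (rule sl2_twistedI[OF S cat_M_D(1)[OF cat]])
  let ?t = "twisted_tensor L f 0 N \<one>\<^bsub>Uf_alg L f\<^esub>"
  have tt: "?t v = tw 0 v" if "v \<in> carrier N" for v by (rule tw_one_tensor[OF that])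
  have act: "act D x (tw 0 v) = tw 0 (act N x v)" if x: "x \<in> carrier L" and v: "v \<in> carrier N" for x v
  proof -
    obtain d where "(br L f ^^ d) x = \<zero>\<^bsub>L\<^esub>" using f_nil[OF x] by blast
    \<comment> \<open>One step more than kills x, so that the sum has a term with index 0 even when
      d = 0.\<close>
    then have d: "(br L f ^^ Suc d) x = \<zero>\<^bsub>L\<^esub>"
      using br_smult_right[of f "\<zero>\<^bsub>L\<^esub>" 0] efh_closed br_closed[of f "\<zero>\<^bsub>L\<^esub>"] cL.s_zero by simp
    have xj: "(br L f ^^ j) x \<in> carrier L" for j by (rule U_gen_ad_pow(1)[OF f_even x])
    let ?g = "\<lambda>j. tw (0 + j) (((-1) ^ j * ((0 - of_nat 0) gchoose j)) \<odot>\<^bsub>N\<^esub> act N ((br L f ^^ j) x) v)"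
    have "act D x (tw 0 v) = nsum D ?g (Suc d)" by (rule act_D_tw[OF x d v])
    also have "\<dots> = ?g 0"
    proof (rule DM.N.M.nsum_single)
      show "?g j = \<zero>\<^bsub>D\<^esub>" if "j < Suc d" "j \<noteq> 0" for j
      proof -
        have "(0 - of_nat 0 gchoose j) = (0 :: complex)" using that(2) by (cases j) simp_all
        then show ?thesis by (simp only: mult_zero_right N.s_zero(1)[OF act_closed[OF xj v]] tw_zero_D)
      qed
    qed (use act_closed[OF xj v] act_closed[OF x v] in simp_all)
    also have "\<dots> = tw 0 (act N x v)" using act_closed[OF x v] by simp
    finally show ?thesis .
  qed
  have W: "tw 0 v \<in> W" if v: "v \<in> carrier N" for v
  proof -
    have pw: "(act D e ^^ k) (tw 0 v) = tw 0 ((act N e ^^ k) v)" for k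
      by (induction k) (use v efh_closed in \<open>simp_all add: act act_pow_closed\<close>)
    obtain k where "(act N e ^^ k) v = \<zero>\<^bsub>N\<^esub>" using loc v by (auto simp: locally_nilpotent_def)
    then have "(act D e ^^ k) (tw 0 v) = \<zero>\<^bsub>D\<^esub>" by (simp add: pw tw_zero_D)
    then show ?thesis using v DM.N.efin_nilpotent[OF DM.act_lin[OF efh_closed(1)]] by simp
  qed
  show "?t \<in> gmod_hom gr L N (C_obj L e f 0 N)"
  proof (intro gmod_homI ahomI)
    fix v assume v: "v \<in> carrier N"
    show "?t v \<in> carrier (C_obj L e f 0 N)" using W[OF v] by (simp only: tt[OF v] C_simps)
    show "?t (c \<odot>\<^bsub>N\<^esub> v) = c \<odot>\<^bsub>C_obj L e f 0 N\<^esub> ?t v" for c using v by (simp add: tt tw_smult)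
    show "?t (act N x v) = act (C_obj L e f 0 N) x (?t v)" if "x \<in> carrier L" for x
      using v that by (simp add: tt act act_closed)
    fix w assume "w \<in> carrier N"
    then show "?t (v \<oplus>\<^bsub>N\<^esub> w) = ?t v \<oplus>\<^bsub>C_obj L e f 0 N\<^esub> ?t w" using v by (simp add: tt tw_add_D)
  next
    fix i v assume gr and v: "v \<in> par N i"
    interpret G: graded_twisted_localization L f N 0
      by (rule graded_twistedI[OF S]) (use cat_M_D(1)[OF cat] \<open>gr\<close> in simp)
    have "v \<in> carrier N" by (rule G.parN_facts(1)[OF v])
    then show "?t v \<in> par (C_obj L e f 0 N) i"
      using W[of v] G.ParI[OF v, of 0] by (simp only: tt C_simps Int_iff D_simps G.D_par_eq)
  qed
  show "{v \<in> carrier N. ?t v = \<zero>\<^bsub>C_obj L e f 0 N\<^esub>} = f_torsion N f"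
  proof -
    have *: "(\<exists>k. (act N f ^^ k) v = \<zero>\<^bsub>N\<^esub>) \<longleftrightarrow> (\<exists>k. \<forall>s\<ge>k. (act N f ^^ s) v = \<zero>\<^bsub>N\<^esub>)" for v
    proof
      assume "\<exists>k. (act N f ^^ k) v = \<zero>\<^bsub>N\<^esub>"
      then obtain k where k: "(act N f ^^ k) v = \<zero>\<^bsub>N\<^esub>" by blast
      have "(act N f ^^ s) v = \<zero>\<^bsub>N\<^esub>" if "s \<ge> k" for s
        using funpow_add_app[where f = "act N f" and m = "s - k" and n = k and x = v] that k
          act_pow_zero[OF efh_closed(3)] by simp
      then show "\<exists>k. \<forall>s\<ge>k. (act N f ^^ s) v = \<zero>\<^bsub>N\<^esub>" by blast
    qed blast
    show ?thesis
      unfolding f_torsion_def *[symmetric] by (intro Collect_cong conj_cong refl) (simp add: tt tw_zero_iff_D)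
  qed
qed

lemma fpow_tensor_in_C:
  assumes S: "sl2_superalgebra L e h f" and N: "cat_Me gr L e h a N" and v: "v \<in> carrier N"
  shows "\<exists>s::int. s > 0 \<and> (\<forall>j\<ge>s. twisted_tensor L f a N (fpow L f j) v \<in> carrier (C_obj L e f a N))"
proof -
  have cat: "cat_M gr L h a N" and loc: "locally_nilpotent N e" using N by (auto simp: cat_Me_def)
  interpret sl2_twisted L e h f N a by (rule sl2_twistedI[OF S cat_M_D(1)[OF cat]])
  have "v \<in> N.spn {v \<in> carrier N. \<exists>n::int. act N h v = (a + of_int n) \<odot>\<^bsub>N\<^esub> v}"
    using v cat_M_D(2)[OF cat] by blast
  from N.weight_decomposition[OF this act_lin[OF efh_closed(2)]]
  obtain I g where g: "finite I" "\<And>n. g n \<in> carrier N \<and> act N h (g n) = (a + of_int n) \<odot>\<^bsub>N\<^esub> g n" "v = finsum N g I"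
    by blast
  have w: "wt (a + of_int n) (g n)" for n using g(2) by (simp add: wt_def)
  have "\<exists>k. (act N e ^^ k) (g n) = \<zero>\<^bsub>N\<^esub>" for n using loc g(2) by (auto simp: locally_nilpotent_def)
  then obtain k where k: "\<And>n. (act N e ^^ k n) (g n) = \<zero>\<^bsub>N\<^esub>" by metis
  \<comment> \<open>The vector f^J (g n) has weight \<mu> = a + n - 2 J, so a - \<mu> is
    \<open>?K\<close>, that is 2 J - n, and e to the power \<open>k n + J\<close> kills it. The
    condition on J says exactly that this power is at most \<open>?K\<close>.\<close>
  have one: "tw 0 ((act N f ^^ J) (g n)) \<in> W" if J: "int J \<ge> n + int (k n)" for n J
  proof -
    let ?K = "nat (2 * int J - n)"
    have "(of_nat ?K :: complex) = of_int (2 * int J - n)" using J by (simp add: of_nat_nat)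
    then have "a - (a + of_int n - 2 * of_nat J) = of_nat ?K" by simp
    moreover have "k n + J \<le> ?K" using J by simp
    ultimately have "(act D e ^^ ?K) (tw 0 ((act N f ^^ J) (g n))) = \<zero>\<^bsub>D\<^esub>"
      by (rule e_nilpotent_tw[OF wt_f_pow[OF w] e_nil_f_pow[OF w k]])
    then show ?thesis
      using g(2) DM.N.efin_nilpotent[OF DM.act_lin[OF efh_closed(1)]] act_pow_closed[OF efh_closed(3)] by simp
  qed
  \<comment> \<open>The entry 1 makes the bound positive and keeps the set non-empty when I is
    empty.\<close>
  let ?M = "insert 1 ((\<lambda>n. n + int (k n)) ` I)"
  show ?thesis
  proof (intro exI[of _ "Max ?M"] conjI allI impI)
    have fin: "finite ?M" using g(1) by simp
    have "1 \<le> Max ?M" using fin by (intro Max_ge) auto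
    then show "Max ?M > 0" by simp
    fix j assume j: "j \<ge> Max ?M"
    then have j0: "j = int (nat j)" using \<open>1 \<le> Max ?M\<close> by simp
    have "tw 0 ((act N f ^^ nat j) (g n)) \<in> W" if n: "n \<in> I" for n
    proof (rule one)
      have "n + int (k n) \<le> Max ?M" using fin n by (intro Max_ge) auto
      then show "n + int (k n) \<le> int (nat j)" using j j0 by simp
    qed
    then have "finsum D (\<lambda>n. tw 0 ((act N f ^^ nat j) (g n))) I \<in> W"
      by (rule DM.N.finsum_subsp[OF W_subsp g(1)])
    also have "finsum D (\<lambda>n. tw 0 ((act N f ^^ nat j) (g n))) I = tw 0 ((act N f ^^ nat j) v)"
      unfolding g(3)
      by (rule ahom_finsum[OF N.M.abelian_group_axioms DM.N.M.abelian_group_axioms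
            ahom_comp[OF act_pow_ahom[OF efh_closed(3)] tw_ahom_D], symmetric]) (use g(2) in auto)
    also have "tw 0 ((act N f ^^ nat j) v) = twisted_tensor L f a N (fpow L f j) v"
      using twisted_tensor_fpow[OF v, of "nat j"] j0 by simp
    finally show "twisted_tensor L f a N (fpow L f j) v \<in> carrier (C_obj L e f a N)" by (simp only: C_simps)
  qed
qed

theorem proposition2p2p2:
  fixes L :: "'g lsa" and e h f :: 'g and a b :: complex and gr :: bool
  assumes "lie_superalgebra L"
    and "sl2_in L e h f"
    and "sl2_locally_finite L e h f"
  shows
    "(\<forall>S. is_subalgebra L S \<and> {e, h, f} \<subseteq> S \<longrightarrow>
        (let L' = sub_lsa L S in
         naturally_isomorphic gr L (is_gmodule gr L :: ('g, 'v) gmod \<Rightarrow> bool) L'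
           (\<lambda>N. res_gmod L' (C_obj L e f a N))
           (\<lambda>M N \<phi>. C_mor L e f a M N \<phi>)
           (\<lambda>N. C_obj L' e f a (res_gmod L' N))
           (\<lambda>M N \<phi>. C_mor L' e f a (res_gmod L' M) (res_gmod L' N) \<phi>)))
     \<and>
     (is_functor gr L (cat_M gr L h a :: ('g, 'v) gmod \<Rightarrow> bool) L (cat_Me gr L e h (- a))
        (C_obj L e f a) (C_mor L e f a)
      \<and> additive_functor gr L (cat_M gr L h a :: ('g, 'v) gmod \<Rightarrow> bool)
        (C_obj L e f a) (C_mor L e f a)
      \<and> left_exact_functor gr L (cat_M gr L h a :: ('g, 'v) gmod \<Rightarrow> bool)
        (C_obj L e f a) (C_mor L e f a))
     \<and>
     (\<forall>V :: ('g, 'v) gmod. cat_Me gr L e h b V \<longrightarrow>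
        (\<exists>A B. is_gsubmodule gr L (D_obj L f a V) A \<and> is_gsubmodule gr L (D_obj L f a V) B \<and> B \<subseteq> A \<and>
           carrier (subquotient (D_obj L f a V) A B) \<noteq> {\<zero>\<^bsub>subquotient (D_obj L f a V) A B\<^esub>} \<and>
           locally_nilpotent (subquotient (D_obj L f a V) A B) e) \<longrightarrow>
        a - b \<in> \<int> \<or> a \<in> \<int>)
     \<and>
     (\<forall>N :: ('g, 'v) gmod. cat_Me gr L e h 0 N \<longrightarrow>
        twisted_tensor L f 0 N \<one>\<^bsub>Uf_alg L f\<^esub> \<in> gmod_hom gr L N (C_obj L e f 0 N) \<and>
        {v \<in> carrier N. twisted_tensor L f 0 N \<one>\<^bsub>Uf_alg L f\<^esub> v = \<zero>\<^bsub>C_obj L e f 0 N\<^esub>} = f_torsion N f)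
     \<and>
     (\<forall>N :: ('g, 'v) gmod. a \<notin> \<int> \<and> cat_Me gr L e h a N \<longrightarrow>
        (\<forall>v\<in>carrier N. \<exists>s::int. s > 0 \<and>
           (\<forall>j\<ge>s. twisted_tensor L f a N (fpow L f j) v \<in> carrier (C_obj L e f a N))))"
proof -
  have S: "sl2_superalgebra L e h f" by (rule sl2_superalgebraI[OF assms])
  show ?thesis
    unfolding Let_def
  proof (intro conjI, goal_cases)
    case 1
    then show ?case using C_res_naturally_isomorphic[OF S] by blast
  next
    case 2
    then show ?case by (rule C_functor[OF S]) (auto intro: C_cat_Me[OF S] cat_M_D)
  next
    case 3
    then show ?case by (rule C_additive[OF S cat_M_D(1)])
  next
    case 4
    then show ?case by (rule C_left_exact[OF S])
  next
    case 5
    then show ?case by (intro allI impI, elim exE conjE) (rule subquotient_e_nilpotent[OF S])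
  next
    case 6
    then show ?case by (intro allI impI conjI) (rule C_unit[OF S], assumption)+
  next
    case 7
    then show ?case by (intro allI impI ballI, elim conjE) (rule fpow_tensor_in_C[OF S])
  qed
qed

end
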